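(* Let $n$ be a positive integer and let $\mathcal C$ be an idempotent complete additive category. There is an inclusion preserving one-to-one correspondence between (1) the $n$-exact structures $(\mathcal C,\mathscr X)$ on $\mathcal C$, and (2) the extension closed subcategories $\mathscr F\subseteq \mathsf{ex}_n\,\mathcal C$ such that $\mathsf{Pb}^{\mathcal C}_n(\mathscr F)=\mathscr F$ and $\mathsf{Po}^{\mathcal C}_n(\mathscr F)=\mathscr F$, given by the mutually inverse assignments $(\mathcal C,\mathscr X)\mapsto \operatorname{Fun}^{\mathcal C}_n(\mathscr X)$ and $\mathscr F\mapsto (\mathcal C,\operatorname{Res}^{\mathcal C}_n(\mathscr F))$.
   Context: **Modules.** A $\mathcal C$-module is an additive functor $\mathcal C^{\mathrm{op}}\to\mathsf{Ab}$; a $\mathcal C$-morphism is a natural transformation. Kernels, images, cokernels and exactness are pointwise. $\mathsf{mod}\,\mathcal C$ is the category of all $\mathcal C$-modules $F$ admitting an infinite pointwise exact sequence $\cdots\to\mathcal C(-,X_1)\to\mathcal C(-,X_0)\to F\to 0$ with $X_i\in\mathcal C$. With the pointwise short exact sequences it is an exact category with enough projectives, the projectives being up to isomorphism the representables $\mathcal C(-,X)$; $\operatorname{Ext}^i_{\mathsf{mod}\,\mathcal C}$ and $\operatorname{pdim}_{\mathsf{mod}\,\mathcal C}$ refer to this exact category ($\operatorname{Ext}^0=\operatorname{Hom}$). **$n$-exact sequences.** A complex $X_\bullet: X_{n+1}\xrightarrow{d^X_{n+1}}X_n\to\cdots\to X_1\xrightarrow{d^X_1}X_0$ in $\mathcal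 C$ is $n$-exact if for all $Y\in\mathcal C$ both $0\to\mathcal C(Y,X_{n+1})\to\cdots\to\mathcal C(Y,X_0)$ and $0\to\mathcal C(X_0,Y)\to\cdots\to\mathcal C(X_{n+1},Y)$ are exact. $\mathbf K^{\mathrm{ex}}_n(\mathcal C)$ is the homotopy category of $n$-exact sequences (chain maps modulo null-homotopic ones). A class $\mathscr X$ closed under isomorphism in $\mathbf K^{\mathrm{ex}}_n(\mathcal C)$ is the same as a class of $n$-exact sequences closed under homotopy equivalence. **$n$-exact structures.** Let $\mathscr X\subseteq\mathbf K^{\mathrm{ex}}_n(\mathcal C)$ be a class closed under isomorphism. Members of $\mathscr X$ are $\mathscr X$-conflations; the first morphism $d^X_{n+1}$ (resp. last morphism $d^X_1$) of an $\mathscr X$-conflation is an $\mathscr X$-inflation (resp. $\mathscr X$-deflation). $(\mathcal C,\mathscr X)$ is an $n$-exact category, and $\mathscr X$ an $n$-exact structure on $\mathcal C$, if: (Ex0) the zero complex is in $\mathscr X$; (Ex1) $\mathscr X$-inflations are closed under composition; (Ex1$^{\mathrm{op}}$) $\mathscr X$-deflations are closed under composition; (Ex2) for every $\mathscr X$-inflation $d^X_{n+1}:X_{n+1}\to X_n$ and every $f_{n+1}:X_{n+1}\to Y_{n+1}$, the morphism $\begin{bmatrix}-d^X_{n+1}\\ f_{n+1}\end{bmatrix}:X_{n+1}\to X_n\oplus Y_{n+1}$ is an $\mathscr X$-inflation admitting a weak cokernel $[f_n\ \ d^Y_{n+1}]:X_n\oplus Y_{n+1}\to Y_n$ such that $d^Y_{n+1}$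 is an $\mathscr X$-inflation; (Ex2$^{\mathrm{op}}$) for every $\mathscr X$-deflation $d^X_1:X_1\to X_0$ and every $f_0:Y_0\to X_0$, the morphism $[-d^X_1\ \ f_0]:X_1\oplus Y_0\to X_0$ is an $\mathscr X$-deflation admitting a weak kernel $\begin{bmatrix}f_1\\ d^Y_1\end{bmatrix}:Y_1\to X_1\oplus Y_0$ such that $d^Y_1$ is an $\mathscr X$-deflation. (A weak kernel of $f$ is a morphism $g$ with $fg=0$ through which every $h$ with $fh=0$ factors, not necessarily uniquely; weak cokernels are dual.) Inclusion of $n$-exact structures means inclusion of the classes $\mathscr X$. **The category $\mathsf{ex}_n\,\mathcal C$ and functors.** $\mathsf{ex}_n\,\mathcal C\subseteq\mathsf{mod}\,\mathcal C$ is the full subcategory of all $F$ with $\operatorname{pdim}_{\mathsf{mod}\,\mathcal C}F\le n+1$ and $\operatorname{Ext}^i_{\mathsf{mod}\,\mathcal C}(F,\mathcal C(-,Y))=0$ for all $0\le i\le n$, $Y\in\mathcal C$. $\operatorname{Fun}^{\mathcal C}_n:\mathbf K^{\mathrm{ex}}_n(\mathcal C)\to\mathsf{ex}_n\,\mathcal C$ sends $X_\bullet$ to $\operatorname{Cok}\mathcal C(-,d^X_1)$ and a chain map to the induced map on cokernels; it is an equivalence. $\operatorname{Res}^{\mathcal C}_n:\mathsf{ex}_n\,\mathcal C\to\mathbf K^{\mathrm{ex}}_n(\mathcal C)$ is a quasi-inverse, sending $F$ to an $n$-exact sequence $X_\bullet$ such that $\mathcal C(-,X_\bullet)$ is a projective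 resolution of $F$. The image of a class under a functor always means its essential image. **$\mathsf{Pb}$ and $\mathsf{Po}$.** For an isomorphism closed full subcategory $\mathscr F\subseteq\mathsf{ex}_n\,\mathcal C$, $\mathsf{Pb}^{\mathcal C}_n(\mathscr F)$ is the full subcategory of all $F\in\mathscr F$ such that for every $G\in\mathsf{mod}\,\mathcal C$ and every $\alpha:G\to F$ both $\operatorname{Im}\alpha$ and $F/\operatorname{Im}\alpha$ are in $\mathscr F$. Let $\operatorname{Op}^{\mathcal C}_n:\mathbf K^{\mathrm{ex}}_n(\mathcal C)\to\mathbf K^{\mathrm{ex}}_n(\mathcal C^{\mathrm{op}})$ be the duality reversing all arrows (sending $X_\bullet$ to $X_{n+1-\bullet}$), and $\operatorname{Tr}^{\mathcal C}_{n+1}=\operatorname{Fun}^{\mathcal C^{\mathrm{op}}}_n\circ\operatorname{Op}^{\mathcal C}_n\circ\operatorname{Res}^{\mathcal C}_n:\mathsf{ex}_n\,\mathcal C\to\mathsf{ex}_n\,\mathcal C^{\mathrm{op}}$. Then $\mathsf{Po}^{\mathcal C}_n(\mathscr F)=\operatorname{Tr}^{\mathcal C^{\mathrm{op}}}_{n+1}(\mathsf{Pb}^{\mathcal C^{\mathrm{op}}}_n(\operatorname{Tr}^{\mathcal C}_{n+1}(\mathscr F)))$. **Extension closed.** Subcategories of $\mathsf{ex}_n\,\mathcal C$ are full and isomorphism closed. Such a subcategory $\mathscr F\subseteq\mathsf{ex}_n\,\mathcal C$ is extension closed if for each pointwise exact sequence $0\to F\to G\to H\to 0$ in $\mathsf{ex}_n\,\mathcal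 C$ with $F,H\in\mathscr F$ one has $G\in\mathscr F$.
   Formalization: The subcategories in (2) are required to be nonempty: the empty class is vacuously extension closed and fixed by Pb and Po, but its image under Res is empty and violates (Ex0). *)

theory Defs
  imports "HOL-Algebra.Elementary_Groups" "HOL-Library.Extended_Nat"
begin

section \<open>Additive categories\<close>

text \<open>
  Abelian groups are commutative groups in the (multiplicatively written) sense of HOL-Algebra, so
  that \<open>\<otimes>\<close> is addition, \<open>\<one>\<close> is the zero and \<open>inv\<close> is negation of morphisms.
  \<open>Comp C g f\<close> is the composite ``g after f''. Each morphism knows its domain and codomain.
\<close>

record ('o, 'm) cat =
  Obj :: "'o set"
  Hom :: "'o \<Rightarrow> 'o \<Rightarrow> 'm monoid"
  Dom :: "'m \<Rightarrow> 'o"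
  Cod :: "'m \<Rightarrow> 'o"
  Comp :: "'m \<Rightarrow> 'm \<Rightarrow> 'm"
  Idn :: "'o \<Rightarrow> 'm"

abbreviation homs :: "('o, 'm) cat \<Rightarrow> 'o \<Rightarrow> 'o \<Rightarrow> 'm set" where
  "homs C X Y \<equiv> carrier (Hom C X Y)"

locale preadditive_category =
  fixes C :: "('o, 'm) cat"
  assumes Hom_group: "X \<in> Obj C \<Longrightarrow> Y \<in> Obj C \<Longrightarrow> comm_group (Hom C X Y)"
    and Dom_Cod: "X \<in> Obj C \<Longrightarrow> Y \<in> Obj C \<Longrightarrow> f \<in> homs C X Y \<Longrightarrow> Dom C f = X \<and> Cod C f = Y"
    and Comp_closed: "X \<in> Obj C \<Longrightarrow> Y \<in> Obj C \<Longrightarrow> Z \<in> Obj C \<Longrightarrow>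
      f \<in> homs C X Y \<Longrightarrow> g \<in> homs C Y Z \<Longrightarrow> Comp C g f \<in> homs C X Z"
    and Comp_assoc: "W \<in> Obj C \<Longrightarrow> X \<in> Obj C \<Longrightarrow> Y \<in> Obj C \<Longrightarrow> Z \<in> Obj C \<Longrightarrow>
      f \<in> homs C W X \<Longrightarrow> g \<in> homs C X Y \<Longrightarrow> h \<in> homs C Y Z \<Longrightarrow>
      Comp C h (Comp C g f) = Comp C (Comp C h g) f"
    and Idn_closed: "X \<in> Obj C \<Longrightarrow> Idn C X \<in> homs C X X"
    and Comp_Idn_left: "X \<in> Obj C \<Longrightarrow> Y \<in> Obj C \<Longrightarrow> f \<in> homs C X Y \<Longrightarrow> Comp C (Idn C Y) f = f"
    and Comp_Idn_right: "X \<in> Obj C \<Longrightarrow> Y \<in> Obj C \<Longrightarrow> f \<in> homs C X Y \<Longrightarrow> Comp C f (Idn C X) = f"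
    and Comp_add_left: "X \<in> Obj C \<Longrightarrow> Y \<in> Obj C \<Longrightarrow> Z \<in> Obj C \<Longrightarrow>
      f \<in> homs C X Y \<Longrightarrow> g \<in> homs C Y Z \<Longrightarrow> g' \<in> homs C Y Z \<Longrightarrow>
      Comp C (g \<otimes>\<^bsub>Hom C Y Z\<^esub> g') f = Comp C g f \<otimes>\<^bsub>Hom C X Z\<^esub> Comp C g' f"
    and Comp_add_right: "X \<in> Obj C \<Longrightarrow> Y \<in> Obj C \<Longrightarrow> Z \<in> Obj C \<Longrightarrow>
      f \<in> homs C X Y \<Longrightarrow> f' \<in> homs C X Y \<Longrightarrow> g \<in> homs C Y Z \<Longrightarrow>
      Comp C g (f \<otimes>\<^bsub>Hom C X Y\<^esub> f') = Comp C g f \<otimes>\<^bsub>Hom C X Z\<^esub> Comp C g f'"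

definition zero_object :: "('o, 'm) cat \<Rightarrow> 'o \<Rightarrow> bool" where
  "zero_object C Z \<longleftrightarrow> Z \<in> Obj C \<and>
    (\<forall>X\<in>Obj C. trivial_group (Hom C X Z) \<and> trivial_group (Hom C Z X))"

definition biproduct ::
  "('o, 'm) cat \<Rightarrow> 'o \<Rightarrow> 'o \<Rightarrow> 'o \<Rightarrow> 'm \<Rightarrow> 'm \<Rightarrow> 'm \<Rightarrow> 'm \<Rightarrow> bool" where
  "biproduct C A B W i1 i2 p1 p2 \<longleftrightarrow>
    A \<in> Obj C \<and> B \<in> Obj C \<and> W \<in> Obj C \<and>
    i1 \<in> homs C A W \<and> i2 \<in> homs C B W \<and> p1 \<in> homs C W A \<and> p2 \<in> homs C W B \<and>
    Comp C p1 i1 = Idn C A \<and> Comp C p2 i2 = Idn C B \<and>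
    Comp C p1 i2 = \<one>\<^bsub>Hom C B A\<^esub> \<and> Comp C p2 i1 = \<one>\<^bsub>Hom C A B\<^esub> \<and>
    Comp C i1 p1 \<otimes>\<^bsub>Hom C W W\<^esub> Comp C i2 p2 = Idn C W"

locale additive_category = preadditive_category +
  assumes has_zero: "\<exists>Z. zero_object C Z"
    and has_biproducts: "A \<in> Obj C \<Longrightarrow> B \<in> Obj C \<Longrightarrow>
      \<exists>W i1 i2 p1 p2. biproduct C A B W i1 i2 p1 p2"

locale idempotent_complete_additive_category = additive_category +
  assumes idempotents_split: "X \<in> Obj C \<Longrightarrow> e \<in> homs C X X \<Longrightarrow> Comp C e e = e \<Longrightarrow>
      \<exists>Y\<in>Obj C. \<exists>r\<in>homs C X Y. \<exists>s\<in>homs C Y X. Comp C s r = e \<and> Comp C r s = Idn C Y"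

definition op_cat :: "('o, 'm) cat \<Rightarrow> ('o, 'm) cat" where
  "op_cat C = \<lparr>Obj = Obj C, Hom = (\<lambda>X Y. Hom C Y X), Dom = Cod C, Cod = Dom C,
     Comp = (\<lambda>g f. Comp C f g), Idn = Idn C\<rparr>"

lemma op_cat_op_cat [simp]: "op_cat (op_cat C) = C"
  by (simp add: op_cat_def)

definition weak_cokernel :: "('o, 'm) cat \<Rightarrow> 'm \<Rightarrow> 'm \<Rightarrow> bool" where
  "weak_cokernel C f c \<longleftrightarrow>
    Cod C c \<in> Obj C \<and> c \<in> homs C (Cod C f) (Cod C c) \<and>
    Comp C c f = \<one>\<^bsub>Hom C (Dom C f) (Cod C c)\<^esub> \<and>
    (\<forall>Z\<in>Obj C. \<forall>h\<in>homs C (Cod C f) Z. Comp C h f = \<one>\<^bsub>Hom C (Dom C f) Z\<^esub> \<longrightarrow>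
       (\<exists>u\<in>homs C (Cod C c) Z. h = Comp C u c))"

definition weak_kernel :: "('o, 'm) cat \<Rightarrow> 'm \<Rightarrow> 'm \<Rightarrow> bool" where
  "weak_kernel C f k \<longleftrightarrow>
    Dom C k \<in> Obj C \<and> k \<in> homs C (Dom C k) (Dom C f) \<and>
    Comp C f k = \<one>\<^bsub>Hom C (Dom C k) (Cod C f)\<^esub> \<and>
    (\<forall>Z\<in>Obj C. \<forall>h\<in>homs C Z (Dom C f). Comp C f h = \<one>\<^bsub>Hom C Z (Cod C f)\<^esub> \<longrightarrow>
       (\<exists>u\<in>homs C Z (Dom C k). h = Comp C k u))"


section \<open>Modules over a category\<close>

text \<open>
  An element of type \<open>('o, 'm, 'a) cmod\<close> is a functor from the opposite category to abelian groups
  whose elements have type \<open>'a\<close>. The representables have elements of type \<open>'m\<close>, and cokernels of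
  maps between them have elements of type \<open>'m set\<close>. Every module with a presentation by
  representables is isomorphic to one with elements in \<open>'m set\<close>, so
  \<open>'m set\<close> serves as the universe of \<open>mod C\<close>.
\<close>

record ('o, 'm, 'a) cmod =
  Val :: "'o \<Rightarrow> 'a monoid"
  Act :: "'m \<Rightarrow> 'a \<Rightarrow> 'a"

definition cmodule :: "('o, 'm) cat \<Rightarrow> ('o, 'm, 'a) cmod \<Rightarrow> bool" where
  "cmodule C F \<longleftrightarrow>
    (\<forall>X\<in>Obj C. comm_group (Val F X)) \<and>
    (\<forall>X\<in>Obj C. \<forall>Y\<in>Obj C. \<forall>f\<in>homs C X Y. Act F f \<in> hom (Val F Y) (Val F X)) \<and>
    (\<forall>X\<in>Obj C. \<forall>x\<in>carrier (Val F X). Act F (Idn C X) x = x) \<and>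
    (\<forall>X\<in>Obj C. \<forall>Y\<in>Obj C. \<forall>Z\<in>Obj C. \<forall>f\<in>homs C X Y. \<forall>g\<in>homs C Y Z. \<forall>x\<in>carrier (Val F Z).
       Act F (Comp C g f) x = Act F f (Act F g x)) \<and>
    (\<forall>X\<in>Obj C. \<forall>Y\<in>Obj C. \<forall>f\<in>homs C X Y. \<forall>g\<in>homs C X Y. \<forall>x\<in>carrier (Val F Y).
       Act F (f \<otimes>\<^bsub>Hom C X Y\<^esub> g) x = Act F f x \<otimes>\<^bsub>Val F X\<^esub> Act F g x)"

definition nat_trans ::
  "('o, 'm) cat \<Rightarrow> ('o, 'm, 'a) cmod \<Rightarrow> ('o, 'm, 'b) cmod \<Rightarrow> ('o \<Rightarrow> 'a \<Rightarrow> 'b) \<Rightarrow> bool" where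
  "nat_trans C F G \<alpha> \<longleftrightarrow>
    (\<forall>X\<in>Obj C. \<alpha> X \<in> hom (Val F X) (Val G X)) \<and>
    (\<forall>X\<in>Obj C. \<forall>Y\<in>Obj C. \<forall>f\<in>homs C X Y. \<forall>x\<in>carrier (Val F Y).
       \<alpha> X (Act F f x) = Act G f (\<alpha> Y x))"

definition mod_iso :: "('o, 'm) cat \<Rightarrow> ('o, 'm, 'a) cmod \<Rightarrow> ('o, 'm, 'b) cmod \<Rightarrow> bool" where
  "mod_iso C F G \<longleftrightarrow>
    (\<exists>\<alpha>. nat_trans C F G \<alpha> \<and> (\<forall>X\<in>Obj C. \<alpha> X \<in> iso (Val F X) (Val G X)))"

definition zero_mod :: "('o, 'm) cat \<Rightarrow> ('o, 'm, 'a) cmod \<Rightarrow> bool" where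
  "zero_mod C F \<longleftrightarrow> (\<forall>X\<in>Obj C. trivial_group (Val F X))"

definition Rep :: "('o, 'm) cat \<Rightarrow> 'o \<Rightarrow> ('o, 'm, 'm) cmod" where
  "Rep C X = \<lparr>Val = (\<lambda>Y. Hom C Y X), Act = (\<lambda>f h. Comp C h f)\<rparr>"

definition Im_mod ::
  "('o \<Rightarrow> 'a \<Rightarrow> 'b) \<Rightarrow> ('o, 'm, 'a) cmod \<Rightarrow> ('o, 'm, 'b) cmod \<Rightarrow> ('o, 'm, 'b) cmod" where
  "Im_mod \<alpha> G F =
    \<lparr>Val = (\<lambda>X. (Val F X)\<lparr>carrier := \<alpha> X ` carrier (Val G X)\<rparr>), Act = Act F\<rparr>"

text \<open>
  In the cokernel, a morphism \<open>f\<close> sends the coset of \<open>k\<close> to the coset of \<open>Act F f k\<close>; the union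
  below is over equal sets.
\<close>

definition Cok_mod :: "('o, 'm) cat \<Rightarrow> ('o \<Rightarrow> 'a \<Rightarrow> 'b) \<Rightarrow> ('o, 'm, 'a) cmod \<Rightarrow>
    ('o, 'm, 'b) cmod \<Rightarrow> ('o, 'm, 'b set) cmod" where
  "Cok_mod C \<alpha> G F =
    \<lparr>Val = (\<lambda>X. Val F X Mod (\<alpha> X ` carrier (Val G X))),
     Act = (\<lambda>f K. \<Union>k\<in>K.
       (\<alpha> (Dom C f) ` carrier (Val G (Dom C f))) #>\<^bsub>Val F (Dom C f)\<^esub> Act F f k)\<rparr>"

text \<open>Exactness of \<open>A \<rightarrow> B \<rightarrow> D\<close> at \<open>B\<close>, for group homomorphisms \<open>f\<close> and \<open>g\<close>.\<close>

definition exact_at :: "'a monoid \<Rightarrow> 'b monoid \<Rightarrow> 'c monoid \<Rightarrow> ('a \<Rightarrow> 'b) \<Rightarrow> ('b \<Rightarrow> 'c) \<Rightarrow> bool" where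
  "exact_at A B D f g \<longleftrightarrow> f ` carrier A = kernel B D g"

definition short_exact ::
  "('o, 'm) cat \<Rightarrow> ('o, 'm, 'a) cmod \<Rightarrow> ('o, 'm, 'b) cmod \<Rightarrow> ('o, 'm, 'c) cmod \<Rightarrow>
    ('o \<Rightarrow> 'a \<Rightarrow> 'b) \<Rightarrow> ('o \<Rightarrow> 'b \<Rightarrow> 'c) \<Rightarrow> bool" where
  "short_exact C F G H \<iota> \<pi> \<longleftrightarrow> nat_trans C F G \<iota> \<and> nat_trans C G H \<pi> \<and>
    (\<forall>X\<in>Obj C. inj_on (\<iota> X) (carrier (Val F X)) \<and>
       exact_at (Val F X) (Val G X) (Val H X) (\<iota> X) (\<pi> X) \<and>
       \<pi> X ` carrier (Val G X) = carrier (Val H X))"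

text \<open>Pointwise exact sequences \<open>\<dots> \<rightarrow> P 1 \<rightarrow> P 0 \<rightarrow> F \<rightarrow> 0\<close>, where \<open>d i\<close> goes from \<open>P (i + 1)\<close> to \<open>P i\<close>.\<close>

definition resolution :: "('o, 'm) cat \<Rightarrow> (nat \<Rightarrow> ('o, 'm, 'a) cmod) \<Rightarrow> (nat \<Rightarrow> 'o \<Rightarrow> 'a \<Rightarrow> 'a) \<Rightarrow>
    ('o \<Rightarrow> 'a \<Rightarrow> 'b) \<Rightarrow> ('o, 'm, 'b) cmod \<Rightarrow> bool" where
  "resolution C P d \<epsilon> F \<longleftrightarrow>
    (\<forall>i. nat_trans C (P (Suc i)) (P i) (d i)) \<and> nat_trans C (P 0) F \<epsilon> \<and>
    (\<forall>X\<in>Obj C.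
      \<epsilon> X ` carrier (Val (P 0) X) = carrier (Val F X) \<and>
      exact_at (Val (P 1) X) (Val (P 0) X) (Val F X) (d 0 X) (\<epsilon> X) \<and>
      (\<forall>i. exact_at (Val (P (Suc (Suc i))) X) (Val (P (Suc i)) X) (Val (P i) X)
             (d (Suc i) X) (d i X)))"

definition in_mod :: "('o, 'm) cat \<Rightarrow> ('o, 'm, 'a) cmod \<Rightarrow> bool" where
  "in_mod C F \<longleftrightarrow> cmodule C F \<and>
    (\<exists>X d \<epsilon>. (\<forall>i. X i \<in> Obj C) \<and> resolution C (\<lambda>i. Rep C (X i)) d \<epsilon> F)"


section \<open>Homological algebra in the exact category \<open>mod C\<close>\<close>

definition projective :: "('o, 'm) cat \<Rightarrow> ('o, 'm, 'm set) cmod \<Rightarrow> bool" where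
  "projective C P \<longleftrightarrow> in_mod C P \<and>
    (\<forall>(K :: ('o, 'm, 'm set) cmod) (G :: ('o, 'm, 'm set) cmod) (H :: ('o, 'm, 'm set) cmod) \<iota> \<pi> \<alpha>.
       in_mod C K \<and> in_mod C G \<and> in_mod C H \<and> short_exact C K G H \<iota> \<pi> \<and> nat_trans C P H \<alpha> \<longrightarrow>
       (\<exists>\<beta>. nat_trans C P G \<beta> \<and>
          (\<forall>X\<in>Obj C. \<forall>x\<in>carrier (Val P X). \<pi> X (\<beta> X x) = \<alpha> X x)))"

definition projective_resolution ::
  "('o, 'm) cat \<Rightarrow> (nat \<Rightarrow> ('o, 'm, 'm set) cmod) \<Rightarrow> (nat \<Rightarrow> 'o \<Rightarrow> 'm set \<Rightarrow> 'm set) \<Rightarrow>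
    ('o \<Rightarrow> 'm set \<Rightarrow> 'm set) \<Rightarrow> ('o, 'm, 'm set) cmod \<Rightarrow> bool" where
  "projective_resolution C P d \<epsilon> F \<longleftrightarrow> (\<forall>i. projective C (P i)) \<and> resolution C P d \<epsilon> F"

definition pdim :: "('o, 'm) cat \<Rightarrow> ('o, 'm, 'm set) cmod \<Rightarrow> enat" where
  "pdim C F = Inf {enat k | k. \<exists>P d \<epsilon>. projective_resolution C P d \<epsilon> F \<and> (\<forall>i>k. zero_mod C (P i))}"

text \<open>
  The group of natural transformations. Since HOL functions are total, they are normalised to be
  \<open>undefined\<close> outside their domains.
\<close>

definition Nat_grp ::
  "('o, 'm) cat \<Rightarrow> ('o, 'm, 'a) cmod \<Rightarrow> ('o, 'm, 'b) cmod \<Rightarrow> ('o \<Rightarrow> 'a \<Rightarrow> 'b) monoid" where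
  "Nat_grp C F G =
    \<lparr>carrier = {\<alpha>. nat_trans C F G \<alpha> \<and> \<alpha> \<in> extensional (Obj C) \<and>
        (\<forall>X\<in>Obj C. \<alpha> X \<in> extensional (carrier (Val F X)))},
     mult = (\<lambda>\<alpha> \<beta>. \<lambda>X\<in>Obj C. \<lambda>x\<in>carrier (Val F X). \<alpha> X x \<otimes>\<^bsub>Val G X\<^esub> \<beta> X x),
     one = (\<lambda>X\<in>Obj C. \<lambda>x\<in>carrier (Val F X). \<one>\<^bsub>Val G X\<^esub>)\<rparr>"

text \<open>The map \<open>Hom(P, G) \<rightarrow> Hom(P', G)\<close> given by precomposition with \<open>d\<close> from \<open>P'\<close> to \<open>P\<close>.\<close>

definition precomp ::
  "('o, 'm) cat \<Rightarrow> ('o, 'm, 'a) cmod \<Rightarrow> ('o \<Rightarrow> 'a \<Rightarrow> 'c) \<Rightarrow> ('o \<Rightarrow> 'c \<Rightarrow> 'b) \<Rightarrow> ('o \<Rightarrow> 'a \<Rightarrow> 'b)" where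
  "precomp C P' d \<phi> = (\<lambda>X\<in>Obj C. \<lambda>x\<in>carrier (Val P' X). \<phi> X (d X x))"

text \<open>
  In positive degrees \<open>Ext\<close> is the cohomology of \<open>Hom(P, G)\<close> for a chosen projective resolution
  \<open>P\<close> of \<open>F\<close>; up to isomorphism it does not depend on the choice.
\<close>

definition chosen_resolution :: "('o, 'm) cat \<Rightarrow> ('o, 'm, 'm set) cmod \<Rightarrow>
    (nat \<Rightarrow> ('o, 'm, 'm set) cmod) \<times> (nat \<Rightarrow> 'o \<Rightarrow> 'm set \<Rightarrow> 'm set)" where
  "chosen_resolution C F = (SOME (P, d). \<exists>\<epsilon>. projective_resolution C P d \<epsilon> F)"

definition Ext_pos :: "('o, 'm) cat \<Rightarrow> nat \<Rightarrow> ('o, 'm, 'm set) cmod \<Rightarrow> ('o, 'm, 'b) cmod \<Rightarrow>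
    ('o \<Rightarrow> 'm set \<Rightarrow> 'b) set monoid" where
  "Ext_pos C i F G = (case chosen_resolution C F of (P, d) \<Rightarrow>
     (Nat_grp C (P i) G)\<lparr>carrier :=
         kernel (Nat_grp C (P i) G) (Nat_grp C (P (Suc i)) G) (precomp C (P (Suc i)) (d i))\<rparr>
       Mod (precomp C (P i) (d (i - 1)) ` carrier (Nat_grp C (P (i - 1)) G)))"

definition Ext_zero :: "('o, 'm) cat \<Rightarrow> nat \<Rightarrow> ('o, 'm, 'm set) cmod \<Rightarrow> ('o, 'm, 'b) cmod \<Rightarrow> bool" where
  "Ext_zero C i F G \<longleftrightarrow>
    (if i = 0 then trivial_group (Nat_grp C F G) else trivial_group (Ext_pos C i F G))"

definition ex_cat :: "('o, 'm) cat \<Rightarrow> nat \<Rightarrow> ('o, 'm, 'm set) cmod set" where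
  "ex_cat C n = {F. in_mod C F \<and> pdim C F \<le> enat (n + 1) \<and>
     (\<forall>i\<le>n. \<forall>Y\<in>Obj C. Ext_zero C i F (Rep C Y))}"


section \<open>\<open>n\<close>-exact sequences and \<open>n\<close>-exact structures\<close>

text \<open>
  A complex \<open>X\<^sub>n\<^sub>+\<^sub>1 \<rightarrow> \<dots> \<rightarrow> X\<^sub>0\<close> has terms \<open>ob X i\<close> for \<open>i \<le> n + 1\<close> and
  differentials \<open>df X i\<close> from \<open>ob X i\<close> to \<open>ob X (i - 1)\<close> for \<open>1 \<le> i \<le> n + 1\<close>; the values at
  other indices are irrelevant.
\<close>

record ('o, 'm) cpx =
  ob :: "nat \<Rightarrow> 'o"
  df :: "nat \<Rightarrow> 'm"

definition is_complex :: "('o, 'm) cat \<Rightarrow> nat \<Rightarrow> ('o, 'm) cpx \<Rightarrow> bool" where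
  "is_complex C n X \<longleftrightarrow>
    (\<forall>i\<le>Suc n. ob X i \<in> Obj C) \<and>
    (\<forall>i\<le>n. df X (Suc i) \<in> homs C (ob X (Suc i)) (ob X i)) \<and>
    (\<forall>i<n. Comp C (df X (Suc i)) (df X (Suc (Suc i))) = \<one>\<^bsub>Hom C (ob X (Suc (Suc i))) (ob X i)\<^esub>)"

text \<open>Exactness of \<open>0 \<rightarrow> C(Y, X\<^sub>n\<^sub>+\<^sub>1) \<rightarrow> \<dots> \<rightarrow> C(Y, X\<^sub>0)\<close>.\<close>

definition hom_exact :: "('o, 'm) cat \<Rightarrow> nat \<Rightarrow> ('o, 'm) cpx \<Rightarrow> 'o \<Rightarrow> bool" where
  "hom_exact C n X Y \<longleftrightarrow>
    inj_on (Comp C (df X (Suc n))) (homs C Y (ob X (Suc n))) \<and>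
    (\<forall>i<n. exact_at (Hom C Y (ob X (Suc (Suc i)))) (Hom C Y (ob X (Suc i))) (Hom C Y (ob X i))
       (Comp C (df X (Suc (Suc i)))) (Comp C (df X (Suc i))))"

text \<open>Exactness of \<open>0 \<rightarrow> C(X\<^sub>0, Y) \<rightarrow> \<dots> \<rightarrow> C(X\<^sub>n\<^sub>+\<^sub>1, Y)\<close>.\<close>

definition cohom_exact :: "('o, 'm) cat \<Rightarrow> nat \<Rightarrow> ('o, 'm) cpx \<Rightarrow> 'o \<Rightarrow> bool" where
  "cohom_exact C n X Y \<longleftrightarrow>
    inj_on (\<lambda>h. Comp C h (df X 1)) (homs C (ob X 0) Y) \<and>
    (\<forall>i<n. exact_at (Hom C (ob X i) Y) (Hom C (ob X (Suc i)) Y) (Hom C (ob X (Suc (Suc i))) Y)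
       (\<lambda>h. Comp C h (df X (Suc i))) (\<lambda>h. Comp C h (df X (Suc (Suc i)))))"

definition n_exact :: "('o, 'm) cat \<Rightarrow> nat \<Rightarrow> ('o, 'm) cpx \<Rightarrow> bool" where
  "n_exact C n X \<longleftrightarrow> is_complex C n X \<and> (\<forall>Y\<in>Obj C. hom_exact C n X Y \<and> cohom_exact C n X Y)"

definition chain_map ::
  "('o, 'm) cat \<Rightarrow> nat \<Rightarrow> ('o, 'm) cpx \<Rightarrow> ('o, 'm) cpx \<Rightarrow> (nat \<Rightarrow> 'm) \<Rightarrow> bool" where
  "chain_map C n X Y f \<longleftrightarrow>
    (\<forall>i\<le>Suc n. f i \<in> homs C (ob X i) (ob Y i)) \<and>
    (\<forall>i\<le>n. Comp C (f i) (df X (Suc i)) = Comp C (df Y (Suc i)) (f (Suc i)))"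

definition homotopic ::
  "('o, 'm) cat \<Rightarrow> nat \<Rightarrow> ('o, 'm) cpx \<Rightarrow> ('o, 'm) cpx \<Rightarrow> (nat \<Rightarrow> 'm) \<Rightarrow> (nat \<Rightarrow> 'm) \<Rightarrow> bool" where
  "homotopic C n X Y f g \<longleftrightarrow>
    (\<exists>h. (\<forall>i\<le>n. h i \<in> homs C (ob X i) (ob Y (Suc i))) \<and>
       f 0 = g 0 \<otimes>\<^bsub>Hom C (ob X 0) (ob Y 0)\<^esub> Comp C (df Y 1) (h 0) \<and>
       (\<forall>i<n. f (Suc i) = g (Suc i) \<otimes>\<^bsub>Hom C (ob X (Suc i)) (ob Y (Suc i))\<^esub>
          (Comp C (df Y (Suc (Suc i))) (h (Suc i))
             \<otimes>\<^bsub>Hom C (ob X (Suc i)) (ob Y (Suc i))\<^esub> Comp C (h i) (df X (Suc i)))) \<and>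
       f (Suc n) = g (Suc n) \<otimes>\<^bsub>Hom C (ob X (Suc n)) (ob Y (Suc n))\<^esub> Comp C (h n) (df X (Suc n)))"

text \<open>Isomorphism in the homotopy category.\<close>

definition homotopy_equiv :: "('o, 'm) cat \<Rightarrow> nat \<Rightarrow> ('o, 'm) cpx \<Rightarrow> ('o, 'm) cpx \<Rightarrow> bool" where
  "homotopy_equiv C n X Y \<longleftrightarrow>
    (\<exists>f g. chain_map C n X Y f \<and> chain_map C n Y X g \<and>
       homotopic C n X X (\<lambda>i. Comp C (g i) (f i)) (\<lambda>i. Idn C (ob X i)) \<and>
       homotopic C n Y Y (\<lambda>i. Comp C (f i) (g i)) (\<lambda>i. Idn C (ob Y i)))"

definition inflation :: "nat \<Rightarrow> ('o, 'm) cpx set \<Rightarrow> 'm \<Rightarrow> bool" where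
  "inflation n \<X> f \<longleftrightarrow> (\<exists>X\<in>\<X>. f = df X (Suc n))"

definition deflation :: "('o, 'm) cpx set \<Rightarrow> 'm \<Rightarrow> bool" where
  "deflation \<X> f \<longleftrightarrow> (\<exists>X\<in>\<X>. f = df X 1)"

text \<open>
  The column with entries \<open>-d\<close>, \<open>f\<close> is written \<open>i1 (-d) + i2 f\<close> and the row with entries \<open>-d\<close>, \<open>f\<close>
  is written \<open>(-d) p1 + f p2\<close>. As direct sums are not part of the data of the category, the
  conditions \<open>Ex2\<close> and \<open>Ex2_op\<close> are imposed for every choice of direct sum.
\<close>

locale n_exact_structure =
  fixes C :: "('o, 'm) cat" and n :: nat and \<X> :: "('o, 'm) cpx set"
  assumes conflations: "X \<in> \<X> \<Longrightarrow> n_exact C n X"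
    and iso_closed: "X \<in> \<X> \<Longrightarrow> n_exact C n Y \<Longrightarrow> homotopy_equiv C n X Y \<Longrightarrow> Y \<in> \<X>"
    and Ex0: "(\<And>i. i \<le> Suc n \<Longrightarrow> zero_object C (ob X i)) \<Longrightarrow> is_complex C n X \<Longrightarrow> X \<in> \<X>"
    and Ex1: "inflation n \<X> f \<Longrightarrow> inflation n \<X> g \<Longrightarrow> Cod C f = Dom C g \<Longrightarrow>
      inflation n \<X> (Comp C g f)"
    and Ex1_op: "deflation \<X> f \<Longrightarrow> deflation \<X> g \<Longrightarrow> Cod C f = Dom C g \<Longrightarrow>
      deflation \<X> (Comp C g f)"
    and Ex2: "inflation n \<X> d \<Longrightarrow> A = Dom C d \<Longrightarrow> B = Cod C d \<Longrightarrow>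
      A' \<in> Obj C \<Longrightarrow> f \<in> homs C A A' \<Longrightarrow> biproduct C B A' W i1 i2 p1 p2 \<Longrightarrow>
      v = Comp C i1 (inv\<^bsub>Hom C A B\<^esub> d) \<otimes>\<^bsub>Hom C A W\<^esub> Comp C i2 f \<Longrightarrow>
      inflation n \<X> v \<and> (\<exists>c. weak_cokernel C v c \<and> inflation n \<X> (Comp C c i2))"
    and Ex2_op: "deflation \<X> d \<Longrightarrow> A = Dom C d \<Longrightarrow> B = Cod C d \<Longrightarrow>
      B' \<in> Obj C \<Longrightarrow> f \<in> homs C B' B \<Longrightarrow> biproduct C A B' W i1 i2 p1 p2 \<Longrightarrow>
      v = Comp C (inv\<^bsub>Hom C A B\<^esub> d) p1 \<otimes>\<^bsub>Hom C W B\<^esub> Comp C f p2 \<Longrightarrow>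
      deflation \<X> v \<and> (\<exists>k. weak_kernel C v k \<and> deflation \<X> (Comp C p2 k))"


section \<open>The functors \<open>Fun\<close>, \<open>Res\<close>, \<open>Op\<close>, \<open>Tr\<close> on objects, and essential images\<close>

definition Fun :: "('o, 'm) cat \<Rightarrow> ('o, 'm) cpx \<Rightarrow> ('o, 'm, 'm set) cmod" where
  "Fun C X = Cok_mod C (\<lambda>Y. Comp C (df X 1)) (Rep C (ob X 1)) (Rep C (ob X 0))"

text \<open>The complex \<open>C(-, X\<^sub>n\<^sub>+\<^sub>1) \<rightarrow> \<dots> \<rightarrow> C(-, X\<^sub>0)\<close> is a (projective) resolution of \<open>F\<close>.\<close>

definition resolves :: "('o, 'm) cat \<Rightarrow> nat \<Rightarrow> ('o, 'm) cpx \<Rightarrow> ('o, 'm, 'm set) cmod \<Rightarrow> bool" where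
  "resolves C n X F \<longleftrightarrow> (\<forall>Y\<in>Obj C. hom_exact C n X Y) \<and>
    (\<exists>\<epsilon>. nat_trans C (Rep C (ob X 0)) F \<epsilon> \<and>
       (\<forall>Y\<in>Obj C. \<epsilon> Y ` homs C Y (ob X 0) = carrier (Val F Y) \<and>
          exact_at (Hom C Y (ob X 1)) (Hom C Y (ob X 0)) (Val F Y) (Comp C (df X 1)) (\<epsilon> Y)))"

definition Res :: "('o, 'm) cat \<Rightarrow> nat \<Rightarrow> ('o, 'm, 'm set) cmod \<Rightarrow> ('o, 'm) cpx" where
  "Res C n F = (SOME X. n_exact C n X \<and> resolves C n X F)"

definition Op_cpx :: "nat \<Rightarrow> ('o, 'm) cpx \<Rightarrow> ('o, 'm) cpx" where
  "Op_cpx n X = \<lparr>ob = (\<lambda>i. ob X (n + 1 - i)), df = (\<lambda>i. df X (n + 2 - i))\<rparr>"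

definition Tr :: "('o, 'm) cat \<Rightarrow> nat \<Rightarrow> ('o, 'm, 'm set) cmod \<Rightarrow> ('o, 'm, 'm set) cmod" where
  "Tr C n F = Fun (op_cat C) (Op_cpx n (Res C n F))"

definition Fun_image :: "('o, 'm) cat \<Rightarrow> nat \<Rightarrow> ('o, 'm) cpx set \<Rightarrow> ('o, 'm, 'm set) cmod set" where
  "Fun_image C n \<X> = {F \<in> ex_cat C n. \<exists>X\<in>\<X>. mod_iso C (Fun C X) F}"

definition Res_image :: "('o, 'm) cat \<Rightarrow> nat \<Rightarrow> ('o, 'm, 'm set) cmod set \<Rightarrow> ('o, 'm) cpx set" where
  "Res_image C n \<F> = {X. n_exact C n X \<and> (\<exists>F\<in>\<F>. homotopy_equiv C n (Res C n F) X)}"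

definition Tr_image ::
  "('o, 'm) cat \<Rightarrow> nat \<Rightarrow> ('o, 'm, 'm set) cmod set \<Rightarrow> ('o, 'm, 'm set) cmod set" where
  "Tr_image C n \<F> = {G \<in> ex_cat (op_cat C) n. \<exists>F\<in>\<F>. mod_iso (op_cat C) (Tr C n F) G}"


section \<open>Subcategories of \<open>ex_cat C n\<close>\<close>

text \<open>
  A full, isomorphism closed subcategory is given by its set of objects. Subcategories are
  nonempty: the empty class is extension closed and fixed by \<open>Pb\<close> and \<open>Po\<close> for trivial reasons, but
  it does not come from an \<open>n\<close>-exact structure.
\<close>

definition subcategory :: "('o, 'm) cat \<Rightarrow> nat \<Rightarrow> ('o, 'm, 'm set) cmod set \<Rightarrow> bool" where
  "subcategory C n \<F> \<longleftrightarrow> \<F> \<subseteq> ex_cat C n \<and> \<F> \<noteq> {} \<and>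
    (\<forall>F\<in>\<F>. \<forall>G\<in>ex_cat C n. mod_iso C F G \<longrightarrow> G \<in> \<F>)"

definition extension_closed :: "('o, 'm) cat \<Rightarrow> nat \<Rightarrow> ('o, 'm, 'm set) cmod set \<Rightarrow> bool" where
  "extension_closed C n \<F> \<longleftrightarrow>
    (\<forall>F\<in>\<F>. \<forall>H\<in>\<F>. \<forall>G\<in>ex_cat C n. \<forall>\<iota> \<pi>. short_exact C F G H \<iota> \<pi> \<longrightarrow> G \<in> \<F>)"

text \<open>
  Membership of a module \<open>M\<close> with elements of arbitrary type in an isomorphism closed class \<open>\<F>\<close>;
  needed because \<open>F / Im \<alpha>\<close> consists of cosets and so has elements of type \<open>'m set set\<close>.
\<close>

definition belongs :: "('o, 'm) cat \<Rightarrow> ('o, 'm, 'a) cmod \<Rightarrow> ('o, 'm, 'm set) cmod set \<Rightarrow> bool" where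
  "belongs C M \<F> \<longleftrightarrow> (\<exists>F\<in>\<F>. mod_iso C M F)"

definition Pb :: "('o, 'm) cat \<Rightarrow> ('o, 'm, 'm set) cmod set \<Rightarrow> ('o, 'm, 'm set) cmod set" where
  "Pb C \<F> = {F \<in> \<F>. \<forall>(G :: ('o, 'm, 'm set) cmod) \<alpha>. in_mod C G \<and> nat_trans C G F \<alpha> \<longrightarrow>
     belongs C (Im_mod \<alpha> G F) \<F> \<and> belongs C (Cok_mod C \<alpha> G F) \<F>}"

definition Po :: "('o, 'm) cat \<Rightarrow> nat \<Rightarrow> ('o, 'm, 'm set) cmod set \<Rightarrow> ('o, 'm, 'm set) cmod set" where
  "Po C n \<F> = Tr_image (op_cat C) n (Pb (op_cat C) (Tr_image C n \<F>))"

end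

theory Submission
  imports Defs
begin

text \<open>
  A resolution of \<open>F\<close> in \<open>ex_cat C n\<close> is an \<open>n\<close>-exact sequence, unique up to homotopy, and a morphism \<open>v\<close>
  is a deflation of a class \<open>\<X>\<close> as soon as the cokernel of \<open>C(-, v)\<close> lies in \<open>Fun \<X>\<close>: by Schanuel's
  lemma and splitting of idempotents, a resolution can be changed so that it starts with \<open>v\<close>.
  So the axioms become statements about cokernels. The cokernel of \<open>[-d f]\<close> is the quotient of
  \<open>Cok C(-, d)\<close> by the image of the map from \<open>C(-, Y)\<close> given by \<open>f\<close>, and the map from the weak kernel to \<open>Y\<close>
  presents that image; hence \<open>Ex2_op\<close> means \<open>Pb \<F> = \<F>\<close>. By the horseshoe lemma \<open>\<F>\<close> is extension closed iff
  \<open>\<X>\<close> is closed under degreewise split extensions, and in the presence of \<open>Ex2_op\<close> this is equivalent to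
  \<open>Ex1_op\<close>. Closure under degreewise split extensions is self-dual, so \<open>Ex1\<close> and \<open>Ex2\<close> follow by passing
  to the opposite category.
\<close>

section \<open>Calculus of morphisms\<close>

text \<open>The Yoneda lemma brings everything down to the category itself: a map from C(-, B) to a
  module is an element at B, so a module enters only through a generator and a morphism
  \<open>v\<close> presenting it, and resolutions become complexes of objects. Two obstacles shape
  the work. Ext and projective dimension are defined by arbitrary projective resolutions, so
  projectives must first be shown to be representable, which is one use of split idempotents. The
  other use is truncation: a resolution with prescribed first differential \<open>v\<close> comes
  out infinite and is cut off at degree n + 1 by splitting an idempotent there; n > 0 keeps
  \<open>v\<close> itself out of reach of this change. Ex0 reduces to nonemptiness: pulling any
  deflation back along an identity gives a split epimorphism, whose cokernel is the zero module. For
  \<open>Po\<close>, transposition can only be cancelled on essential images, so \<open>Pb\<close>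
  of the transposed class has to be recognised as an essential image again.\<close>

definition Ar :: "('o, 'm) cat \<Rightarrow> 'm \<Rightarrow> bool" where
  "Ar C f \<longleftrightarrow> Dom C f \<in> Obj C \<and> Cod C f \<in> Obj C \<and> f \<in> homs C (Dom C f) (Cod C f)"

text \<open>Morphisms know their ends, so typing conditions are equations between \<open>Dom\<close>
  and \<open>Cod\<close>, and the hom set in question never has to be named.\<close>

abbreviation ar :: "('o, 'm) cat \<Rightarrow> 'm \<Rightarrow> 'o \<Rightarrow> 'o \<Rightarrow> bool" where
  "ar C f X Y \<equiv> Ar C f \<and> Dom C f = X \<and> Cod C f = Y"

definition zr :: "('o, 'm) cat \<Rightarrow> 'o \<Rightarrow> 'o \<Rightarrow> 'm" where
  "zr C X Y = \<one>\<^bsub>Hom C X Y\<^esub>"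

definition add :: "('o, 'm) cat \<Rightarrow> 'm \<Rightarrow> 'm \<Rightarrow> 'm" where
  "add C f g = f \<otimes>\<^bsub>Hom C (Dom C f) (Cod C f)\<^esub> g"

definition neg :: "('o, 'm) cat \<Rightarrow> 'm \<Rightarrow> 'm" where
  "neg C f = inv\<^bsub>Hom C (Dom C f) (Cod C f)\<^esub> f"

definition sub :: "('o, 'm) cat \<Rightarrow> 'm \<Rightarrow> 'm \<Rightarrow> 'm" where
  "sub C f g = add C f (neg C g)"

lemma op_cat_simps [simp]:
  "Obj (op_cat C) = Obj C" "Hom (op_cat C) X Y = Hom C Y X" "Dom (op_cat C) = Cod C"
  "Cod (op_cat C) = Dom C" "Comp (op_cat C) = (\<lambda>g f. Comp C f g)" "Idn (op_cat C) = Idn C"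
  by (simp_all add: op_cat_def)

text \<open>Except for \<open>zr\<close>, whose ends are swapped, these notions read the hom group
  off the morphism and do not notice that arrows are reversed. A dual statement is therefore the
  original one instantiated at \<open>op_cat C\<close> and simplified, as in \<open>cmp_zr\<close>
  and \<open>cmp_neg\<close>.\<close>

lemma op_ops [simp]:
  "Ar (op_cat C) f \<longleftrightarrow> Ar C f" "zr (op_cat C) X Y = zr C Y X"
  "add (op_cat C) = add C" "neg (op_cat C) = neg C" "sub (op_cat C) = sub C"
  by (auto simp: Ar_def zr_def add_def neg_def sub_def fun_eq_iff)

context preadditive_category
begin

abbreviation cmp (infixr "\<cdot>" 75) where "g \<cdot> f \<equiv> Comp C g f"
abbreviation pls (infixl "\<boxplus>" 65) where "f \<boxplus> g \<equiv> add C f g"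
abbreviation mns (infixl "\<boxminus>" 65) where "f \<boxminus> g \<equiv> sub C f g"

lemma op_preadditive: "preadditive_category (op_cat C)"
proof (rule preadditive_category.intro, unfold op_cat_simps, goal_cases)
  case (1 X Y) then show ?case by (intro Hom_group)
next
  case (2 X Y f) then show ?case using Dom_Cod[of Y X f] by simp
next
  case (3 X Y Z f g) then show ?case using Comp_closed[of Z Y X] by simp
next
  case (4 W X Y Z f g h) then show ?case using Comp_assoc[of Z Y X W h g f] by simp
next
  case (5 X) then show ?case by (rule Idn_closed)
next
  case (6 X Y f) then show ?case using Comp_Idn_right[of Y X f] by simp
next
  case (7 X Y f) then show ?case using Comp_Idn_left[of Y X f] by simp
next
  case (8 X Y Z f g g') then show ?case using Comp_add_right[of Z Y X g g' f] by simp
next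
  case (9 X Y Z f f' g) then show ?case using Comp_add_left[of Z Y X g f f'] by simp
qed

lemma arI: "X \<in> Obj C \<Longrightarrow> Y \<in> Obj C \<Longrightarrow> f \<in> homs C X Y \<Longrightarrow> ar C f X Y"
  using Dom_Cod[of X Y f] by (auto simp: Ar_def)

lemma homs_iff: "X \<in> Obj C \<Longrightarrow> Y \<in> Obj C \<Longrightarrow> f \<in> homs C X Y \<longleftrightarrow> ar C f X Y"
  using Dom_Cod[of X Y f] by (auto simp: Ar_def)

lemma ArD [simp]: "Ar C f \<Longrightarrow> Dom C f \<in> Obj C" "Ar C f \<Longrightarrow> Cod C f \<in> Obj C"
  by (auto simp: Ar_def)

lemma Ar_homs: "Ar C f \<Longrightarrow> Dom C f = X \<Longrightarrow> Cod C f = Y \<Longrightarrow> f \<in> homs C X Y"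
  by (simp only: Ar_def)

lemma grp: "Ar C f \<Longrightarrow> comm_group (Hom C (Dom C f) (Cod C f))"
  by (simp add: Hom_group)

lemma mult_eq_add: "ar C f X Y \<Longrightarrow> f \<otimes>\<^bsub>Hom C X Y\<^esub> g = f \<boxplus> g"
  by (auto simp: add_def)

lemma cmp_ar: "Ar C f \<Longrightarrow> Ar C g \<Longrightarrow> Dom C g = Cod C f \<Longrightarrow> ar C (g \<cdot> f) (Dom C f) (Cod C g)"
  using Comp_closed[of "Dom C f" "Cod C f" "Cod C g" f g]
  by (intro arI) (simp_all add: Ar_homs)

lemma add_ar: "Ar C f \<Longrightarrow> Ar C g \<Longrightarrow> Dom C g = Dom C f \<Longrightarrow> Cod C g = Cod C f \<Longrightarrow>
    ar C (f \<boxplus> g) (Dom C f) (Cod C f)"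
proof -
  assume a: "Ar C f" "Ar C g" "Dom C g = Dom C f" "Cod C g = Cod C f"
  interpret G: comm_group "Hom C (Dom C f) (Cod C f)" by (rule grp[OF a(1)])
  have "f \<boxplus> g \<in> homs C (Dom C f) (Cod C f)"
    using a G.m_closed[of f g] by (simp add: add_def Ar_homs)
  then show ?thesis using a by (intro arI) simp_all
qed

lemma neg_ar: "Ar C f \<Longrightarrow> ar C (neg C f) (Dom C f) (Cod C f)"
proof -
  assume a: "Ar C f"
  interpret G: comm_group "Hom C (Dom C f) (Cod C f)" by (rule grp[OF a(1)])
  have "neg C f \<in> homs C (Dom C f) (Cod C f)"
    using a G.inv_closed[of f] by (simp add: neg_def Ar_homs)
  then show ?thesis using a by (intro arI) simp_all
qed

lemma zr_ar: "X \<in> Obj C \<Longrightarrow> Y \<in> Obj C \<Longrightarrow> ar C (zr C X Y) X Y"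
proof -
  assume a: "X \<in> Obj C" "Y \<in> Obj C"
  interpret G: comm_group "Hom C X Y" using a by (simp add: Hom_group)
  show ?thesis using a G.one_closed by (simp add: zr_def arI)
qed

lemma Idn_ar: "X \<in> Obj C \<Longrightarrow> ar C (Idn C X) X X"
  by (intro arI) (auto simp: Idn_closed)

lemma sub_ar: "Ar C f \<Longrightarrow> Ar C g \<Longrightarrow> Dom C g = Dom C f \<Longrightarrow> Cod C g = Cod C f \<Longrightarrow>
    ar C (f \<boxminus> g) (Dom C f) (Cod C f)"
  using add_ar[of f "neg C g"] neg_ar[of g] by (simp add: sub_def)

lemmas ar_simps [simp] =
  cmp_ar[THEN conjunct1] cmp_ar[THEN conjunct2, THEN conjunct1] cmp_ar[THEN conjunct2, THEN conjunct2]
  add_ar[THEN conjunct1] add_ar[THEN conjunct2, THEN conjunct1] add_ar[THEN conjunct2, THEN conjunct2]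
  neg_ar[THEN conjunct1] neg_ar[THEN conjunct2, THEN conjunct1] neg_ar[THEN conjunct2, THEN conjunct2]
  sub_ar[THEN conjunct1] sub_ar[THEN conjunct2, THEN conjunct1] sub_ar[THEN conjunct2, THEN conjunct2]
  zr_ar[THEN conjunct1] zr_ar[THEN conjunct2, THEN conjunct1] zr_ar[THEN conjunct2, THEN conjunct2]
  Idn_ar[THEN conjunct1] Idn_ar[THEN conjunct2, THEN conjunct1] Idn_ar[THEN conjunct2, THEN conjunct2]

lemma assoc [simp]: "Ar C f \<Longrightarrow> Ar C g \<Longrightarrow> Ar C h \<Longrightarrow> Dom C g = Cod C f \<Longrightarrow> Dom C h = Cod C g \<Longrightarrow>
    (h \<cdot> g) \<cdot> f = h \<cdot> g \<cdot> f"
  by (rule Comp_assoc[of "Dom C f" "Cod C f" "Cod C g" "Cod C h" f g h, symmetric]) (simp_all add: Ar_homs)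

lemma idl [simp]: "Ar C f \<Longrightarrow> Cod C f = Y \<Longrightarrow> Idn C Y \<cdot> f = f"
  by (rule Comp_Idn_left[of "Dom C f" Y f]) (auto simp: Ar_homs)

lemma idr [simp]: "Ar C f \<Longrightarrow> Dom C f = Y \<Longrightarrow> f \<cdot> Idn C Y = f"
  by (rule Comp_Idn_right[of Y "Cod C f" f]) (auto simp: Ar_homs)

lemma addl [simp]: "Ar C f \<Longrightarrow> Ar C g \<Longrightarrow> Ar C g' \<Longrightarrow> Dom C g = Cod C f \<Longrightarrow> Dom C g' = Cod C f \<Longrightarrow>
    Cod C g' = Cod C g \<Longrightarrow> (g \<boxplus> g') \<cdot> f = g \<cdot> f \<boxplus> g' \<cdot> f"
  using Comp_add_left[of "Dom C f" "Cod C f" "Cod C g" f g g'] unfolding add_def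
  by (simp only: cmp_ar Ar_homs ArD)

lemma addr [simp]: "Ar C f \<Longrightarrow> Ar C f' \<Longrightarrow> Ar C g \<Longrightarrow> Dom C g = Cod C f \<Longrightarrow> Dom C f' = Dom C f \<Longrightarrow>
    Cod C f' = Cod C f \<Longrightarrow> g \<cdot> (f \<boxplus> f') = g \<cdot> f \<boxplus> g \<cdot> f'"
  using Comp_add_right[of "Dom C f" "Cod C f" "Cod C g" f f' g] unfolding add_def
  by (simp only: cmp_ar Ar_homs ArD)

lemma add_assoc: "Ar C f \<Longrightarrow> Ar C g \<Longrightarrow> Ar C h \<Longrightarrow> Dom C g = Dom C f \<Longrightarrow> Dom C h = Dom C f \<Longrightarrow>
   Cod C g = Cod C f \<Longrightarrow> Cod C h = Cod C f \<Longrightarrow> (f \<boxplus> g) \<boxplus> h = f \<boxplus> (g \<boxplus> h)"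
proof -
  assume a: "Ar C f" "Ar C g" "Ar C h" "Dom C g = Dom C f" "Dom C h = Dom C f" "Cod C g = Cod C f" "Cod C h = Cod C f"
  interpret G: comm_group "Hom C (Dom C f) (Cod C f)" by (rule grp[OF a(1)])
  have "(f \<boxplus> g) \<boxplus> h = (f \<boxplus> g) \<otimes>\<^bsub>Hom C (Dom C f) (Cod C f)\<^esub> h"
    using a by (subst (1) add_def) simp
  then show ?thesis using a G.m_assoc[of f g h] by (simp add: Ar_homs add_def)
qed

lemma add_comm: "Ar C f \<Longrightarrow> Ar C g \<Longrightarrow> Dom C g = Dom C f \<Longrightarrow> Cod C g = Cod C f \<Longrightarrow> f \<boxplus> g = g \<boxplus> f"
proof -
  assume a: "Ar C f" "Ar C g" "Dom C g = Dom C f" "Cod C g = Cod C f"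
  interpret G: comm_group "Hom C (Dom C f) (Cod C f)" by (rule grp[OF a(1)])
  show ?thesis using a G.m_comm[of f g] by (simp add: Ar_homs add_def)
qed

lemma add_zr [simp]: "Ar C f \<Longrightarrow> Dom C f = X \<Longrightarrow> Cod C f = Y \<Longrightarrow> f \<boxplus> zr C X Y = f"
proof -
  assume a: "Ar C f" "Dom C f = X" "Cod C f = Y"
  interpret G: comm_group "Hom C (Dom C f) (Cod C f)" by (rule grp[OF a(1)])
  show ?thesis using a by (auto simp: Ar_homs add_def zr_def)
qed

lemma zr_add [simp]: "Ar C f \<Longrightarrow> Dom C f = X \<Longrightarrow> Cod C f = Y \<Longrightarrow> zr C X Y \<boxplus> f = f"
  by (subst add_comm) auto

lemma add_neg [simp]: "Ar C f \<Longrightarrow> f \<boxplus> neg C f = zr C (Dom C f) (Cod C f)"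
proof -
  assume a: "Ar C f"
  interpret G: comm_group "Hom C (Dom C f) (Cod C f)" by (rule grp[OF a(1)])
  show ?thesis using a by (auto simp: Ar_homs add_def zr_def neg_def)
qed

lemma add_cancel: "Ar C f \<Longrightarrow> Ar C g \<Longrightarrow> Ar C h \<Longrightarrow> Dom C g = Dom C f \<Longrightarrow> Dom C h = Dom C f \<Longrightarrow>
   Cod C g = Cod C f \<Longrightarrow> Cod C h = Cod C f \<Longrightarrow> g \<boxplus> f = h \<boxplus> f \<longleftrightarrow> g = h"
  by (metis add_assoc add_neg add_zr neg_ar)

lemma sub_self [simp]: "Ar C f \<Longrightarrow> f \<boxminus> f = zr C (Dom C f) (Cod C f)"
  by (simp add: sub_def)

lemma sub_add [simp]: "Ar C f \<Longrightarrow> Ar C g \<Longrightarrow> Dom C g = Dom C f \<Longrightarrow> Cod C g = Cod C f \<Longrightarrow> (f \<boxminus> g) \<boxplus> g = f"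
  by (simp add: sub_def add_assoc add_comm[of "neg C g" g])

lemma sub_add2 [simp]: "Ar C f \<Longrightarrow> Ar C g \<Longrightarrow> Dom C g = Dom C f \<Longrightarrow> Cod C g = Cod C f \<Longrightarrow> g \<boxplus> (f \<boxminus> g) = f"
  by (subst add_comm) simp_all

lemma add_sub [simp]: "Ar C f \<Longrightarrow> Ar C g \<Longrightarrow> Dom C g = Dom C f \<Longrightarrow> Cod C g = Cod C f \<Longrightarrow> (f \<boxplus> g) \<boxminus> g = f"
  by (simp add: sub_def add_assoc)

lemma add_sub2 [simp]: "Ar C f \<Longrightarrow> Ar C g \<Longrightarrow> Dom C g = Dom C f \<Longrightarrow> Cod C g = Cod C f \<Longrightarrow> (g \<boxplus> f) \<boxminus> g = f"
  by (subst add_comm) simp_all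

lemma sub_eq_iff: "Ar C f \<Longrightarrow> Ar C g \<Longrightarrow> Ar C h \<Longrightarrow> Dom C g = Dom C f \<Longrightarrow> Dom C h = Dom C f \<Longrightarrow>
   Cod C g = Cod C f \<Longrightarrow> Cod C h = Cod C f \<Longrightarrow> f \<boxminus> g = h \<longleftrightarrow> f = h \<boxplus> g"
  by (metis sub_add add_sub)

lemma sub_eq_zr: "Ar C f \<Longrightarrow> Ar C g \<Longrightarrow> Dom C g = Dom C f \<Longrightarrow> Cod C g = Cod C f \<Longrightarrow> Dom C f = X \<Longrightarrow> Cod C f = Y \<Longrightarrow>
   f \<boxminus> g = zr C X Y \<longleftrightarrow> f = g"
  by (subst sub_eq_iff) auto

lemma zr_cmp [simp]: "Ar C f \<Longrightarrow> Cod C f = Y \<Longrightarrow> Z \<in> Obj C \<Longrightarrow> zr C Y Z \<cdot> f = zr C (Dom C f) Z"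
proof -
  assume a: "Ar C f" "Cod C f = Y" "Z \<in> Obj C"
  have Y: "Y \<in> Obj C" using a by auto
  have "(zr C Y Z \<boxplus> zr C Y Z) \<cdot> f = zr C Y Z \<cdot> f \<boxplus> zr C Y Z \<cdot> f" using a Y by (intro addl) auto
  then have "zr C (Dom C f) Z \<boxplus> zr C Y Z \<cdot> f = zr C Y Z \<cdot> f \<boxplus> zr C Y Z \<cdot> f" using a Y by simp
  then show ?thesis using add_cancel[of "zr C Y Z \<cdot> f" "zr C (Dom C f) Z" "zr C Y Z \<cdot> f"] a Y by simp
qed

lemma cmp_zr [simp]: "Ar C f \<Longrightarrow> Dom C f = Y \<Longrightarrow> X \<in> Obj C \<Longrightarrow> f \<cdot> zr C X Y = zr C X (Cod C f)"
  using preadditive_category.zr_cmp[OF op_preadditive, of f Y X] by simp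

lemma neg_unique: "Ar C f \<Longrightarrow> Ar C g \<Longrightarrow> Dom C g = Dom C f \<Longrightarrow> Cod C g = Cod C f \<Longrightarrow>
   g \<boxplus> f = zr C (Dom C f) (Cod C f) \<Longrightarrow> neg C f = g"
  by (metis add_cancel add_comm add_neg neg_ar)

lemma neg_cmp [simp]: "Ar C f \<Longrightarrow> Ar C g \<Longrightarrow> Dom C g = Cod C f \<Longrightarrow> neg C g \<cdot> f = neg C (g \<cdot> f)"
  by (intro neg_unique[symmetric]) (simp_all add: addl[symmetric] add_comm[of "neg C g" g] del: addl)

lemma cmp_neg [simp]: "Ar C f \<Longrightarrow> Ar C g \<Longrightarrow> Dom C g = Cod C f \<Longrightarrow> g \<cdot> neg C f = neg C (g \<cdot> f)"
  using preadditive_category.neg_cmp[OF op_preadditive, of g f] by simp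

lemma neg_neg [simp]: "Ar C f \<Longrightarrow> neg C (neg C f) = f"
  by (intro neg_unique) simp_all

lemma neg_zr [simp]: "X \<in> Obj C \<Longrightarrow> Y \<in> Obj C \<Longrightarrow> neg C (zr C X Y) = zr C X Y"
  by (intro neg_unique) auto

lemma sub_zr [simp]: "Ar C f \<Longrightarrow> Dom C f = X \<Longrightarrow> Cod C f = Y \<Longrightarrow> f \<boxminus> zr C X Y = f"
  by (auto simp: sub_def)

lemma subl [simp]: "Ar C f \<Longrightarrow> Ar C g \<Longrightarrow> Ar C g' \<Longrightarrow> Dom C g = Cod C f \<Longrightarrow> Dom C g' = Cod C f \<Longrightarrow>
    Cod C g' = Cod C g \<Longrightarrow> (g \<boxminus> g') \<cdot> f = g \<cdot> f \<boxminus> g' \<cdot> f"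
  by (simp add: sub_def)

lemma subr [simp]: "Ar C f \<Longrightarrow> Ar C f' \<Longrightarrow> Ar C g \<Longrightarrow> Dom C g = Cod C f \<Longrightarrow> Dom C f' = Dom C f \<Longrightarrow>
    Cod C f' = Cod C f \<Longrightarrow> g \<cdot> (f \<boxminus> f') = g \<cdot> f \<boxminus> g \<cdot> f'"
  by (simp add: sub_def)

text \<open>Composites are normalised to the right, so the left side of an equation between two
  composites no longer occurs as a subterm once a further factor \<open>h\<close> follows. This form
  and \<open>cmp_eq1\<close> carry the extra factor along.\<close>

lemma cmp_eq_cmp: "g \<cdot> f = g' \<cdot> f' \<Longrightarrow> Ar C f \<Longrightarrow> Ar C g \<Longrightarrow> Dom C g = Cod C f \<Longrightarrow> Ar C f' \<Longrightarrow> Ar C g' \<Longrightarrow>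
    Dom C g' = Cod C f' \<Longrightarrow> Dom C f' = Dom C f \<Longrightarrow> Ar C h \<Longrightarrow> Cod C h = Dom C f \<Longrightarrow>
    g \<cdot> f \<cdot> h = g' \<cdot> f' \<cdot> h"
  using assoc[of h f g] assoc[of h f' g'] by simp

lemma cmp_eq1: "g \<cdot> f = e \<Longrightarrow> Ar C f \<Longrightarrow> Ar C g \<Longrightarrow> Dom C g = Cod C f \<Longrightarrow> Ar C h \<Longrightarrow> Cod C h = Dom C f \<Longrightarrow>
    g \<cdot> f \<cdot> h = e \<cdot> h"
  using assoc[of h f g] by simp

lemma add_lcomm: "Ar C f \<Longrightarrow> Ar C g \<Longrightarrow> Ar C h \<Longrightarrow> Dom C g = Dom C f \<Longrightarrow> Dom C h = Dom C f \<Longrightarrow>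
   Cod C g = Cod C f \<Longrightarrow> Cod C h = Cod C f \<Longrightarrow> g \<boxplus> (f \<boxplus> h) = f \<boxplus> (g \<boxplus> h)"
  using add_assoc[of f g h] add_assoc[of g f h] add_comm[of f g] by metis

lemmas add_ac = add_assoc add_comm add_lcomm

end

section \<open>Modules through generators and relations\<close>

text \<open>Under the Yoneda lemma \<open>x\<close> is a map from C(-, B) to \<open>M\<close>; the
  last clause is its surjectivity at every object.\<close>

definition gen :: "('o, 'm) cat \<Rightarrow> ('o, 'm, 'a) cmod \<Rightarrow> 'o \<Rightarrow> 'a \<Rightarrow> bool" where
  "gen C M B x \<longleftrightarrow> cmodule C M \<and> B \<in> Obj C \<and> x \<in> carrier (Val M B) \<and>
    (\<forall>Y\<in>Obj C. \<forall>m\<in>carrier (Val M Y). \<exists>h. ar C h Y B \<and> m = Act M h x)"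

text \<open>By the Yoneda lemma, \<open>presents C v x M\<close> says that \<open>C(-, A) \<rightarrow> C(-, B) \<rightarrow> M \<rightarrow> 0\<close> is exact, where
  \<open>v\<close> from \<open>A\<close> to \<open>B\<close> induces the first map and \<open>x\<close> corresponds to the second one.\<close>

definition presents :: "('o, 'm) cat \<Rightarrow> 'm \<Rightarrow> 'a \<Rightarrow> ('o, 'm, 'a) cmod \<Rightarrow> bool" where
  "presents C v x M \<longleftrightarrow> Ar C v \<and> gen C M (Cod C v) x \<and>
    (\<forall>h. Ar C h \<and> Cod C h = Cod C v \<longrightarrow>
      (Act M h x = \<one>\<^bsub>Val M (Dom C h)\<^esub> \<longleftrightarrow> (\<exists>k. ar C k (Dom C h) (Dom C v) \<and> h = Comp C v k)))"

text \<open>A universal element: the map from C(-, X) given by \<open>p\<close> is bijective. It is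
  kept apart from \<open>Rep\<close> because two copies of C(-, X) occur, \<open>Rep\<close> with
  elements of type \<open>'m\<close> and \<open>ssub\<close> with elements of type
  \<open>'m set\<close>.\<close>

definition represents :: "('o, 'm) cat \<Rightarrow> ('o, 'm, 'a) cmod \<Rightarrow> 'o \<Rightarrow> 'a \<Rightarrow> bool" where
  "represents C P X p \<longleftrightarrow> gen C P X p \<and>
    (\<forall>h. Ar C h \<and> Cod C h = X \<and> Act P h p = \<one>\<^bsub>Val P (Dom C h)\<^esub> \<longrightarrow> h = zr C (Dom C h) X)"

lemma genD: "gen C M B x \<Longrightarrow> cmodule C M" "gen C M B x \<Longrightarrow> B \<in> Obj C"
    "gen C M B x \<Longrightarrow> x \<in> carrier (Val M B)"
  by (auto simp: gen_def)

lemma genE: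
  assumes "gen C M B x" "m \<in> carrier (Val M Y)" "Y \<in> Obj C"
  obtains h where "ar C h Y B" "m = Act M h x"
  using assms unfolding gen_def by blast

lemma presents_gen: "presents C v x M \<Longrightarrow> gen C M (Cod C v) x"
  by (simp add: presents_def)

lemma presents_iff: "presents C v x M \<Longrightarrow> Ar C h \<Longrightarrow> Cod C h = Cod C v \<Longrightarrow>
    Act M h x = \<one>\<^bsub>Val M (Dom C h)\<^esub> \<longleftrightarrow> (\<exists>k. ar C k (Dom C h) (Dom C v) \<and> h = Comp C v k)"
  by (auto simp: presents_def)

context preadditive_category
begin

lemma Val_grp: "cmodule C M \<Longrightarrow> X \<in> Obj C \<Longrightarrow> comm_group (Val M X)"
  by (auto simp: cmodule_def)

lemma Val_group: "cmodule C M \<Longrightarrow> X \<in> Obj C \<Longrightarrow> group (Val M X)"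
  using Val_grp comm_group.axioms(2) by blast

lemma Act_hom: "cmodule C M \<Longrightarrow> Ar C f \<Longrightarrow> Act M f \<in> hom (Val M (Cod C f)) (Val M (Dom C f))"
  unfolding cmodule_def by (meson ArD Ar_homs)

lemma Act_closed: "cmodule C M \<Longrightarrow> Ar C f \<Longrightarrow> x \<in> carrier (Val M (Cod C f)) \<Longrightarrow>
    Act M f x \<in> carrier (Val M (Dom C f))"
  using hom_in_carrier[OF Act_hom] .

lemma Act_mult: "cmodule C M \<Longrightarrow> Ar C f \<Longrightarrow> x \<in> carrier (Val M (Cod C f)) \<Longrightarrow>
    y \<in> carrier (Val M (Cod C f)) \<Longrightarrow>
    Act M f (x \<otimes>\<^bsub>Val M (Cod C f)\<^esub> y) = Act M f x \<otimes>\<^bsub>Val M (Dom C f)\<^esub> Act M f y"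
  by (rule hom_mult[OF Act_hom])

lemma Act_one: "cmodule C M \<Longrightarrow> Ar C f \<Longrightarrow> Cod C f = Y \<Longrightarrow> Act M f \<one>\<^bsub>Val M Y\<^esub> = \<one>\<^bsub>Val M (Dom C f)\<^esub>"
  using Act_hom[of M f] Val_group hom_one by (metis ArD)

lemma Act_cmp: "cmodule C M \<Longrightarrow> Ar C f \<Longrightarrow> Ar C g \<Longrightarrow> Dom C g = Cod C f \<Longrightarrow> x \<in> carrier (Val M (Cod C g)) \<Longrightarrow>
    Act M (g \<cdot> f) x = Act M f (Act M g x)"
proof -
  assume a: "cmodule C M" "Ar C f" "Ar C g" "Dom C g = Cod C f" "x \<in> carrier (Val M (Cod C g))"
  then have "\<forall>X\<in>Obj C. \<forall>Y\<in>Obj C. \<forall>Z\<in>Obj C. \<forall>f\<in>homs C X Y. \<forall>g\<in>homs C Y Z. \<forall>x\<in>carrier (Val M Z).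
       Act M (Comp C g f) x = Act M f (Act M g x)"
    unfolding cmodule_def by blast
  moreover have "f \<in> homs C (Dom C f) (Cod C f)" "g \<in> homs C (Cod C f) (Cod C g)"
    "Dom C f \<in> Obj C" "Cod C f \<in> Obj C" "Cod C g \<in> Obj C" using a by (auto simp: Ar_homs)
  ultimately show ?thesis using a(5) by blast
qed

lemma Act_Idn: "cmodule C M \<Longrightarrow> X \<in> Obj C \<Longrightarrow> x \<in> carrier (Val M X) \<Longrightarrow> Act M (Idn C X) x = x"
  by (auto simp: cmodule_def)

lemma Act_add: "cmodule C M \<Longrightarrow> Ar C f \<Longrightarrow> Ar C g \<Longrightarrow> Dom C g = Dom C f \<Longrightarrow> Cod C g = Cod C f \<Longrightarrow>
   x \<in> carrier (Val M (Cod C f)) \<Longrightarrow> Act M (f \<boxplus> g) x = Act M f x \<otimes>\<^bsub>Val M (Dom C f)\<^esub> Act M g x"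
proof -
  assume a: "cmodule C M" "Ar C f" "Ar C g" "Dom C g = Dom C f" "Cod C g = Cod C f" "x \<in> carrier (Val M (Cod C f))"
  then have "\<forall>X\<in>Obj C. \<forall>Y\<in>Obj C. \<forall>f\<in>homs C X Y. \<forall>g\<in>homs C X Y. \<forall>x\<in>carrier (Val M Y).
       Act M (f \<otimes>\<^bsub>Hom C X Y\<^esub> g) x = Act M f x \<otimes>\<^bsub>Val M X\<^esub> Act M g x"
    unfolding cmodule_def by blast
  moreover have "f \<in> homs C (Dom C f) (Cod C f)" "g \<in> homs C (Dom C f) (Cod C f)"
    "Dom C f \<in> Obj C" "Cod C f \<in> Obj C" using a by (auto simp: Ar_homs)
  ultimately show ?thesis using a(6) unfolding add_def by blast
qed

lemma Act_zr: "cmodule C M \<Longrightarrow> X \<in> Obj C \<Longrightarrow> Y \<in> Obj C \<Longrightarrow> x \<in> carrier (Val M Y) \<Longrightarrow>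
    Act M (zr C X Y) x = \<one>\<^bsub>Val M X\<^esub>"
proof -
  assume a: "cmodule C M" "X \<in> Obj C" "Y \<in> Obj C" "x \<in> carrier (Val M Y)"
  interpret G: comm_group "Val M X" using a Val_grp by blast
  let ?z = "Act M (zr C X Y) x"
  have z: "?z \<in> carrier (Val M X)" using Act_closed[of M "zr C X Y" x] a by simp
  have "?z \<otimes>\<^bsub>Val M X\<^esub> ?z = ?z" using Act_add[of M "zr C X Y" "zr C X Y" x] a by simp
  then show ?thesis using z by (metis G.r_cancel_one)
qed

lemma Act_sub: "cmodule C M \<Longrightarrow> Ar C f \<Longrightarrow> Ar C g \<Longrightarrow> Dom C g = Dom C f \<Longrightarrow> Cod C g = Cod C f \<Longrightarrow>
   x \<in> carrier (Val M (Cod C f)) \<Longrightarrow> Dom C f = X \<Longrightarrow>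
   Act M (f \<boxminus> g) x = \<one>\<^bsub>Val M X\<^esub> \<longleftrightarrow> Act M f x = Act M g x"
proof -
  assume a: "cmodule C M" "Ar C f" "Ar C g" "Dom C g = Dom C f" "Cod C g = Cod C f" "x \<in> carrier (Val M (Cod C f))"
    "Dom C f = X"
  interpret G: comm_group "Val M (Dom C f)" by (rule Val_grp[OF a(1) ArD(1)[OF a(2)]])
  have c: "Act M f x \<in> carrier (Val M (Dom C f))" "Act M g x \<in> carrier (Val M (Dom C f))"
     "Act M (f \<boxminus> g) x \<in> carrier (Val M (Dom C f))"
    using Act_closed[of M f x] Act_closed[of M g x] Act_closed[of M "f \<boxminus> g" x] a by simp_all
  have "Act M f x = Act M (f \<boxminus> g) x \<otimes>\<^bsub>Val M (Dom C f)\<^esub> Act M g x"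
    using Act_add[of M "f \<boxminus> g" g x] a by simp
  then show ?thesis using c a(7) by (metis G.l_one G.r_cancel_one G.m_comm)
qed

lemma nat_transD:
  assumes "nat_trans C M N \<alpha>"
  shows "X \<in> Obj C \<Longrightarrow> \<alpha> X \<in> hom (Val M X) (Val N X)"
    and "X \<in> Obj C \<Longrightarrow> x \<in> carrier (Val M X) \<Longrightarrow> \<alpha> X x \<in> carrier (Val N X)"
    and "Ar C f \<Longrightarrow> x \<in> carrier (Val M (Cod C f)) \<Longrightarrow> \<alpha> (Dom C f) (Act M f x) = Act N f (\<alpha> (Cod C f) x)"
    and "X \<in> Obj C \<Longrightarrow> x \<in> carrier (Val M X) \<Longrightarrow> y \<in> carrier (Val M X) \<Longrightarrow>
      \<alpha> X (x \<otimes>\<^bsub>Val M X\<^esub> y) = \<alpha> X x \<otimes>\<^bsub>Val N X\<^esub> \<alpha> X y"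
proof -
  show "X \<in> Obj C \<Longrightarrow> \<alpha> X \<in> hom (Val M X) (Val N X)" for X using assms by (simp add: nat_trans_def)
  then show "X \<in> Obj C \<Longrightarrow> x \<in> carrier (Val M X) \<Longrightarrow> \<alpha> X x \<in> carrier (Val N X)"
   "X \<in> Obj C \<Longrightarrow> x \<in> carrier (Val M X) \<Longrightarrow> y \<in> carrier (Val M X) \<Longrightarrow>
      \<alpha> X (x \<otimes>\<^bsub>Val M X\<^esub> y) = \<alpha> X x \<otimes>\<^bsub>Val N X\<^esub> \<alpha> X y" by (auto simp: hom_def)
  assume "Ar C f" "x \<in> carrier (Val M (Cod C f))"
  then show "\<alpha> (Dom C f) (Act M f x) = Act N f (\<alpha> (Cod C f) x)" using assms unfolding nat_trans_def
    by (metis ArD Ar_homs)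
qed

lemma nat_trans_one: "nat_trans C M N \<alpha> \<Longrightarrow> cmodule C M \<Longrightarrow> cmodule C N \<Longrightarrow> X \<in> Obj C \<Longrightarrow>
    \<alpha> X \<one>\<^bsub>Val M X\<^esub> = \<one>\<^bsub>Val N X\<^esub>"
  by (meson Val_group hom_one nat_transD(1))

lemma nat_transI:
  assumes "\<And>X x. X \<in> Obj C \<Longrightarrow> x \<in> carrier (Val M X) \<Longrightarrow> \<alpha> X x \<in> carrier (Val N X)"
    and "\<And>X x y. X \<in> Obj C \<Longrightarrow> x \<in> carrier (Val M X) \<Longrightarrow> y \<in> carrier (Val M X) \<Longrightarrow>
      \<alpha> X (x \<otimes>\<^bsub>Val M X\<^esub> y) = \<alpha> X x \<otimes>\<^bsub>Val N X\<^esub> \<alpha> X y"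
    and "\<And>f x. Ar C f \<Longrightarrow> x \<in> carrier (Val M (Cod C f)) \<Longrightarrow> \<alpha> (Dom C f) (Act M f x) = Act N f (\<alpha> (Cod C f) x)"
  shows "nat_trans C M N \<alpha>"
  unfolding nat_trans_def
proof (intro conjI ballI, goal_cases)
  case (1 X) then show ?case using assms(1,2) by (auto simp: hom_def)
next
  case (2 X Y f x)
  then have "ar C f X Y" by (simp add: homs_iff)
  then show ?case using assms(3)[of f x] 2 by auto
qed

lemma nat_trans_comp: "nat_trans C L M \<alpha> \<Longrightarrow> nat_trans C M N \<beta> \<Longrightarrow> nat_trans C L N (\<lambda>X x. \<beta> X (\<alpha> X x))"
  by (rule nat_transI) (simp_all add: nat_transD)

text \<open>The value at m is defined by choosing some h with m = \<open>Act M h x\<close>. Two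
  choices differ by a relation of \<open>x\<close>, which by hypothesis is also a relation of
  \<open>y\<close>, so the value does not depend on the choice; additivity and naturality follow by
  computing with convenient representatives.\<close>

lemma hom_from_gen:
  assumes g: "gen C M B x" and N: "cmodule C N" "y \<in> carrier (Val N B)"
    and r: "\<And>h. Ar C h \<Longrightarrow> Cod C h = B \<Longrightarrow> Act M h x = \<one>\<^bsub>Val M (Dom C h)\<^esub> \<Longrightarrow> Act N h y = \<one>\<^bsub>Val N (Dom C h)\<^esub>"
  obtains \<alpha> where "nat_trans C M N \<alpha>" "\<And>h. Ar C h \<Longrightarrow> Cod C h = B \<Longrightarrow> \<alpha> (Dom C h) (Act M h x) = Act N h y"
    "\<alpha> B x = y"
proof -
  have M: "cmodule C M" "B \<in> Obj C" "x \<in> carrier (Val M B)" using genD[OF g] by auto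
  define \<alpha> where "\<alpha> Y m = Act N (SOME h. ar C h Y B \<and> m = Act M h x) y" for Y m
  have \<alpha>: "\<alpha> Y (Act M h x) = Act N h y" if h: "ar C h Y B" for Y h
  proof -
    define k where "k = (SOME k. ar C k Y B \<and> Act M h x = Act M k x)"
    have "ar C k Y B \<and> Act M h x = Act M k x" unfolding k_def by (rule someI[of _ h]) (use h in simp)
    then have k: "ar C k Y B" "Act M h x = Act M k x" by blast+
    then have "Act M (h \<boxminus> k) x = \<one>\<^bsub>Val M Y\<^esub>" using h M by (simp add: Act_sub)
    then have "Act N (h \<boxminus> k) y = \<one>\<^bsub>Val N Y\<^esub>" using r[of "h \<boxminus> k"] h k by simp
    then have "Act N h y = Act N k y" using h k N Act_sub[of N h k y] by auto
    then show ?thesis by (simp add: \<alpha>_def k_def)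
  qed
  have c: "Act N h y \<in> carrier (Val N Y)" if "ar C h Y B" for Y h
    using Act_closed[of N h y] that N by auto
  have "nat_trans C M N \<alpha>"
  proof (rule nat_transI, goal_cases)
    case (1 X m) then show ?case by (metis genE[OF g] \<alpha> c)
  next
    case (2 X m m')
    obtain h where h: "ar C h X B" "m = Act M h x" using genE[OF g 2(2,1)] .
    obtain h' where h': "ar C h' X B" "m' = Act M h' x" using genE[OF g 2(3,1)] .
    have "m \<otimes>\<^bsub>Val M X\<^esub> m' = Act M (h \<boxplus> h') x" using h h' M by (simp add: Act_add)
    then have "\<alpha> X (m \<otimes>\<^bsub>Val M X\<^esub> m') = Act N (h \<boxplus> h') y" using \<alpha>[of "h \<boxplus> h'" X] h h' by simp
    also have "\<dots> = Act N h y \<otimes>\<^bsub>Val N X\<^esub> Act N h' y" using h h' N by (simp add: Act_add)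
    finally show ?case using \<alpha> h h' by metis
  next
    case (3 f m)
    obtain h where h: "ar C h (Cod C f) B" "m = Act M h x" using genE[OF g 3(2)] 3 by auto
    have "\<alpha> (Dom C f) (Act M (h \<cdot> f) x) = Act N (h \<cdot> f) y" using \<alpha>[of "h \<cdot> f" "Dom C f"] h 3 by simp
    then show ?case using h 3 M N \<alpha>[of h "Cod C f"] by (simp add: Act_cmp)
  qed
  moreover have "\<alpha> B (Act M (Idn C B) x) = Act N (Idn C B) y" by (rule \<alpha>) (simp add: M(2))
  then have "\<alpha> B x = y" by (simp only: Act_Idn[OF M] Act_Idn[OF N(1) M(2) N(2)])
  ultimately show ?thesis using that \<alpha> by blast
qed

lemma iso_presents:
  assumes "nat_trans C M N \<alpha>" "\<And>X. X \<in> Obj C \<Longrightarrow> \<alpha> X \<in> iso (Val M X) (Val N X)" "cmodule C N"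
    and v: "presents C v x M"
  shows "presents C v (\<alpha> (Cod C v) x) N"
proof -
  let ?B = "Cod C v"
  have g: "gen C M ?B x" and Av: "Ar C v" using v by (auto simp: presents_def)
  note M = genD[OF g]
  have n: "\<alpha> (Dom C h) (Act M h x) = Act N h (\<alpha> ?B x)" if "Ar C h" "Cod C h = ?B" for h
    using nat_transD(3)[OF assms(1), of h x] that M by simp
  have y: "\<alpha> ?B x \<in> carrier (Val N ?B)" using nat_transD(2)[OF assms(1)] M by blast
  have "gen C N ?B (\<alpha> ?B x)" unfolding gen_def
  proof (intro conjI ballI)
    fix Y m assume Y: "Y \<in> Obj C" "m \<in> carrier (Val N Y)"
    then have "m \<in> \<alpha> Y ` carrier (Val M Y)" using assms(2)[of Y] by (auto simp: iso_def bij_betw_def)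
    then obtain m' where m': "m' \<in> carrier (Val M Y)" "m = \<alpha> Y m'" by blast
    obtain h where "ar C h Y ?B" "m' = Act M h x" using genE[OF g m'(1) Y(1)] .
    then show "\<exists>h. ar C h Y ?B \<and> m = Act N h (\<alpha> ?B x)" using n m' by auto
  qed (use assms M y in auto)
  moreover have "Act N h (\<alpha> ?B x) = \<one>\<^bsub>Val N (Dom C h)\<^esub> \<longleftrightarrow> Act M h x = \<one>\<^bsub>Val M (Dom C h)\<^esub>"
    if h: "Ar C h" "Cod C h = ?B" for h
  proof -
    have "inj_on (\<alpha> (Dom C h)) (carrier (Val M (Dom C h)))"
      using assms(2)[of "Dom C h"] h by (auto simp: iso_def bij_betw_def)
    moreover have "\<one>\<^bsub>Val M (Dom C h)\<^esub> \<in> carrier (Val M (Dom C h))"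
      using Val_group[OF M(1), of "Dom C h"] h by (simp add: group.is_monoid monoid.one_closed)
    moreover have "Act M h x \<in> carrier (Val M (Dom C h))" using Act_closed[of M h x] h M by simp
    ultimately show ?thesis
      using n[OF h] nat_trans_one[OF assms(1) M(1) assms(3), of "Dom C h"] h by (metis ArD(1) inj_on_eq_iff)
  qed
  ultimately show ?thesis using v by (auto simp: presents_def)
qed

lemma mod_iso_presents: "mod_iso C M N \<Longrightarrow> cmodule C N \<Longrightarrow> presents C v x M \<Longrightarrow> \<exists>y. presents C v y N"
  unfolding mod_iso_def by (elim exE conjE) (rule exI, rule iso_presents, auto)

text \<open>Sending \<open>x\<close> to \<open>y\<close> is well defined and injective because both
  generators have the same relations, namely the morphisms factoring through \<open>v\<close>. The
  element types of the two modules may differ, which makes it possible to compare quotients, whose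
  elements are cosets, with modules over \<open>'m set\<close>.\<close>

lemma presents_mod_iso:
  assumes v: "presents C v x M" and w: "presents C v y N"
  shows "mod_iso C M N"
proof -
  let ?B = "Cod C v"
  have g: "gen C M ?B x" "gen C N ?B y" using v w by (auto simp: presents_def)
  note M = genD[OF g(1)] note N = genD[OF g(2)]
  have e: "Act M h x = \<one>\<^bsub>Val M (Dom C h)\<^esub> \<longleftrightarrow> Act N h y = \<one>\<^bsub>Val N (Dom C h)\<^esub>"
    if h: "Ar C h" "Cod C h = ?B" for h
    using v w h by (auto simp: presents_def)
  obtain \<alpha> where \<alpha>: "nat_trans C M N \<alpha>" "\<And>h. Ar C h \<Longrightarrow> Cod C h = ?B \<Longrightarrow> \<alpha> (Dom C h) (Act M h x) = Act N h y"
    using hom_from_gen[OF g(1) N(1,3)] e by metis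
  have "\<alpha> Y \<in> iso (Val M Y) (Val N Y)" if Y: "Y \<in> Obj C" for Y
  proof (rule isoI)
    show "\<alpha> Y \<in> hom (Val M Y) (Val N Y)" using \<alpha>(1) Y by (rule nat_transD)
    have "inj_on (\<alpha> Y) (carrier (Val M Y))"
    proof (rule inj_onI)
      fix m m' assume m: "m \<in> carrier (Val M Y)" "m' \<in> carrier (Val M Y)" "\<alpha> Y m = \<alpha> Y m'"
      obtain h where h: "ar C h Y ?B" "m = Act M h x" using genE[OF g(1) m(1) Y] .
      obtain h' where h': "ar C h' Y ?B" "m' = Act M h' x" using genE[OF g(1) m(2) Y] .
      have "Act N h y = Act N h' y" using m(3) h h' \<alpha>(2)[of h] \<alpha>(2)[of h'] by auto
      then have "Act N (h \<boxminus> h') y = \<one>\<^bsub>Val N Y\<^esub>" using h h' N by (simp add: Act_sub)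
      then have "Act M (h \<boxminus> h') x = \<one>\<^bsub>Val M Y\<^esub>" using e[of "h \<boxminus> h'"] h h' by simp
      then show "m = m'" using h h' M Act_sub[of M h h' x] by auto
    qed
    moreover have "\<alpha> Y ` carrier (Val M Y) = carrier (Val N Y)"
    proof (intro equalityI subsetI)
      fix m assume m: "m \<in> carrier (Val N Y)"
      obtain h where h: "ar C h Y ?B" "m = Act N h y" using genE[OF g(2) m Y] .
      have "\<alpha> Y (Act M h x) = m" using \<alpha>(2)[of h] h by simp
      moreover have "Act M h x \<in> carrier (Val M Y)" using Act_closed[of M h x] h M by simp
      ultimately show "m \<in> \<alpha> Y ` carrier (Val M Y)" by blast
    qed (use nat_transD(2)[OF \<alpha>(1) Y] in auto)
    ultimately show "bij_betw (\<alpha> Y) (carrier (Val M Y)) (carrier (Val N Y))" by (simp add: bij_betw_def)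
  qed
  then show ?thesis using \<alpha>(1) by (auto simp: mod_iso_def)
qed

lemma cmodule_Rep:
  assumes "X \<in> Obj C"
  shows "cmodule C (Rep C X)"
  unfolding cmodule_def Rep_def
proof (intro conjI ballI, simp_all, goal_cases)
  case 1 then show ?case using assms by (simp add: Hom_group)
next
  case (2 Y Z f) then show ?case using assms
    by (auto simp: hom_def Comp_closed Comp_add_left)
next
  case (3 Y x) then show ?case using assms Comp_Idn_right by blast
next
  case (4 Y Z Z' f g x) then show ?case using assms by (intro Comp_assoc[of Y Z Z' X])
next
  case (5 Y Z f g h) then show ?case using assms by (intro Comp_add_right)
qed

lemma Rep_simps [simp]: "Val (Rep C X) Y = Hom C Y X" "Act (Rep C X) f h = h \<cdot> f"
  by (auto simp: Rep_def)

lemma represents_Rep: "X \<in> Obj C \<Longrightarrow> represents C (Rep C X) X (Idn C X)"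
  unfolding represents_def gen_def
  by (auto simp: cmodule_Rep Ar_homs homs_iff zr_def[symmetric])

section \<open>Images and cokernels of module morphisms\<close>

lemma image_subgroup:
  assumes "nat_trans C G F \<alpha>" "cmodule C G" "cmodule C F" "X \<in> Obj C"
  shows "subgroup (\<alpha> X ` carrier (Val G X)) (Val F X)"
proof -
  interpret group_hom "Val G X" "Val F X" "\<alpha> X"
    using assms by (auto simp: group_hom_def group_hom_axioms_def Val_group nat_transD(1))
  show ?thesis by (rule img_is_subgroup)
qed

lemma image_Act: "nat_trans C G F \<alpha> \<Longrightarrow> cmodule C G \<Longrightarrow> Ar C f \<Longrightarrow> m \<in> \<alpha> (Cod C f) ` carrier (Val G (Cod C f)) \<Longrightarrow>
   Act F f m \<in> \<alpha> (Dom C f) ` carrier (Val G (Dom C f))"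
  by (auto simp: nat_transD(3)[symmetric] Act_closed)

lemma cmodule_Im:
  assumes "nat_trans C G F \<alpha>" "cmodule C G" "cmodule C F"
  shows "cmodule C (Im_mod \<alpha> G F)"
  unfolding cmodule_def Im_mod_def
proof (intro conjI ballI, simp_all only: cmod.simps, goal_cases)
  case (1 X)
  interpret F: comm_group "Val F X" by (rule Val_grp[OF assms(3) 1])
  interpret S: subgroup "\<alpha> X ` carrier (Val G X)" "Val F X" by (rule image_subgroup[OF assms 1])
  show ?case using S.subgroup_is_group[OF F.is_group] F.m_comm
    by (intro group.group_comm_groupI) auto
next
  case (2 X Y f)
  then have f: "ar C f X Y" by (simp add: homs_iff)
  have s: "\<alpha> Y ` carrier (Val G Y) \<subseteq> carrier (Val F Y)"
    using nat_transD(2)[OF assms(1) 2(2)] by blast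
  show ?case using image_Act[OF assms(1,2), of f] f Act_mult[OF assms(3), of f] s
    by (auto simp: hom_def subset_iff)
next
  case (3 X x) then show ?case using nat_transD(2)[OF assms(1) 3(1)] Act_Idn[OF assms(3)] by auto
next
  case (4 X Y Z f g x)
  then have "ar C f X Y" "ar C g Y Z" by (simp_all add: homs_iff)
  then show ?case using 4 nat_transD(2)[OF assms(1) 4(3)] Act_cmp[OF assms(3), of f g x] by auto
next
  case (5 X Y f g x)
  then have "ar C f X Y" "ar C g X Y" by (simp_all add: homs_iff)
  then show ?case using 5 nat_transD(2)[OF assms(1) 5(2)] Act_add[OF assms(3), of f g x] mult_eq_add[of f X Y g]
    by auto
qed

lemma Cok_coset:
  assumes \<alpha>: "nat_trans C G F \<alpha>" "cmodule C G" "cmodule C F"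
  defines "N \<equiv> \<lambda>X. \<alpha> X ` carrier (Val G X)"
  shows "Ar C f \<Longrightarrow> m \<in> carrier (Val F (Cod C f)) \<Longrightarrow>
      Act (Cok_mod C \<alpha> G F) f (N (Cod C f) #>\<^bsub>Val F (Cod C f)\<^esub> m) = N (Dom C f) #>\<^bsub>Val F (Dom C f)\<^esub> Act F f m"
proof -
  assume f: "Ar C f" and m: "m \<in> carrier (Val F (Cod C f))"
  let ?X = "Dom C f" and ?Y = "Cod C f"
  interpret X: comm_group "Val F ?X" by (rule Val_grp[OF \<alpha>(3) ArD(1)[OF f]])
  interpret NX: subgroup "N ?X" "Val F ?X" using image_subgroup[OF \<alpha>, of ?X] f by (simp add: N_def)
  interpret Y: comm_group "Val F ?Y" by (rule Val_grp[OF \<alpha>(3) ArD(2)[OF f]])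
  interpret NY: subgroup "N ?Y" "Val F ?Y" using image_subgroup[OF \<alpha>, of ?Y] f by (simp add: N_def)
  have e: "N ?X #>\<^bsub>Val F ?X\<^esub> Act F f k = N ?X #>\<^bsub>Val F ?X\<^esub> Act F f m"
    if k: "k \<in> N ?Y #>\<^bsub>Val F ?Y\<^esub> m" for k
  proof -
    obtain a where a: "a \<in> N ?Y" "k = a \<otimes>\<^bsub>Val F ?Y\<^esub> m" using k by (auto simp: r_coset_def)
    have "a \<in> carrier (Val F ?Y)" using a NY.subset by blast
    then have k': "Act F f k = Act F f a \<otimes>\<^bsub>Val F ?X\<^esub> Act F f m" unfolding a(2) by (rule Act_mult[OF \<alpha>(3) f _ m])
    have "Act F f a \<in> N ?X" using a(1) unfolding N_def by (rule image_Act[OF \<alpha>(1,2) f])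
    then have "Act F f k \<in> N ?X #>\<^bsub>Val F ?X\<^esub> Act F f m" unfolding k' r_coset_def by blast
    then show ?thesis by (rule X.repr_independence[OF _ Act_closed[OF \<alpha>(3) f m] NX.subgroup_axioms, symmetric])
  qed
  have "m \<in> N ?Y #>\<^bsub>Val F ?Y\<^esub> m" by (rule Y.rcos_self[OF m NY.subgroup_axioms])
  then have "(\<Union>k\<in>N ?Y #>\<^bsub>Val F ?Y\<^esub> m. N ?X #>\<^bsub>Val F ?X\<^esub> Act F f k) = N ?X #>\<^bsub>Val F ?X\<^esub> Act F f m"
    by (rule UN_constant_eq) (use e in blast)
  then show ?thesis by (simp only: Cok_mod_def N_def cmod.simps)
qed

lemma Cok_props:
  assumes \<alpha>: "nat_trans C G F \<alpha>" "cmodule C G" "cmodule C F"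
  defines "N \<equiv> \<lambda>X. \<alpha> X ` carrier (Val G X)" and "Q \<equiv> Cok_mod C \<alpha> G F"
  shows "cmodule C Q" 
    and "nat_trans C F Q (\<lambda>X m. N X #>\<^bsub>Val F X\<^esub> m)"
    and "X \<in> Obj C \<Longrightarrow> K \<in> carrier (Val Q X) \<Longrightarrow> \<exists>m\<in>carrier (Val F X). K = N X #>\<^bsub>Val F X\<^esub> m"
    and "X \<in> Obj C \<Longrightarrow> m \<in> carrier (Val F X) \<Longrightarrow> N X #>\<^bsub>Val F X\<^esub> m = \<one>\<^bsub>Val Q X\<^esub> \<longleftrightarrow> m \<in> N X"
proof -
  have Nsub: "subgroup (N X) (Val F X)" if "X \<in> Obj C" for X
    using image_subgroup[OF \<alpha> that] by (simp add: N_def)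
  have grpF: "X \<in> Obj C \<Longrightarrow> comm_group (Val F X)" for X using \<alpha> Val_grp by blast
  have V: "Val Q X = Val F X Mod N X" for X unfolding Q_def N_def by (simp add: Cok_mod_def)
  have grpK: "X \<in> Obj C \<Longrightarrow> comm_group (Val Q X)" for X
    using comm_group.abelian_FactGroup[OF grpF Nsub] V by simp
  show ex: "X \<in> Obj C \<Longrightarrow> K \<in> carrier (Val Q X) \<Longrightarrow> \<exists>m\<in>carrier (Val F X). K = N X #>\<^bsub>Val F X\<^esub> m" for X K
    by (auto simp: V FactGroup_def RCOSETS_def)
  have cl: "X \<in> Obj C \<Longrightarrow> m \<in> carrier (Val F X) \<Longrightarrow> N X #>\<^bsub>Val F X\<^esub> m \<in> carrier (Val Q X)" for X m
    by (auto simp: V FactGroup_def RCOSETS_def)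
  have mu: "(N X #>\<^bsub>Val F X\<^esub> m) \<otimes>\<^bsub>Val Q X\<^esub> (N X #>\<^bsub>Val F X\<^esub> m') = N X #>\<^bsub>Val F X\<^esub> (m \<otimes>\<^bsub>Val F X\<^esub> m')"
    if "X \<in> Obj C" "m \<in> carrier (Val F X)" "m' \<in> carrier (Val F X)" for X m m'
    using normal.rcos_sum[OF comm_group.subgroup_imp_normal[OF grpF[OF that(1)] Nsub[OF that(1)]] that(2,3)]
    by (simp add: V FactGroup_def)
  have co: "Act Q f (N (Cod C f) #>\<^bsub>Val F (Cod C f)\<^esub> m) = N (Dom C f) #>\<^bsub>Val F (Dom C f)\<^esub> Act F f m"
    if "Ar C f" "m \<in> carrier (Val F (Cod C f))" for f m
    using Cok_coset[OF \<alpha> that] unfolding N_def Q_def .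
  show "nat_trans C F Q (\<lambda>X m. N X #>\<^bsub>Val F X\<^esub> m)"
    by (rule nat_transI) (simp_all add: cl mu co)
  show "X \<in> Obj C \<Longrightarrow> m \<in> carrier (Val F X) \<Longrightarrow> N X #>\<^bsub>Val F X\<^esub> m = \<one>\<^bsub>Val Q X\<^esub> \<longleftrightarrow> m \<in> N X" for X m
  proof -
    assume X: "X \<in> Obj C" and m: "m \<in> carrier (Val F X)"
    note G = Val_group[OF \<alpha>(3) X]
    have "N X #>\<^bsub>Val F X\<^esub> m = N X \<longleftrightarrow> m \<in> N X"
      using group.coset_join1[OF G _ m Nsub[OF X]] group.coset_join2[OF G m Nsub[OF X]]
        subgroup.subset[OF Nsub[OF X]] by blast
    then show "N X #>\<^bsub>Val F X\<^esub> m = \<one>\<^bsub>Val Q X\<^esub> \<longleftrightarrow> m \<in> N X" by (simp add: V FactGroup_def)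
  qed
  have Fc: "Act F f m \<in> carrier (Val F X)" if "ar C f X Y" "m \<in> carrier (Val F Y)" for f m X Y
    using that Act_closed[OF \<alpha>(3), of f m] by auto
  have co': "Act Q f (N Y #>\<^bsub>Val F Y\<^esub> m) = N X #>\<^bsub>Val F X\<^esub> Act F f m"
    if "ar C f X Y" "m \<in> carrier (Val F Y)" for f m X Y using co[of f m] that by auto
  show "cmodule C Q" unfolding cmodule_def
  proof (intro conjI ballI)
    fix X assume "X \<in> Obj C" then show "comm_group (Val Q X)" by (rule grpK)
  next
    fix X Y f assume a: "X \<in> Obj C" "Y \<in> Obj C" "f \<in> homs C X Y"
    then have f: "ar C f X Y" by (simp add: homs_iff)
    show "Act Q f \<in> hom (Val Q Y) (Val Q X)"
    proof (rule homI)
      fix K assume "K \<in> carrier (Val Q Y)"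
      then show "Act Q f K \<in> carrier (Val Q X)" using ex[OF a(2)] co'[OF f] cl[OF a(1) Fc[OF f]] by force
    next
      fix K K' assume K: "K \<in> carrier (Val Q Y)" "K' \<in> carrier (Val Q Y)"
      obtain m where m: "m \<in> carrier (Val F Y)" "K = N Y #>\<^bsub>Val F Y\<^esub> m" using ex[OF a(2) K(1)] by blast
      obtain m' where m': "m' \<in> carrier (Val F Y)" "K' = N Y #>\<^bsub>Val F Y\<^esub> m'" using ex[OF a(2) K(2)] by blast
      have mm: "m \<otimes>\<^bsub>Val F Y\<^esub> m' \<in> carrier (Val F Y)"
        using m m' comm_groupE(1)[OF grpF[OF a(2)]] by blast
      have "Act F f (m \<otimes>\<^bsub>Val F Y\<^esub> m') = Act F f m \<otimes>\<^bsub>Val F X\<^esub> Act F f m'"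
        using Act_mult[OF \<alpha>(3), of f m m'] f m m' by auto
      then show "Act Q f (K \<otimes>\<^bsub>Val Q Y\<^esub> K') = Act Q f K \<otimes>\<^bsub>Val Q X\<^esub> Act Q f K'"
        using m m' mu[OF a(2)] mu[OF a(1)] co'[OF f] Fc[OF f] mm by simp
    qed
  next
    fix X K assume a: "X \<in> Obj C" "K \<in> carrier (Val Q X)"
    then obtain m where "m \<in> carrier (Val F X)" "K = N X #>\<^bsub>Val F X\<^esub> m" using ex by blast
    then show "Act Q (Idn C X) K = K" using co'[of "Idn C X" X X m] a by (simp add: Act_Idn[OF \<alpha>(3)])
  next
    fix X Y Z f g K assume a: "X \<in> Obj C" "Y \<in> Obj C" "Z \<in> Obj C" "f \<in> homs C X Y" "g \<in> homs C Y Z" "K \<in> carrier (Val Q Z)"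
    then have f: "ar C f X Y" "ar C g Y Z" by (simp_all add: homs_iff)
    obtain m where m: "m \<in> carrier (Val F Z)" "K = N Z #>\<^bsub>Val F Z\<^esub> m" using ex a by blast
    then show "Act Q (g \<cdot> f) K = Act Q f (Act Q g K)"
      using co'[of "g \<cdot> f" X Z m] co'[of g Y Z m] co'[of f X Y "Act F g m"] f Fc Act_cmp[OF \<alpha>(3), of f g m] by simp
  next
    fix X Y f g K assume a: "X \<in> Obj C" "Y \<in> Obj C" "f \<in> homs C X Y" "g \<in> homs C X Y" "K \<in> carrier (Val Q Y)"
    then have f: "ar C f X Y" "ar C g X Y" by (simp_all add: homs_iff)
    obtain m where m: "m \<in> carrier (Val F Y)" "K = N Y #>\<^bsub>Val F Y\<^esub> m" using ex a by blast
    show "Act Q (f \<otimes>\<^bsub>Hom C X Y\<^esub> g) K = Act Q f K \<otimes>\<^bsub>Val Q X\<^esub> Act Q g K"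
      using m co'[of "f \<boxplus> g" X Y m] co'[of f X Y m] co'[of g X Y m] f mu[OF a(1) Fc[OF f(1) m(1)] Fc[OF f(2) m(1)]] Fc
        Act_add[OF \<alpha>(3), of f g m] mult_eq_add[of f X Y g] by simp
  qed
qed

text \<open>The cokernel of C(-, v). It is \<open>Fun\<close> of an n-exact sequence when
  \<open>v\<close> is the last differential (\<open>Fun_cok\<close>).\<close>

definition cok :: "'m \<Rightarrow> ('o, 'm, 'm set) cmod" where
  "cok v = Cok_mod C (\<lambda>Y. Comp C v) (Rep C (Dom C v)) (Rep C (Cod C v))"

lemma nat_trans_Comp: "Ar C v \<Longrightarrow> nat_trans C (Rep C (Dom C v)) (Rep C (Cod C v)) (\<lambda>Y. Comp C v)"
  by (rule nat_transI) (auto simp: Ar_homs homs_iff mult_eq_add)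

text \<open>Stated for a general \<alpha> because it serves two quotients: \<open>cok v\<close>
  itself, and the quotient of a presented module by an image in
  \<open>presents_pullback_Cok\<close>.\<close>

lemma gen_Cok:
  assumes \<alpha>: "nat_trans C G F \<alpha>" "cmodule C G" and g: "gen C F B x"
  defines "z \<equiv> (\<alpha> B ` carrier (Val G B)) #>\<^bsub>Val F B\<^esub> x"
  shows "gen C (Cok_mod C \<alpha> G F) B z" 
    and "\<And>h. Ar C h \<Longrightarrow> Cod C h = B \<Longrightarrow> Act (Cok_mod C \<alpha> G F) h z = \<one>\<^bsub>Val (Cok_mod C \<alpha> G F) (Dom C h)\<^esub> \<longleftrightarrow>
      Act F h x \<in> \<alpha> (Dom C h) ` carrier (Val G (Dom C h))"
proof -
  note F = genD[OF g]
  note K = Cok_props[OF \<alpha> F(1)]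
  have n: "Act (Cok_mod C \<alpha> G F) h z = (\<alpha> (Dom C h) ` carrier (Val G (Dom C h))) #>\<^bsub>Val F (Dom C h)\<^esub> Act F h x"
    if "Ar C h" "Cod C h = B" for h
    using nat_transD(3)[OF K(2), of h x] that F by (simp add: z_def)
  show "gen C (Cok_mod C \<alpha> G F) B z" unfolding gen_def
  proof (intro conjI ballI)
    show "z \<in> carrier (Val (Cok_mod C \<alpha> G F) B)" using nat_transD(2)[OF K(2) F(2,3)] by (simp add: z_def)
    fix Y m assume Y: "Y \<in> Obj C" "m \<in> carrier (Val (Cok_mod C \<alpha> G F) Y)"
    then obtain m' where m': "m' \<in> carrier (Val F Y)" "m = (\<alpha> Y ` carrier (Val G Y)) #>\<^bsub>Val F Y\<^esub> m'" using K(3) by blast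
    obtain h where "ar C h Y B" "m' = Act F h x" using genE[OF g m'(1) Y(1)] .
    then show "\<exists>h. ar C h Y B \<and> m = Act (Cok_mod C \<alpha> G F) h z" using n m' by auto
  qed (use K F in auto)
  fix h assume h: "Ar C h" "Cod C h = B"
  show "Act (Cok_mod C \<alpha> G F) h z = \<one>\<^bsub>Val (Cok_mod C \<alpha> G F) (Dom C h)\<^esub> \<longleftrightarrow>
      Act F h x \<in> \<alpha> (Dom C h) ` carrier (Val G (Dom C h))"
    unfolding n[OF h] by (rule K(4)) (use h F Act_closed[of F h x] in auto)
qed

lemma presents_cok: "Ar C v \<Longrightarrow> \<exists>x. presents C v x (cok v)"
proof -
  assume v: "Ar C v"
  have r: "gen C (Rep C (Cod C v)) (Cod C v) (Idn C (Cod C v))"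
    using represents_Rep v by (simp add: represents_def)
  note g = gen_Cok[OF nat_trans_Comp[OF v] cmodule_Rep[OF ArD(1)[OF v]] r, folded cok_def]
  let ?z = "(Comp C v ` carrier (Val (Rep C (Dom C v)) (Cod C v))) #>\<^bsub>Val (Rep C (Cod C v)) (Cod C v)\<^esub> Idn C (Cod C v)"
  have "presents C v ?z (cok v)" unfolding presents_def
  proof (intro conjI allI impI)
    show "gen C (cok v) (Cod C v) ?z" by (rule g(1))
    fix h assume h: "Ar C h \<and> Cod C h = Cod C v"
    have "h \<in> Comp C v ` homs C (Dom C h) (Dom C v) \<longleftrightarrow> (\<exists>k. ar C k (Dom C h) (Dom C v) \<and> h = v \<cdot> k)"
      unfolding image_iff Bex_def using h v by (simp add: homs_iff)
    then show "Act (cok v) h ?z = \<one>\<^bsub>Val (cok v) (Dom C h)\<^esub> \<longleftrightarrow> (\<exists>k. ar C k (Dom C h) (Dom C v) \<and> h = v \<cdot> k)"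
      using g(2)[of h] h by simp
  qed (rule v)
  then show ?thesis by blast
qed

end

section \<open>Resolutions by representable modules and the comparison theorem\<close>

text \<open>The record \<open>cpx\<close> is reused for complexes that are infinite to the left, so
  that arbitrary resolutions and those of length n + 1 are treated alike. Exactness is that of C(-,
  X) in positive degrees only; in degree 0 the cokernel is the resolved module.\<close>

definition acyc :: "('o, 'm) cat \<Rightarrow> ('o, 'm) cpx \<Rightarrow> bool" where
  "acyc C X \<longleftrightarrow> (\<forall>i. ar C (df X (Suc i)) (ob X (Suc i)) (ob X i)) \<and>
    (\<forall>i. Comp C (df X (Suc i)) (df X (Suc (Suc i))) = zr C (ob X (Suc (Suc i))) (ob X i)) \<and>
    (\<forall>i h. Ar C h \<and> Cod C h = ob X (Suc i) \<and> Comp C (df X (Suc i)) h = zr C (Dom C h) (ob X i) \<longrightarrow>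
      (\<exists>k. ar C k (Dom C h) (ob X (Suc (Suc i))) \<and> h = Comp C (df X (Suc (Suc i))) k))"

definition rres :: "('o, 'm) cat \<Rightarrow> ('o, 'm) cpx \<Rightarrow> 'a \<Rightarrow> ('o, 'm, 'a) cmod \<Rightarrow> bool" where
  "rres C X x F \<longleftrightarrow> acyc C X \<and> presents C (df X (Suc 0)) x F"

definition chain :: "('o, 'm) cat \<Rightarrow> ('o, 'm) cpx \<Rightarrow> ('o, 'm) cpx \<Rightarrow> (nat \<Rightarrow> 'm) \<Rightarrow> bool" where
  "chain C X Y f \<longleftrightarrow> (\<forall>i. ar C (f i) (ob X i) (ob Y i) \<and>
    Comp C (f i) (df X (Suc i)) = Comp C (df Y (Suc i)) (f (Suc i)))"

text \<open>Vanishing of the i-th cohomology of the cochain complex C(X, T), hence of Ext^i(F, C(-,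
  T)) once \<open>X\<close> resolves F. In degree 0 there are no coboundaries, so the cocycle itself
  has to vanish.\<close>

definition coh :: "('o, 'm) cat \<Rightarrow> ('o, 'm) cpx \<Rightarrow> 'o \<Rightarrow> nat \<Rightarrow> bool" where
  "coh C X T i \<longleftrightarrow> (\<forall>h. ar C h (ob X i) T \<and> Comp C h (df X (Suc i)) = zr C (ob X (Suc i)) T \<longrightarrow>
    (case i of 0 \<Rightarrow> h = zr C (ob X 0) T | Suc j \<Rightarrow> \<exists>k. ar C k (ob X j) T \<and> h = Comp C k (df X i)))"

text \<open>Continues a sequence of length n + 1 by the object \<open>Z\<close>. Index n + 2 is
  singled out because that differential still ends in \<open>ob X (Suc n)\<close>.\<close>

definition extend :: "('o, 'm) cat \<Rightarrow> nat \<Rightarrow> 'o \<Rightarrow> ('o, 'm) cpx \<Rightarrow> ('o, 'm) cpx" where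
  "extend C n Z X = \<lparr>ob = (\<lambda>i. if i \<le> Suc n then ob X i else Z),
     df = (\<lambda>i. if i \<le> Suc n then df X i else zr C Z (if i = Suc (Suc n) then ob X (Suc n) else Z))\<rparr>"

lemma acycD:
  assumes "acyc C X"
  shows "Ar C (df X (Suc i))" "Dom C (df X (Suc i)) = ob X (Suc i)" "Cod C (df X (Suc i)) = ob X i"
    and "Comp C (df X (Suc i)) (df X (Suc (Suc i))) = zr C (ob X (Suc (Suc i))) (ob X i)"
  using assms by (auto simp: acyc_def)

lemma acycE:
  assumes "acyc C X" "ar C h Y (ob X (Suc i))" "Comp C (df X (Suc i)) h = zr C Y (ob X i)"
  obtains k where "ar C k Y (ob X (Suc (Suc i)))" "h = Comp C (df X (Suc (Suc i))) k"
  using assms unfolding acyc_def by metis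

lemma chainD:
  assumes "chain C X Y f"
  shows "Ar C (f i)" "Dom C (f i) = ob X i" "Cod C (f i) = ob Y i"
    and "Comp C (f i) (df X (Suc i)) = Comp C (df Y (Suc i)) (f (Suc i))"
  using assms by (auto simp: chain_def)

lemma presentsE:
  assumes "presents C v x M" "ar C h Y (Cod C v)" "Act M h x = \<one>\<^bsub>Val M Y\<^esub>"
  obtains k where "ar C k Y (Dom C v)" "h = Comp C v k"
  using assms unfolding presents_def by metis

section \<open>Chain maps and homotopies between resolutions\<close>

context preadditive_category
begin

lemma acyc_ob: "acyc C X \<Longrightarrow> ob X i \<in> Obj C"
  using acycD[of C X i] ArD(2) by metis

lemma presents_rel: "presents C v x M \<Longrightarrow> Act M v x = \<one>\<^bsub>Val M (Dom C v)\<^esub>"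
  unfolding presents_def
  by (metis ArD(1) Idn_ar idr)

lemma acyc_dd: "acyc C X \<Longrightarrow> Ar C h \<Longrightarrow> Cod C h = ob X (Suc (Suc i)) \<Longrightarrow>
    df X (Suc i) \<cdot> df X (Suc (Suc i)) \<cdot> h = zr C (Dom C h) (ob X i)"
  using assoc[of h "df X (Suc (Suc i))" "df X (Suc i)"] by (simp add: acycD acyc_ob)

text \<open>Degree by degree lifting along the exact complex \<open>Y\<close>. The invariant of the
  recursive choice includes the existence of the next component: what is chosen in degree n + 1 is
  the factorisation already known to exist in degree n, and exactness of \<open>Y\<close> produces
  the one after it.\<close>

lemma lift_chain:
  assumes X: "acyc C X" and Y: "acyc C Y" and f0: "ar C f0 (ob X 0) (ob Y 0)"
    and k0: "ar C k0 (ob X (Suc 0)) (ob Y (Suc 0))" "f0 \<cdot> df X (Suc 0) = df Y (Suc 0) \<cdot> k0"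
  obtains f where "chain C X Y f" "f 0 = f0"
proof -
  note [simp] = acycD[OF X] acycD[OF Y] acyc_ob[OF X] acyc_ob[OF Y]
  let ?P = "\<lambda>n x. (n = 0 \<longrightarrow> x = f0) \<and> ar C x (ob X n) (ob Y n) \<and>
    (\<exists>k. ar C k (ob X (Suc n)) (ob Y (Suc n)) \<and> x \<cdot> df X (Suc n) = df Y (Suc n) \<cdot> k)"
  let ?Q = "\<lambda>n x y. x \<cdot> df X (Suc n) = df Y (Suc n) \<cdot> y"
  have "\<exists>f. \<forall>n. ?P n (f n) \<and> ?Q n (f n) (f (Suc n))"
  proof (rule dependent_nat_choice)
    show "\<exists>x. ?P 0 x" using f0 k0 by blast
    fix x n assume "?P n x"
    then obtain k where x: "ar C x (ob X n) (ob Y n)" and k: "ar C k (ob X (Suc n)) (ob Y (Suc n))"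
      "x \<cdot> df X (Suc n) = df Y (Suc n) \<cdot> k" by blast
    have "df Y (Suc n) \<cdot> k \<cdot> df X (Suc (Suc n)) = x \<cdot> df X (Suc n) \<cdot> df X (Suc (Suc n))"
      using cmp_eq_cmp[OF k(2), of "df X (Suc (Suc n))"] x k by simp
    also have "\<dots> = zr C (ob X (Suc (Suc n))) (ob Y n)" using x by simp
    finally obtain l where "ar C l (ob X (Suc (Suc n))) (ob Y (Suc (Suc n)))"
      "k \<cdot> df X (Suc (Suc n)) = df Y (Suc (Suc n)) \<cdot> l"
      using acycE[OF Y, of "k \<cdot> df X (Suc (Suc n))" "ob X (Suc (Suc n))" n] k by auto
    then show "\<exists>y. ?P (Suc n) y \<and> ?Q n x y" using k by blast
  qed
  then show ?thesis using that unfolding chain_def by blast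
qed

text \<open>Given the homotopy in degree 0, exactness of \<open>X\<close> yields it in all degrees:
  the difference between \<open>c (Suc n)\<close> and 1 + s_n d is killed by d and therefore factors
  through the next differential.\<close>

lemma chain_homotopy:
  assumes X: "acyc C X" and c: "chain C X X c" and s0: "ar C s0 (ob X 0) (ob X (Suc 0))"
    "c 0 = Idn C (ob X 0) \<boxplus> df X (Suc 0) \<cdot> s0"
  obtains s where "s 0 = s0" "\<And>i. ar C (s i) (ob X i) (ob X (Suc i))"
    "\<And>i. c (Suc i) = Idn C (ob X (Suc i)) \<boxplus> (df X (Suc (Suc i)) \<cdot> s (Suc i) \<boxplus> s i \<cdot> df X (Suc i))"
proof -
  note [simp] = acycD[OF X] acyc_ob[OF X] chainD(1-3)[OF c]
  \<comment> \<open>The last clause is the homotopy equation in degree n composed with the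
    differential, in which the term with two consecutive differentials has disappeared. This form
    has the same shape for n = 0 and n > 0.\<close>
  let ?P = "\<lambda>n x. (n = 0 \<longrightarrow> x = s0) \<and> ar C x (ob X n) (ob X (Suc n)) \<and>
    c n \<cdot> df X (Suc n) = df X (Suc n) \<boxplus> df X (Suc n) \<cdot> x \<cdot> df X (Suc n)"
  let ?Q = "\<lambda>n x y. c (Suc n) = Idn C (ob X (Suc n)) \<boxplus> (df X (Suc (Suc n)) \<cdot> y \<boxplus> x \<cdot> df X (Suc n))"
  have "\<exists>f. \<forall>n. ?P n (f n) \<and> ?Q n (f n) (f (Suc n))"
  proof (rule dependent_nat_choice)
    show "\<exists>x. ?P 0 x" using s0 by auto
    fix x n assume "?P n x"
    then have x: "ar C x (ob X n) (ob X (Suc n))"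
      "c n \<cdot> df X (Suc n) = df X (Suc n) \<boxplus> df X (Suc n) \<cdot> x \<cdot> df X (Suc n)" by blast+
    let ?e = "c (Suc n) \<boxminus> (Idn C (ob X (Suc n)) \<boxplus> x \<cdot> df X (Suc n))"
    have "df X (Suc n) \<cdot> c (Suc n) = df X (Suc n) \<boxplus> df X (Suc n) \<cdot> x \<cdot> df X (Suc n)"
      using chainD(4)[OF c, of n] x by simp
    then have "df X (Suc n) \<cdot> ?e = zr C (ob X (Suc n)) (ob X n)" using x by simp
    then obtain y where y: "ar C y (ob X (Suc n)) (ob X (Suc (Suc n)))" "?e = df X (Suc (Suc n)) \<cdot> y"
      using acycE[OF X, of ?e "ob X (Suc n)" n] x by auto
    then have "c (Suc n) = df X (Suc (Suc n)) \<cdot> y \<boxplus> (Idn C (ob X (Suc n)) \<boxplus> x \<cdot> df X (Suc n))"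
      using x by (simp add: sub_eq_iff)
    then have Q: "?Q n x y" using x y by (simp add: add_lcomm)
    then have "?P (Suc n) y" using x y by simp
    with Q show "\<exists>y. ?P (Suc n) y \<and> ?Q n x y" by blast
  qed
  then obtain s where "\<forall>n. ?P n (s n) \<and> ?Q n (s n) (s (Suc n))" by blast
  then show ?thesis using that[of s] by blast
qed

lemma chain_comp: "acyc C X \<Longrightarrow> acyc C Y \<Longrightarrow> acyc C Z \<Longrightarrow> chain C X Y f \<Longrightarrow> chain C Y Z g \<Longrightarrow> chain C X Z (\<lambda>i. g i \<cdot> f i)"
  unfolding chain_def
proof (intro allI conjI, goal_cases)
  case (4 i)
  then have "g i \<cdot> f i \<cdot> df X (Suc i) = g i \<cdot> df Y (Suc i) \<cdot> f (Suc i)" by simp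
  also have "\<dots> = df Z (Suc i) \<cdot> g (Suc i) \<cdot> f (Suc i)"
    using 4 by (intro cmp_eq_cmp) (simp_all add: acycD)
  finally show ?case using 4 by (simp add: acycD)
qed simp_all

lemma comparison_map:
  assumes X: "rres C X x F" and Y: "rres C Y y F"
  obtains f where "chain C X Y f" "x = Act F (f 0) y"
proof -
  have aX: "acyc C X" and pX: "presents C (df X (Suc 0)) x F" using X by (auto simp: rres_def)
  have aY: "acyc C Y" and pY: "presents C (df Y (Suc 0)) y F" using Y by (auto simp: rres_def)
  note [simp] = acycD[OF aX] acycD[OF aY] acyc_ob[OF aX] acyc_ob[OF aY]
  have gX: "gen C F (ob X 0) x" using presents_gen[OF pX] by simp
  have gY: "gen C F (ob Y 0) y" using presents_gen[OF pY] by simp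
  obtain f0 where f0: "ar C f0 (ob X 0) (ob Y 0)" "x = Act F f0 y" using genE[OF gY genD(3)[OF gX]] by auto
  have "Act F (f0 \<cdot> df X (Suc 0)) y = \<one>\<^bsub>Val F (ob X (Suc 0))\<^esub>"
    using presents_rel[OF pX] f0 genD[OF gY] by (simp add: Act_cmp)
  then obtain k0 where "ar C k0 (ob X (Suc 0)) (ob Y (Suc 0))" "f0 \<cdot> df X (Suc 0) = df Y (Suc 0) \<cdot> k0"
    using presentsE[OF pY, of "f0 \<cdot> df X (Suc 0)" "ob X (Suc 0)"] f0 by auto
  from lift_chain[OF aX aY f0(1) this] show ?thesis using that f0 by metis
qed

text \<open>The morphism \<open>c 0\<close> minus the identity kills the generator, hence factors
  through the first differential; this starts the homotopy.\<close>

lemma comparison_homotopy: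
  assumes X: "rres C X x F" and c: "chain C X X c" "Act F (c 0) x = x"
  obtains s where "\<And>i. ar C (s i) (ob X i) (ob X (Suc i))"
    "c 0 = Idn C (ob X 0) \<boxplus> df X (Suc 0) \<cdot> s 0"
    "\<And>i. c (Suc i) = Idn C (ob X (Suc i)) \<boxplus> (df X (Suc (Suc i)) \<cdot> s (Suc i) \<boxplus> s i \<cdot> df X (Suc i))"
proof -
  have aX: "acyc C X" and pX: "presents C (df X (Suc 0)) x F" using X by (auto simp: rres_def)
  note [simp] = acycD[OF aX] acyc_ob[OF aX] chainD(1-3)[OF c(1)]
  have gX: "gen C F (ob X 0) x" using presents_gen[OF pX] by simp
  have "Act F (c 0 \<boxminus> Idn C (ob X 0)) x = \<one>\<^bsub>Val F (ob X 0)\<^esub>" using c genD[OF gX] by (simp add: Act_sub Act_Idn)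
  then obtain s0 where s0: "ar C s0 (ob X 0) (ob X (Suc 0))" "c 0 \<boxminus> Idn C (ob X 0) = df X (Suc 0) \<cdot> s0"
    using presentsE[OF pX, of "c 0 \<boxminus> Idn C (ob X 0)" "ob X 0"] by auto
  then have "c 0 = Idn C (ob X 0) \<boxplus> df X (Suc 0) \<cdot> s0" by (simp add: sub_eq_iff add_comm)
  from chain_homotopy[OF aX c(1) s0(1) this] show ?thesis using that \<open>c 0 = _\<close> by metis
qed

text \<open>Both maps respect the generators, so \<open>g 0\<close> after \<open>f 0\<close> fixes
  \<open>x\<close> and \<open>f 0\<close> after \<open>g 0\<close> fixes \<open>y\<close>; then
  \<open>comparison_homotopy\<close> applies to both composites.\<close>

lemma comparison:
  assumes X: "rres C X x F" and Y: "rres C Y y F"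
  obtains f g s t where "chain C X Y f" "chain C Y X g" "x = Act F (f 0) y" "y = Act F (g 0) x"
    "\<And>i. ar C (s i) (ob X i) (ob X (Suc i))" "\<And>i. ar C (t i) (ob Y i) (ob Y (Suc i))"
    "g 0 \<cdot> f 0 = Idn C (ob X 0) \<boxplus> df X (Suc 0) \<cdot> s 0"
    "\<And>i. g (Suc i) \<cdot> f (Suc i) = Idn C (ob X (Suc i)) \<boxplus> (df X (Suc (Suc i)) \<cdot> s (Suc i) \<boxplus> s i \<cdot> df X (Suc i))"
    "f 0 \<cdot> g 0 = Idn C (ob Y 0) \<boxplus> df Y (Suc 0) \<cdot> t 0"
    "\<And>i. f (Suc i) \<cdot> g (Suc i) = Idn C (ob Y (Suc i)) \<boxplus> (df Y (Suc (Suc i)) \<cdot> t (Suc i) \<boxplus> t i \<cdot> df Y (Suc i))"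
proof -
  have aX: "acyc C X" and pX: "presents C (df X (Suc 0)) x F" using X by (auto simp: rres_def)
  have aY: "acyc C Y" and pY: "presents C (df Y (Suc 0)) y F" using Y by (auto simp: rres_def)
  have gX: "gen C F (ob X 0) x" using presents_gen[OF pX] acycD[OF aX] by simp
  have gY: "gen C F (ob Y 0) y" using presents_gen[OF pY] acycD[OF aY] by simp
  obtain f where f: "chain C X Y f" "x = Act F (f 0) y" using comparison_map[OF X Y] .
  obtain g where g: "chain C Y X g" "y = Act F (g 0) x" using comparison_map[OF Y X] .
  note [simp] = chainD(1-3)[OF f(1)] chainD(1-3)[OF g(1)]
  have gf: "chain C X X (\<lambda>i. g i \<cdot> f i)" using chain_comp aX aY f g by blast
  have fg: "chain C Y Y (\<lambda>i. f i \<cdot> g i)" using chain_comp aX aY f g by blast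
  have 1: "Act F (g 0 \<cdot> f 0) x = x" using f(2) g(2) genD[OF gX] by (simp add: Act_cmp)
  have 2: "Act F (f 0 \<cdot> g 0) y = y" using f(2) g(2) genD[OF gY] by (simp add: Act_cmp)
  show ?thesis
    using comparison_homotopy[OF X gf 1] comparison_homotopy[OF Y fg 2] that[OF f(1) g(1) f(2) g(2)] by metis
qed

lemma cohD: "coh C X T i \<Longrightarrow> ar C h (ob X i) T \<Longrightarrow> h \<cdot> df X (Suc i) = zr C (ob X (Suc i)) T \<Longrightarrow>
    (case i of 0 \<Rightarrow> h = zr C (ob X 0) T | Suc j \<Rightarrow> \<exists>k. ar C k (ob X j) T \<and> h = k \<cdot> df X i)"
  by (simp add: coh_def)

text \<open>For a cocycle h on \<open>X\<close>, composing g f = 1 + d s + s d with h gives h g f =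
  h + h s d, because h d = 0. Since h g is a cocycle on \<open>Y\<close>, it is a coboundary there
  (or zero in degree 0), and solving for h exhibits h as a coboundary on \<open>X\<close>.\<close>

lemma coh_transfer:
  assumes X: "rres C X x F" and Y: "rres C Y y F" and T: "T \<in> Obj C" and c: "coh C Y T i"
  shows "coh C X T i"
proof -
  have aX: "acyc C X" and aY: "acyc C Y" using X Y by (auto simp: rres_def)
  obtain f g s t where fg: "chain C X Y f" "chain C Y X g"
    and st: "\<And>i. ar C (s i) (ob X i) (ob X (Suc i))" "\<And>i. ar C (t i) (ob Y i) (ob Y (Suc i))"
    and h0: "g 0 \<cdot> f 0 = Idn C (ob X 0) \<boxplus> df X (Suc 0) \<cdot> s 0"
    and hS: "\<And>i. g (Suc i) \<cdot> f (Suc i) = Idn C (ob X (Suc i)) \<boxplus> (df X (Suc (Suc i)) \<cdot> s (Suc i) \<boxplus> s i \<cdot> df X (Suc i))"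
    using comparison[OF X Y] by metis
  note [simp] = acycD(1-3)[OF aX] acycD(1-3)[OF aY] acyc_ob[OF aX] acyc_ob[OF aY] chainD(1-3)[OF fg(1)] chainD(1-3)[OF fg(2)] st T
  show ?thesis unfolding coh_def
  proof (intro allI impI)
    fix h assume h: "ar C h (ob X i) T \<and> h \<cdot> df X (Suc i) = zr C (ob X (Suc i)) T"
    then have [simp]: "Ar C h" "Dom C h = ob X i" "Cod C h = T" by auto
    have hd: "h \<cdot> df X (Suc i) \<cdot> k = zr C (Dom C k) T" if "Ar C k" "Cod C k = ob X (Suc i)" for k
      using cmp_eq1[of h "df X (Suc i)" _ k] h that by simp
    have "(h \<cdot> g i) \<cdot> df Y (Suc i) = h \<cdot> df X (Suc i) \<cdot> g (Suc i)"
      using chainD(4)[OF fg(2), of i] by simp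
    then have "(h \<cdot> g i) \<cdot> df Y (Suc i) = zr C (ob Y (Suc i)) T" by (simp add: hd)
    note * = cohD[OF c _ this]
    show "case i of 0 \<Rightarrow> h = zr C (ob X 0) T | Suc j \<Rightarrow> \<exists>k. ar C k (ob X j) T \<and> h = k \<cdot> df X i"
    proof (cases i)
      case 0
      then have "h \<cdot> g 0 = zr C (ob Y 0) T" using * by simp
      then have "h \<cdot> g 0 \<cdot> f 0 = zr C (ob X 0) T" using cmp_eq1[of h "g 0" _ "f 0"] 0 by simp
      then show ?thesis using 0 hd[of "s 0"] by (simp add: h0)
    next
      case (Suc j)
      then obtain k where k: "ar C k (ob Y j) T" "h \<cdot> g i = k \<cdot> df Y i" using * by auto
      have "h \<cdot> g i \<cdot> f i = k \<cdot> df Y i \<cdot> f i" using cmp_eq_cmp[OF k(2), of "f i"] k Suc by simp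
      also have "\<dots> = k \<cdot> f j \<cdot> df X i" using chainD(4)[OF fg(1), of j] Suc by simp
      finally have e: "h \<boxplus> h \<cdot> s j \<cdot> df X i = k \<cdot> f j \<cdot> df X i" using hd[of "s i"] Suc k by (simp add: hS)
      have "h = (h \<boxplus> h \<cdot> s j \<cdot> df X i) \<boxminus> h \<cdot> s j \<cdot> df X i" using Suc by simp
      also have "\<dots> = k \<cdot> f j \<cdot> df X i \<boxminus> h \<cdot> s j \<cdot> df X i" by (simp only: e)
      also have "\<dots> = (k \<cdot> f j \<boxminus> h \<cdot> s j) \<cdot> df X i" using k Suc by simp
      finally have "h = (k \<cdot> f j \<boxminus> h \<cdot> s j) \<cdot> df X i" .
      moreover have "ar C (k \<cdot> f j \<boxminus> h \<cdot> s j) (ob X j) T" using k Suc by simp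
      ultimately have "\<exists>k. ar C k (ob X j) T \<and> h = k \<cdot> df X i" by blast
      then show ?thesis using Suc by simp
    qed
  qed
qed

section \<open>Zero objects, and exactness of hom groups as factorisation of morphisms\<close>

lemma zero_objectD:
  "zero_object C Z \<Longrightarrow> Z \<in> Obj C"
  "zero_object C Z \<Longrightarrow> Ar C f \<Longrightarrow> Dom C f = Z \<Longrightarrow> f = zr C Z (Cod C f)"
  "zero_object C Z \<Longrightarrow> Ar C f \<Longrightarrow> Cod C f = Z \<Longrightarrow> f = zr C (Dom C f) Z"
proof -
  assume z: "zero_object C Z"
  then show "Z \<in> Obj C" by (simp add: zero_object_def)
  assume f: "Ar C f"
  { assume "Dom C f = Z"
    then have "f \<in> homs C Z (Cod C f)" using f Ar_homs by blast
    then show "f = zr C Z (Cod C f)" using z f by (auto simp: zero_object_def trivial_group_def zr_def) }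
  { assume "Cod C f = Z"
    then have "f \<in> homs C (Dom C f) Z" using f Ar_homs by blast
    then show "f = zr C (Dom C f) Z" using z f by (auto simp: zero_object_def trivial_group_def zr_def) }
qed

text \<open>The equality of image and kernel is split into a vanishing composite and a factorisation
  property, the form in which exactness is used everywhere; \<open>exact_at_pre\<close> is the
  dual.\<close>

lemma exact_at_post:
  assumes "Y \<in> Obj C" "ar C d A B" "ar C d' B D"
  shows "exact_at (Hom C Y A) (Hom C Y B) (Hom C Y D) (Comp C d) (Comp C d') \<longleftrightarrow>
     (\<forall>h. ar C h Y A \<longrightarrow> d' \<cdot> d \<cdot> h = zr C Y D) \<and>
     (\<forall>h. ar C h Y B \<and> d' \<cdot> h = zr C Y D \<longrightarrow> (\<exists>k. ar C k Y A \<and> h = d \<cdot> k))"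
proof -
  have o: "A \<in> Obj C" "B \<in> Obj C" "D \<in> Obj C" using assms by auto
  show ?thesis using assms o unfolding exact_at_def kernel_def zr_def[symmetric] set_eq_iff image_iff Bex_def mem_Collect_eq
    by (auto simp: homs_iff)
qed

lemma exact_at_pre:
  assumes "Y \<in> Obj C" "ar C d A B" "ar C d' B D"
  shows "exact_at (Hom C D Y) (Hom C B Y) (Hom C A Y) (\<lambda>h. Comp C h d') (\<lambda>h. Comp C h d) \<longleftrightarrow>
     (\<forall>h. ar C h D Y \<longrightarrow> (h \<cdot> d') \<cdot> d = zr C A Y) \<and>
     (\<forall>h. ar C h B Y \<and> h \<cdot> d = zr C A Y \<longrightarrow> (\<exists>k. ar C k D Y \<and> h = k \<cdot> d'))"
  using preadditive_category.exact_at_post[OF op_preadditive, of Y d' D B d A] assms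
  by (simp add: conj_comms)

lemma inj_on_post:
  assumes "Y \<in> Obj C" "ar C d A B"
  shows "inj_on (Comp C d) (homs C Y A) \<longleftrightarrow> (\<forall>h. ar C h Y A \<and> d \<cdot> h = zr C Y B \<longrightarrow> h = zr C Y A)"
proof
  have o: "A \<in> Obj C" "B \<in> Obj C" using assms by auto
  assume i: "inj_on (Comp C d) (homs C Y A)"
  then show "\<forall>h. ar C h Y A \<and> d \<cdot> h = zr C Y B \<longrightarrow> h = zr C Y A"
    using assms o inj_onD[OF i, of _ "zr C Y A"] by (auto simp: homs_iff)
next
  have o: "A \<in> Obj C" "B \<in> Obj C" using assms by auto
  assume r: "\<forall>h. ar C h Y A \<and> d \<cdot> h = zr C Y B \<longrightarrow> h = zr C Y A"
  show "inj_on (Comp C d) (homs C Y A)"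
  proof (rule inj_onI)
    fix h k assume "h \<in> homs C Y A" "k \<in> homs C Y A" "d \<cdot> h = d \<cdot> k"
    then have a: "ar C h Y A" "ar C k Y A" "d \<cdot> h = d \<cdot> k" using assms o by (simp_all add: homs_iff)
    then have "d \<cdot> (h \<boxminus> k) = zr C Y B" using assms o by simp
    then have "h \<boxminus> k = zr C Y A" using r a by simp
    then show "h = k" using a by (simp add: sub_eq_zr)
  qed
qed

lemma inj_on_pre:
  assumes "Y \<in> Obj C" "ar C d A B"
  shows "inj_on (\<lambda>h. Comp C h d) (homs C B Y) \<longleftrightarrow> (\<forall>h. ar C h B Y \<and> h \<cdot> d = zr C A Y \<longrightarrow> h = zr C B Y)"
  using preadditive_category.inj_on_post[OF op_preadditive, of Y d B A] assms by auto

text \<open>The covariant half is acyclicity, with injectivity at the left end because a morphism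
  killed by the differential of degree n + 1 factors through a zero object. The contravariant half
  is exactly the vanishing of cohomology in degrees up to n.\<close>

lemma n_exact_acyc:
  assumes X: "acyc C X" and z: "\<And>i. i > Suc n \<Longrightarrow> zero_object C (ob X i)"
    and c: "\<And>i T. i \<le> n \<Longrightarrow> T \<in> Obj C \<Longrightarrow> coh C X T i"
  shows "n_exact C n X"
proof -
  note [simp] = acycD(1-4)[OF X] acyc_ob[OF X]
  have "is_complex C n X" unfolding is_complex_def
    by (auto intro: Ar_homs simp: zr_def[symmetric])
  moreover have "hom_exact C n X Y" if Y: "Y \<in> Obj C" for Y
    unfolding hom_exact_def
  proof (intro conjI allI impI)
    have "h = zr C Y (ob X (Suc n))" if h: "ar C h Y (ob X (Suc n))" "df X (Suc n) \<cdot> h = zr C Y (ob X n)" for h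
    proof -
      obtain k where k: "ar C k Y (ob X (Suc (Suc n)))" "h = df X (Suc (Suc n)) \<cdot> k" using acycE[OF X h] .
      have "k = zr C Y (ob X (Suc (Suc n)))" using zero_objectD(3)[OF z, of "Suc (Suc n)" k] k by simp
      then show ?thesis using k Y by simp
    qed
    then show "inj_on (Comp C (df X (Suc n))) (homs C Y (ob X (Suc n)))"
      using inj_on_post[of Y "df X (Suc n)"] Y by simp
    fix i assume i: "i < n"
    show "exact_at (Hom C Y (ob X (Suc (Suc i)))) (Hom C Y (ob X (Suc i))) (Hom C Y (ob X i))
       (Comp C (df X (Suc (Suc i)))) (Comp C (df X (Suc i)))"
    proof -
      have "\<exists>k. ar C k Y (ob X (Suc (Suc i))) \<and> h = df X (Suc (Suc i)) \<cdot> k"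
        if "ar C h Y (ob X (Suc i))" "df X (Suc i) \<cdot> h = zr C Y (ob X i)" for h
        using acycE[OF X that] by blast
      then show ?thesis
        using exact_at_post[of Y "df X (Suc (Suc i))" "ob X (Suc (Suc i))" "ob X (Suc i)" "df X (Suc i)" "ob X i"] Y
        by (auto simp: acyc_dd[OF X])
    qed
  qed
  moreover have "cohom_exact C n X Y" if Y: "Y \<in> Obj C" for Y
    unfolding cohom_exact_def
  proof (intro conjI allI impI)
    show "inj_on (\<lambda>h. h \<cdot> df X 1) (homs C (ob X 0) Y)"
      using inj_on_pre[of Y "df X (Suc 0)"] Y cohD[OF c[of 0 Y]] by simp
    fix i assume i: "i < n"
    show "exact_at (Hom C (ob X i) Y) (Hom C (ob X (Suc i)) Y) (Hom C (ob X (Suc (Suc i))) Y)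
       (\<lambda>h. h \<cdot> df X (Suc i)) (\<lambda>h. h \<cdot> df X (Suc (Suc i)))"
      using exact_at_pre[of Y "df X (Suc (Suc i))" _ _ "df X (Suc i)"] Y i cohD[OF c[of "Suc i" Y]] by simp
  qed
  ultimately show ?thesis by (simp add: n_exact_def)
qed

lemma n_exactD:
  assumes X: "n_exact C n X"
  shows "i \<le> n \<Longrightarrow> ar C (df X (Suc i)) (ob X (Suc i)) (ob X i)"
    and "i \<le> Suc n \<Longrightarrow> ob X i \<in> Obj C"
    and "i < n \<Longrightarrow> df X (Suc i) \<cdot> df X (Suc (Suc i)) = zr C (ob X (Suc (Suc i))) (ob X i)"
    and "ar C h Y (ob X (Suc n)) \<Longrightarrow> df X (Suc n) \<cdot> h = zr C Y (ob X n) \<Longrightarrow> h = zr C Y (ob X (Suc n))"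
    and "i < n \<Longrightarrow> ar C h Y (ob X (Suc i)) \<Longrightarrow> df X (Suc i) \<cdot> h = zr C Y (ob X i) \<Longrightarrow>
       \<exists>k. ar C k Y (ob X (Suc (Suc i))) \<and> h = df X (Suc (Suc i)) \<cdot> k"
    and "i \<le> n \<Longrightarrow> T \<in> Obj C \<Longrightarrow> coh C X T i"
proof -
  have c: "is_complex C n X" and e: "\<And>Y. Y \<in> Obj C \<Longrightarrow> hom_exact C n X Y" "\<And>Y. Y \<in> Obj C \<Longrightarrow> cohom_exact C n X Y"
    using X by (auto simp: n_exact_def)
  show o: "i \<le> Suc n \<Longrightarrow> ob X i \<in> Obj C" for i using c by (simp add: is_complex_def)
  show d: "i \<le> n \<Longrightarrow> ar C (df X (Suc i)) (ob X (Suc i)) (ob X i)" for i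
  proof -
    assume i: "i \<le> n"
    then have "df X (Suc i) \<in> homs C (ob X (Suc i)) (ob X i)" using c unfolding is_complex_def by blast
    then show ?thesis using o[of i] o[of "Suc i"] i by (simp add: homs_iff)
  qed
  show "i < n \<Longrightarrow> df X (Suc i) \<cdot> df X (Suc (Suc i)) = zr C (ob X (Suc (Suc i))) (ob X i)"
    using c by (simp add: is_complex_def zr_def)
  { assume "ar C h Y (ob X (Suc n))" "df X (Suc n) \<cdot> h = zr C Y (ob X n)"
    then show "h = zr C Y (ob X (Suc n))"
      using e(1)[of Y] inj_on_post[of Y "df X (Suc n)" "ob X (Suc n)" "ob X n"] d[of n] by (auto simp: hom_exact_def) }
  { assume "i < n" "ar C h Y (ob X (Suc i))" "df X (Suc i) \<cdot> h = zr C Y (ob X i)"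
    then show "\<exists>k. ar C k Y (ob X (Suc (Suc i))) \<and> h = df X (Suc (Suc i)) \<cdot> k"
    proof -
      assume a: "i < n" "ar C h Y (ob X (Suc i))" "df X (Suc i) \<cdot> h = zr C Y (ob X i)"
      then have Y: "Y \<in> Obj C" by auto
      then have "exact_at (Hom C Y (ob X (Suc (Suc i)))) (Hom C Y (ob X (Suc i))) (Hom C Y (ob X i))
       (Comp C (df X (Suc (Suc i)))) (Comp C (df X (Suc i)))" using e(1)[OF Y] a(1) by (simp add: hom_exact_def)
      then show ?thesis using iffD1[OF exact_at_post[OF Y d[of "Suc i"] d[of i]]] a by auto
    qed }
  { assume i: "i \<le> n" and T: "T \<in> Obj C"
    note e' = e(2)[OF T, unfolded cohom_exact_def]
    show "coh C X T i"
    proof (cases i)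
      case 0
      then show ?thesis using e' inj_on_pre[of T "df X (Suc 0)"] d[of 0] i T by (auto simp: coh_def)
    next
      case (Suc j)
      then have "exact_at (Hom C (ob X j) T) (Hom C (ob X (Suc j)) T) (Hom C (ob X (Suc (Suc j))) T)
       (\<lambda>h. h \<cdot> df X (Suc j)) (\<lambda>h. h \<cdot> df X (Suc (Suc j)))" using e' i by auto
      then show ?thesis using Suc exact_at_pre[of T "df X (Suc (Suc j))" _ _ "df X (Suc j)"] d[of j] d[of "Suc j"] i T
        by (auto simp: coh_def)
    qed }
qed

lemma extend_simps [simp]:
  "i \<le> Suc n \<Longrightarrow> ob (extend C n Z X) i = ob X i"
  "i \<le> n \<Longrightarrow> df (extend C n Z X) (Suc i) = df X (Suc i)"
  by (auto simp: extend_def)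

text \<open>Converse passage from n-exact sequences to infinite complexes. Exactness at degree n + 1
  is injectivity of the first morphism of the sequence, and from degree n + 2 on all morphisms into
  the complex are zero.\<close>

lemma extend_acyc:
  assumes X: "n_exact C n X" and Z: "zero_object C Z"
  shows "acyc C (extend C n Z X)" "i > Suc n \<Longrightarrow> ob (extend C n Z X) i = Z"
    "i \<le> n \<Longrightarrow> T \<in> Obj C \<Longrightarrow> coh C (extend C n Z X) T i"
proof -
  let ?X = "extend C n Z X"
  have ZO: "Z \<in> Obj C" using Z by (rule zero_objectD)
  show ZZ: "i > Suc n \<Longrightarrow> ob ?X i = Z" for i by (simp add: extend_def)
  have o: "ob ?X i \<in> Obj C" for i using n_exactD(2)[OF X, of i] ZO by (auto simp: extend_def)
  have dz: "df ?X (Suc i) = zr C (ob ?X (Suc i)) (ob ?X i)" if "i > n" for i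
    using that by (cases "i = Suc n") (auto simp: extend_def)
  have d: "ar C (df ?X (Suc i)) (ob ?X (Suc i)) (ob ?X i)" for i
  proof (cases "i \<le> n")
    case True then show ?thesis using n_exactD(1)[OF X, of i] by simp
  next
    case False then show ?thesis using dz[of i] o by simp
  qed
  have hz: "h = zr C Y (ob ?X i)" if "ar C h Y (ob ?X i)" "i > Suc n" for h Y i
    using zero_objectD(3)[OF Z, of h] that ZZ[of i] by simp
  show "acyc C ?X" unfolding acyc_def
  proof (intro conjI allI impI)
    fix i
    show "Ar C (df ?X (Suc i))" "Dom C (df ?X (Suc i)) = ob ?X (Suc i)" "Cod C (df ?X (Suc i)) = ob ?X i" using d by auto
    show "df ?X (Suc i) \<cdot> df ?X (Suc (Suc i)) = zr C (ob ?X (Suc (Suc i))) (ob ?X i)"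
    proof (cases "i < n")
      case True then show ?thesis using n_exactD(3)[OF X, of i] by simp
    next
      case False then show ?thesis using dz[of "Suc i"] o d[of i] by simp
    qed
    fix h assume h: "Ar C h \<and> Cod C h = ob ?X (Suc i) \<and> df ?X (Suc i) \<cdot> h = zr C (Dom C h) (ob ?X i)"
    show "\<exists>k. ar C k (Dom C h) (ob ?X (Suc (Suc i))) \<and> h = df ?X (Suc (Suc i)) \<cdot> k"
    proof (cases "i < n")
      case True then show ?thesis using n_exactD(5)[OF X, of i h "Dom C h"] h by simp
    next
      case False
      have "h = zr C (Dom C h) (ob ?X (Suc i))"
      proof (cases "i = n")
        case True then show ?thesis using n_exactD(4)[OF X, of h "Dom C h"] h by simp
      next
        case False then show ?thesis using hz[of h "Dom C h" "Suc i"] h \<open>\<not> i < n\<close> by simp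
      qed
      then show ?thesis using h o d[of "Suc i"] by (intro exI[of _ "zr C (Dom C h) (ob ?X (Suc (Suc i)))"]) simp
    qed
  qed
  show "coh C ?X T i" if "i \<le> n" "T \<in> Obj C"
    using n_exactD(6)[OF X that] that unfolding coh_def by (auto split: nat.splits)
qed

lemma presents_cmp: "presents C v x M \<Longrightarrow> ar C k Y (Dom C v) \<Longrightarrow> Act M (v \<cdot> k) x = \<one>\<^bsub>Val M Y\<^esub>"
proof -
  assume p: "presents C v x M" and k: "ar C k Y (Dom C v)"
  then have v: "Ar C v" by (simp add: presents_def)
  have "\<exists>l. ar C l (Dom C (v \<cdot> k)) (Dom C v) \<and> v \<cdot> k = v \<cdot> l" using k v by (intro exI[of _ k]) simp
  then show ?thesis using presents_iff[OF p, of "v \<cdot> k"] k v by simp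
qed

section \<open>Homotopy equivalence of n-exact sequences and the presented module\<close>

lemma homotopicI:
  assumes f: "\<And>i. i \<le> Suc n \<Longrightarrow> ar C (g i) (ob X i) (ob Y i)"
    and X: "\<And>i. i \<le> n \<Longrightarrow> ar C (df X (Suc i)) (ob X (Suc i)) (ob X i)"
    and Y: "\<And>i. i \<le> n \<Longrightarrow> ar C (df Y (Suc i)) (ob Y (Suc i)) (ob Y i)"
    and h: "\<And>i. i \<le> n \<Longrightarrow> ar C (h i) (ob X i) (ob Y (Suc i))"
    and "f 0 = g 0 \<boxplus> df Y (Suc 0) \<cdot> h 0"
    and "\<And>i. i < n \<Longrightarrow> f (Suc i) = g (Suc i) \<boxplus> (df Y (Suc (Suc i)) \<cdot> h (Suc i) \<boxplus> h i \<cdot> df X (Suc i))"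
    and "f (Suc n) = g (Suc n) \<boxplus> h n \<cdot> df X (Suc n)"
  shows "homotopic C n X Y f g"
  unfolding homotopic_def
proof (intro exI[of _ h] conjI allI impI)
  show "f 0 = g 0 \<otimes>\<^bsub>Hom C (ob X 0) (ob Y 0)\<^esub> df Y 1 \<cdot> h 0"
    using assms(5) f[of 0] by (simp add: mult_eq_add)
  show "f (Suc n) = g (Suc n) \<otimes>\<^bsub>Hom C (ob X (Suc n)) (ob Y (Suc n))\<^esub> h n \<cdot> df X (Suc n)"
    using assms(7) f[of "Suc n"] by (simp add: mult_eq_add)
  fix i assume i: "i < n"
  have 1: "ar C (df Y (Suc (Suc i)) \<cdot> h (Suc i)) (ob X (Suc i)) (ob Y (Suc i))"
    using Y[of "Suc i"] h[of "Suc i"] i by simp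
  show "f (Suc i) = g (Suc i) \<otimes>\<^bsub>Hom C (ob X (Suc i)) (ob Y (Suc i))\<^esub>
          (df Y (Suc (Suc i)) \<cdot> h (Suc i) \<otimes>\<^bsub>Hom C (ob X (Suc i)) (ob Y (Suc i))\<^esub> h i \<cdot> df X (Suc i))"
    using assms(6)[OF i] f[of "Suc i"] i mult_eq_add[OF 1] by (simp add: mult_eq_add)
next
  fix i assume "i \<le> n" then show "h i \<in> homs C (ob X i) (ob Y (Suc i))" using h[of i] Ar_homs by blast
qed

lemma homotopic_zeroE:
  assumes "homotopic C n X Y f g" "ar C (g 0) (ob X 0) (ob Y 0)" "ob X 0 \<in> Obj C" "ob Y (Suc 0) \<in> Obj C"
  obtains h where "ar C h (ob X 0) (ob Y (Suc 0))" "f 0 = g 0 \<boxplus> df Y (Suc 0) \<cdot> h"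
  using assms that unfolding homotopic_def One_nat_def
  by (metis homs_iff mult_eq_add le0)

lemma chain_mapI:
  assumes "\<And>i. i \<le> Suc n \<Longrightarrow> ar C (f i) (ob X i) (ob Y i)"
    and "\<And>i. i \<le> n \<Longrightarrow> f i \<cdot> df X (Suc i) = df Y (Suc i) \<cdot> f (Suc i)"
  shows "chain_map C n X Y f"
  using assms unfolding chain_map_def by (blast intro: Ar_homs)

lemma chain_mapD:
  assumes "chain_map C n X Y f" "n_exact C n X" "n_exact C n Y"
  shows "i \<le> Suc n \<Longrightarrow> ar C (f i) (ob X i) (ob Y i)"
    and "i \<le> n \<Longrightarrow> f i \<cdot> df X (Suc i) = df Y (Suc i) \<cdot> f (Suc i)"
proof -
  assume i: "i \<le> Suc n"
  then have "f i \<in> homs C (ob X i) (ob Y i)" using assms(1) unfolding chain_map_def by blast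
  then show "ar C (f i) (ob X i) (ob Y i)" using n_exactD(2)[OF assms(2) i] n_exactD(2)[OF assms(3) i]
    by (simp add: homs_iff)
qed (use assms(1) in \<open>simp add: chain_map_def\<close>)

text \<open>The generator is transported along \<open>f 0\<close>. In degree 0 the homotopies say
  that g f and f g are identities up to morphisms factoring through the last differential, that is,
  up to relations; only degrees 0 and 1 of the two chain maps enter.\<close>

lemma homotopy_equiv_presents:
  assumes e: "homotopy_equiv C n X Y" and X: "n_exact C n X" and Y: "n_exact C n Y"
    and p: "presents C (df Y (Suc 0)) y F"
  shows "\<exists>x. presents C (df X (Suc 0)) x F"
proof -
  obtain f g where fg: "chain_map C n X Y f" "chain_map C n Y X g"
    and hX: "homotopic C n X X (\<lambda>i. g i \<cdot> f i) (\<lambda>i. Idn C (ob X i))"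
    and hY: "homotopic C n Y Y (\<lambda>i. f i \<cdot> g i) (\<lambda>i. Idn C (ob Y i))"
    using e unfolding homotopy_equiv_def by blast
  note fD = chain_mapD[OF fg(1) X Y] and gD = chain_mapD[OF fg(2) Y X]
  have [simp]: "ob X 0 \<in> Obj C" "ob X (Suc 0) \<in> Obj C" "ob Y 0 \<in> Obj C" "ob Y (Suc 0) \<in> Obj C"
    using n_exactD(2)[OF X] n_exactD(2)[OF Y] by simp_all
  obtain s where s: "ar C s (ob X 0) (ob X (Suc 0))" "g 0 \<cdot> f 0 = Idn C (ob X 0) \<boxplus> df X (Suc 0) \<cdot> s"
    using homotopic_zeroE[OF hX] by auto
  obtain t where t: "ar C t (ob Y 0) (ob Y (Suc 0))" "f 0 \<cdot> g 0 = Idn C (ob Y 0) \<boxplus> df Y (Suc 0) \<cdot> t"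
    using homotopic_zeroE[OF hY] by auto
  note [simp] = n_exactD(1)[OF X le0] n_exactD(1)[OF Y le0] fD(1)[of 0, simplified] gD(1)[of 0, simplified]
    fD(1)[of "Suc 0", simplified] gD(1)[of "Suc 0", simplified]
  have gY: "gen C F (ob Y 0) y" using presents_gen[OF p] by simp
  note F = genD[OF gY]
  let ?x = "Act F (f 0) y"
  have x: "Act F h ?x = Act F (f 0 \<cdot> h) y" if "ar C h Z (ob X 0)" for h Z using that F by (simp add: Act_cmp)
  have k: "Act F (df Y (Suc 0) \<cdot> k) y = \<one>\<^bsub>Val F Z\<^esub>" if "ar C k Z (ob Y (Suc 0))" for k Z
    using presents_cmp[OF p, of k Z] that by simp
  have "presents C (df X (Suc 0)) ?x F" unfolding presents_def gen_def
  proof (intro conjI ballI allI impI)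
    show "?x \<in> carrier (Val F (Cod C (df X (Suc 0))))" using Act_closed[OF F(1), of "f 0" y] F by simp
    fix Z m assume Z: "Z \<in> Obj C" "m \<in> carrier (Val F Z)"
    obtain h where h: "ar C h Z (ob Y 0)" "m = Act F h y" using genE[OF gY Z(2,1)] .
    have "(f 0 \<cdot> g 0 \<cdot> h) \<boxminus> h = (h \<boxplus> df Y (Suc 0) \<cdot> t \<cdot> h) \<boxminus> h"
      using cmp_eq1[OF t(2), of h] h t by simp
    also have "\<dots> = df Y (Suc 0) \<cdot> t \<cdot> h" using h t by simp
    finally have "Act F ((f 0 \<cdot> g 0 \<cdot> h) \<boxminus> h) y = \<one>\<^bsub>Val F Z\<^esub>" using k[of "t \<cdot> h" Z] h t by simp
    then have "Act F (f 0 \<cdot> g 0 \<cdot> h) y = m" using h F by (simp add: Act_sub)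
    then have "m = Act F (g 0 \<cdot> h) ?x" using x[of "g 0 \<cdot> h" Z] h by simp
    then show "\<exists>h. ar C h Z (Cod C (df X (Suc 0))) \<and> m = Act F h ?x" using h by (intro exI[of _ "g 0 \<cdot> h"]) simp
  next
    fix h assume "Ar C h \<and> Cod C h = Cod C (df X (Suc 0))"
    then have h: "ar C h (Dom C h) (ob X 0)" by simp
    show "Act F h ?x = \<one>\<^bsub>Val F (Dom C h)\<^esub> \<longleftrightarrow> (\<exists>k. ar C k (Dom C h) (Dom C (df X (Suc 0))) \<and> h = df X (Suc 0) \<cdot> k)"
    proof
      assume "Act F h ?x = \<one>\<^bsub>Val F (Dom C h)\<^esub>"
      then obtain l where l: "ar C l (Dom C h) (ob Y (Suc 0))" "f 0 \<cdot> h = df Y (Suc 0) \<cdot> l"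
        using presentsE[OF p, of "f 0 \<cdot> h" "Dom C h"] x[OF h] h by auto
      have "h \<boxplus> df X (Suc 0) \<cdot> s \<cdot> h = g 0 \<cdot> f 0 \<cdot> h" using cmp_eq1[OF s(2), of h] h s by simp
      also have "\<dots> = (g 0 \<cdot> df Y (Suc 0)) \<cdot> l" using h l by simp
      also have "\<dots> = df X (Suc 0) \<cdot> g (Suc 0) \<cdot> l" using gD(2)[of 0] l by simp
      finally have e: "h \<boxplus> df X (Suc 0) \<cdot> s \<cdot> h = df X (Suc 0) \<cdot> g (Suc 0) \<cdot> l" .
      have "h = (h \<boxplus> df X (Suc 0) \<cdot> s \<cdot> h) \<boxminus> df X (Suc 0) \<cdot> s \<cdot> h" using h s by simp
      also have "\<dots> = df X (Suc 0) \<cdot> (g (Suc 0) \<cdot> l \<boxminus> s \<cdot> h)" unfolding e using h s l by simp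
      finally show "\<exists>k. ar C k (Dom C h) (Dom C (df X (Suc 0))) \<and> h = df X (Suc 0) \<cdot> k"
        using h l s by (intro exI[of _ "g (Suc 0) \<cdot> l \<boxminus> s \<cdot> h"]) simp
    next
      assume "\<exists>k. ar C k (Dom C h) (Dom C (df X (Suc 0))) \<and> h = df X (Suc 0) \<cdot> k"
      then obtain l where l: "ar C l (Dom C h) (ob X (Suc 0))" "h = df X (Suc 0) \<cdot> l" by auto
      have "f 0 \<cdot> h = (f 0 \<cdot> df X (Suc 0)) \<cdot> l" using l(1) by (simp add: l(2))
      also have "\<dots> = df Y (Suc 0) \<cdot> f (Suc 0) \<cdot> l" using fD(2)[of 0] l(1) by simp
      finally show "Act F h ?x = \<one>\<^bsub>Val F (Dom C h)\<^esub>" using x[OF h] k[of "f (Suc 0) \<cdot> l" "Dom C h"] l(1) by simp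
    qed
  qed (use F in simp_all)
  then show ?thesis by blast
qed

section \<open>Complexes in the category and resolutions by representable modules\<close>

lemma represents_gen: "represents C P X p \<Longrightarrow> gen C P X p"
  by (simp add: represents_def)

lemma represents_zr: "represents C P X p \<Longrightarrow> ar C h Y X \<Longrightarrow> Act P h p = \<one>\<^bsub>Val P Y\<^esub> \<longleftrightarrow> h = zr C Y X"
proof -
  assume P: "represents C P X p" and h: "ar C h Y X"
  note D = genD[OF represents_gen[OF P]]
  have "Act P (zr C Y X) p = \<one>\<^bsub>Val P Y\<^esub>" by (rule Act_zr) (use D h in auto)
  then show ?thesis using P h unfolding represents_def by blast
qed

lemma represents_inj: "represents C P X p \<Longrightarrow> ar C h Y X \<Longrightarrow> ar C k Y X \<Longrightarrow> Act P h p = Act P k p \<longleftrightarrow> h = k"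
proof -
  assume P: "represents C P X p" and h: "ar C h Y X" "ar C k Y X"
  have "Act P h p = Act P k p \<longleftrightarrow> Act P (h \<boxminus> k) p = \<one>\<^bsub>Val P Y\<^esub>" using h genD[OF represents_gen[OF P]] by (simp add: Act_sub)
  also have "\<dots> \<longleftrightarrow> h \<boxminus> k = zr C Y X" using represents_zr[OF P, of "h \<boxminus> k"] h by simp
  finally show ?thesis using h by (simp add: sub_eq_zr)
qed

lemma hom_from_represents:
  assumes P: "represents C P X p" and N: "cmodule C N" "y \<in> carrier (Val N X)"
  obtains \<alpha> where "nat_trans C P N \<alpha>" "\<And>h. Ar C h \<Longrightarrow> Cod C h = X \<Longrightarrow> \<alpha> (Dom C h) (Act P h p) = Act N h y"
    "\<alpha> X p = y"
proof (rule hom_from_gen[OF represents_gen[OF P] N])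
  fix h assume h: "Ar C h" "Cod C h = X" "Act P h p = \<one>\<^bsub>Val P (Dom C h)\<^esub>"
  then have "h = zr C (Dom C h) X" using represents_zr[OF P, of h "Dom C h"] by simp
  then show "Act N h y = \<one>\<^bsub>Val N (Dom C h)\<^esub>" using Act_zr[OF N(1) _ _ N(2), of "Dom C h"] h by (metis ArD)
qed (rule that)

lemma nat_trans_gen: "nat_trans C M N \<alpha> \<Longrightarrow> gen C M B x \<Longrightarrow> ar C h Y B \<Longrightarrow> \<alpha> Y (Act M h x) = Act N h (\<alpha> B x)"
  using nat_transD(3)[of M N \<alpha> h x] genD[of C M B x] by auto

text \<open>The modules \<open>P i\<close> are arbitrary representable ones, since the same complex
  has to give two resolutions: one by \<open>Rep\<close>, as \<open>in_mod\<close> requires, and one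
  by \<open>ssub\<close>, whose element type is that of projective resolutions.\<close>

lemma rres_resolution:
  assumes X: "rres C X x F" and P: "\<And>i. represents C (P i) (ob X i) (p i)"
  shows "\<exists>d \<epsilon>. resolution C P d \<epsilon> F"
proof -
  have aX: "acyc C X" and pX: "presents C (df X (Suc 0)) x F" using X by (auto simp: rres_def)
  note [simp] = acycD[OF aX] acyc_ob[OF aX]
  have Pg: "gen C (P i) (ob X i) (p i)" for i by (rule represents_gen[OF P])
  have PD: "cmodule C (P i)" "ob X i \<in> Obj C" "p i \<in> carrier (Val (P i) (ob X i))" for i using genD[OF Pg[of i]] .
  have gX: "gen C F (ob X 0) x" using presents_gen[OF pX] by simp
  note F = genD[OF gX]
  obtain \<epsilon> where \<epsilon>: "nat_trans C (P 0) F \<epsilon>" "\<epsilon> (ob X 0) (p 0) = x"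
    using hom_from_represents[OF P F(1,3)] by metis
  have "\<exists>\<delta>. nat_trans C (P (Suc i)) (P i) \<delta> \<and> \<delta> (ob X (Suc i)) (p (Suc i)) = Act (P i) (df X (Suc i)) (p i)" for i
  proof (rule hom_from_represents[OF P[of "Suc i"] PD(1)[of i]])
    show "Act (P i) (df X (Suc i)) (p i) \<in> carrier (Val (P i) (ob X (Suc i)))"
      using Act_closed[OF PD(1)[of i], of "df X (Suc i)" "p i"] PD(3)[of i] by simp
  qed blast
  then obtain d where d: "\<And>i. nat_trans C (P (Suc i)) (P i) (d i)"
     "\<And>i. d i (ob X (Suc i)) (p (Suc i)) = Act (P i) (df X (Suc i)) (p i)" by metis
  have de: "d i Y (Act (P (Suc i)) h (p (Suc i))) = Act (P i) (df X (Suc i) \<cdot> h) (p i)" if "ar C h Y (ob X (Suc i))" for i h Y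
    using nat_trans_gen[OF d(1) Pg that] that PD[of i] by (simp add: d(2) Act_cmp)
  have ee: "\<epsilon> Y (Act (P 0) h (p 0)) = Act F h x" if "ar C h Y (ob X 0)" for h Y
    using nat_trans_gen[OF \<epsilon>(1) Pg that] by (simp add: \<epsilon>(2))
  have Pc: "Act (P i) h (p i) \<in> carrier (Val (P i) Y)" if "ar C h Y (ob X i)" for h Y i
    using Act_closed[OF PD(1)[of i], of h "p i"] that PD(3)[of i] by auto
  have "resolution C P d \<epsilon> F" unfolding resolution_def
  proof (intro conjI allI ballI)
    fix Y assume Y: "Y \<in> Obj C"
    show "\<epsilon> Y ` carrier (Val (P 0) Y) = carrier (Val F Y)"
    proof (intro equalityI subsetI)
      fix m assume m: "m \<in> carrier (Val F Y)"
      obtain h where h: "ar C h Y (ob X 0)" "m = Act F h x" using genE[OF gX m Y] .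
      then show "m \<in> \<epsilon> Y ` carrier (Val (P 0) Y)" using rev_image_eqI[OF Pc[OF h(1)]] ee[OF h(1)] h(2) by metis
    qed (use nat_transD(2)[OF \<epsilon>(1) Y] in blast)
    show "exact_at (Val (P 1) Y) (Val (P 0) Y) (Val F Y) (d 0 Y) (\<epsilon> Y)" unfolding exact_at_def kernel_def One_nat_def
    proof (intro equalityI subsetI)
      fix m assume "m \<in> d 0 Y ` carrier (Val (P (Suc 0)) Y)"
      then obtain m' where m': "m' \<in> carrier (Val (P (Suc 0)) Y)" "m = d 0 Y m'" by blast
      obtain h where h: "ar C h Y (ob X (Suc 0))" "m' = Act (P (Suc 0)) h (p (Suc 0))" using genE[OF Pg m'(1) Y] .
      have m: "m = Act (P 0) (df X (Suc 0) \<cdot> h) (p 0)" using h m' de by simp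
      have "\<epsilon> Y m = Act F (df X (Suc 0) \<cdot> h) x" unfolding m by (rule ee) (use h in simp)
      also have "\<dots> = \<one>\<^bsub>Val F Y\<^esub>" using presents_cmp[OF pX, of h Y] h by simp
      finally show "m \<in> {m \<in> carrier (Val (P 0) Y). \<epsilon> Y m = \<one>\<^bsub>Val F Y\<^esub>}" using Pc[of "df X (Suc 0) \<cdot> h" Y 0] h m by simp
    next
      fix m assume "m \<in> {m \<in> carrier (Val (P 0) Y). \<epsilon> Y m = \<one>\<^bsub>Val F Y\<^esub>}"
      then have m: "m \<in> carrier (Val (P 0) Y)" "\<epsilon> Y m = \<one>\<^bsub>Val F Y\<^esub>" by auto
      obtain h where h: "ar C h Y (ob X 0)" "m = Act (P 0) h (p 0)" using genE[OF Pg m(1) Y] .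
      then have "Act F h x = \<one>\<^bsub>Val F Y\<^esub>" using m ee by simp
      then obtain k where k: "ar C k Y (ob X (Suc 0))" "h = df X (Suc 0) \<cdot> k" using presentsE[OF pX, of h Y] h by auto
      then show "m \<in> d 0 Y ` carrier (Val (P (Suc 0)) Y)" using rev_image_eqI[OF Pc[OF k(1)]] de[OF k(1)] h(2) k(2) by metis
    qed
    fix i
    show "exact_at (Val (P (Suc (Suc i))) Y) (Val (P (Suc i)) Y) (Val (P i) Y) (d (Suc i) Y) (d i Y)"
      unfolding exact_at_def kernel_def
    proof (intro equalityI subsetI)
      fix m assume "m \<in> d (Suc i) Y ` carrier (Val (P (Suc (Suc i))) Y)"
      then obtain m' where m': "m' \<in> carrier (Val (P (Suc (Suc i))) Y)" "m = d (Suc i) Y m'" by blast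
      obtain h where h: "ar C h Y (ob X (Suc (Suc i)))" "m' = Act (P (Suc (Suc i))) h (p (Suc (Suc i)))" using genE[OF Pg m'(1) Y] .
      have m: "m = Act (P (Suc i)) (df X (Suc (Suc i)) \<cdot> h) (p (Suc i))" using h m' de by simp
      have "d i Y m = Act (P i) (df X (Suc i) \<cdot> df X (Suc (Suc i)) \<cdot> h) (p i)" unfolding m by (rule de) (use h in simp)
      also have "\<dots> = \<one>\<^bsub>Val (P i) Y\<^esub>" using h acyc_dd[OF aX, of h i] PD[of i] Y by (simp add: Act_zr)
      finally show "m \<in> {m \<in> carrier (Val (P (Suc i)) Y). d i Y m = \<one>\<^bsub>Val (P i) Y\<^esub>}"
        using Pc[of "df X (Suc (Suc i)) \<cdot> h" Y "Suc i"] h m by simp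
    next
      fix m assume "m \<in> {m \<in> carrier (Val (P (Suc i)) Y). d i Y m = \<one>\<^bsub>Val (P i) Y\<^esub>}"
      then have m: "m \<in> carrier (Val (P (Suc i)) Y)" "d i Y m = \<one>\<^bsub>Val (P i) Y\<^esub>" by auto
      obtain h where h: "ar C h Y (ob X (Suc i))" "m = Act (P (Suc i)) h (p (Suc i))" using genE[OF Pg m(1) Y] .
      then have "Act (P i) (df X (Suc i) \<cdot> h) (p i) = \<one>\<^bsub>Val (P i) Y\<^esub>" using m de by simp
      then have "df X (Suc i) \<cdot> h = zr C Y (ob X i)" using represents_zr[OF P[of i], of "df X (Suc i) \<cdot> h" Y] h by simp
      then obtain k where k: "ar C k Y (ob X (Suc (Suc i)))" "h = df X (Suc (Suc i)) \<cdot> k" using acycE[OF aX h(1)] by metis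
      then show "m \<in> d (Suc i) Y ` carrier (Val (P (Suc (Suc i))) Y)" using rev_image_eqI[OF Pc[OF k(1)]] de[OF k(1)] h(2) k(2) by metis
    qed
  qed (simp_all add: d(1) \<epsilon>(1))
  then show ?thesis by blast
qed

lemma rres_in_mod:
  assumes X: "rres C X x F"
  shows "in_mod C F"
proof -
  have aX: "acyc C X" and F: "cmodule C F"
    using X genD(1)[OF presents_gen] by (auto simp: rres_def)
  obtain d \<epsilon> where "resolution C (\<lambda>i. Rep C (ob X i)) d \<epsilon> F"
    using rres_resolution[OF X represents_Rep[OF acyc_ob[OF aX]]] by blast
  then show ?thesis unfolding in_mod_def
    by (intro conjI F exI[of _ "ob X"] exI[of _ d] exI[of _ \<epsilon>] allI acyc_ob[OF aX])
qed

text \<open>By the Yoneda lemma each d_i is determined by where it sends the universal element of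
  \<open>P (Suc i)\<close>, and that value is the action of a morphism, which becomes the
  differential. The last conjunct keeps this correspondence because the computation of Ext needs
  it.\<close>

lemma resolution_rres:
  assumes R: "resolution C P d \<epsilon> F" and P: "\<And>i. represents C (P i) (Y i) (p i)" and F: "cmodule C F"
  shows "\<exists>X x. rres C X x F \<and> ob X = Y \<and> (\<forall>i. d i (Y (Suc i)) (p (Suc i)) = Act (P i) (df X (Suc i)) (p i))"
proof -
  have Pg: "gen C (P i) (Y i) (p i)" for i by (rule represents_gen[OF P])
  have PD: "cmodule C (P i)" "Y i \<in> Obj C" "p i \<in> carrier (Val (P i) (Y i))" for i using genD[OF Pg[of i]] .
  have dn: "nat_trans C (P (Suc i)) (P i) (d i)" for i using R unfolding resolution_def by blast
  have en: "nat_trans C (P 0) F \<epsilon>" using R unfolding resolution_def by blast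
  have "\<exists>D. ar C D (Y (Suc i)) (Y i) \<and> d i (Y (Suc i)) (p (Suc i)) = Act (P i) D (p i)" for i
    by (rule genE[OF Pg[of i] nat_transD(2)[OF dn PD(2)[of "Suc i"] PD(3)[of "Suc i"]] PD(2)[of "Suc i"]]) blast
  then obtain D where D: "\<And>i. ar C (D i) (Y (Suc i)) (Y i)" "\<And>i. d i (Y (Suc i)) (p (Suc i)) = Act (P i) (D i) (p i)"
    by metis
  \<comment> \<open>The differential from degree i + 1 to degree i is \<open>D i\<close> and is
    stored at index i + 1; index 0 carries no meaning.\<close>
  define X where "X = \<lparr>ob = Y, df = (\<lambda>i. D (i - 1))\<rparr>"
  have [simp]: "ob X = Y" "df X (Suc i) = D i" for i by (auto simp: X_def)
  note [simp] = D(1) PD(2)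
  have de: "d i T (Act (P (Suc i)) h (p (Suc i))) = Act (P i) (D i \<cdot> h) (p i)" if "ar C h T (Y (Suc i))" for i h T
    using nat_trans_gen[OF dn Pg that] that PD[of i] by (simp add: D(2) Act_cmp)
  have ee: "\<epsilon> T (Act (P 0) h (p 0)) = Act F h (\<epsilon> (Y 0) (p 0))" if "ar C h T (Y 0)" for h T
    using nat_trans_gen[OF en Pg that] .
  have Pc: "Act (P i) h (p i) \<in> carrier (Val (P i) T)" if "ar C h T (Y i)" for h T i
    using Act_closed[OF PD(1)[of i], of h "p i"] that PD(3)[of i] by auto
  have ex0: "\<epsilon> T ` carrier (Val (P 0) T) = carrier (Val F T)"
    "d 0 T ` carrier (Val (P (Suc 0)) T) = {m \<in> carrier (Val (P 0) T). \<epsilon> T m = \<one>\<^bsub>Val F T\<^esub>}"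
    "d (Suc i) T ` carrier (Val (P (Suc (Suc i))) T) = {m \<in> carrier (Val (P (Suc i)) T). d i T m = \<one>\<^bsub>Val (P i) T\<^esub>}"
    if "T \<in> Obj C" for T i
    using R that unfolding resolution_def exact_at_def kernel_def One_nat_def by blast+
  have "acyc C X" unfolding acyc_def
  proof (intro conjI allI impI)
    fix i
    have "d (Suc i) (Y (Suc (Suc i))) (p (Suc (Suc i))) \<in> d (Suc i) (Y (Suc (Suc i))) ` carrier (Val (P (Suc (Suc i))) (Y (Suc (Suc i))))"
      using PD(3) by blast
    then have "d i (Y (Suc (Suc i))) (Act (P (Suc i)) (D (Suc i)) (p (Suc i))) = \<one>\<^bsub>Val (P i) (Y (Suc (Suc i)))\<^esub>"
      unfolding ex0(3)[OF PD(2)] by (simp add: D(2))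
    then have "Act (P i) (D i \<cdot> D (Suc i)) (p i) = \<one>\<^bsub>Val (P i) (Y (Suc (Suc i)))\<^esub>" by (simp add: de)
    then show "df X (Suc i) \<cdot> df X (Suc (Suc i)) = zr C (ob X (Suc (Suc i))) (ob X i)"
      using represents_zr[OF P[of i], of "D i \<cdot> D (Suc i)" "Y (Suc (Suc i))"] by simp
    fix h assume h: "Ar C h \<and> Cod C h = ob X (Suc i) \<and> df X (Suc i) \<cdot> h = zr C (Dom C h) (ob X i)"
    then have "d i (Dom C h) (Act (P (Suc i)) h (p (Suc i))) = \<one>\<^bsub>Val (P i) (Dom C h)\<^esub>"
      using PD[of i] de[of h "Dom C h" i] by (simp add: Act_zr)
    then have "Act (P (Suc i)) h (p (Suc i)) \<in> d (Suc i) (Dom C h) ` carrier (Val (P (Suc (Suc i))) (Dom C h))"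
      using ex0(3)[of "Dom C h" i] h Pc[of h "Dom C h" "Suc i"] by simp
    then obtain m where m: "m \<in> carrier (Val (P (Suc (Suc i))) (Dom C h))" "Act (P (Suc i)) h (p (Suc i)) = d (Suc i) (Dom C h) m" by blast
    obtain k where k: "ar C k (Dom C h) (Y (Suc (Suc i)))" "m = Act (P (Suc (Suc i))) k (p (Suc (Suc i)))"
      by (rule genE[OF Pg m(1) ArD(1)[OF conjunct1[OF h]]])
    have "Act (P (Suc i)) h (p (Suc i)) = Act (P (Suc i)) (D (Suc i) \<cdot> k) (p (Suc i))" using m k de by simp
    moreover have "ar C (D (Suc i) \<cdot> k) (Dom C h) (Y (Suc i))" "ar C h (Dom C h) (Y (Suc i))" using k(1) h by simp_all
    ultimately have "h = D (Suc i) \<cdot> k" using represents_inj[OF P[of "Suc i"]] by blast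
    then show "\<exists>k. ar C k (Dom C h) (ob X (Suc (Suc i))) \<and> h = df X (Suc (Suc i)) \<cdot> k"
      by (intro exI[of _ k] conjI) (simp_all only: k \<open>ob X = Y\<close> \<open>\<And>i. df X (Suc i) = D i\<close>)
  qed simp_all
  moreover have "presents C (df X (Suc 0)) (\<epsilon> (Y 0) (p 0)) F" unfolding presents_def gen_def
  proof (intro conjI allI impI ballI)
    show "\<epsilon> (Y 0) (p 0) \<in> carrier (Val F (Cod C (df X (Suc 0))))" using nat_transD(2)[OF en PD(2) PD(3)] by simp
    fix T m assume T: "T \<in> Obj C" "m \<in> carrier (Val F T)"
    then obtain m' where m': "m' \<in> carrier (Val (P 0) T)" "m = \<epsilon> T m'" using ex0(1)[OF T(1)] by blast
    obtain h where "ar C h T (Y 0)" "m' = Act (P 0) h (p 0)" using genE[OF Pg m'(1) T(1)] .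
    then show "\<exists>h. ar C h T (Cod C (df X (Suc 0))) \<and> m = Act F h (\<epsilon> (Y 0) (p 0))" using m' ee by auto
  next
    fix h assume h: "Ar C h \<and> Cod C h = Cod C (df X (Suc 0))"
    then have c: "Act (P 0) h (p 0) \<in> carrier (Val (P 0) (Dom C h))" using Pc by simp
    show "Act F h (\<epsilon> (Y 0) (p 0)) = \<one>\<^bsub>Val F (Dom C h)\<^esub> \<longleftrightarrow> (\<exists>k. ar C k (Dom C h) (Dom C (df X (Suc 0))) \<and> h = df X (Suc 0) \<cdot> k)"
    proof
      assume "Act F h (\<epsilon> (Y 0) (p 0)) = \<one>\<^bsub>Val F (Dom C h)\<^esub>"
      then have "Act (P 0) h (p 0) \<in> d 0 (Dom C h) ` carrier (Val (P (Suc 0)) (Dom C h))"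
        using ex0(2)[of "Dom C h"] c ee[of h "Dom C h"] h by simp
      then obtain m where m: "m \<in> carrier (Val (P (Suc 0)) (Dom C h))" "Act (P 0) h (p 0) = d 0 (Dom C h) m" by blast
      obtain k where k: "ar C k (Dom C h) (Y (Suc 0))" "m = Act (P (Suc 0)) k (p (Suc 0))"
        by (rule genE[OF Pg m(1) ArD(1)[OF conjunct1[OF h]]])
      have "Act (P 0) h (p 0) = Act (P 0) (D 0 \<cdot> k) (p 0)" using m k de by simp
      moreover have "ar C (D 0 \<cdot> k) (Dom C h) (Y 0)" "ar C h (Dom C h) (Y 0)" using k(1) h by simp_all
      ultimately have "h = D 0 \<cdot> k" using represents_inj[OF P[of 0]] by blast
      then show "\<exists>k. ar C k (Dom C h) (Dom C (df X (Suc 0))) \<and> h = df X (Suc 0) \<cdot> k"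
        by (intro exI[of _ k] conjI) (simp_all only: k D(1) \<open>\<And>i. df X (Suc i) = D i\<close>)
    next
      assume "\<exists>k. ar C k (Dom C h) (Dom C (df X (Suc 0))) \<and> h = df X (Suc 0) \<cdot> k"
      then obtain k where k: "ar C k (Dom C h) (Y (Suc 0))" "h = D 0 \<cdot> k" by auto
      then have "Act (P 0) h (p 0) = d 0 (Dom C h) (Act (P (Suc 0)) k (p (Suc 0)))" using de[OF k(1)] by metis
      then have "Act (P 0) h (p 0) \<in> d 0 (Dom C h) ` carrier (Val (P (Suc 0)) (Dom C h))" using Pc[OF k(1)] by simp
      then show "Act F h (\<epsilon> (Y 0) (p 0)) = \<one>\<^bsub>Val F (Dom C h)\<^esub>"
        using ex0(2)[of "Dom C h"] ee[of h "Dom C h"] h by simp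
    qed
  qed (use F in simp_all)
  ultimately show ?thesis using D(2) unfolding rres_def by (intro exI[of _ X] exI[of _ "\<epsilon> (Y 0) (p 0)"]) simp
qed

lemma in_mod_rres:
  assumes "in_mod C F"
  obtains X x where "rres C X x F"
proof -
  obtain Y d \<epsilon> where F: "cmodule C F" and o: "\<And>i. Y i \<in> Obj C" and R: "resolution C (\<lambda>i. Rep C (Y i)) d \<epsilon> F"
    using assms unfolding in_mod_def by auto
  show ?thesis using resolution_rres[OF R represents_Rep[OF o] F] that by (elim exE conjE)
qed

lemma in_mod_cmodule: "in_mod C F \<Longrightarrow> cmodule C F"
  by (simp add: in_mod_def)

end

lemma (in additive_category) op_additive: "additive_category (op_cat C)"
proof (intro additive_category.intro additive_category_axioms.intro op_preadditive)
  show "\<exists>Z. zero_object (op_cat C) Z" using has_zero by (auto simp: zero_object_def)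
  fix A B assume "A \<in> Obj (op_cat C)" "B \<in> Obj (op_cat C)"
  then obtain W i1 i2 p1 p2 where "biproduct C A B W i1 i2 p1 p2" using has_biproducts by fastforce
  then have "biproduct (op_cat C) A B W p1 p2 i1 i2" by (simp add: biproduct_def)
  then show "\<exists>W i1 i2 p1 p2. biproduct (op_cat C) A B W i1 i2 p1 p2" by blast
qed

lemma (in idempotent_complete_additive_category) op_idempotent_complete:
  "idempotent_complete_additive_category (op_cat C)"
proof (intro idempotent_complete_additive_category.intro idempotent_complete_additive_category_axioms.intro op_additive)
  fix X e assume "X \<in> Obj (op_cat C)" "e \<in> homs (op_cat C) X X" "Comp (op_cat C) e e = e"
  then show "\<exists>Y\<in>Obj (op_cat C). \<exists>r\<in>homs (op_cat C) X Y. \<exists>s\<in>homs (op_cat C) Y X. Comp (op_cat C) s r = e \<and> Comp (op_cat C) r s = Idn (op_cat C) Y"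
    using idempotents_split[of X e] by auto
qed

context additive_category
begin

lemma n_exact_rres:
  assumes X: "n_exact C n X" and p: "presents C (df X (Suc 0)) x F"
  obtains X' where "rres C X' x F" "\<And>i. i \<le> Suc n \<Longrightarrow> ob X' i = ob X i" "\<And>i. i \<le> n \<Longrightarrow> df X' (Suc i) = df X (Suc i)"
    "\<And>i. i > Suc n \<Longrightarrow> zero_object C (ob X' i)" "\<And>i T. i \<le> n \<Longrightarrow> T \<in> Obj C \<Longrightarrow> coh C X' T i"
proof -
  obtain Z where Z: "zero_object C Z" using has_zero by blast
  note e = extend_acyc[OF X Z]
  show ?thesis using that[of "extend C n Z X"] e Z p by (simp add: rres_def)
qed

text \<open>Both sequences are padded by zero objects and compared as resolutions of the same
  module. The differential of degree n + 2 starts in a zero object, so the homotopy equation in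
  degree n + 1 loses one term and becomes the boundary case in \<open>homotopic\<close>.\<close>

lemma presents_homotopy_equiv:
  assumes X: "n_exact C n X" "presents C (df X (Suc 0)) x F" and Y: "n_exact C n Y" "presents C (df Y (Suc 0)) y F"
  shows "homotopy_equiv C n X Y"
proof -
  obtain X' where X': "rres C X' x F" and Xo: "\<And>i. i \<le> Suc n \<Longrightarrow> ob X' i = ob X i" "\<And>i. i \<le> n \<Longrightarrow> df X' (Suc i) = df X (Suc i)"
    and Xz: "\<And>i. i > Suc n \<Longrightarrow> zero_object C (ob X' i)" using n_exact_rres[OF X] by metis
  obtain Y' where Y': "rres C Y' y F" and Yo: "\<And>i. i \<le> Suc n \<Longrightarrow> ob Y' i = ob Y i" "\<And>i. i \<le> n \<Longrightarrow> df Y' (Suc i) = df Y (Suc i)"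
    and Yz: "\<And>i. i > Suc n \<Longrightarrow> zero_object C (ob Y' i)" using n_exact_rres[OF Y] by metis
  have aX: "acyc C X'" and aY: "acyc C Y'" using X' Y' by (auto simp: rres_def)
  obtain f g s t where f: "chain C X' Y' f" and g: "chain C Y' X' g"
    and s: "\<And>i. ar C (s i) (ob X' i) (ob X' (Suc i))" and t: "\<And>i. ar C (t i) (ob Y' i) (ob Y' (Suc i))"
    and s0: "g 0 \<cdot> f 0 = Idn C (ob X' 0) \<boxplus> df X' (Suc 0) \<cdot> s 0"
    and sS: "\<And>i. g (Suc i) \<cdot> f (Suc i) = Idn C (ob X' (Suc i)) \<boxplus> (df X' (Suc (Suc i)) \<cdot> s (Suc i) \<boxplus> s i \<cdot> df X' (Suc i))"
    and t0: "f 0 \<cdot> g 0 = Idn C (ob Y' 0) \<boxplus> df Y' (Suc 0) \<cdot> t 0"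
    and tS: "\<And>i. f (Suc i) \<cdot> g (Suc i) = Idn C (ob Y' (Suc i)) \<boxplus> (df Y' (Suc (Suc i)) \<cdot> t (Suc i) \<boxplus> t i \<cdot> df Y' (Suc i))"
    using comparison[OF X' Y'] by metis
  note fD = chainD[OF f] and gD = chainD[OF g]
  have zX: "df X' (Suc (Suc n)) = zr C (ob X' (Suc (Suc n))) (ob X' (Suc n))"
    using zero_objectD(2)[OF Xz, of "Suc (Suc n)" "df X' (Suc (Suc n))"] acycD[OF aX] by simp
  have zY: "df Y' (Suc (Suc n)) = zr C (ob Y' (Suc (Suc n))) (ob Y' (Suc n))"
    using zero_objectD(2)[OF Yz, of "Suc (Suc n)" "df Y' (Suc (Suc n))"] acycD[OF aY] by simp
  have sn: "g (Suc n) \<cdot> f (Suc n) = Idn C (ob X' (Suc n)) \<boxplus> s n \<cdot> df X' (Suc n)"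
    using sS[of n] zX s[of "Suc n"] s[of n] acycD[OF aX, of n] acyc_ob[OF aX] by simp
  have tn: "f (Suc n) \<cdot> g (Suc n) = Idn C (ob Y' (Suc n)) \<boxplus> t n \<cdot> df Y' (Suc n)"
    using tS[of n] zY t[of "Suc n"] t[of n] acycD[OF aY, of n] acyc_ob[OF aY] by simp
  have 1: "chain_map C n X Y f"
    by (rule chain_mapI) (use fD Xo Yo in \<open>auto simp flip: Xo(2) Yo(2)\<close>)
  have 2: "chain_map C n Y X g"
    by (rule chain_mapI) (use gD Xo Yo in \<open>auto simp flip: Xo(2) Yo(2)\<close>)
  have 3: "homotopic C n X X (\<lambda>i. g i \<cdot> f i) (\<lambda>i. Idn C (ob X i))"
  proof (rule homotopicI[where h = s])
    fix i assume "i < n" then show "g (Suc i) \<cdot> f (Suc i) = Idn C (ob X (Suc i)) \<boxplus> (df X (Suc (Suc i)) \<cdot> s (Suc i) \<boxplus> s i \<cdot> df X (Suc i))"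
      using sS[of i] Xo(1)[of "Suc i"] Xo(2)[of i] Xo(2)[of "Suc i"] by simp
  qed (use s0 s sn n_exactD(1,2)[OF X(1)] in \<open>simp_all add: Xo(1)[symmetric] Xo(2)[symmetric] del: Xo\<close>)
  have 4: "homotopic C n Y Y (\<lambda>i. f i \<cdot> g i) (\<lambda>i. Idn C (ob Y i))"
  proof (rule homotopicI[where h = t])
    fix i assume "i < n" then show "f (Suc i) \<cdot> g (Suc i) = Idn C (ob Y (Suc i)) \<boxplus> (df Y (Suc (Suc i)) \<cdot> t (Suc i) \<boxplus> t i \<cdot> df Y (Suc i))"
      using tS[of i] Yo(1)[of "Suc i"] Yo(2)[of i] Yo(2)[of "Suc i"] by simp
  qed (use t0 t tn n_exactD(1,2)[OF Y(1)] in \<open>simp_all add: Yo(1)[symmetric] Yo(2)[symmetric] del: Yo\<close>)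
  show ?thesis unfolding homotopy_equiv_def using 1 2 3 4 by blast
qed

end

section \<open>Projective modules, projective dimension and Ext\<close>

text \<open>The subfunctor of \<open>C(-, X)\<close> cut out by \<open>S\<close>; a morphism \<open>h\<close> is encoded as \<open>{h}\<close> because the objects
  of \<open>mod C\<close> have elements of type \<open>'m set\<close>.\<close>

definition ssub :: "('o, 'm) cat \<Rightarrow> 'o \<Rightarrow> ('m \<Rightarrow> bool) \<Rightarrow> ('o, 'm, 'm set) cmod" where
  "ssub C X S = \<lparr>Val = (\<lambda>Y. \<lparr>carrier = {{h} | h. ar C h Y X \<and> S h},
      mult = (\<lambda>A B. {add C (the_elem A) (the_elem B)}), one = {zr C Y X}\<rparr>),
    Act = (\<lambda>f A. {Comp C (the_elem A) f})\<rparr>"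

definition tail :: "('o, 'm) cpx \<Rightarrow> ('o, 'm) cpx" where
  "tail X = \<lparr>ob = (\<lambda>i. ob X (Suc i)), df = (\<lambda>i. df X (Suc i))\<rparr>"

lemma tail_simps [simp]: "ob (tail X) i = ob X (Suc i)" "df (tail X) i = df X (Suc i)"
  by (auto simp: tail_def)

lemma tail_acyc: "acyc C X \<Longrightarrow> acyc C (tail X)"
  unfolding acyc_def tail_simps by blast

text \<open>Members of \<open>Nat_grp\<close> have to be undefined outside their domains; this turns
  any natural transformation into such a normalised one.\<close>

definition rst :: "('o, 'm) cat \<Rightarrow> ('o, 'm, 'a) cmod \<Rightarrow> ('o \<Rightarrow> 'a \<Rightarrow> 'b) \<Rightarrow> ('o \<Rightarrow> 'a \<Rightarrow> 'b)" where
  "rst C M \<alpha> = (\<lambda>X\<in>Obj C. \<lambda>x\<in>carrier (Val M X). \<alpha> X x)"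

lemma rst_apply [simp]: "X \<in> Obj C \<Longrightarrow> x \<in> carrier (Val M X) \<Longrightarrow> rst C M \<alpha> X x = \<alpha> X x"
  by (simp add: rst_def)

lemma Nat_grp_mult: "\<alpha> \<otimes>\<^bsub>Nat_grp C M N\<^esub> \<beta> = rst C M (\<lambda>X x. \<alpha> X x \<otimes>\<^bsub>Val N X\<^esub> \<beta> X x)"
  by (simp add: Nat_grp_def rst_def)

lemma Nat_grp_one: "\<one>\<^bsub>Nat_grp C M N\<^esub> = rst C M (\<lambda>X x. \<one>\<^bsub>Val N X\<^esub>)"
  by (simp add: Nat_grp_def rst_def)

lemma precomp_rst: "precomp C M d \<phi> = rst C M (\<lambda>X x. \<phi> X (d X x))"
  by (simp add: precomp_def rst_def)

lemma Nat_grpD: "\<alpha> \<in> carrier (Nat_grp C M N) \<Longrightarrow> nat_trans C M N \<alpha>"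
  by (simp add: Nat_grp_def)

lemma Nat_grp_eqI:
  assumes "\<alpha> \<in> carrier (Nat_grp C M N)" "\<beta> \<in> carrier (Nat_grp C M N)"
    "\<And>X x. X \<in> Obj C \<Longrightarrow> x \<in> carrier (Val M X) \<Longrightarrow> \<alpha> X x = \<beta> X x"
  shows "\<alpha> = \<beta>"
proof (rule extensionalityI[of _ "Obj C"])
  show "\<alpha> \<in> extensional (Obj C)" "\<beta> \<in> extensional (Obj C)" using assms(1,2) by (auto simp: Nat_grp_def)
  fix X assume X: "X \<in> Obj C"
  then have "\<alpha> X \<in> extensional (carrier (Val M X))" "\<beta> X \<in> extensional (carrier (Val M X))"
    using assms(1,2) by (auto simp: Nat_grp_def)
  then show "\<alpha> X = \<beta> X" by (rule extensionalityI) (use assms(3) X in blast)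
qed

lemma subgroup_quotient_trivial:
  assumes "comm_group G" "subgroup K G" "subgroup N G" "N \<subseteq> K"
  shows "trivial_group (G\<lparr>carrier := K\<rparr> Mod N) \<longleftrightarrow> K \<subseteq> N"
proof -
  interpret G: comm_group G by fact
  interpret K: comm_group "G\<lparr>carrier := K\<rparr>"
    using subgroup.subgroup_is_group[OF assms(2) G.is_group] G.m_comm subgroup.subset[OF assms(2)]
    by (intro group.group_comm_groupI) auto
  have N: "subgroup N (G\<lparr>carrier := K\<rparr>)"
    by (rule G.subgroup_incl[OF assms(3,2,4)])
  have g: "group (G\<lparr>carrier := K\<rparr> Mod N)"
    by (rule comm_group.axioms(2)[OF K.abelian_FactGroup[OF N]])
  have c: "carrier (G\<lparr>carrier := K\<rparr> Mod N) = (\<lambda>a. N #>\<^bsub>G\<lparr>carrier := K\<rparr>\<^esub> a) ` K"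
    by (auto simp: FactGroup_def RCOSETS_def)
  have o: "\<one>\<^bsub>G\<lparr>carrier := K\<rparr> Mod N\<^esub> = N" by (simp add: FactGroup_def)
  have a: "N #>\<^bsub>G\<lparr>carrier := K\<rparr>\<^esub> a = N \<longleftrightarrow> a \<in> N" if "a \<in> K" for a
    using K.coset_join1[OF _ _ N, of a] K.coset_join2[OF _ N, of a] subgroup.subset[OF N] that by auto
  show ?thesis unfolding group.trivial_group_subset[OF g] c o using a by auto
qed

context preadditive_category
begin

lemma trivial_HomI:
  assumes "X \<in> Obj C" "Y \<in> Obj C" "\<And>h. ar C h X Y \<Longrightarrow> h = zr C X Y"
  shows "trivial_group (Hom C X Y)"
proof -
  interpret comm_group "Hom C X Y" using assms by (simp add: Hom_group)
  show ?thesis unfolding trivial_group_subset using assms by (auto simp: homs_iff zr_def)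
qed

lemma zero_objectI: "X \<in> Obj C \<Longrightarrow> Idn C X = zr C X X \<Longrightarrow> zero_object C X"
  unfolding zero_object_def
proof (intro conjI ballI)
  assume X: "X \<in> Obj C" "Idn C X = zr C X X"
  fix Y assume Y: "Y \<in> Obj C"
  show "trivial_group (Hom C Y X)"
  proof (rule trivial_HomI[OF Y X(1)])
    fix h assume h: "ar C h Y X"
    then have "h = Idn C X \<cdot> h" by simp
    also have "\<dots> = zr C Y X" unfolding X(2) using h X by simp
    finally show "h = zr C Y X" .
  qed
  show "trivial_group (Hom C X Y)"
  proof (rule trivial_HomI[OF X(1) Y])
    fix h assume h: "ar C h X Y"
    then have "h = h \<cdot> Idn C X" by simp
    also have "\<dots> = zr C X Y" unfolding X(2) using h X by simp
    finally show "h = zr C X Y" .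
  qed
qed

lemma ssub_simps [simp]:
  "carrier (Val (ssub C X S) Y) = {{h} | h. ar C h Y X \<and> S h}"
  "\<one>\<^bsub>Val (ssub C X S) Y\<^esub> = {zr C Y X}"
  "{h} \<otimes>\<^bsub>Val (ssub C X S) Y\<^esub> {k} = {h \<boxplus> k}"
  "Act (ssub C X S) f {h} = {h \<cdot> f}"
  by (auto simp: ssub_def)

lemma cmodule_ssub:
  assumes X: "X \<in> Obj C" and z: "\<And>Y. Y \<in> Obj C \<Longrightarrow> S (zr C Y X)"
    and a: "\<And>h k Y. ar C h Y X \<Longrightarrow> ar C k Y X \<Longrightarrow> S h \<Longrightarrow> S k \<Longrightarrow> S (h \<boxplus> k)"
    and n: "\<And>h Y. ar C h Y X \<Longrightarrow> S h \<Longrightarrow> S (neg C h)"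
    and c: "\<And>h f Y Z. ar C h Y X \<Longrightarrow> ar C f Z Y \<Longrightarrow> S h \<Longrightarrow> S (h \<cdot> f)"
  shows "cmodule C (ssub C X S)" (is "cmodule C ?M")
proof -
  have E: "\<exists>h. A = {h} \<and> ar C h Y X \<and> S h" if "A \<in> carrier (Val ?M Y)" for A Y using that by auto
  have cl: "{h} \<in> carrier (Val ?M Y)" if "ar C h Y X" "S h" for h Y using that by auto
  have g: "comm_group (Val ?M Y)" if Y: "Y \<in> Obj C" for Y
  proof (rule comm_groupI)
    fix A B assume "A \<in> carrier (Val ?M Y)" "B \<in> carrier (Val ?M Y)"
    then obtain h k where h: "A = {h}" "ar C h Y X" "S h" "B = {k}" "ar C k Y X" "S k" using E by meson
    show "A \<otimes>\<^bsub>Val ?M Y\<^esub> B \<in> carrier (Val ?M Y)" unfolding h ssub_simps(3)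
      by (rule cl) (use h a[of h Y k] in simp_all)
    show "A \<otimes>\<^bsub>Val ?M Y\<^esub> B = B \<otimes>\<^bsub>Val ?M Y\<^esub> A" unfolding h ssub_simps(3) using h add_comm[of h k] by simp
    fix D assume "D \<in> carrier (Val ?M Y)"
    then obtain l where l: "D = {l}" "ar C l Y X" "S l" using E by meson
    show "(A \<otimes>\<^bsub>Val ?M Y\<^esub> B) \<otimes>\<^bsub>Val ?M Y\<^esub> D = A \<otimes>\<^bsub>Val ?M Y\<^esub> (B \<otimes>\<^bsub>Val ?M Y\<^esub> D)"
      unfolding h l ssub_simps(3) using h l add_assoc[of h k l] by simp
  next
    show "\<one>\<^bsub>Val ?M Y\<^esub> \<in> carrier (Val ?M Y)" unfolding ssub_simps(2) by (rule cl) (use X Y z in simp_all)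
  next
    fix A assume "A \<in> carrier (Val ?M Y)"
    then obtain h where h: "A = {h}" "ar C h Y X" "S h" using E by meson
    show "\<one>\<^bsub>Val ?M Y\<^esub> \<otimes>\<^bsub>Val ?M Y\<^esub> A = A" unfolding h ssub_simps(2,3) using h by simp
    have "{neg C h} \<in> carrier (Val ?M Y)" by (rule cl) (use h n[of h Y] in simp_all)
    moreover have "{neg C h} \<otimes>\<^bsub>Val ?M Y\<^esub> A = \<one>\<^bsub>Val ?M Y\<^esub>"
      unfolding h ssub_simps(2,3) using h add_comm[of h "neg C h"] by simp
    ultimately show "\<exists>B\<in>carrier (Val ?M Y). B \<otimes>\<^bsub>Val ?M Y\<^esub> A = \<one>\<^bsub>Val ?M Y\<^esub>" by blast
  qed
  show ?thesis unfolding cmodule_def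
  proof (intro conjI ballI)
    fix Y Z f assume "Y \<in> Obj C" "Z \<in> Obj C" "f \<in> homs C Y Z"
    then have f: "ar C f Y Z" by (simp add: homs_iff)
    show "Act ?M f \<in> hom (Val ?M Z) (Val ?M Y)"
    proof (rule homI)
      fix A assume "A \<in> carrier (Val ?M Z)"
      then obtain h where h: "A = {h}" "ar C h Z X" "S h" using E by meson
      show "Act ?M f A \<in> carrier (Val ?M Y)" unfolding h ssub_simps(4)
        by (rule cl) (use h f c[of h Z f Y] in simp_all)
      fix B assume "B \<in> carrier (Val ?M Z)"
      then obtain k where k: "B = {k}" "ar C k Z X" "S k" using E by meson
      show "Act ?M f (A \<otimes>\<^bsub>Val ?M Z\<^esub> B) = Act ?M f A \<otimes>\<^bsub>Val ?M Y\<^esub> Act ?M f B"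
        unfolding h k ssub_simps(3,4) using h k f by simp
    qed
    fix g A assume "g \<in> homs C Y Z" "A \<in> carrier (Val ?M Z)"
    then obtain h where h: "A = {h}" "ar C h Z X" "S h" and g: "ar C g Y Z"
      using E \<open>Y \<in> Obj C\<close> \<open>Z \<in> Obj C\<close> homs_iff by meson
    show "Act ?M (f \<otimes>\<^bsub>Hom C Y Z\<^esub> g) A = Act ?M f A \<otimes>\<^bsub>Val ?M Y\<^esub> Act ?M g A"
      unfolding h ssub_simps(3,4) mult_eq_add[OF f] using h f g by simp
  next
    fix Y A assume "Y \<in> Obj C" "A \<in> carrier (Val ?M Y)"
    then obtain h where h: "A = {h}" "ar C h Y X" "S h" using E by meson
    show "Act ?M (Idn C Y) A = A" unfolding h ssub_simps(4) using h by simp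
  next
    fix U Y Z f g A assume "U \<in> Obj C" "Y \<in> Obj C" "Z \<in> Obj C" "f \<in> homs C U Y" "g \<in> homs C Y Z" "A \<in> carrier (Val ?M Z)"
    then obtain h where h: "A = {h}" "ar C h Z X" "S h" and f: "ar C f U Y" "ar C g Y Z"
      using E homs_iff by meson
    show "Act ?M (g \<cdot> f) A = Act ?M f (Act ?M g A)" unfolding h ssub_simps(4) using h f by simp
  qed (rule g)
qed

text \<open>With the trivial condition the subfunctor is all of C(-, X): a copy of the representable
  module whose elements have type \<open>'m set\<close>.\<close>

lemma represents_ssub: "X \<in> Obj C \<Longrightarrow> represents C (ssub C X (\<lambda>_. True)) X {Idn C X}"
proof -
  assume X: "X \<in> Obj C"
  have c: "cmodule C (ssub C X (\<lambda>_. True))" by (rule cmodule_ssub[OF X]) simp_all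
  show ?thesis unfolding represents_def gen_def
  proof (intro conjI ballI allI impI)
    fix Y m assume "Y \<in> Obj C" "m \<in> carrier (Val (ssub C X (\<lambda>_. True)) Y)"
    then obtain h where h: "m = {h}" "ar C h Y X" by auto
    then have "m = Act (ssub C X (\<lambda>_. True)) h {Idn C X}" unfolding ssub_simps(4) by simp
    then show "\<exists>h. ar C h Y X \<and> m = Act (ssub C X (\<lambda>_. True)) h {Idn C X}" using h(2) by blast
  qed (use c X in auto)
qed

text \<open>The kernel of C(-, X_0) \<rightarrow> P is the subfunctor of those h that kill
  \<open>x\<close>. These are the h factoring through the first differential, which therefore
  generates the kernel, and the relations of this generator are the morphisms factoring through the
  second differential.\<close>

lemma kernel_rres:
  assumes X: "rres C X x P"
  defines "S \<equiv> \<lambda>h. Act P h x = \<one>\<^bsub>Val P (Dom C h)\<^esub>"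
  shows "rres C (tail X) {df X (Suc 0)} (ssub C (ob X 0) S)"
proof -
  have aX: "acyc C X" and pX: "presents C (df X (Suc 0)) x P" using X by (auto simp: rres_def)
  note [simp] = acycD(1-4)[OF aX] acyc_ob[OF aX]
  have gX: "gen C P (ob X 0) x" using presents_gen[OF pX] by simp
  note P = genD[OF gX]
  let ?K = "ssub C (ob X 0) S" and ?d = "df X (Suc 0)"
  have SI: "S h \<longleftrightarrow> (\<exists>k. ar C k Y (ob X (Suc 0)) \<and> h = ?d \<cdot> k)" if "ar C h Y (ob X 0)" for h Y
    using presents_iff[OF pX, of h] that unfolding S_def by auto
  have Sd: "S (?d \<cdot> k)" if "ar C k Y (ob X (Suc 0))" for k Y
    using SI[of "?d \<cdot> k" Y] that by auto
  have c: "cmodule C ?K"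
  proof (rule cmodule_ssub)
    fix Y assume "Y \<in> Obj C" then show "S (zr C Y (ob X 0))" using Sd[of "zr C Y (ob X (Suc 0))" Y] by simp
  next
    fix h k Y assume a: "ar C h Y (ob X 0)" "ar C k Y (ob X 0)" "S h" "S k"
    obtain h' where h': "ar C h' Y (ob X (Suc 0))" "h = ?d \<cdot> h'" using a SI[of h Y] by blast
    obtain k' where k': "ar C k' Y (ob X (Suc 0))" "k = ?d \<cdot> k'" using a SI[of k Y] by blast
    show "S (h \<boxplus> k)" using Sd[of "h' \<boxplus> k'" Y] h'(1) k'(1) unfolding h'(2) k'(2) by simp
  next
    fix h Y assume a: "ar C h Y (ob X 0)" "S h"
    obtain h' where h': "ar C h' Y (ob X (Suc 0))" "h = ?d \<cdot> h'" using a SI[of h Y] by blast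
    show "S (neg C h)" using Sd[of "neg C h'" Y] h'(1) unfolding h'(2) by simp
  next
    fix h f Y Z assume a: "ar C h Y (ob X 0)" "ar C f Z Y" "S h"
    obtain h' where h': "ar C h' Y (ob X (Suc 0))" "h = ?d \<cdot> h'" using a SI[of h Y] by blast
    show "S (h \<cdot> f)" using Sd[of "h' \<cdot> f" Z] h'(1) a(2) unfolding h'(2) by simp
  qed simp
  have "presents C (df X (Suc (Suc 0))) {?d} ?K" unfolding presents_def gen_def
  proof (intro conjI ballI allI impI)
    show "{?d} \<in> carrier (Val ?K (Cod C (df X (Suc (Suc 0)))))" using Sd[of "Idn C (ob X (Suc 0))"] by simp
    fix Y m assume "Y \<in> Obj C" "m \<in> carrier (Val ?K Y)"
    then obtain h where h: "m = {h}" "ar C h Y (ob X 0)" "S h" by auto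
    obtain h' where h': "ar C h' Y (ob X (Suc 0))" "h = ?d \<cdot> h'" using h SI[of h Y] by blast
    have "m = Act ?K h' {?d}" unfolding ssub_simps(4) h(1) h'(2) ..
    then show "\<exists>h. ar C h Y (Cod C (df X (Suc (Suc 0)))) \<and> m = Act ?K h {?d}" using h'(1) by (intro exI[of _ h']) simp
  next
    fix h assume h: "Ar C h \<and> Cod C h = Cod C (df X (Suc (Suc 0)))"
    define Y where "Y = Dom C h"
    have hY: "ar C h Y (ob X (Suc 0))" using h by (simp add: Y_def)
    have "Act ?K h {?d} = \<one>\<^bsub>Val ?K (Dom C h)\<^esub> \<longleftrightarrow> ?d \<cdot> h = zr C Y (ob X 0)"
      unfolding ssub_simps Y_def by simp
    also have "\<dots> \<longleftrightarrow> (\<exists>k. ar C k Y (ob X (Suc (Suc 0))) \<and> h = df X (Suc (Suc 0)) \<cdot> k)" (is "?l \<longleftrightarrow> ?r")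
    proof
      assume ?l then show ?r using acycE[OF aX hY] by metis
    next
      assume ?r
      then obtain k where k: "ar C k Y (ob X (Suc (Suc 0)))" "h = df X (Suc (Suc 0)) \<cdot> k" by blast
      show ?l unfolding k(2) using acyc_dd[OF aX, of k 0] k(1) by simp
    qed
    finally show "Act ?K h {?d} = \<one>\<^bsub>Val ?K (Dom C h)\<^esub> \<longleftrightarrow>
      (\<exists>k. ar C k (Dom C h) (Dom C (df X (Suc (Suc 0)))) \<and> h = df X (Suc (Suc 0)) \<cdot> k)" unfolding Y_def by simp
  qed (use c in simp_all)
  then show ?thesis using tail_acyc[OF aX] by (simp add: rres_def)
qed

lemma zero_mod_represents:
  assumes P: "represents C P X p"
  shows "zero_mod C P \<longleftrightarrow> zero_object C X"
proof
  note D = genD[OF represents_gen[OF P]]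
  { assume z: "zero_mod C P"
    have "Act P (Idn C X) p = \<one>\<^bsub>Val P X\<^esub>"
      using z D by (auto simp: Act_Idn zero_mod_def trivial_group_def)
    then have "Idn C X = zr C X X" using represents_zr[OF P, of "Idn C X" X] D by simp
    then show "zero_object C X" using zero_objectI D by blast }
  { assume z: "zero_object C X"
    show "zero_mod C P" unfolding zero_mod_def
    proof
      fix Y assume Y: "Y \<in> Obj C"
      interpret comm_group "Val P Y" by (rule Val_grp[OF D(1) Y])
      have "m = \<one>\<^bsub>Val P Y\<^esub>" if m: "m \<in> carrier (Val P Y)" for m
      proof -
        obtain h where h: "ar C h Y X" "m = Act P h p" using genE[OF represents_gen[OF P] m Y] .
        then have "h = zr C Y X" using zero_objectD(3)[OF z, of h] by simp
        then show ?thesis using h represents_zr[OF P, of h Y] by simp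
      qed
      then show "trivial_group (Val P Y)" unfolding trivial_group_subset by blast
    qed }
qed

section \<open>Groups of natural transformations and the cohomology of C(X, T)\<close>

lemma Nat_grp_rst: "nat_trans C M N \<alpha> \<Longrightarrow> cmodule C M \<Longrightarrow> rst C M \<alpha> \<in> carrier (Nat_grp C M N)"
proof -
  assume \<alpha>: "nat_trans C M N \<alpha>" and M: "cmodule C M"
  have "nat_trans C M N (rst C M \<alpha>)"
  proof (rule nat_transI)
    fix X x y assume X: "X \<in> Obj C" "x \<in> carrier (Val M X)" "y \<in> carrier (Val M X)"
    then have "x \<otimes>\<^bsub>Val M X\<^esub> y \<in> carrier (Val M X)" using comm_groupE(1)[OF Val_grp[OF M X(1)]] by blast
    then show "rst C M \<alpha> X (x \<otimes>\<^bsub>Val M X\<^esub> y) = rst C M \<alpha> X x \<otimes>\<^bsub>Val N X\<^esub> rst C M \<alpha> X y"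
      using X nat_transD(4)[OF \<alpha>] by simp
  qed (use nat_transD(2,3)[OF \<alpha>] Act_closed[OF M] in simp_all)
  then show ?thesis by (simp add: Nat_grp_def rst_def)
qed

lemma Nat_grp_comm_group:
  assumes M: "cmodule C M" and N: "cmodule C N"
  shows "comm_group (Nat_grp C M N)"
proof (rule comm_groupI)
  have V: "comm_group (Val N X)" if "X \<in> Obj C" for X by (rule Val_grp[OF N that])
  have cl: "rst C M (\<lambda>X x. \<alpha> X x \<otimes>\<^bsub>Val N X\<^esub> \<beta> X x) \<in> carrier (Nat_grp C M N)"
    if \<alpha>: "nat_trans C M N \<alpha>" and \<beta>: "nat_trans C M N \<beta>" for \<alpha> \<beta>
  proof (rule Nat_grp_rst[OF nat_transI M])
    fix X x assume X: "X \<in> Obj C" "x \<in> carrier (Val M X)"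
    note G = comm_groupE[OF V[OF X(1)]]
    note a = nat_transD(2)[OF \<alpha> X] nat_transD(2)[OF \<beta> X]
    show "\<alpha> X x \<otimes>\<^bsub>Val N X\<^esub> \<beta> X x \<in> carrier (Val N X)" using G(1) a by blast
    fix y assume y: "y \<in> carrier (Val M X)"
    note b = nat_transD(2)[OF \<alpha> X(1) y] nat_transD(2)[OF \<beta> X(1) y]
    interpret G: comm_group "Val N X" by (rule V[OF X(1)])
    show "\<alpha> X (x \<otimes>\<^bsub>Val M X\<^esub> y) \<otimes>\<^bsub>Val N X\<^esub> \<beta> X (x \<otimes>\<^bsub>Val M X\<^esub> y) =
      (\<alpha> X x \<otimes>\<^bsub>Val N X\<^esub> \<beta> X x) \<otimes>\<^bsub>Val N X\<^esub> (\<alpha> X y \<otimes>\<^bsub>Val N X\<^esub> \<beta> X y)"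
      unfolding nat_transD(4)[OF \<alpha> X y] nat_transD(4)[OF \<beta> X y] using a b G.m_ac by simp
  next
    fix f x assume f: "Ar C f" "x \<in> carrier (Val M (Cod C f))"
    show "\<alpha> (Dom C f) (Act M f x) \<otimes>\<^bsub>Val N (Dom C f)\<^esub> \<beta> (Dom C f) (Act M f x) =
       Act N f (\<alpha> (Cod C f) x \<otimes>\<^bsub>Val N (Cod C f)\<^esub> \<beta> (Cod C f) x)"
      using nat_transD(3)[OF \<alpha> f] nat_transD(3)[OF \<beta> f] nat_transD(2)[OF \<alpha> ArD(2)[OF f(1)] f(2)]
        nat_transD(2)[OF \<beta> ArD(2)[OF f(1)] f(2)] Act_mult[OF N f(1)] by simp
  qed
  have one: "\<one>\<^bsub>Nat_grp C M N\<^esub> \<in> carrier (Nat_grp C M N)" unfolding Nat_grp_one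
    using comm_groupE(2)[OF V] comm_groupE(5)[OF V] by (intro Nat_grp_rst[OF nat_transI M]) (simp_all add: Act_one[OF N])
  show "\<one>\<^bsub>Nat_grp C M N\<^esub> \<in> carrier (Nat_grp C M N)" by (rule one)
  fix \<alpha> assume \<alpha>: "\<alpha> \<in> carrier (Nat_grp C M N)"
  note an = Nat_grpD[OF \<alpha>]
  have ac: "\<alpha> X x \<in> carrier (Val N X)" if "X \<in> Obj C" "x \<in> carrier (Val M X)" for X x using nat_transD(2)[OF an that] .
  show "\<one>\<^bsub>Nat_grp C M N\<^esub> \<otimes>\<^bsub>Nat_grp C M N\<^esub> \<alpha> = \<alpha>"
    by (rule Nat_grp_eqI[OF _ \<alpha>]) (use cl[OF Nat_grpD[OF one] an] in \<open>simp_all add: Nat_grp_mult Nat_grp_one comm_groupE(5)[OF V] ac\<close>)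
  have inv: "rst C M (\<lambda>X x. inv\<^bsub>Val N X\<^esub> \<alpha> X x) \<in> carrier (Nat_grp C M N)"
  proof (rule Nat_grp_rst[OF nat_transI M])
    fix X x assume X: "X \<in> Obj C" "x \<in> carrier (Val M X)"
    interpret G: comm_group "Val N X" by (rule V[OF X(1)])
    show "inv\<^bsub>Val N X\<^esub> \<alpha> X x \<in> carrier (Val N X)" using ac[OF X] by simp
    fix y assume y: "y \<in> carrier (Val M X)"
    show "inv\<^bsub>Val N X\<^esub> \<alpha> X (x \<otimes>\<^bsub>Val M X\<^esub> y) = inv\<^bsub>Val N X\<^esub> \<alpha> X x \<otimes>\<^bsub>Val N X\<^esub> inv\<^bsub>Val N X\<^esub> \<alpha> X y"
      unfolding nat_transD(4)[OF an X y] using G.inv_mult[OF ac[OF X] ac[OF X(1) y]] .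
  next
    fix f x assume f: "Ar C f" "x \<in> carrier (Val M (Cod C f))"
    interpret group_hom "Val N (Cod C f)" "Val N (Dom C f)" "Act N f"
      using Act_hom[OF N f(1)] Val_group[OF N] f by (simp add: group_hom_def group_hom_axioms_def)
    show "inv\<^bsub>Val N (Dom C f)\<^esub> \<alpha> (Dom C f) (Act M f x) = Act N f (inv\<^bsub>Val N (Cod C f)\<^esub> \<alpha> (Cod C f) x)"
      unfolding nat_transD(3)[OF an f] using hom_inv[OF ac[OF _ f(2)]] f by simp
  qed
  have "rst C M (\<lambda>X x. inv\<^bsub>Val N X\<^esub> \<alpha> X x) \<otimes>\<^bsub>Nat_grp C M N\<^esub> \<alpha> = \<one>\<^bsub>Nat_grp C M N\<^esub>"
  proof (rule Nat_grp_eqI[OF _ one])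
    show "rst C M (\<lambda>X x. inv\<^bsub>Val N X\<^esub> \<alpha> X x) \<otimes>\<^bsub>Nat_grp C M N\<^esub> \<alpha> \<in> carrier (Nat_grp C M N)"
      unfolding Nat_grp_mult by (rule cl[OF Nat_grpD[OF inv] an])
    fix X x assume X: "X \<in> Obj C" "x \<in> carrier (Val M X)"
    interpret G: comm_group "Val N X" by (rule V[OF X(1)])
    show "(rst C M (\<lambda>X x. inv\<^bsub>Val N X\<^esub> \<alpha> X x) \<otimes>\<^bsub>Nat_grp C M N\<^esub> \<alpha>) X x = \<one>\<^bsub>Nat_grp C M N\<^esub> X x"
      using ac[OF X] X by (simp add: Nat_grp_mult Nat_grp_one)
  qed
  then show "\<exists>\<beta>\<in>carrier (Nat_grp C M N). \<beta> \<otimes>\<^bsub>Nat_grp C M N\<^esub> \<alpha> = \<one>\<^bsub>Nat_grp C M N\<^esub>" using inv by blast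
  fix \<beta> assume \<beta>: "\<beta> \<in> carrier (Nat_grp C M N)"
  note bn = Nat_grpD[OF \<beta>]
  have bc: "\<beta> X x \<in> carrier (Val N X)" if "X \<in> Obj C" "x \<in> carrier (Val M X)" for X x using nat_transD(2)[OF bn that] .
  show ab: "\<alpha> \<otimes>\<^bsub>Nat_grp C M N\<^esub> \<beta> \<in> carrier (Nat_grp C M N)" unfolding Nat_grp_mult by (rule cl[OF an bn])
  show "\<alpha> \<otimes>\<^bsub>Nat_grp C M N\<^esub> \<beta> = \<beta> \<otimes>\<^bsub>Nat_grp C M N\<^esub> \<alpha>"
  proof (rule Nat_grp_eqI[OF ab cl[OF bn an, folded Nat_grp_mult]])
    fix X x assume X: "X \<in> Obj C" "x \<in> carrier (Val M X)"
    then show "(\<alpha> \<otimes>\<^bsub>Nat_grp C M N\<^esub> \<beta>) X x = (\<beta> \<otimes>\<^bsub>Nat_grp C M N\<^esub> \<alpha>) X x"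
      using comm_groupE(4)[OF V[OF X(1)] ac[OF X] bc[OF X]] by (simp add: Nat_grp_mult)
  qed
  fix \<gamma> assume \<gamma>: "\<gamma> \<in> carrier (Nat_grp C M N)"
  note cn = Nat_grpD[OF \<gamma>]
  have cc: "\<gamma> X x \<in> carrier (Val N X)" if "X \<in> Obj C" "x \<in> carrier (Val M X)" for X x using nat_transD(2)[OF cn that] .
  show "(\<alpha> \<otimes>\<^bsub>Nat_grp C M N\<^esub> \<beta>) \<otimes>\<^bsub>Nat_grp C M N\<^esub> \<gamma> = \<alpha> \<otimes>\<^bsub>Nat_grp C M N\<^esub> (\<beta> \<otimes>\<^bsub>Nat_grp C M N\<^esub> \<gamma>)"
  proof (rule Nat_grp_eqI[OF cl[OF Nat_grpD[OF ab] cn, folded Nat_grp_mult] cl[OF an Nat_grpD[OF cl[OF bn cn]], folded Nat_grp_mult]])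
    fix X x assume X: "X \<in> Obj C" "x \<in> carrier (Val M X)"
    then show "((\<alpha> \<otimes>\<^bsub>Nat_grp C M N\<^esub> \<beta>) \<otimes>\<^bsub>Nat_grp C M N\<^esub> \<gamma>) X x = (\<alpha> \<otimes>\<^bsub>Nat_grp C M N\<^esub> (\<beta> \<otimes>\<^bsub>Nat_grp C M N\<^esub> \<gamma>)) X x"
      using comm_groupE(3)[OF V[OF X(1)] ac[OF X] bc[OF X] cc[OF X]] by (simp add: Nat_grp_mult)
  qed
qed

lemma nat_trans_eq_gen:
  assumes "nat_trans C M N \<alpha>" "nat_trans C M N \<beta>" "gen C M B x" "\<alpha> B x = \<beta> B x" "X \<in> Obj C" "m \<in> carrier (Val M X)"
  shows "\<alpha> X m = \<beta> X m"
proof -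
  obtain h where h: "ar C h X B" "m = Act M h x" using genE[OF assms(3,6,5)] .
  show ?thesis unfolding h(2) nat_trans_gen[OF assms(1,3) h(1)] nat_trans_gen[OF assms(2,3) h(1)] assms(4) ..
qed

text \<open>Evaluation at the generator identifies maps from F to C(-, T) with morphisms g from
  \<open>ob X 0\<close> to T that respect the relations, that is, with g d = 0.\<close>

lemma Nat_grp_zero_iff:
  assumes X: "rres C X x F" and T: "T \<in> Obj C"
  shows "trivial_group (Nat_grp C F (Rep C T)) \<longleftrightarrow> coh C X T 0"
proof -
  have aX: "acyc C X" and pX: "presents C (df X (Suc 0)) x F" using X by (auto simp: rres_def)
  note [simp] = acycD(1-4)[OF aX] acyc_ob[OF aX]
  have gX: "gen C F (ob X 0) x" using presents_gen[OF pX] by simp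
  note F = genD[OF gX]
  note R = cmodule_Rep[OF T]
  interpret G: comm_group "Nat_grp C F (Rep C T)" by (rule Nat_grp_comm_group[OF F(1) R])
  let ?o = "\<one>\<^bsub>Nat_grp C F (Rep C T)\<^esub>"
  have o: "?o (ob X 0) x = zr C (ob X 0) T" using F by (simp add: Nat_grp_one zr_def)
  show ?thesis unfolding G.trivial_group_subset
  proof
    assume t: "carrier (Nat_grp C F (Rep C T)) \<subseteq> {?o}"
    show "coh C X T 0" unfolding coh_def nat.case
    proof (intro allI impI)
      fix g assume a: "ar C g (ob X 0) T \<and> g \<cdot> df X (Suc 0) = zr C (ob X (Suc 0)) T"
      then have g: "ar C g (ob X 0) T" "g \<cdot> df X (Suc 0) = zr C (ob X (Suc 0)) T" by auto
      have gc: "g \<in> carrier (Val (Rep C T) (ob X 0))" using g by (simp add: Ar_homs)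
      have r: "Act (Rep C T) h g = \<one>\<^bsub>Val (Rep C T) (Dom C h)\<^esub>"
        if h: "Ar C h" "Cod C h = ob X 0" "Act F h x = \<one>\<^bsub>Val F (Dom C h)\<^esub>" for h
      proof -
        define Y where "Y = Dom C h"
        obtain k where k: "ar C k Y (ob X (Suc 0))" "h = df X (Suc 0) \<cdot> k"
          using presentsE[OF pX, of h Y] h by (auto simp: Y_def)
        have "g \<cdot> h = zr C Y T" unfolding k(2) using cmp_eq1[OF g(2), of k] g k(1) T by simp
        then show ?thesis by (simp add: zr_def Y_def)
      qed
      obtain \<alpha> where \<alpha>: "nat_trans C F (Rep C T) \<alpha>" "\<alpha> (ob X 0) x = g"
        using hom_from_gen[OF gX R gc] r by metis
      have "rst C F \<alpha> = ?o" using t Nat_grp_rst[OF \<alpha>(1) F(1)] by blast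
      then have "rst C F \<alpha> (ob X 0) x = zr C (ob X 0) T" using o by simp
      then show "g = zr C (ob X 0) T" using \<alpha>(2) F by simp
    qed
  next
    assume c: "coh C X T 0"
    show "carrier (Nat_grp C F (Rep C T)) \<subseteq> {?o}"
    proof (intro subsetI, unfold singleton_iff)
      fix \<alpha> assume \<alpha>: "\<alpha> \<in> carrier (Nat_grp C F (Rep C T))"
      note n = Nat_grpD[OF \<alpha>]
      let ?g = "\<alpha> (ob X 0) x"
      have g: "ar C ?g (ob X 0) T" using nat_transD(2)[OF n F(2,3)] T by (simp add: homs_iff)
      have "?g \<cdot> df X (Suc 0) = \<alpha> (ob X (Suc 0)) (Act F (df X (Suc 0)) x)"
        using nat_trans_gen[OF n gX, of "df X (Suc 0)" "ob X (Suc 0)"] by simp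
      also have "\<dots> = zr C (ob X (Suc 0)) T"
        using presents_rel[OF pX] nat_trans_one[OF n F(1) R, of "ob X (Suc 0)"] by (simp add: zr_def)
      finally have z: "?g = zr C (ob X 0) T" using cohD[OF c g] by simp
      show "\<alpha> = ?o"
        by (rule Nat_grp_eqI[OF \<alpha> G.one_closed], rule nat_trans_eq_gen[OF n Nat_grpD[OF G.one_closed] gX])
          (simp_all add: o z)
    qed
  qed
qed

text \<open>Evaluation at the universal element \<open>p i\<close> is a bijection from maps
  \<open>P i\<close> \<rightarrow> C(-, T) to morphisms from \<open>ob X i\<close> to T, under which
  \<open>precomp\<close> becomes composition with the differential. Kernel and image of the Hom
  complex thus turn into the cocycles and coboundaries in \<open>coh\<close>.\<close>

lemma Ext_complex_iff:
  fixes P :: "nat \<Rightarrow> ('o, 'm, 'a) cmod"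
  assumes X: "acyc C X" and P: "\<And>i. represents C (P i) (ob X i) (p i)"
    and d: "\<And>i. nat_trans C (P (Suc i)) (P i) (d i)"
    and dp: "\<And>i. d i (ob X (Suc i)) (p (Suc i)) = Act (P i) (df X (Suc i)) (p i)" and T: "T \<in> Obj C"
  defines "N \<equiv> \<lambda>i. Nat_grp C (P i) (Rep C T)"
  shows "trivial_group ((N (Suc j))\<lparr>carrier := kernel (N (Suc j)) (N (Suc (Suc j))) (precomp C (P (Suc (Suc j))) (d (Suc j)))\<rparr>
       Mod (precomp C (P (Suc j)) (d j) ` carrier (N j))) \<longleftrightarrow> coh C X T (Suc j)"
proof -
  note [simp] = acycD(1-4)[OF X] acyc_ob[OF X]
  have Pg: "gen C (P i) (ob X i) (p i)" for i by (rule represents_gen[OF P])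
  have PD: "cmodule C (P i)" "ob X i \<in> Obj C" "p i \<in> carrier (Val (P i) (ob X i))" for i using genD[OF Pg[of i]] .
  note R = cmodule_Rep[OF T]
  have G: "comm_group (N i)" for i unfolding N_def by (rule Nat_grp_comm_group[OF PD(1) R])
  define pc :: "nat \<Rightarrow> ('o \<Rightarrow> 'a \<Rightarrow> 'm) \<Rightarrow> 'o \<Rightarrow> 'a \<Rightarrow> 'm" where "pc i = precomp C (P (Suc i)) (d i)" for i
  have pcN: "pc i \<phi> \<in> carrier (N (Suc i))" if "\<phi> \<in> carrier (N i)" for i \<phi>
    unfolding pc_def precomp_rst N_def
    using that by (intro Nat_grp_rst nat_trans_comp[OF d] PD) (auto simp: N_def intro: Nat_grpD)
  have pca: "pc i \<phi> Y m = \<phi> Y (d i Y m)" if "Y \<in> Obj C" "m \<in> carrier (Val (P (Suc i)) Y)" for i \<phi> Y m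
    using that by (simp add: pc_def precomp_rst)
  have pch: "pc i \<in> hom (N i) (N (Suc i))" for i
  proof (rule homI)
    fix \<phi> \<psi> assume f: "\<phi> \<in> carrier (N i)" "\<psi> \<in> carrier (N i)"
    show "pc i (\<phi> \<otimes>\<^bsub>N i\<^esub> \<psi>) = pc i \<phi> \<otimes>\<^bsub>N (Suc i)\<^esub> pc i \<psi>"
    proof (rule Nat_grp_eqI[of _ C "P (Suc i)" "Rep C T"])
      show "pc i (\<phi> \<otimes>\<^bsub>N i\<^esub> \<psi>) \<in> carrier (Nat_grp C (P (Suc i)) (Rep C T))"
        using pcN[OF comm_groupE(1)[OF G f]] by (simp add: N_def)
      show "pc i \<phi> \<otimes>\<^bsub>N (Suc i)\<^esub> pc i \<psi> \<in> carrier (Nat_grp C (P (Suc i)) (Rep C T))"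
        using comm_groupE(1)[OF G pcN[OF f(1)] pcN[OF f(2)]] by (simp add: N_def)
      fix Y m assume Y: "Y \<in> Obj C" "m \<in> carrier (Val (P (Suc i)) Y)"
      then show "pc i (\<phi> \<otimes>\<^bsub>N i\<^esub> \<psi>) Y m = (pc i \<phi> \<otimes>\<^bsub>N (Suc i)\<^esub> pc i \<psi>) Y m"
        using nat_transD(2)[OF d Y] unfolding N_def Nat_grp_mult by (simp add: pca)
    qed
  qed (rule pcN)
  have gh: "group_hom (N i) (N (Suc i)) (pc i)" for i
    using comm_group.axioms(2)[OF G] pch by (simp add: group_hom_def group_hom_axioms_def)
  have g: "ar C (\<phi> (ob X i) (p i)) (ob X i) T" if "\<phi> \<in> carrier (N i)" for \<phi> i
    using nat_transD(2)[OF Nat_grpD PD(2,3)] that T unfolding N_def by (fastforce simp: homs_iff)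
  have pcp: "pc i \<phi> (ob X (Suc i)) (p (Suc i)) = \<phi> (ob X i) (p i) \<cdot> df X (Suc i)" if f: "\<phi> \<in> carrier (N i)" for i \<phi>
    using pca[OF PD(2,3)] dp nat_trans_gen[OF Nat_grpD[OF f[unfolded N_def]] Pg, of "df X (Suc i)" "ob X (Suc i)"] by simp
  have eqI: "\<phi> = \<psi> \<longleftrightarrow> \<phi> (ob X i) (p i) = \<psi> (ob X i) (p i)" if f: "\<phi> \<in> carrier (N i)" "\<psi> \<in> carrier (N i)" for \<phi> \<psi> i
    using Nat_grp_eqI[OF f[unfolded N_def]] nat_trans_eq_gen[OF f[unfolded N_def, THEN Nat_grpD] Pg] by blast
  have ex: "\<exists>\<phi>\<in>carrier (N i). \<phi> (ob X i) (p i) = k" if k: "ar C k (ob X i) T" for k i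
  proof -
    have "k \<in> carrier (Val (Rep C T) (ob X i))" using k Ar_homs by simp
    then obtain \<alpha> where \<alpha>: "nat_trans C (P i) (Rep C T) \<alpha>" "\<alpha> (ob X i) (p i) = k"
      using hom_from_represents[OF P R] by metis
    show ?thesis using Nat_grp_rst[OF \<alpha>(1) PD(1)] \<alpha>(2) PD(2,3) unfolding N_def by (intro bexI[of _ "rst C (P i) \<alpha>"]) simp_all
  qed
  have on: "\<one>\<^bsub>N i\<^esub> (ob X i) (p i) = zr C (ob X i) T" for i using PD by (simp add: N_def Nat_grp_one zr_def)
  have ker: "\<phi> \<in> kernel (N i) (N (Suc i)) (pc i) \<longleftrightarrow> \<phi> \<in> carrier (N i) \<and> \<phi> (ob X i) (p i) \<cdot> df X (Suc i) = zr C (ob X (Suc i)) T" for \<phi> i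
    unfolding kernel_def using eqI[OF pcN comm_groupE(2)[OF G]] pcp on by auto
  have im: "\<phi> \<in> pc i ` carrier (N i) \<longleftrightarrow> \<phi> \<in> carrier (N (Suc i)) \<and> (\<exists>k. ar C k (ob X i) T \<and> \<phi> (ob X (Suc i)) (p (Suc i)) = k \<cdot> df X (Suc i))" for \<phi> i
  proof
    assume "\<phi> \<in> pc i ` carrier (N i)"
    then obtain \<psi> where "\<psi> \<in> carrier (N i)" "\<phi> = pc i \<psi>" by blast
    then show "\<phi> \<in> carrier (N (Suc i)) \<and> (\<exists>k. ar C k (ob X i) T \<and> \<phi> (ob X (Suc i)) (p (Suc i)) = k \<cdot> df X (Suc i))"
      using pcN pcp g by blast
  next
    assume a: "\<phi> \<in> carrier (N (Suc i)) \<and> (\<exists>k. ar C k (ob X i) T \<and> \<phi> (ob X (Suc i)) (p (Suc i)) = k \<cdot> df X (Suc i))"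
    then obtain k where k: "ar C k (ob X i) T" "\<phi> (ob X (Suc i)) (p (Suc i)) = k \<cdot> df X (Suc i)" by blast
    obtain \<psi> where \<psi>: "\<psi> \<in> carrier (N i)" "\<psi> (ob X i) (p i) = k" using ex[OF k(1)] by blast
    have "\<phi> = pc i \<psi>" using eqI[OF conjunct1[OF a] pcN[OF \<psi>(1)]] pcp[OF \<psi>(1)] k(2) \<psi>(2) by simp
    then show "\<phi> \<in> pc i ` carrier (N i)" using \<psi>(1) by blast
  qed
  have sub: "pc j ` carrier (N j) \<subseteq> kernel (N (Suc j)) (N (Suc (Suc j))) (pc (Suc j))"
  proof
    fix \<phi> assume "\<phi> \<in> pc j ` carrier (N j)"
    then obtain k where k: "\<phi> \<in> carrier (N (Suc j))" "ar C k (ob X j) T" "\<phi> (ob X (Suc j)) (p (Suc j)) = k \<cdot> df X (Suc j)"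
      unfolding im by blast
    then show "\<phi> \<in> kernel (N (Suc j)) (N (Suc (Suc j))) (pc (Suc j))" unfolding ker using T by simp
  qed
  have "trivial_group ((N (Suc j))\<lparr>carrier := kernel (N (Suc j)) (N (Suc (Suc j))) (pc (Suc j))\<rparr> Mod (pc j ` carrier (N j)))
    \<longleftrightarrow> kernel (N (Suc j)) (N (Suc (Suc j))) (pc (Suc j)) \<subseteq> pc j ` carrier (N j)"
    by (rule subgroup_quotient_trivial[OF G group_hom.subgroup_kernel[OF gh] group_hom.img_is_subgroup[OF gh] sub])
  also have "\<dots> \<longleftrightarrow> coh C X T (Suc j)"
  proof
    assume s: "kernel (N (Suc j)) (N (Suc (Suc j))) (pc (Suc j)) \<subseteq> pc j ` carrier (N j)"
    show "coh C X T (Suc j)" unfolding coh_def nat.case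
    proof (intro allI impI)
      fix h assume a: "ar C h (ob X (Suc j)) T \<and> h \<cdot> df X (Suc (Suc j)) = zr C (ob X (Suc (Suc j))) T"
      then have h: "ar C h (ob X (Suc j)) T" "h \<cdot> df X (Suc (Suc j)) = zr C (ob X (Suc (Suc j))) T" by auto
      obtain \<phi> where \<phi>: "\<phi> \<in> carrier (N (Suc j))" "\<phi> (ob X (Suc j)) (p (Suc j)) = h" using ex[OF h(1)] by blast
      then have "\<phi> \<in> pc j ` carrier (N j)" using s ker[of \<phi> "Suc j"] h(2) by blast
      then show "\<exists>k. ar C k (ob X j) T \<and> h = k \<cdot> df X (Suc j)" using im[of \<phi> j] \<phi>(2) by blast
    qed
  next
    assume c: "coh C X T (Suc j)"
    show "kernel (N (Suc j)) (N (Suc (Suc j))) (pc (Suc j)) \<subseteq> pc j ` carrier (N j)"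
    proof
      fix \<phi> assume "\<phi> \<in> kernel (N (Suc j)) (N (Suc (Suc j))) (pc (Suc j))"
      then have f: "\<phi> \<in> carrier (N (Suc j))" "\<phi> (ob X (Suc j)) (p (Suc j)) \<cdot> df X (Suc (Suc j)) = zr C (ob X (Suc (Suc j))) T"
        unfolding ker by auto
      then show "\<phi> \<in> pc j ` carrier (N j)" unfolding im using cohD[OF c g[OF f(1)] f(2)] by simp
    qed
  qed
  finally show ?thesis unfolding pc_def .
qed

end

section \<open>Projective modules are the representable ones; Ext and projective dimension in terms
  of complexes\<close>

context additive_category
begin

text \<open>The resolution consists of the representing object in degree 0 and zero objects
  elsewhere.\<close>

lemma represents_rres:
  assumes P: "represents C P X p"
  shows "\<exists>Y. rres C Y p P"
proof -
  note D = genD[OF represents_gen[OF P]]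
  obtain Z where Z: "zero_object C Z" using has_zero by blast
  have ZO: "Z \<in> Obj C" by (rule zero_objectD(1)[OF Z])
  define o' where "o' i = (case i of 0 \<Rightarrow> X | Suc j \<Rightarrow> Z)" for i
  define Y where "Y = \<lparr>ob = o', df = (\<lambda>i. zr C (o' i) (o' (i - 1)))\<rparr>"
  have [simp]: "ob Y i = o' i" "df Y (Suc i) = zr C (o' (Suc i)) (o' i)" "o' 0 = X" "o' (Suc i) = Z" "o' i \<in> Obj C" for i
    using D ZO by (auto simp: Y_def o'_def split: nat.split)
  note [simp] = ZO D
  have zh: "h = zr C T Z" if "ar C h T Z" for h T using zero_objectD(3)[OF Z, of h] that by simp
  have zk: "\<exists>k. ar C k T Z" if "T \<in> Obj C" for T using that by (intro exI[of _ "zr C T Z"]) simp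
  have "acyc C Y" unfolding acyc_def
  proof (intro conjI allI impI)
    fix i h assume "Ar C h \<and> Cod C h = ob Y (Suc i) \<and> df Y (Suc i) \<cdot> h = zr C (Dom C h) (ob Y i)"
    then have h: "ar C h (Dom C h) Z" by simp
    show "\<exists>k. ar C k (Dom C h) (ob Y (Suc (Suc i))) \<and> h = df Y (Suc (Suc i)) \<cdot> k"
      using zh[OF h] h by (intro exI[of _ "zr C (Dom C h) Z"]) simp
  qed simp_all
  moreover have "presents C (df Y (Suc 0)) p P" unfolding presents_def
  proof (intro conjI allI impI)
    fix h assume "Ar C h \<and> Cod C h = Cod C (df Y (Suc 0))"
    then have h: "ar C h (Dom C h) X" by simp
    define T where "T = Dom C h"
    have T: "T \<in> Obj C" using h by (auto simp: T_def)
    have "(\<exists>k. ar C k T Z \<and> h = zr C Z X \<cdot> k) \<longleftrightarrow> h = zr C T X" (is "?l \<longleftrightarrow> ?r")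
    proof
      assume ?l
      then obtain k where k: "ar C k T Z" "h = zr C Z X \<cdot> k" by blast
      then show ?r by simp
    next
      assume ?r then show ?l using T by (intro exI[of _ "zr C T Z"]) simp
    qed
    then show "Act P h p = \<one>\<^bsub>Val P (Dom C h)\<^esub> \<longleftrightarrow> (\<exists>k. ar C k (Dom C h) (Dom C (df Y (Suc 0))) \<and> h = df Y (Suc 0) \<cdot> k)"
      using represents_zr[OF P h] unfolding T_def by simp
  qed (use represents_gen[OF P] in simp_all)
  ultimately show ?thesis by (auto simp: rres_def)
qed

text \<open>Only the image of the universal element has to be lifted along the surjection; the
  Yoneda lemma extends the lift to a natural transformation.\<close>

lemma represents_projective:
  fixes P :: "('a, 'b, 'b set) cmod"
  assumes P: "represents C P X p"
  shows "projective C P"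
  unfolding projective_def
proof (intro conjI allI impI)
  note D = genD[OF represents_gen[OF P]]
  show "in_mod C P" using represents_rres[OF P] by (elim exE) (rule rres_in_mod)
  fix K G H :: "('a, 'b, 'b set) cmod" and \<iota> \<pi> \<alpha>
  assume a: "in_mod C K \<and> in_mod C G \<and> in_mod C H \<and> short_exact C K G H \<iota> \<pi> \<and> nat_trans C P H \<alpha>"
  then have G: "cmodule C G" and n: "nat_trans C G H \<pi>" "nat_trans C P H \<alpha>"
    and s: "\<And>Y. Y \<in> Obj C \<Longrightarrow> \<pi> Y ` carrier (Val G Y) = carrier (Val H Y)"
    using in_mod_cmodule by (auto simp: short_exact_def)
  have "\<alpha> X p \<in> \<pi> X ` carrier (Val G X)" using s[OF D(2)] nat_transD(2)[OF n(2) D(2,3)] by simp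
  then obtain g where g: "g \<in> carrier (Val G X)" "\<pi> X g = \<alpha> X p" by auto
  obtain \<beta> where \<beta>: "nat_trans C P G \<beta>" "\<beta> X p = g" using hom_from_represents[OF P G g(1)] by metis
  have "\<pi> Y (\<beta> Y m) = \<alpha> Y m" if "Y \<in> Obj C" "m \<in> carrier (Val P Y)" for Y m
    using nat_trans_eq_gen[OF nat_trans_comp[OF \<beta>(1) n(1)] n(2) represents_gen[OF P] _ that] \<beta>(2) g(2) by simp
  then show "\<exists>\<beta>. nat_trans C P G \<beta> \<and> (\<forall>X\<in>Obj C. \<forall>x\<in>carrier (Val P X). \<pi> X (\<beta> X x) = \<alpha> X x)"
    using \<beta>(1) by blast
qed

end

context idempotent_complete_additive_category
begin

text \<open>A projective module is a direct summand of a representable one, hence representable.\<close>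

lemma projective_represents:
  assumes P: "projective C P"
  shows "\<exists>Y y. represents C P Y y"
proof -
  have Pm: "in_mod C P" and lift: "\<And>(K :: ('a, 'b, 'b set) cmod) (G :: ('a, 'b, 'b set) cmod) (H :: ('a, 'b, 'b set) cmod) \<iota> \<pi> \<alpha>.
       in_mod C K \<Longrightarrow> in_mod C G \<Longrightarrow> in_mod C H \<Longrightarrow> short_exact C K G H \<iota> \<pi> \<Longrightarrow> nat_trans C P H \<alpha> \<Longrightarrow>
       \<exists>\<beta>. nat_trans C P G \<beta> \<and> (\<forall>X\<in>Obj C. \<forall>x\<in>carrier (Val P X). \<pi> X (\<beta> X x) = \<alpha> X x)"
    using P unfolding projective_def by blast+
  obtain X x where X: "rres C X x P" using in_mod_rres[OF Pm] .
  have aX: "acyc C X" and pX: "presents C (df X (Suc 0)) x P" using X by (auto simp: rres_def)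
  let ?X = "ob X 0"
  have XO: "?X \<in> Obj C" by (rule acyc_ob[OF aX])
  have gX: "gen C P ?X x" using presents_gen[OF pX] acycD[OF aX] by simp
  note PD = genD[OF gX]
  define S where "S = (\<lambda>h. Act P h x = \<one>\<^bsub>Val P (Dom C h)\<^esub>)"
  \<comment> \<open>\<open>?R\<close> is a copy of C(-, X_0) and \<open>?K\<close> the kernel of its
    map to P. Both are in the module category and have elements of type \<open>'m set\<close>, as
    the lifting property in \<open>projective\<close> demands.\<close>
  let ?K = "ssub C ?X S" and ?R = "ssub C ?X (\<lambda>_. True)"
  have K: "in_mod C ?K" using rres_in_mod[OF kernel_rres[OF X]] unfolding S_def .
  have R: "represents C ?R ?X {Idn C ?X}" by (rule represents_ssub[OF XO])
  have Rm: "in_mod C ?R" using represents_rres[OF R] by (elim exE) (rule rres_in_mod)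
  obtain \<pi> where \<pi>: "nat_trans C ?R P \<pi>" "\<pi> ?X {Idn C ?X} = x" using hom_from_represents[OF R PD(1,3)] by metis
  have \<pi>h: "\<pi> Y {h} = Act P h x" if "ar C h Y ?X" for h Y
    using nat_trans_gen[OF \<pi>(1) represents_gen[OF R] that] that by (simp add: \<pi>(2))
  have "short_exact C ?K ?R P (\<lambda>Y A. A) \<pi>" unfolding short_exact_def
  proof (intro conjI ballI)
    show "nat_trans C ?K ?R (\<lambda>Y A. A)" by (rule nat_transI) (auto simp: ssub_def)
    show "nat_trans C ?R P \<pi>" by (rule \<pi>(1))
    fix Y assume Y: "Y \<in> Obj C"
    show "inj_on (\<lambda>A. A) (carrier (Val ?K Y))" by simp
    show "exact_at (Val ?K Y) (Val ?R Y) (Val P Y) (\<lambda>A. A) (\<pi> Y)" unfolding exact_at_def kernel_def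
      using \<pi>h by (auto simp: S_def)
    show "\<pi> Y ` carrier (Val ?R Y) = carrier (Val P Y)"
    proof (intro equalityI subsetI)
      fix m assume m: "m \<in> carrier (Val P Y)"
      obtain h where h: "ar C h Y ?X" "m = Act P h x" using genE[OF gX m Y] .
      then have "{h} \<in> carrier (Val ?R Y)" "\<pi> Y {h} = m" using \<pi>h[OF h(1)] by auto
      then show "m \<in> \<pi> Y ` carrier (Val ?R Y)" by blast
    qed (use nat_transD(2)[OF \<pi>(1) Y] in blast)
  qed
  moreover have "nat_trans C P P (\<lambda>Y m. m)" by (rule nat_transI) simp_all
  ultimately obtain \<beta> where \<beta>: "nat_trans C P ?R \<beta>" "\<And>Y m. Y \<in> Obj C \<Longrightarrow> m \<in> carrier (Val P Y) \<Longrightarrow> \<pi> Y (\<beta> Y m) = m"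
    using lift[OF K Rm Pm] by metis
  have "\<beta> ?X x \<in> carrier (Val ?R ?X)" using nat_transD(2)[OF \<beta>(1) PD(2,3)] .
  then obtain e where e: "\<beta> ?X x = {e}" "ar C e ?X ?X" by auto
  have ex: "Act P e x = x" using \<beta>(2)[OF PD(2,3)] \<pi>h[OF e(2)] e(1) by simp
  have bh: "\<beta> Y (Act P h x) = {e \<cdot> h}" if "ar C h Y ?X" for h Y
    using nat_trans_gen[OF \<beta>(1) gX that] by (simp add: e(1))
  \<comment> \<open>Lifting the identity gave a section \<beta> with \<beta>(x) = {e}. As
    \<open>e\<close> fixes \<open>x\<close>, the value of \<beta> at \<open>Act P e x\<close> is
    {e}, while naturality computes it as {e e}. The object splitting \<open>e\<close> will represent
    P.\<close>
  have "{e \<cdot> e} = {e}" using bh[OF e(2)] ex e(1) by simp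
  then obtain Y r s where Y: "Y \<in> Obj C" and r': "r \<in> homs C ?X Y" "s \<in> homs C Y ?X" and sr: "s \<cdot> r = e" and rs: "r \<cdot> s = Idn C Y"
    using idempotents_split[OF XO, of e] e(2) Ar_homs by auto
  have r: "ar C r ?X Y" "ar C s Y ?X" using r' XO Y by (simp_all add: homs_iff)
  have "represents C P Y (Act P s x)" unfolding represents_def gen_def
  proof (intro conjI ballI allI impI)
    show "Act P s x \<in> carrier (Val P Y)" using Act_closed[OF PD(1), of s x] r PD by simp
    fix T m assume T: "T \<in> Obj C" "m \<in> carrier (Val P T)"
    obtain h where h: "ar C h T ?X" "m = Act P h x" using genE[OF gX T(2,1)] .
    have "Act P (s \<cdot> r \<cdot> h) x = Act P ((s \<cdot> r) \<cdot> h) x" using r h by simp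
    also have "\<dots> = Act P h (Act P e x)" unfolding sr using e(2) h(1) PD by (simp add: Act_cmp)
    finally have "Act P (r \<cdot> h) (Act P s x) = m" using r h PD by (simp add: Act_cmp ex)
    then show "\<exists>h. ar C h T Y \<and> m = Act P h (Act P s x)" using r h(1) by (intro exI[of _ "r \<cdot> h"]) simp
  next
    fix h assume h: "Ar C h \<and> Cod C h = Y \<and> Act P h (Act P s x) = \<one>\<^bsub>Val P (Dom C h)\<^esub>"
    define T where "T = Dom C h"
    have hT: "ar C h T Y" using h by (simp add: T_def)
    have TO: "T \<in> Obj C" using hT by auto
    have "Act P h (Act P s x) = \<one>\<^bsub>Val P T\<^esub>" using h by (simp add: T_def)
    then have "Act P (s \<cdot> h) x = \<one>\<^bsub>Val P T\<^esub>" using hT r PD by (simp add: Act_cmp)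
    then have "\<beta> T \<one>\<^bsub>Val P T\<^esub> = {e \<cdot> s \<cdot> h}" using bh[of "s \<cdot> h" T] r hT by simp
    moreover have "\<beta> T \<one>\<^bsub>Val P T\<^esub> = {zr C T ?X}"
      using nat_trans_one[OF \<beta>(1) PD(1) in_mod_cmodule[OF Rm] TO] by simp
    ultimately have z: "e \<cdot> s \<cdot> h = zr C T ?X" by simp
    have "h = (r \<cdot> s) \<cdot> (r \<cdot> s) \<cdot> h" using hT rs by simp
    also have "\<dots> = r \<cdot> (s \<cdot> r) \<cdot> s \<cdot> h" using r hT by simp
    also have "\<dots> = zr C T Y" unfolding sr z using r TO by simp
    finally show "h = zr C (Dom C h) Y" by (simp add: T_def)
  qed (use PD Y in simp_all)
  then show ?thesis by blast
qed

text \<open>The resolution chosen in \<open>Ext_pos\<close> is unknown, but its terms are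
  projective, hence representable, so it comes from some complex in the category. Cohomology
  vanishing is computed there and moved to the given complex by \<open>coh_transfer\<close>. A
  resolution by \<open>ssub\<close> shows that the choice is meaningful.\<close>

lemma Ext_zero_iff:
  assumes X: "rres C X x F" and T: "T \<in> Obj C"
  shows "Ext_zero C i F (Rep C T) \<longleftrightarrow> coh C X T i"
proof (cases i)
  case 0
  then show ?thesis using Nat_grp_zero_iff[OF X T] by (simp add: Ext_zero_def)
next
  case (Suc j)
  have aX: "acyc C X" and F: "cmodule C F"
    using X genD(1)[OF presents_gen] by (auto simp: rres_def)
  have "\<exists>d \<epsilon>. resolution C (\<lambda>i. ssub C (ob X i) (\<lambda>_. True)) d \<epsilon> F"
    using rres_resolution[OF X represents_ssub[OF acyc_ob[OF aX]]] .
  then obtain d \<epsilon> where "resolution C (\<lambda>i. ssub C (ob X i) (\<lambda>_. True)) d \<epsilon> F" by blast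
  then have "projective_resolution C (\<lambda>i. ssub C (ob X i) (\<lambda>_. True)) d \<epsilon> F"
    using represents_projective[OF represents_ssub[OF acyc_ob[OF aX]]] by (simp add: projective_resolution_def)
  then have "\<exists>Pd. (case Pd of (P, d) \<Rightarrow> \<exists>\<epsilon>. projective_resolution C P d \<epsilon> F)" by auto
  then have "case chosen_resolution C F of (P, d) \<Rightarrow> \<exists>\<epsilon>. projective_resolution C P d \<epsilon> F"
    unfolding chosen_resolution_def by (rule someI_ex)
  then obtain P d \<epsilon> where ch: "chosen_resolution C F = (P, d)" and R: "projective_resolution C P d \<epsilon> F"
    by (auto split: prod.splits)
  have "\<forall>i. \<exists>Yy. represents C (P i) (fst Yy) (snd Yy)"
    using R projective_represents unfolding projective_resolution_def by simp
  then obtain Yy where Yy: "\<And>i. represents C (P i) (fst (Yy i)) (snd (Yy i))" by metis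
  have Res: "resolution C P d \<epsilon> F" using R by (simp add: projective_resolution_def)
  obtain X' x' where X': "rres C X' x' F" "ob X' = (\<lambda>i. fst (Yy i))"
    and dp: "\<And>i. d i (fst (Yy (Suc i))) (snd (Yy (Suc i))) = Act (P i) (df X' (Suc i)) (snd (Yy i))"
    using resolution_rres[OF Res Yy F] by auto
  have aX': "acyc C X'" using X' by (simp add: rres_def)
  have dn: "nat_trans C (P (Suc i)) (P i) (d i)" for i using Res unfolding resolution_def by blast
  have "Ext_zero C i F (Rep C T) \<longleftrightarrow> trivial_group (Ext_pos C (Suc j) F (Rep C T))"
    by (simp add: Ext_zero_def Suc)
  also have "\<dots> \<longleftrightarrow> coh C X' T (Suc j)"
    using Ext_complex_iff[OF aX', of P "\<lambda>i. snd (Yy i)" d T j] Yy dn dp X'(2) T by (simp add: Ext_pos_def ch)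
  also have "\<dots> \<longleftrightarrow> coh C X T (Suc j)" using coh_transfer[OF X X'(1) T] coh_transfer[OF X'(1) X T] by blast
  finally show ?thesis by (simp add: Suc)
qed

text \<open>The infimum of a nonempty set of extended naturals is attained, and for the empty set it
  is infinite, which a finite bound excludes.\<close>

lemma pdim_le_iff: "pdim C F \<le> enat m \<longleftrightarrow> (\<exists>P d \<epsilon>. projective_resolution C P d \<epsilon> F \<and> (\<forall>i>m. zero_mod C (P i)))"
proof
  let ?S = "{enat k | k. \<exists>P d \<epsilon>. projective_resolution C P d \<epsilon> F \<and> (\<forall>i>k. zero_mod C (P i))}"
  assume a: "pdim C F \<le> enat m"
  have "?S \<noteq> {}"
  proof
    assume "?S = {}"
    then have "pdim C F = \<infinity>" by (simp only: pdim_def Inf_enat_def) simp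
    then show False using a by simp
  qed
  then have "pdim C F \<in> ?S" unfolding pdim_def by (metis (no_types, lifting) ex_in_conv wellorder_InfI)
  then obtain k P d \<epsilon> where k: "pdim C F = enat k" "projective_resolution C P d \<epsilon> F" "\<forall>i>k. zero_mod C (P i)" by blast
  then have "\<forall>i>m. zero_mod C (P i)" using a by auto
  then show "\<exists>P d \<epsilon>. projective_resolution C P d \<epsilon> F \<and> (\<forall>i>m. zero_mod C (P i))" using k(2) by blast
next
  assume "\<exists>P d \<epsilon>. projective_resolution C P d \<epsilon> F \<and> (\<forall>i>m. zero_mod C (P i))"
  then show "pdim C F \<le> enat m" unfolding pdim_def by (intro Inf_lower) blast
qed

text \<open>The bound on the projective dimension yields a complex of representing objects that are
  zero beyond degree n + 1, and the vanishing of Ext in degrees 0 to n is exactness after applying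
  C(-, Y). Together these are the two halves of n-exactness. From here on no projective resolution
  or Ext group is mentioned again.\<close>

lemma ex_cat_iff: "F \<in> ex_cat C n \<longleftrightarrow> (\<exists>X x. n_exact C n X \<and> presents C (df X (Suc 0)) x F)"
proof
  assume F: "F \<in> ex_cat C n"
  then have Fc: "cmodule C F" and E: "\<And>i T. i \<le> n \<Longrightarrow> T \<in> Obj C \<Longrightarrow> Ext_zero C i F (Rep C T)"
    and "pdim C F \<le> enat (Suc n)" by (auto simp: ex_cat_def in_mod_cmodule)
  then obtain P d \<epsilon> where R: "projective_resolution C P d \<epsilon> F" and z: "\<And>i. i > Suc n \<Longrightarrow> zero_mod C (P i)"
    unfolding pdim_le_iff by blast
  have "\<forall>i. \<exists>Yy. represents C (P i) (fst Yy) (snd Yy)"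
    using R projective_represents unfolding projective_resolution_def by simp
  then obtain Yy where Yy: "\<And>i. represents C (P i) (fst (Yy i)) (snd (Yy i))" by metis
  have Res: "resolution C P d \<epsilon> F" using R by (simp add: projective_resolution_def)
  obtain X x where X: "rres C X x F" "ob X = (\<lambda>i. fst (Yy i))"
    using resolution_rres[OF Res Yy Fc] by auto
  have aX: "acyc C X" and pX: "presents C (df X (Suc 0)) x F" using X by (auto simp: rres_def)
  have "n_exact C n X"
  proof (rule n_exact_acyc[OF aX])
    fix i assume "i > Suc n" then show "zero_object C (ob X i)" using zero_mod_represents[OF Yy] z X(2) by simp
  next
    fix i T assume "i \<le> n" "T \<in> Obj C" then show "coh C X T i" using E Ext_zero_iff[OF X(1)] by blast
  qed
  then show "\<exists>X x. n_exact C n X \<and> presents C (df X (Suc 0)) x F" using pX by blast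
next
  assume "\<exists>X x. n_exact C n X \<and> presents C (df X (Suc 0)) x F"
  then obtain X0 x where X0: "n_exact C n X0" "presents C (df X0 (Suc 0)) x F" by blast
  obtain X where X: "rres C X x F" and z: "\<And>i. i > Suc n \<Longrightarrow> zero_object C (ob X i)"
    and c: "\<And>i T. i \<le> n \<Longrightarrow> T \<in> Obj C \<Longrightarrow> coh C X T i"
    using n_exact_rres[OF X0] by metis
  have aX: "acyc C X" using X by (simp add: rres_def)
  note S = represents_ssub[OF acyc_ob[OF aX]]
  obtain d \<epsilon> where "resolution C (\<lambda>i. ssub C (ob X i) (\<lambda>_. True)) d \<epsilon> F"
    using rres_resolution[OF X S] by blast
  then have "projective_resolution C (\<lambda>i. ssub C (ob X i) (\<lambda>_. True)) d \<epsilon> F"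
    using represents_projective[OF S] by (simp add: projective_resolution_def)
  moreover have "zero_mod C (ssub C (ob X i) (\<lambda>_. True))" if "i > Suc n" for i
    using zero_mod_represents[OF S] z[OF that] by blast
  ultimately have "pdim C F \<le> enat (n + 1)" unfolding pdim_le_iff by auto
  then show "F \<in> ex_cat C n" using rres_in_mod[OF X] c Ext_zero_iff[OF X] by (simp add: ex_cat_def)
qed

end

section \<open>Changing the first terms of a resolution\<close>

context preadditive_category
begin

lemma acycI:
  assumes "\<And>i. ar C (df X (Suc i)) (ob X (Suc i)) (ob X i)"
    and "\<And>i. df X (Suc i) \<cdot> df X (Suc (Suc i)) = zr C (ob X (Suc (Suc i))) (ob X i)"
    and "\<And>i h Y. ar C h Y (ob X (Suc i)) \<Longrightarrow> df X (Suc i) \<cdot> h = zr C Y (ob X i) \<Longrightarrow>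
      \<exists>k. ar C k Y (ob X (Suc (Suc i))) \<and> h = df X (Suc (Suc i)) \<cdot> k"
  shows "acyc C X"
  using assms unfolding acyc_def by blast

lemma presentsI:
  assumes "Ar C v" "gen C M (Cod C v) x"
    and "\<And>k Y. ar C k Y (Dom C v) \<Longrightarrow> Act M (v \<cdot> k) x = \<one>\<^bsub>Val M Y\<^esub>"
    and "\<And>h Y. ar C h Y (Cod C v) \<Longrightarrow> Act M h x = \<one>\<^bsub>Val M Y\<^esub> \<Longrightarrow> \<exists>k. ar C k Y (Dom C v) \<and> h = v \<cdot> k"
  shows "presents C v x M"
  unfolding presents_def
proof (intro conjI allI impI iffI)
  fix h assume h: "Ar C h \<and> Cod C h = Cod C v"
  { assume "Act M h x = \<one>\<^bsub>Val M (Dom C h)\<^esub>"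
    then show "\<exists>k. ar C k (Dom C h) (Dom C v) \<and> h = v \<cdot> k" using assms(4)[of h "Dom C h"] h by blast }
  { assume "\<exists>k. ar C k (Dom C h) (Dom C v) \<and> h = v \<cdot> k"
    then show "Act M h x = \<one>\<^bsub>Val M (Dom C h)\<^esub>" using assms(3) by blast }
qed (use assms in blast)+

lemma biproductD:
  assumes "biproduct C A B W i1 i2 p1 p2"
  shows "A \<in> Obj C" "B \<in> Obj C" "W \<in> Obj C" "ar C i1 A W" "ar C i2 B W" "ar C p1 W A" "ar C p2 W B"
    "p1 \<cdot> i1 = Idn C A" "p2 \<cdot> i2 = Idn C B" "p1 \<cdot> i2 = zr C B A" "p2 \<cdot> i1 = zr C A B"
    "i1 \<cdot> p1 \<boxplus> i2 \<cdot> p2 = Idn C W"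
proof -
  have *: "A \<in> Obj C" "B \<in> Obj C" "W \<in> Obj C" "i1 \<in> homs C A W" "i2 \<in> homs C B W" "p1 \<in> homs C W A" "p2 \<in> homs C W B"
    "p1 \<cdot> i1 = Idn C A" "p2 \<cdot> i2 = Idn C B" "p1 \<cdot> i2 = zr C B A" "p2 \<cdot> i1 = zr C A B"
    "i1 \<cdot> p1 \<otimes>\<^bsub>Hom C W W\<^esub> i2 \<cdot> p2 = Idn C W"
    using assms by (auto simp: biproduct_def zr_def)
  then show **: "A \<in> Obj C" "B \<in> Obj C" "W \<in> Obj C" "ar C i1 A W" "ar C i2 B W" "ar C p1 W A" "ar C p2 W B"
    "p1 \<cdot> i1 = Idn C A" "p2 \<cdot> i2 = Idn C B" "p1 \<cdot> i2 = zr C B A" "p2 \<cdot> i1 = zr C A B"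
    using homs_iff by simp_all
  show "i1 \<cdot> p1 \<boxplus> i2 \<cdot> p2 = Idn C W" using *(12) mult_eq_add[of "i1 \<cdot> p1" W W] ** by simp
qed

lemma biproduct_cmp:
  assumes b: "biproduct C A B W i1 i2 p1 p2" and h: "Ar C h"
  shows "Cod C h = A \<Longrightarrow> p1 \<cdot> i1 \<cdot> h = h" "Cod C h = B \<Longrightarrow> p2 \<cdot> i2 \<cdot> h = h"
    "Cod C h = B \<Longrightarrow> p1 \<cdot> i2 \<cdot> h = zr C (Dom C h) A" "Cod C h = A \<Longrightarrow> p2 \<cdot> i1 \<cdot> h = zr C (Dom C h) B"
proof -
  note D = biproductD[OF b]
  note [simp] = D(1-7)
  show "Cod C h = A \<Longrightarrow> p1 \<cdot> i1 \<cdot> h = h" using cmp_eq1[OF D(8), of h] h by simp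
  show "Cod C h = B \<Longrightarrow> p2 \<cdot> i2 \<cdot> h = h" using cmp_eq1[OF D(9), of h] h by simp
  show "Cod C h = B \<Longrightarrow> p1 \<cdot> i2 \<cdot> h = zr C (Dom C h) A" using cmp_eq1[OF D(10), of h] h by simp
  show "Cod C h = A \<Longrightarrow> p2 \<cdot> i1 \<cdot> h = zr C (Dom C h) B" using cmp_eq1[OF D(11), of h] h by simp
qed

lemma biproduct_split:
  assumes b: "biproduct C A B W i1 i2 p1 p2" and h: "ar C h Y W"
  shows "i1 \<cdot> p1 \<cdot> h \<boxplus> i2 \<cdot> p2 \<cdot> h = h"
proof -
  note D = biproductD[OF b]
  note [simp] = D(1-7)
  have "(i1 \<cdot> p1 \<boxplus> i2 \<cdot> p2) \<cdot> h = h" unfolding D(12) using h by simp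
  then show ?thesis using h by simp
qed

lemma sub_swap: "Ar C a \<Longrightarrow> Ar C b \<Longrightarrow> Dom C b = Dom C a \<Longrightarrow> Cod C b = Cod C a \<Longrightarrow>
  (a \<boxminus> b) \<boxplus> (b \<boxminus> a) = zr C (Dom C a) (Cod C a)"
proof -
  assume *: "Ar C a" "Ar C b" "Dom C b = Dom C a" "Cod C b = Cod C a"
  have "((a \<boxminus> b) \<boxplus> (b \<boxminus> a)) \<boxplus> a = (a \<boxminus> b) \<boxplus> ((b \<boxminus> a) \<boxplus> a)" using * by (simp add: add_assoc del: sub_add)
  also have "\<dots> = zr C (Dom C a) (Cod C a) \<boxplus> a" using * by simp
  finally show ?thesis using add_cancel[of a "(a \<boxminus> b) \<boxplus> (b \<boxminus> a)" "zr C (Dom C a) (Cod C a)"] * by simp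
qed

lemma add_eq_zrD: "Ar C a \<Longrightarrow> Ar C b \<Longrightarrow> Ar C c \<Longrightarrow> Dom C b = Dom C a \<Longrightarrow> Cod C b = Cod C a \<Longrightarrow>
  Dom C c = Dom C a \<Longrightarrow> Cod C c = Cod C a \<Longrightarrow> Dom C a = X \<Longrightarrow> Cod C a = Y \<Longrightarrow>
  a \<boxplus> (b \<boxminus> c) = zr C X Y \<Longrightarrow> b = c \<boxminus> a"
proof -
  assume *: "Ar C a" "Ar C b" "Ar C c" "Dom C b = Dom C a" "Cod C b = Cod C a"
    "Dom C c = Dom C a" "Cod C c = Cod C a" "Dom C a = X" "Cod C a = Y" "a \<boxplus> (b \<boxminus> c) = zr C X Y"
  have "c = (a \<boxplus> (b \<boxminus> c)) \<boxplus> c" unfolding *(10) using * by simp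
  also have "\<dots> = a \<boxplus> b" using *(1-9) by (simp add: add_assoc)
  finally have "c = a \<boxplus> b" .
  then show "b = c \<boxminus> a" using * by simp
qed

end

context additive_category
begin

text \<open>Schanuel's lemma in explicit form. If K and L are the kernels of C(-, X_0) \<rightarrow>
  F and C(-, B) \<rightarrow> F, then K + C(-, B) and L + C(-, X_0) are isomorphic, so X_1 + B
  covers L, and the kernel of this cover is an extension of C(-, X_0) by the kernel of C(-, X_1)
  \<rightarrow> K. The new complex is ... X_4, X_3, X_0 + X_2, X_1 + B, B.\<close>

lemma rres_change_generator:
  assumes X: "rres C X x F" and b: "gen C F B b"
  shows "\<exists>X'. rres C X' b F \<and> ob X' 0 = B"
proof -
  have aX: "acyc C X" and pX: "presents C (df X (Suc 0)) x F" using X by (auto simp: rres_def)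
  note [simp] = acycD[OF aX] acyc_ob[OF aX]
  have gX: "gen C F (ob X 0) x" using presents_gen[OF pX] by simp
  note FD = genD[OF gX] and BD = genD[OF b]
  note [simp] = BD(2)
  obtain \<phi> where \<phi>: "ar C \<phi> B (ob X 0)" "b = Act F \<phi> x" using genE[OF gX BD(3,2)] .
  obtain \<psi> where \<psi>: "ar C \<psi> (ob X 0) B" "x = Act F \<psi> b" using genE[OF b FD(3,2)] .
  note [simp] = \<phi>(1) \<psi>(1)
  let ?d0 = "df X (Suc 0)" and ?d1 = "df X (Suc (Suc 0))" and ?d2 = "df X (Suc (Suc (Suc 0)))"
  have "Act F (\<phi> \<cdot> \<psi>) x = x" using \<phi> \<psi> FD by (simp add: Act_cmp)
  then have "Act F (\<phi> \<cdot> \<psi> \<boxminus> Idn C (ob X 0)) x = \<one>\<^bsub>Val F (ob X 0)\<^esub>" using FD by (simp add: Act_sub Act_Idn)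
  then obtain \<tau> where \<tau>: "ar C \<tau> (ob X 0) (ob X (Suc 0))" "\<phi> \<cdot> \<psi> \<boxminus> Idn C (ob X 0) = ?d0 \<cdot> \<tau>"
    using presentsE[OF pX, of "\<phi> \<cdot> \<psi> \<boxminus> Idn C (ob X 0)" "ob X 0"] by auto
  note [simp] = \<tau>(1)
  have \<tau>h: "?d0 \<cdot> \<tau> \<cdot> h = \<phi> \<cdot> \<psi> \<cdot> h \<boxminus> h" if "ar C h Y (ob X 0)" for h Y
    using cmp_eq1[OF \<tau>(2)[symmetric], of h] that by simp
  obtain W1 i1 i2 p1 p2 where W1: "biproduct C (ob X (Suc 0)) B W1 i1 i2 p1 p2"
    using has_biproducts[of "ob X (Suc 0)" B] by auto
  obtain W2 j1 j2 q1 q2 where W2: "biproduct C (ob X 0) (ob X (Suc (Suc 0))) W2 j1 j2 q1 q2"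
    using has_biproducts[of "ob X 0" "ob X (Suc (Suc 0))"] by auto
  note [simp] = biproductD(1-11)[OF W1] biproductD(1-11)[OF W2] biproduct_cmp[OF W1] biproduct_cmp[OF W2]
  \<comment> \<open>Here \<phi> and \<psi> translate between the two generators and \<tau> satisfies
    d \<tau> = \<phi> \<psi> - 1. In matrix form w1 = [\<psi> d, 1 - \<psi> \<phi>], w2 has rows
    (\<tau>, d) and (\<psi>, 0), and w3 is the old differential into the second summand. The product
    w1 w2 vanishes because d \<tau> compensates \<phi> \<psi> - 1.\<close>
  define w1 where "w1 = \<psi> \<cdot> ?d0 \<cdot> p1 \<boxplus> (Idn C B \<boxminus> \<psi> \<cdot> \<phi>) \<cdot> p2"
  define w2 where "w2 = i1 \<cdot> (\<tau> \<cdot> q1 \<boxplus> ?d1 \<cdot> q2) \<boxplus> i2 \<cdot> \<psi> \<cdot> q1"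
  define w3 where "w3 = j2 \<cdot> ?d2"
  have w[simp]: "ar C w1 W1 B" "ar C w2 W2 W1" "ar C w3 (ob X (Suc (Suc (Suc 0)))) W2"
    by (simp_all add: w1_def w2_def w3_def)
  have w1h: "w1 \<cdot> h = \<psi> \<cdot> ?d0 \<cdot> p1 \<cdot> h \<boxplus> (p2 \<cdot> h \<boxminus> \<psi> \<cdot> \<phi> \<cdot> p2 \<cdot> h)" if "ar C h Y W1" for h Y
    using that by (simp add: w1_def)
  have w2p: "p1 \<cdot> w2 \<cdot> h = \<tau> \<cdot> q1 \<cdot> h \<boxplus> ?d1 \<cdot> q2 \<cdot> h" "p2 \<cdot> w2 \<cdot> h = \<psi> \<cdot> q1 \<cdot> h" if "ar C h Y W2" for h Y
    using that ArD(1)[of h] by (simp_all add: w2_def add_assoc[symmetric])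
  have w12: "w1 \<cdot> w2 \<cdot> h = zr C Y B" if h: "ar C h Y W2" for h Y
  proof -
    have YO: "Y \<in> Obj C" using h by auto
    have "w1 \<cdot> w2 \<cdot> h = \<psi> \<cdot> ?d0 \<cdot> (\<tau> \<cdot> q1 \<cdot> h \<boxplus> ?d1 \<cdot> q2 \<cdot> h) \<boxplus> (\<psi> \<cdot> q1 \<cdot> h \<boxminus> \<psi> \<cdot> \<phi> \<cdot> \<psi> \<cdot> q1 \<cdot> h)"
      using w1h[of "w2 \<cdot> h" Y] h w2p[OF h] by simp
    also have "\<dots> = (\<psi> \<cdot> \<phi> \<cdot> \<psi> \<cdot> q1 \<cdot> h \<boxminus> \<psi> \<cdot> q1 \<cdot> h) \<boxplus> (\<psi> \<cdot> q1 \<cdot> h \<boxminus> \<psi> \<cdot> \<phi> \<cdot> \<psi> \<cdot> q1 \<cdot> h)"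
      using h YO \<tau>h[of "q1 \<cdot> h" Y] acyc_dd[OF aX, of "q2 \<cdot> h" 0] by simp
    also have "\<dots> = zr C Y B" using h by (subst sub_swap) simp_all
    finally show ?thesis .
  qed
  define Y where "Y = \<lparr>ob = (\<lambda>i. if i = 0 then B else if i = 1 then W1 else if i = 2 then W2 else ob X i),
    df = (\<lambda>i. if i = 1 then w1 else if i = 2 then w2 else if i = 3 then w3 else df X i)\<rparr>"
  have Y0: "ob Y 0 = B" "ob Y (Suc 0) = W1" "ob Y (Suc (Suc 0)) = W2" "ob Y (Suc (Suc (Suc i))) = ob X (Suc (Suc (Suc i)))"
    "df Y (Suc 0) = w1" "df Y (Suc (Suc 0)) = w2" "df Y (Suc (Suc (Suc 0))) = w3"
    "df Y (Suc (Suc (Suc (Suc i)))) = df X (Suc (Suc (Suc (Suc i))))" for i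
    by (auto simp: Y_def)
  have c3: "\<And>i. P (Suc (Suc (Suc i))) \<Longrightarrow> P 0 \<Longrightarrow> P (Suc 0) \<Longrightarrow> P (Suc (Suc 0)) \<Longrightarrow> P j" if "\<And>i. P (Suc (Suc (Suc i)))" for P :: "nat \<Rightarrow> bool" and j
    using that by (metis not0_implies_Suc)
  have "acyc C Y"
  proof (rule acycI)
    fix i show "ar C (df Y (Suc i)) (ob Y (Suc i)) (ob Y i)"
      by (rule c3[of _ 0 i]) (simp_all add: Y0)
  next
    fix i show "df Y (Suc i) \<cdot> df Y (Suc (Suc i)) = zr C (ob Y (Suc (Suc i))) (ob Y i)"
    proof (rule c3[of _ 0 i])
      show "df Y (Suc 0) \<cdot> df Y (Suc (Suc 0)) = zr C (ob Y (Suc (Suc 0))) (ob Y 0)"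
        using w12[of "Idn C W2" W2] by (simp add: Y0)
      show "df Y (Suc (Suc 0)) \<cdot> df Y (Suc (Suc (Suc 0))) = zr C (ob Y (Suc (Suc (Suc 0)))) (ob Y (Suc 0))"
        by (simp add: Y0 w2_def w3_def)
      show "df Y (Suc (Suc (Suc 0))) \<cdot> df Y (Suc (Suc (Suc (Suc 0)))) = zr C (ob Y (Suc (Suc (Suc (Suc 0))))) (ob Y (Suc (Suc 0)))"
        by (simp add: Y0 w3_def)
    qed (simp_all add: Y0)
  next
    fix i h T assume h: "ar C h T (ob Y (Suc i))" "df Y (Suc i) \<cdot> h = zr C T (ob Y i)"
    then have TO: "T \<in> Obj C" by auto
    consider "i = 0" | "i = Suc 0" | "i = Suc (Suc 0)" | j where "i = Suc (Suc (Suc j))" by (metis not0_implies_Suc)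
    then show "\<exists>k. ar C k T (ob Y (Suc (Suc i))) \<and> h = df Y (Suc (Suc i)) \<cdot> k"
    proof cases
      case 1
      then have h1: "ar C h T W1" "w1 \<cdot> h = zr C T B" using h by (simp_all add: Y0)
      let ?a = "p1 \<cdot> h" and ?b = "p2 \<cdot> h"
      have eb: "?b = \<psi> \<cdot> \<phi> \<cdot> ?b \<boxminus> \<psi> \<cdot> ?d0 \<cdot> ?a"
        by (rule add_eq_zrD[of _ _ _ T B]) (use h1 w1h[OF h1(1)] in simp_all)
      \<comment> \<open>This will be the X_0 component of the preimage under w2: the equation w1 h =
        0 says that the B component of h equals \<psi> applied to it.\<close>
      let ?c = "\<phi> \<cdot> ?b \<boxminus> ?d0 \<cdot> ?a"
      have c: "ar C ?c T (ob X 0)" using h1 by simp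
      have bc: "?b = \<psi> \<cdot> ?c" using eb h1 by simp
      have "?d0 \<cdot> \<tau> \<cdot> ?c = \<phi> \<cdot> \<psi> \<cdot> ?c \<boxminus> ?c" by (rule \<tau>h[OF c])
      also have "\<dots> = \<phi> \<cdot> ?b \<boxminus> ?c" by (simp only: bc[symmetric])
      also have "\<dots> = ?d0 \<cdot> ?a"
        using h1 by (subst sub_eq_iff) simp_all
      finally have "?d0 \<cdot> (?a \<boxminus> \<tau> \<cdot> ?c) = zr C T (ob X 0)" using h1 by simp
      then obtain z where z: "ar C z T (ob X (Suc (Suc 0)))" "?a \<boxminus> \<tau> \<cdot> ?c = ?d1 \<cdot> z"
        using acycE[OF aX, of "?a \<boxminus> \<tau> \<cdot> ?c" T 0] h1 by auto
      have az: "?a = \<tau> \<cdot> ?c \<boxplus> ?d1 \<cdot> z" using iffD1[OF sub_eq_iff z(2)] add_comm[of "\<tau> \<cdot> ?c" "?d1 \<cdot> z"] h1 z(1) by simp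
      let ?l = "j1 \<cdot> ?c \<boxplus> j2 \<cdot> z"
      have l: "ar C ?l T W2" using c z(1) by simp
      have ql: "q1 \<cdot> ?l = ?c" "q2 \<cdot> ?l = z" using c z(1) by simp_all
      have "w2 \<cdot> ?l = i1 \<cdot> (\<tau> \<cdot> q1 \<cdot> ?l \<boxplus> ?d1 \<cdot> q2 \<cdot> ?l) \<boxplus> i2 \<cdot> \<psi> \<cdot> q1 \<cdot> ?l"
        using l by (simp add: w2_def)
      also have "\<dots> = i1 \<cdot> ?a \<boxplus> i2 \<cdot> ?b" unfolding ql by (simp only: az[symmetric] bc[symmetric])
      also have "\<dots> = h" by (rule biproduct_split[OF W1 h1(1)])
      finally show ?thesis using 1 l by (intro exI[of _ ?l]) (simp add: Y0)
    next
      case 2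
      then have h1: "ar C h T W2" "w2 \<cdot> h = zr C T W1" using h by (simp_all add: Y0)
      let ?c = "q1 \<cdot> h" and ?z = "q2 \<cdot> h"
      have "p1 \<cdot> w2 \<cdot> h = zr C T (ob X (Suc 0))" "p2 \<cdot> w2 \<cdot> h = zr C T B" using h1 TO by simp_all
      then have e: "\<tau> \<cdot> ?c \<boxplus> ?d1 \<cdot> ?z = zr C T (ob X (Suc 0))" "\<psi> \<cdot> ?c = zr C T B" using w2p[OF h1(1)] by simp_all
      have "zr C T (ob X 0) = ?d0 \<cdot> (\<tau> \<cdot> ?c \<boxplus> ?d1 \<cdot> ?z)" unfolding e(1) using TO by simp
      also have "\<dots> = \<phi> \<cdot> \<psi> \<cdot> ?c \<boxminus> ?c" using h1 \<tau>h[of ?c T] acyc_dd[OF aX, of ?z 0] by simp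
      also have "\<dots> = zr C T (ob X 0) \<boxminus> ?c" unfolding e(2) using TO by simp
      finally have "zr C T (ob X 0) \<boxminus> ?c = zr C T (ob X 0)" by (rule sym)
      then have "zr C T (ob X 0) = ?c" by (subst (asm) sub_eq_zr) (use h1 TO in simp_all)
      then have c: "?c = zr C T (ob X 0)" by (rule sym)
      have "?d1 \<cdot> ?z = zr C T (ob X (Suc 0))" using e(1) h1 TO unfolding c by simp
      then obtain u where u: "ar C u T (ob X (Suc (Suc (Suc 0))))" "?z = ?d2 \<cdot> u"
        using acycE[OF aX, of ?z T "Suc 0"] h1 by auto
      have "h = j1 \<cdot> ?c \<boxplus> j2 \<cdot> ?z" using biproduct_split[OF W2 h1(1)] by simp
      also have "\<dots> = w3 \<cdot> u" unfolding c u(2) using u(1) TO by (simp add: w3_def)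
      finally show ?thesis using 2 u(1) by (intro exI[of _ u]) (simp add: Y0)
    next
      case 3
      then have h1: "ar C h T (ob X (Suc (Suc (Suc 0))))" "w3 \<cdot> h = zr C T W2" using h by (simp_all add: Y0)
      have "q2 \<cdot> w3 \<cdot> h = zr C T (ob X (Suc (Suc 0)))" using h1 TO by simp
      then have "?d2 \<cdot> h = zr C T (ob X (Suc (Suc 0)))" using h1(1) by (simp add: w3_def)
      then show ?thesis using acycE[OF aX h1(1)] 3 by (metis Y0(4,8))
    next
      case 4
      then have "ar C h T (ob X (Suc i))" "df X (Suc i) \<cdot> h = zr C T (ob X i)" using h by (simp_all add: Y0)
      then show ?thesis using acycE[OF aX, of h T i] 4 by (metis Y0(4,8))
    qed
  qed
  moreover have "presents C (df Y (Suc 0)) b F"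
  proof (rule presentsI)
    have 1: "Act F (\<psi> \<cdot> ?d0 \<cdot> p1) b = \<one>\<^bsub>Val F W1\<^esub>"
      using presents_rel[OF pX] FD BD by (simp add: Act_cmp Act_one \<psi>(2)[symmetric])
    have 2: "Act F (Idn C B \<boxminus> \<psi> \<cdot> \<phi>) b = \<one>\<^bsub>Val F B\<^esub>"
    proof -
      have "Act F (\<psi> \<cdot> \<phi>) b = b" using FD BD by (simp add: Act_cmp \<psi>(2)[symmetric] \<phi>(2)[symmetric])
      then show ?thesis using BD by (simp add: Act_sub Act_Idn)
    qed
    have "Act F w1 b = Act F (\<psi> \<cdot> ?d0 \<cdot> p1) b \<otimes>\<^bsub>Val F W1\<^esub> Act F ((Idn C B \<boxminus> \<psi> \<cdot> \<phi>) \<cdot> p2) b"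
      unfolding w1_def using FD BD by (subst Act_add) simp_all
    also have "Act F ((Idn C B \<boxminus> \<psi> \<cdot> \<phi>) \<cdot> p2) b = Act F p2 (Act F (Idn C B \<boxminus> \<psi> \<cdot> \<phi>) b)"
      by (rule Act_cmp) (use FD BD in simp_all)
    also have "\<dots> = \<one>\<^bsub>Val F W1\<^esub>" unfolding 2 using FD by (simp add: Act_one)
    finally have w1b: "Act F w1 b = \<one>\<^bsub>Val F W1\<^esub>"
      using comm_groupE(5)[OF Val_grp[OF FD(1), of W1]] comm_groupE(2)[OF Val_grp[OF FD(1), of W1]] by (simp add: 1)
    show "Act F (df Y (Suc 0) \<cdot> k) b = \<one>\<^bsub>Val F T\<^esub>" if "ar C k T (Dom C (df Y (Suc 0)))" for k T
      using that FD BD w1b by (simp add: Y0 Act_cmp Act_one)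
    fix h T assume h: "ar C h T (Cod C (df Y (Suc 0)))" "Act F h b = \<one>\<^bsub>Val F T\<^esub>"
    then have hT: "ar C h T B" by (simp add: Y0)
    have "Act F (\<phi> \<cdot> h) x = \<one>\<^bsub>Val F T\<^esub>" using h(2) hT FD \<phi>(2) by (simp add: Act_cmp)
    then obtain k where k: "ar C k T (ob X (Suc 0))" "\<phi> \<cdot> h = ?d0 \<cdot> k"
      using presentsE[OF pX, of "\<phi> \<cdot> h" T] hT by auto
    let ?l = "i1 \<cdot> k \<boxplus> i2 \<cdot> h"
    have l: "ar C ?l T W1" "p1 \<cdot> ?l = k" "p2 \<cdot> ?l = h" using k(1) hT by simp_all
    have "w1 \<cdot> ?l = \<psi> \<cdot> \<phi> \<cdot> h \<boxplus> (h \<boxminus> \<psi> \<cdot> \<phi> \<cdot> h)" unfolding w1h[OF l(1)] l(2,3) by (simp only: k(2))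
    also have "\<dots> = h" using hT by simp
    finally show "\<exists>k. ar C k T (Dom C (df Y (Suc 0))) \<and> h = df Y (Suc 0) \<cdot> k" using l(1) by (intro exI[of _ ?l]) (simp add: Y0)
  qed (use b in \<open>simp_all add: Y0\<close>)
  ultimately show ?thesis using Y0(1) by (auto simp: rres_def)
qed

text \<open>Two changes of generator. The first makes the resolution start with the codomain B of
  \<open>v\<close>; the second is applied to the kernel of C(-, B) \<rightarrow> F, which
  \<open>v\<close> generates. Splicing the second resolution after \<open>v\<close> gives the
  result.\<close>

lemma presents_rres:
  assumes X: "rres C X x F" and v: "presents C v b F"
  shows "\<exists>Y. rres C Y b F \<and> df Y (Suc 0) = v"
proof -
  have vA: "Ar C v" using v by (simp add: presents_def)
  note [simp] = vA
  define B A where "B = Cod C v" and "A = Dom C v"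
  have vB: "ar C v A B" by (simp add: A_def B_def)
  have gb: "gen C F B b" using presents_gen[OF v] by (simp add: B_def)
  obtain X' where X': "rres C X' b F" "ob X' 0 = B" using rres_change_generator[OF X gb] by blast
  define S where "S = (\<lambda>h. Act F h b = \<one>\<^bsub>Val F (Dom C h)\<^esub>)"
  let ?K = "ssub C B S"
  have K: "rres C (tail X') {df X' (Suc 0)} ?K" using kernel_rres[OF X'(1)] X'(2) unfolding S_def by simp
  have Kc: "cmodule C ?K" using K genD(1)[OF presents_gen] by (auto simp: rres_def)
  have SI: "S h \<longleftrightarrow> (\<exists>k. ar C k Y A \<and> h = v \<cdot> k)" if "ar C h Y B" for h Y
    using presents_iff[OF v, of h] that vB unfolding S_def by simp
  have Sv: "S v" using SI[OF vB] vB by (metis ArD(1) Idn_ar idr)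
  have "gen C ?K A {v}" unfolding gen_def
  proof (intro conjI ballI)
    fix Y m assume "Y \<in> Obj C" "m \<in> carrier (Val ?K Y)"
    then obtain h where h: "m = {h}" "ar C h Y B" "S h" by auto
    obtain k where k: "ar C k Y A" "h = v \<cdot> k" using SI[OF h(2)] h(3) by blast
    then show "\<exists>h. ar C h Y A \<and> m = Act ?K h {v}" unfolding h(1) ssub_simps(4) by blast
  qed (use Kc vB Sv in \<open>auto simp: A_def\<close>)
  then obtain Y where Y: "rres C Y {v} ?K" "ob Y 0 = A" using rres_change_generator[OF K] by blast
  have aY: "acyc C Y" and pY: "presents C (df Y (Suc 0)) {v} ?K" using Y by (auto simp: rres_def)
  define R where "R = \<lparr>ob = (\<lambda>i. if i = 0 then B else ob Y (i - 1)), df = (\<lambda>i. if i = 1 then v else df Y (i - 1))\<rparr>"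
  have R: "ob R 0 = B" "ob R (Suc i) = ob Y i" "df R (Suc 0) = v" "df R (Suc (Suc i)) = df Y (Suc i)" for i
    by (auto simp: R_def)
  note [simp] = acycD[OF aY] acyc_ob[OF aY]
  have vz: "{v \<cdot> h} = \<one>\<^bsub>Val ?K T\<^esub> \<longleftrightarrow> v \<cdot> h = zr C T B" for h T by simp
  have "acyc C R"
  proof (rule acycI)
    fix i show "ar C (df R (Suc i)) (ob R (Suc i)) (ob R i)" using vB Y(2) by (cases i) (simp_all add: R)
    show "df R (Suc i) \<cdot> df R (Suc (Suc i)) = zr C (ob R (Suc (Suc i))) (ob R i)"
    proof (cases i)
      case 0
      have "Act ?K (df Y (Suc 0)) {v} = \<one>\<^bsub>Val ?K (ob Y (Suc 0))\<^esub>" using presents_rel[OF pY] by simp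
      then show ?thesis using 0 by (simp add: R)
    qed (simp add: R)
    fix h T assume h: "ar C h T (ob R (Suc i))" "df R (Suc i) \<cdot> h = zr C T (ob R i)"
    show "\<exists>k. ar C k T (ob R (Suc (Suc i))) \<and> h = df R (Suc (Suc i)) \<cdot> k"
    proof (cases i)
      case 0
      then have h1: "ar C h T (Cod C (df Y (Suc 0)))" "v \<cdot> h = zr C T B" using h by (simp_all add: R)
      then have "Act ?K h {v} = \<one>\<^bsub>Val ?K T\<^esub>" by simp
      then obtain k where "ar C k T (ob Y (Suc 0))" "h = df Y (Suc 0) \<cdot> k" using presentsE[OF pY h1(1)] by auto
      then show ?thesis using 0 by (auto simp: R)
    next
      case (Suc j)
      then have h1: "ar C h T (ob Y (Suc j))" "df Y (Suc j) \<cdot> h = zr C T (ob Y j)" using h by (simp_all add: R)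
      show ?thesis using acycE[OF aY h1] Suc by (metis R(2,4))
    qed
  qed
  then show ?thesis using v R(3) by (intro exI[of _ R]) (simp add: rres_def)
qed

end

context idempotent_complete_additive_category
begin

text \<open>The resolution \<open>Y\<close> starting with \<open>v\<close> may be too long, but
  comparison with the resolution that vanishes beyond n + 1 makes its identity in degree n + 2
  null-homotopic. So the differential \<delta> of degree n + 2 satisfies \<delta> \<sigma> \<delta>
  = \<delta>, its image is cut out by the idempotent \<delta> \<sigma>, and Y_{n+1} can be replaced
  by a complement of that image. Contravariant exactness is inherited through
  \<open>coh_transfer\<close>.\<close>

lemma presents_n_exact:
  assumes n: "n > 0" and X0: "n_exact C n X0" "presents C (df X0 (Suc 0)) x F" and v: "presents C v b F"
  shows "\<exists>Y. n_exact C n Y \<and> df Y (Suc 0) = v"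
proof -
  obtain X where X: "rres C X x F" and Xz: "\<And>i. i > Suc n \<Longrightarrow> zero_object C (ob X i)"
    and Xc: "\<And>i T. i \<le> n \<Longrightarrow> T \<in> Obj C \<Longrightarrow> coh C X T i"
    using n_exact_rres[OF X0] by metis
  obtain Y where Y: "rres C Y b F" "df Y (Suc 0) = v" using presents_rres[OF X v] by blast
  have aX: "acyc C X" and aY: "acyc C Y" using X Y by (auto simp: rres_def)
  obtain f g s where f: "chain C Y X f" and g: "chain C X Y g" and s: "\<And>i. ar C (s i) (ob Y i) (ob Y (Suc i))"
    and h: "\<And>i. g (Suc i) \<cdot> f (Suc i) = Idn C (ob Y (Suc i)) \<boxplus> (df Y (Suc (Suc i)) \<cdot> s (Suc i) \<boxplus> s i \<cdot> df Y (Suc i))"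
    using comparison[OF Y(1) X] by metis
  note [simp] = acycD[OF aY] acyc_ob[OF aY] acyc_ob[OF aX] chainD(1-3)[OF f] chainD(1-3)[OF g] s
  obtain m where m: "n = Suc m" using n by (cases n) auto
  let ?M = "Suc n"
  let ?\<delta> = "df Y (Suc ?M)"
  define \<sigma> where "\<sigma> = neg C (s ?M)"
  have \<sigma>[simp]: "ar C \<sigma> (ob Y ?M) (ob Y (Suc ?M))" by (simp add: \<sigma>_def)
  have "f (Suc ?M) = zr C (ob Y (Suc ?M)) (ob X (Suc ?M))" using zero_objectD(3)[OF Xz, of "Suc ?M" "f (Suc ?M)"] by simp
  \<comment> \<open>The composite through X_{n+2} is zero; composing this equation with \<delta> on
    the left removes the term with two differentials and leaves \<delta> + \<delta> s \<delta> = 0.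
    This accounts for the sign in \<sigma>.\<close>
  then have z: "Idn C (ob Y (Suc ?M)) \<boxplus> (df Y (Suc (Suc ?M)) \<cdot> s (Suc ?M) \<boxplus> s ?M \<cdot> ?\<delta>) = zr C (ob Y (Suc ?M)) (ob Y (Suc ?M))"
    using h[of ?M] by simp
  have "?\<delta> \<cdot> (Idn C (ob Y (Suc ?M)) \<boxplus> (df Y (Suc (Suc ?M)) \<cdot> s (Suc ?M) \<boxplus> s ?M \<cdot> ?\<delta>)) = ?\<delta> \<boxplus> ?\<delta> \<cdot> s ?M \<cdot> ?\<delta>"
    using acyc_dd[OF aY, of "s (Suc ?M)" ?M] by simp
  then have "?\<delta> \<boxplus> ?\<delta> \<cdot> s ?M \<cdot> ?\<delta> = zr C (ob Y (Suc ?M)) (ob Y ?M)" unfolding z by simp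
  then have "neg C (?\<delta> \<cdot> s ?M \<cdot> ?\<delta>) = ?\<delta>" by (intro neg_unique) simp_all
  then have \<delta>: "?\<delta> \<cdot> \<sigma> \<cdot> ?\<delta> = ?\<delta>" by (simp add: \<sigma>_def)
  define e where "e = ?\<delta> \<cdot> \<sigma>"
  have e[simp]: "ar C e (ob Y ?M) (ob Y ?M)" by (simp add: e_def)
  have e\<delta>: "e \<cdot> ?\<delta> = ?\<delta>" by (simp add: e_def \<delta>)
  have ee: "e \<cdot> e = e" using cmp_eq1[OF e\<delta>, of \<sigma>] by (simp add: e_def)
  let ?I = "Idn C (ob Y ?M)"
  have "(?I \<boxminus> e) \<cdot> (?I \<boxminus> e) = ?I \<boxminus> e" by (simp add: ee)
  moreover have "?I \<boxminus> e \<in> homs C (ob Y ?M) (ob Y ?M)" by (rule Ar_homs) simp_all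
  ultimately obtain W r \<iota> where W: "W \<in> Obj C" and r': "r \<in> homs C (ob Y ?M) W" "\<iota> \<in> homs C W (ob Y ?M)"
    and \<iota>r: "\<iota> \<cdot> r = ?I \<boxminus> e" and r\<iota>: "r \<cdot> \<iota> = Idn C W"
    using idempotents_split[of "ob Y ?M" "?I \<boxminus> e"] by auto
  have r[simp]: "ar C r (ob Y ?M) W" "ar C \<iota> W (ob Y ?M)" using r' W by (simp_all add: homs_iff)
  note [simp] = W
  have "r \<cdot> ?\<delta> = (r \<cdot> \<iota>) \<cdot> r \<cdot> ?\<delta>" unfolding r\<iota> by simp
  also have "\<dots> = r \<cdot> (\<iota> \<cdot> r) \<cdot> ?\<delta>" by simp
  also have "\<dots> = zr C (ob Y (Suc ?M)) W" unfolding \<iota>r by (simp add: e\<delta>)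
  finally have r\<delta>: "r \<cdot> ?\<delta> = zr C (ob Y (Suc ?M)) W" .
  obtain Z where Z: "zero_object C Z" using has_zero by blast
  have ZO[simp]: "Z \<in> Obj C" by (rule zero_objectD(1)[OF Z])
  let ?d = "df Y ?M"
  \<comment> \<open>Only the term and the differential of degree n + 1 are altered below the cut. As
    n > 0, the differential of degree 1 is still \<open>v\<close>.\<close>
  define R where "R = \<lparr>ob = (\<lambda>i. if i < ?M then ob Y i else if i = ?M then W else Z),
     df = (\<lambda>i. if i < ?M then df Y i else if i = ?M then ?d \<cdot> \<iota> else if i = Suc ?M then zr C Z W else zr C Z Z)\<rparr>"
  have Ro: "i < ?M \<Longrightarrow> ob R i = ob Y i" "ob R ?M = W" "i > ?M \<Longrightarrow> ob R i = Z" for i by (auto simp: R_def)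
  have Rd: "i < n \<Longrightarrow> df R (Suc i) = df Y (Suc i)" "df R ?M = ?d \<cdot> \<iota>" "i \<ge> ?M \<Longrightarrow> df R (Suc i) = zr C Z (ob R i)" for i
    by (auto simp: R_def)
  have aR: "acyc C R"
  proof (rule acycI)
    fix i
    consider "i < n" | "i = n" | "i \<ge> ?M" by linarith
    then show dR: "ar C (df R (Suc i)) (ob R (Suc i)) (ob R i)"
    proof cases
      case 3 then show ?thesis using Ro(2) Ro(3)[of i] Ro(3)[of "Suc i"] by (cases "i = ?M") (simp_all add: Rd)
    qed (simp_all add: Ro Rd)
    consider "i < m" | "i = m" | "i \<ge> n" using m by linarith
    then show "df R (Suc i) \<cdot> df R (Suc (Suc i)) = zr C (ob R (Suc (Suc i))) (ob R i)"
    proof cases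
      case 1 then show ?thesis using m by (simp add: Ro Rd)
    next
      case 2
      have "df Y n \<cdot> ?d \<cdot> \<iota> = zr C W (ob Y m)" using acyc_dd[OF aY, of \<iota> m] m by simp
      then show ?thesis using 2 m Rd(1)[of m] Rd(2) Ro(1)[of m] Ro(2) by simp
    next
      case 3
      then show ?thesis using Rd(3)[of "Suc i"] dR Ro(3)[of "Suc (Suc i)"] by auto
    qed
    fix h T assume h: "ar C h T (ob R (Suc i))" "df R (Suc i) \<cdot> h = zr C T (ob R i)"
    then have TO: "T \<in> Obj C" by auto
    consider "i < m" | "i = m" | "i \<ge> n" using m by linarith
    then show "\<exists>k. ar C k T (ob R (Suc (Suc i))) \<and> h = df R (Suc (Suc i)) \<cdot> k"
    proof cases
      case 1
      then have "ar C h T (ob Y (Suc i))" "df Y (Suc i) \<cdot> h = zr C T (ob Y i)" using h m by (simp_all add: Ro Rd)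
      then obtain k where "ar C k T (ob Y (Suc (Suc i)))" "h = df Y (Suc (Suc i)) \<cdot> k" by (rule acycE[OF aY])
      then show ?thesis using 1 m by (auto simp: Ro Rd)
    next
      case 2
      then have h1: "ar C h T (ob Y n)" "df Y n \<cdot> h = zr C T (ob Y m)" using h m Rd(1)[of m] Ro(1)[of n] Ro(1)[of m] by simp_all
      obtain k where k: "ar C k T (ob Y ?M)" "h = ?d \<cdot> k"
        using acycE[OF aY, of h T m] h1 m by auto
      \<comment> \<open>The part of k in the image of \<open>e\<close> is killed by
        \<open>?d\<close>, since \<open>e\<close> begins with a composite through \<delta>;
        projecting to W therefore loses nothing.\<close>
      have "?d \<cdot> (\<iota> \<cdot> r) \<cdot> k = ?d \<cdot> k" unfolding \<iota>r using k(1) acyc_dd[OF aY, of "\<sigma> \<cdot> k" n] by (simp add: e_def)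
      then have "h = (?d \<cdot> \<iota>) \<cdot> r \<cdot> k" using k by simp
      moreover have "ar C (r \<cdot> k) T W" using k(1) by simp
      ultimately show ?thesis using 2 m Rd(2) Ro(2) by auto
    next
      case 3
      have "h = zr C T (ob R (Suc i))"
      proof (cases "i = n")
        case True
        then have h1: "ar C h T W" "?d \<cdot> \<iota> \<cdot> h = zr C T (ob Y n)" using h by (simp_all add: Ro Rd)
        obtain k where k: "ar C k T (ob Y (Suc ?M))" "\<iota> \<cdot> h = ?\<delta> \<cdot> k"
          using acycE[OF aY, of "\<iota> \<cdot> h" T n] h1 by auto
        have "h = (r \<cdot> \<iota>) \<cdot> h" unfolding r\<iota> using h1 by simp
        also have "\<dots> = r \<cdot> ?\<delta> \<cdot> k" using h1 k by simp
        also have "\<dots> = zr C T W" using cmp_eq1[OF r\<delta>, of k] k(1) by simp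
        finally show ?thesis using True Ro(2) by simp
      next
        case False
        then have "ob R (Suc i) = Z" using 3 Ro(3)[of "Suc i"] by simp
        then show ?thesis using zero_objectD(3)[OF Z, of h] h by simp
      qed
      moreover have "ob R (Suc (Suc i)) = Z" "df R (Suc (Suc i)) = zr C Z (ob R (Suc i))"
        using 3 Ro(3)[of "Suc (Suc i)"] Rd(3)[of "Suc i"] by simp_all
      moreover have "ob R (Suc i) \<in> Obj C" using ArD(2)[of h] h by simp
      ultimately show ?thesis using TO by (intro exI[of _ "zr C T Z"]) simp
    qed
  qed
  have Rv: "df R (Suc 0) = v" using Rd(1)[of 0] n Y(2) by simp
  have R: "rres C R b F" using aR v Rv by (simp add: rres_def)
  have "n_exact C n R"
  proof (rule n_exact_acyc[OF aR])
    fix i assume "i > Suc n" then show "zero_object C (ob R i)" using Ro(3) Z by simp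
  next
    fix i T assume "i \<le> n" "T \<in> Obj C" then show "coh C R T i" using coh_transfer[OF R X] Xc by blast
  qed
  then show ?thesis using Rv by blast
qed

end

section \<open>Degreewise split extensions and the horseshoe lemma\<close>

text \<open>A short exact sequence of complexes X \<rightarrow> Z \<rightarrow> Y that splits in
  each degree. Only the inclusion \<open>a\<close> and the projection \<open>b\<close> are chain
  maps; the splittings \<open>s\<close> and \<open>r\<close> need not commute with the
  differentials.\<close>

definition split_ext :: "('o, 'm) cat \<Rightarrow> nat \<Rightarrow> ('o, 'm) cpx \<Rightarrow> ('o, 'm) cpx \<Rightarrow> ('o, 'm) cpx \<Rightarrow> bool" where
  "split_ext C n X Z Y \<longleftrightarrow> (\<exists>a b r s. chain_map C n X Z a \<and> chain_map C n Z Y b \<and>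
    (\<forall>i\<le>Suc n. biproduct C (ob X i) (ob Y i) (ob Z i) (a i) (s i) (r i) (b i)))"

context preadditive_category
begin

lemma biproduct_zr: "biproduct C A B W i1 i2 p1 p2 \<Longrightarrow> ar C h Y W \<Longrightarrow> p1 \<cdot> h = zr C Y A \<Longrightarrow> p2 \<cdot> h = zr C Y B \<Longrightarrow> h = zr C Y W"
  using biproduct_split[of A B W i1 i2 p1 p2 h Y] biproductD[of A B W i1 i2 p1 p2] ArD(1)[of h] by simp

lemma biproduct_ker: "biproduct C A B W i1 i2 p1 p2 \<Longrightarrow> ar C h Y W \<Longrightarrow> p2 \<cdot> h = zr C Y B \<Longrightarrow> h = i1 \<cdot> p1 \<cdot> h"
  using biproduct_split[of A B W i1 i2 p1 p2 h Y] biproductD[of A B W i1 i2 p1 p2] ArD(1)[of h] by simp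

lemma biproduct_swap: "biproduct C A B W i1 i2 p1 p2 \<Longrightarrow> biproduct C B A W i2 i1 p2 p1"
proof -
  assume b: "biproduct C A B W i1 i2 p1 p2"
  note D = biproductD[OF b]
  have "i2 \<cdot> p2 \<boxplus> i1 \<cdot> p1 = Idn C W" unfolding D(12)[symmetric] by (rule add_comm) (simp_all add: D)
  then have "i2 \<cdot> p2 \<otimes>\<^bsub>Hom C W W\<^esub> i1 \<cdot> p1 = Idn C W" using mult_eq_add[of "i2 \<cdot> p2" W W] D by simp
  then show ?thesis using b by (simp add: biproduct_def)
qed

lemma biproduct_op: "biproduct C A B W i1 i2 p1 p2 \<longleftrightarrow> biproduct (op_cat C) A B W p1 p2 i1 i2"
  by (auto simp: biproduct_def)

lemma biproduct_zero: "biproduct C A B W i1 i2 p1 p2 \<Longrightarrow> zero_object C A \<Longrightarrow> zero_object C B \<Longrightarrow> zero_object C W"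
proof -
  assume b: "biproduct C A B W i1 i2 p1 p2" and z: "zero_object C A" "zero_object C B"
  note D = biproductD[OF b]
  have "Idn C W = zr C W W"
    using biproduct_zr[OF b, of "Idn C W" W] zero_objectD(3)[OF z(1), of p1] zero_objectD(3)[OF z(2), of p2] D by simp
  then show ?thesis using zero_objectI D by blast
qed

text \<open>Chase behind the long exact sequence: the Y component of a cycle is a boundary in Y;
  after subtracting the boundary of its lift along \<open>s\<close> the rest comes from X and is a
  boundary there.\<close>

lemma split_acyc:
  assumes X: "acyc C X" and Y: "acyc C Y" and Z: "\<And>i. ar C (df Z (Suc i)) (ob Z (Suc i)) (ob Z i)"
    "\<And>i. df Z (Suc i) \<cdot> df Z (Suc (Suc i)) = zr C (ob Z (Suc (Suc i))) (ob Z i)"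
    and a: "chain C X Z a" and b: "chain C Z Y b"
    and bi: "\<And>i. biproduct C (ob X i) (ob Y i) (ob Z i) (a i) (s i) (r i) (b i)"
  shows "acyc C Z"
proof (rule acycI[OF Z])
  note [simp] = acycD[OF X] acycD[OF Y] acyc_ob[OF X] acyc_ob[OF Y] Z biproductD(1-11)[OF bi] chainD(1-3)[OF a] chainD(1-3)[OF b]
  fix i h T assume h: "ar C h T (ob Z (Suc i))" "df Z (Suc i) \<cdot> h = zr C T (ob Z i)"
  have TO: "T \<in> Obj C" using h by auto
  have "df Y (Suc i) \<cdot> b (Suc i) \<cdot> h = b i \<cdot> df Z (Suc i) \<cdot> h"
    using cmp_eq_cmp[OF chainD(4)[OF b, of i], of h] h by simp
  then have "df Y (Suc i) \<cdot> b (Suc i) \<cdot> h = zr C T (ob Y i)" using h TO by simp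
  then obtain k where k: "ar C k T (ob Y (Suc (Suc i)))" "b (Suc i) \<cdot> h = df Y (Suc (Suc i)) \<cdot> k"
    using acycE[OF Y, of "b (Suc i) \<cdot> h" T i] h by auto
  let ?u = "h \<boxminus> df Z (Suc (Suc i)) \<cdot> s (Suc (Suc i)) \<cdot> k"
  have u: "ar C ?u T (ob Z (Suc i))" using h k by simp
  have "b (Suc i) \<cdot> df Z (Suc (Suc i)) \<cdot> s (Suc (Suc i)) \<cdot> k = df Y (Suc (Suc i)) \<cdot> b (Suc (Suc i)) \<cdot> s (Suc (Suc i)) \<cdot> k"
    using cmp_eq_cmp[OF chainD(4)[OF b, of "Suc i"], of "s (Suc (Suc i)) \<cdot> k"] k by simp
  also have "\<dots> = df Y (Suc (Suc i)) \<cdot> k" using biproduct_cmp(2)[OF bi[of "Suc (Suc i)"], of k] k by simp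
  finally have "b (Suc i) \<cdot> ?u = zr C T (ob Y (Suc i))" using h k by simp
  then have ua: "?u = a (Suc i) \<cdot> r (Suc i) \<cdot> ?u" by (rule biproduct_ker[OF bi u])
  define v where "v = r (Suc i) \<cdot> ?u"
  have v: "ar C v T (ob X (Suc i))" "?u = a (Suc i) \<cdot> v" using u ua by (simp_all add: v_def del: subr)
  have "a i \<cdot> df X (Suc i) \<cdot> v = df Z (Suc i) \<cdot> ?u"
    unfolding v(2) using cmp_eq_cmp[OF chainD(4)[OF a, of i], of v] v(1) by simp
  also have "\<dots> = zr C T (ob Z i)" using h k cmp_eq1[OF Z(2)[of i], of "s (Suc (Suc i)) \<cdot> k"] TO by simp
  finally have az: "a i \<cdot> df X (Suc i) \<cdot> v = zr C T (ob Z i)" .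
  have "df X (Suc i) \<cdot> v = r i \<cdot> a i \<cdot> df X (Suc i) \<cdot> v" using biproduct_cmp(1)[OF bi[of i], of "df X (Suc i) \<cdot> v"] v(1) by simp
  also have "\<dots> = zr C T (ob X i)" unfolding az using TO by simp
  finally obtain w where w: "ar C w T (ob X (Suc (Suc i)))" "v = df X (Suc (Suc i)) \<cdot> w"
    using acycE[OF X v(1)] by metis
  have "?u = df Z (Suc (Suc i)) \<cdot> a (Suc (Suc i)) \<cdot> w"
    unfolding v(2) w(2) using cmp_eq_cmp[OF chainD(4)[OF a, of "Suc i"], of w] w(1) by simp
  then have "h = df Z (Suc (Suc i)) \<cdot> a (Suc (Suc i)) \<cdot> w \<boxplus> df Z (Suc (Suc i)) \<cdot> s (Suc (Suc i)) \<cdot> k"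
    using iffD1[OF sub_eq_iff] h k w(1) by simp
  then have "h = df Z (Suc (Suc i)) \<cdot> (a (Suc (Suc i)) \<cdot> w \<boxplus> s (Suc (Suc i)) \<cdot> k)" using w(1) k(1) by simp
  moreover have "ar C (a (Suc (Suc i)) \<cdot> w \<boxplus> s (Suc (Suc i)) \<cdot> k) T (ob Z (Suc (Suc i)))" using w(1) k(1) by simp
  ultimately show "\<exists>k. ar C k T (ob Z (Suc (Suc i))) \<and> h = df Z (Suc (Suc i)) \<cdot> k" by blast
qed

lemma cohI:
  assumes "\<And>h. i = 0 \<Longrightarrow> ar C h (ob X 0) T \<Longrightarrow> h \<cdot> df X (Suc 0) = zr C (ob X (Suc 0)) T \<Longrightarrow> h = zr C (ob X 0) T"
    and "\<And>h j. i = Suc j \<Longrightarrow> ar C h (ob X i) T \<Longrightarrow> h \<cdot> df X (Suc i) = zr C (ob X (Suc i)) T \<Longrightarrow> \<exists>k. ar C k (ob X j) T \<and> h = k \<cdot> df X i"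
  shows "coh C X T i"
  using assms unfolding coh_def by (cases i) auto

text \<open>The dual chase for C(-, T): the restriction of h to X is a coboundary, whose cochain is
  extended to Z along \<open>r\<close> and subtracted; what remains vanishes on X, so it factors
  through \<open>b\<close>, and Y finishes the argument.\<close>

lemma split_coh:
  assumes X: "acyc C X" and Y: "acyc C Y" and Z: "acyc C Z"
    and a: "chain C X Z a" and b: "chain C Z Y b"
    and bi: "\<And>i. biproduct C (ob X i) (ob Y i) (ob Z i) (a i) (s i) (r i) (b i)"
    and cX: "coh C X T i" and cY: "coh C Y T i" and TO: "T \<in> Obj C"
  shows "coh C Z T i"
proof -
  note [simp] = acycD[OF X] acycD[OF Y] acycD[OF Z] acyc_ob[OF X] acyc_ob[OF Y] acyc_ob[OF Z] biproductD(1-11)[OF bi]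
    chainD(1-3)[OF a] chainD(1-3)[OF b] TO
  have factor: "h = h \<cdot> s i \<cdot> b i" if h: "ar C h (ob Z i) T" "h \<cdot> a i = zr C (ob X i) T" for h i
  proof -
    have "h = h \<cdot> (a i \<cdot> r i \<boxplus> s i \<cdot> b i)" unfolding biproductD(12)[OF bi] using h by simp
    also have "\<dots> = h \<cdot> a i \<cdot> r i \<boxplus> h \<cdot> s i \<cdot> b i" using h(1) by simp
    also have "h \<cdot> a i \<cdot> r i = zr C (ob Z i) T" using cmp_eq1[OF h(2), of "r i"] h(1) by simp
    finally show ?thesis using h(1) by simp
  qed
  have sy: "(h \<cdot> s i) \<cdot> df Y (Suc i) = zr C (ob Y (Suc i)) T"
    if h: "ar C h (ob Z i) T" "h \<cdot> a i = zr C (ob X i) T" "h \<cdot> df Z (Suc i) = zr C (ob Z (Suc i)) T" for h i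
  proof -
    have "zr C (ob Y (Suc i)) T = (h \<cdot> df Z (Suc i)) \<cdot> s (Suc i)" unfolding h(3) by simp
    also have "\<dots> = (h \<cdot> s i \<cdot> b i) \<cdot> df Z (Suc i) \<cdot> s (Suc i)" using factor[OF h(1,2)] h(1) by simp
    also have "\<dots> = h \<cdot> s i \<cdot> df Y (Suc i) \<cdot> b (Suc i) \<cdot> s (Suc i)"
      using cmp_eq_cmp[OF chainD(4)[OF b, of i], of "s (Suc i)"] h(1) by simp
    also have "\<dots> = h \<cdot> s i \<cdot> df Y (Suc i)" using h(1) by simp
    finally show ?thesis using h(1) by simp
  qed
  have xa: "(h \<cdot> a i) \<cdot> df X (Suc i) = zr C (ob X (Suc i)) T"
    if h: "ar C h (ob Z i) T" "h \<cdot> df Z (Suc i) = zr C (ob Z (Suc i)) T" for h i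
    using cmp_eq1[OF h(2), of "a (Suc i)"] chainD(4)[OF a, of i] h(1) by simp
  show ?thesis
  proof (rule cohI)
    fix h assume i: "i = 0" and h: "ar C h (ob Z 0) T" "h \<cdot> df Z (Suc 0) = zr C (ob Z (Suc 0)) T"
    have ha: "h \<cdot> a 0 = zr C (ob X 0) T" using cohD[OF cX[unfolded i] _ xa[OF h]] h(1) by simp
    have hs: "h \<cdot> s 0 = zr C (ob Y 0) T" using cohD[OF cY[unfolded i] _ sy[OF h(1) ha h(2)]] h(1) by simp
    have "h = h \<cdot> s 0 \<cdot> b 0" by (rule factor[OF h(1) ha])
    also have "\<dots> = zr C (ob Z 0) T" using cmp_eq1[OF hs, of "b 0"] h(1) by simp
    finally show "h = zr C (ob Z 0) T" .
  next
    fix h j assume i: "i = Suc j" and h: "ar C h (ob Z i) T" "h \<cdot> df Z (Suc i) = zr C (ob Z (Suc i)) T"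
    obtain k where k: "ar C k (ob X j) T" "h \<cdot> a i = k \<cdot> df X i"
      using cohD[OF cX _ xa[OF h]] h(1) i by auto
    let ?h = "h \<boxminus> k \<cdot> r j \<cdot> df Z i"
    have h': "ar C ?h (ob Z i) T" using h(1) k(1) i by simp
    have "df Z (Suc j) \<cdot> a (Suc j) = a j \<cdot> df X (Suc j)" using chainD(4)[OF a, of j] by simp
    then have "r j \<cdot> df Z i \<cdot> a i = df X i" using biproduct_cmp(1)[OF bi[of j], of "df X i"] i by simp
    then have h'a: "?h \<cdot> a i = zr C (ob X i) T" using h(1) k i by simp
    have "?h \<cdot> df Z (Suc i) = zr C (ob Z (Suc i)) T" using h k(1) i by simp
    from cohD[OF cY _ sy[OF h' h'a this]] obtain l where l: "ar C l (ob Y j) T" "?h \<cdot> s i = l \<cdot> df Y i"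
      using h' i by auto
    have "?h = ?h \<cdot> s i \<cdot> b i" by (rule factor[OF h' h'a])
    also have "\<dots> = (?h \<cdot> s i) \<cdot> b i" using h' by (simp del: subl)
    also have "\<dots> = l \<cdot> b j \<cdot> df Z i" unfolding l(2) using l(1) chainD(4)[OF b, of j] i by simp
    finally have "?h = l \<cdot> b j \<cdot> df Z i" .
    then have "h = l \<cdot> b j \<cdot> df Z i \<boxplus> k \<cdot> r j \<cdot> df Z i" using iffD1[OF sub_eq_iff] h(1) k(1) l(1) i by simp
    then have "h = (l \<cdot> b j \<boxplus> k \<cdot> r j) \<cdot> df Z i" using k(1) l(1) i by simp
    moreover have "ar C (l \<cdot> b j \<boxplus> k \<cdot> r j) (ob Z j) T" using k(1) l(1) by simp
    ultimately show "\<exists>k. ar C k (ob Z j) T \<and> h = k \<cdot> df Z i" by blast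
  qed
qed

end

context additive_category
begin

text \<open>On X_i + Y_i the differential has to be triangular with diagonal entries those of X and
  Y and an off-diagonal entry \<open>t i\<close>. It squares to zero iff d t + t d = 0, and the
  \<open>t i\<close> are found recursively from exactness of X. In degree 0 the choice of
  \<open>t\<close> must also fit the module E.\<close>

lemma horseshoe:
  assumes X: "rres C X x F" and Y: "rres C Y y H" and E: "cmodule C E" and se: "short_exact C F E H \<iota> \<pi>"
  obtains Z z a b r s where "rres C Z z E" "chain C X Z a" "chain C Z Y b"
    "\<And>i. biproduct C (ob X i) (ob Y i) (ob Z i) (a i) (s i) (r i) (b i)"
proof -
  have aX: "acyc C X" and pX: "presents C (df X (Suc 0)) x F" using X by (auto simp: rres_def)
  have aY: "acyc C Y" and pY: "presents C (df Y (Suc 0)) y H" using Y by (auto simp: rres_def)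
  note [simp] = acycD[OF aX] acycD[OF aY] acyc_ob[OF aX] acyc_ob[OF aY]
  have gX: "gen C F (ob X 0) x" using presents_gen[OF pX] by simp
  have gY: "gen C H (ob Y 0) y" using presents_gen[OF pY] by simp
  note F = genD[OF gX] and H = genD[OF gY]
  have \<iota>: "nat_trans C F E \<iota>" and \<pi>: "nat_trans C E H \<pi>"
    and inj: "\<And>T. T \<in> Obj C \<Longrightarrow> inj_on (\<iota> T) (carrier (Val F T))"
    and ex: "\<And>T. T \<in> Obj C \<Longrightarrow> \<iota> T ` carrier (Val F T) = {m \<in> carrier (Val E T). \<pi> T m = \<one>\<^bsub>Val H T\<^esub>}"
    and surj: "\<And>T. T \<in> Obj C \<Longrightarrow> \<pi> T ` carrier (Val E T) = carrier (Val H T)"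
    using se by (auto simp: short_exact_def exact_at_def kernel_def)
  have EG: "comm_group (Val E T)" if "T \<in> Obj C" for T by (rule Val_grp[OF E that])
  obtain y' where y': "y' \<in> carrier (Val E (ob Y 0))" "\<pi> (ob Y 0) y' = y"
    using surj[OF H(2)] H(3) by (metis imageE)
  define x' where "x' = \<iota> (ob X 0) x"
  have x': "x' \<in> carrier (Val E (ob X 0))" using nat_transD(2)[OF \<iota> F(2,3)] by (simp add: x'_def)
  have \<iota>h: "\<iota> T (Act F h x) = Act E h x'" if "ar C h T (ob X 0)" for h T
    using nat_trans_gen[OF \<iota> gX that] by (simp add: x'_def)
  have \<pi>h: "\<pi> T (Act E h y') = Act H h y" if "ar C h T (ob Y 0)" for h T
    using nat_transD(3)[OF \<pi>, of h y'] that y' by auto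
  have kerI: "\<exists>k. ar C k T (ob X 0) \<and> m = Act E k x'" if m: "T \<in> Obj C" "m \<in> carrier (Val E T)" "\<pi> T m = \<one>\<^bsub>Val H T\<^esub>" for T m
  proof -
    have "m \<in> \<iota> T ` carrier (Val F T)" using ex[OF m(1)] m by simp
    then obtain f where f: "f \<in> carrier (Val F T)" "m = \<iota> T f" by blast
    obtain k where k: "ar C k T (ob X 0)" "f = Act F k x" using genE[OF gX f(1) m(1)] .
    then show ?thesis using f \<iota>h by blast
  qed
  have xz: "Act F h x = \<one>\<^bsub>Val F T\<^esub>" if h: "ar C h T (ob X 0)" "Act E h x' = \<one>\<^bsub>Val E T\<^esub>" for h T
  proof -
    have TO: "T \<in> Obj C" using h by auto
    have "\<iota> T (Act F h x) = \<iota> T \<one>\<^bsub>Val F T\<^esub>" using \<iota>h[OF h(1)] h(2) nat_trans_one[OF \<iota> F(1) E TO] by simp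
    moreover have "Act F h x \<in> carrier (Val F T)" using Act_closed[OF F(1), of h x] h(1) F by auto
    ultimately show ?thesis using inj_onD[OF inj[OF TO]] comm_groupE(2)[OF Val_grp[OF F(1) TO]] by blast
  qed
  let ?dX = "\<lambda>i. df X (Suc i)" and ?dY = "\<lambda>i. df Y (Suc i)"
  \<comment> \<open>The lift y' of the generator of H need not satisfy the relation given by the
    differential of Y, but the error vanishes in H and so comes from F. \<open>t0\<close> is chosen
    to cancel it, so that the generator z below is killed by \<open>D 0\<close>.\<close>
  have "\<exists>k. ar C k (ob Y (Suc 0)) (ob X 0) \<and> inv\<^bsub>Val E (ob Y (Suc 0))\<^esub> (Act E (?dY 0) y') = Act E k x'"
  proof (rule kerI)
    interpret G: comm_group "Val E (ob Y (Suc 0))" by (rule EG) simp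
    interpret \<pi>: group_hom "Val E (ob Y (Suc 0))" "Val H (ob Y (Suc 0))" "\<pi> (ob Y (Suc 0))"
      using nat_transD(1)[OF \<pi>] Val_group[OF H(1)] G.is_group by (simp add: group_hom_def group_hom_axioms_def)
    have c: "Act E (?dY 0) y' \<in> carrier (Val E (ob Y (Suc 0)))" using Act_closed[OF E, of "?dY 0" y'] y' by simp
    show "inv\<^bsub>Val E (ob Y (Suc 0))\<^esub> (Act E (?dY 0) y') \<in> carrier (Val E (ob Y (Suc 0)))" using c by simp
    have "\<pi> (ob Y (Suc 0)) (Act E (?dY 0) y') = \<one>\<^bsub>Val H (ob Y (Suc 0))\<^esub>"
      using \<pi>h[of "?dY 0" "ob Y (Suc 0)"] presents_rel[OF pY] by simp
    then show "\<pi> (ob Y (Suc 0)) (inv\<^bsub>Val E (ob Y (Suc 0))\<^esub> (Act E (?dY 0) y')) = \<one>\<^bsub>Val H (ob Y (Suc 0))\<^esub>"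
      using \<pi>.hom_inv[OF c] by simp
  qed simp
  then obtain t0 where t0: "ar C t0 (ob Y (Suc 0)) (ob X 0)" "Act E t0 x' = inv\<^bsub>Val E (ob Y (Suc 0))\<^esub> (Act E (?dY 0) y')"
    by metis
  have t0y: "Act E t0 x' \<otimes>\<^bsub>Val E (ob Y (Suc 0))\<^esub> Act E (?dY 0) y' = \<one>\<^bsub>Val E (ob Y (Suc 0))\<^esub>"
  proof -
    interpret G: comm_group "Val E (ob Y (Suc 0))" by (rule EG) simp
    show ?thesis unfolding t0(2) using Act_closed[OF E, of "?dY 0" y'] y' by simp
  qed
  have "\<exists>l. ar C l (ob Y (Suc (Suc 0))) (ob X (Suc 0)) \<and> t0 \<cdot> ?dY (Suc 0) = ?dX 0 \<cdot> l"
  proof -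
    let ?T = "ob Y (Suc (Suc 0))"
    interpret G: comm_group "Val E ?T" by (rule EG) simp
    have c: "Act E (t0 \<cdot> ?dY (Suc 0)) x' \<in> carrier (Val E ?T)" using Act_closed[OF E, of "t0 \<cdot> ?dY (Suc 0)" x'] t0(1) x' by simp
    have "\<one>\<^bsub>Val E ?T\<^esub> = Act E (?dY (Suc 0)) (Act E t0 x' \<otimes>\<^bsub>Val E (ob Y (Suc 0))\<^esub> Act E (?dY 0) y')"
      unfolding t0y using Act_one[OF E, of "?dY (Suc 0)"] by simp
    also have "\<dots> = Act E (?dY (Suc 0)) (Act E t0 x') \<otimes>\<^bsub>Val E ?T\<^esub> Act E (?dY (Suc 0)) (Act E (?dY 0) y')"
      using Act_mult[OF E, of "?dY (Suc 0)" "Act E t0 x'" "Act E (?dY 0) y'"] Act_closed[OF E, of t0 x'] Act_closed[OF E, of "?dY 0" y'] t0(1) x' y' by simp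
    also have "Act E (?dY (Suc 0)) (Act E (?dY 0) y') = Act E (?dY 0 \<cdot> ?dY (Suc 0)) y'"
      by (rule Act_cmp[OF E, symmetric]) (use y' in simp_all)
    also have "\<dots> = \<one>\<^bsub>Val E ?T\<^esub>" using Act_zr[OF E] y' by simp
    also have "Act E (?dY (Suc 0)) (Act E t0 x') = Act E (t0 \<cdot> ?dY (Suc 0)) x'"
      by (rule Act_cmp[OF E, symmetric]) (use t0(1) x' in simp_all)
    finally have "Act E (t0 \<cdot> ?dY (Suc 0)) x' = \<one>\<^bsub>Val E ?T\<^esub>" using c by simp
    then have "Act F (t0 \<cdot> ?dY (Suc 0)) x = \<one>\<^bsub>Val F ?T\<^esub>" by (intro xz) (use t0(1) in simp_all)
    then show ?thesis using presentsE[OF pX, of "t0 \<cdot> ?dY (Suc 0)" ?T] t0(1) by auto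
  qed
  then obtain l0 where l0: "ar C l0 (ob Y (Suc (Suc 0))) (ob X (Suc 0))" "t0 \<cdot> ?dY (Suc 0) = ?dX 0 \<cdot> l0" by blast
  \<comment> \<open>The invariant keeps a factorisation of u d through the differential of X; the
    next entry is minus that factor, which makes the squares anticommute.\<close>
  let ?P = "\<lambda>n u. (n = 0 \<longrightarrow> u = t0) \<and> ar C u (ob Y (Suc n)) (ob X n) \<and>
    (\<exists>l. ar C l (ob Y (Suc (Suc n))) (ob X (Suc n)) \<and> u \<cdot> ?dY (Suc n) = ?dX n \<cdot> l)"
  let ?Q = "\<lambda>n u v. ?dX n \<cdot> v \<boxplus> u \<cdot> ?dY (Suc n) = zr C (ob Y (Suc (Suc n))) (ob X n)"
  have "\<exists>f. \<forall>n. ?P n (f n) \<and> ?Q n (f n) (f (Suc n))"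
  proof (rule dependent_nat_choice)
    show "\<exists>u. ?P 0 u" using t0(1) l0 by blast
    fix u n assume "?P n u"
    then obtain l where u: "ar C u (ob Y (Suc n)) (ob X n)" and l: "ar C l (ob Y (Suc (Suc n))) (ob X (Suc n))"
      "u \<cdot> ?dY (Suc n) = ?dX n \<cdot> l" by blast
    have "?dX n \<cdot> l \<cdot> ?dY (Suc (Suc n)) = u \<cdot> ?dY (Suc n) \<cdot> ?dY (Suc (Suc n))"
      using cmp_eq_cmp[OF l(2), of "?dY (Suc (Suc n))"] u l(1) by simp
    also have "\<dots> = zr C (ob Y (Suc (Suc (Suc n)))) (ob X n)" using u by simp
    finally obtain l' where l': "ar C l' (ob Y (Suc (Suc (Suc n)))) (ob X (Suc (Suc n)))" "l \<cdot> ?dY (Suc (Suc n)) = ?dX (Suc n) \<cdot> l'"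
      using acycE[OF aX, of "l \<cdot> ?dY (Suc (Suc n))" "ob Y (Suc (Suc (Suc n)))" n] l(1) by auto
    have "?P (Suc n) (neg C l)"
      using l(1) l' by (intro conjI exI[of _ "neg C l'"]) simp_all
    moreover have "?Q n u (neg C l)" unfolding l(2) using l(1) add_comm[of "?dX n \<cdot> l" "neg C (?dX n \<cdot> l)"] by simp
    ultimately show "\<exists>v. ?P (Suc n) v \<and> ?Q n u v" by blast
  qed
  then obtain t where "\<forall>n. ?P n (t n) \<and> ?Q n (t n) (t (Suc n))" by blast
  then have tt: "t 0 = t0" "\<And>i. ar C (t i) (ob Y (Suc i)) (ob X i)" "\<And>i. ?Q i (t i) (t (Suc i))" by auto
  note [simp] = tt(2)
  have "\<forall>i. \<exists>w. biproduct C (ob X i) (ob Y i) (fst w) (fst (snd w)) (fst (snd (snd w))) (fst (snd (snd (snd w)))) (snd (snd (snd (snd w))))"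
    using has_biproducts[OF acyc_ob[OF aX] acyc_ob[OF aY]] by (metis fst_conv snd_conv)
  then obtain w where w: "\<And>i. biproduct C (ob X i) (ob Y i) (fst (w i)) (fst (snd (w i))) (fst (snd (snd (w i)))) (fst (snd (snd (snd (w i))))) (snd (snd (snd (snd (w i)))))"
    by metis
  define W a s r b where "W i = fst (w i)" and "a i = fst (snd (w i))" and "s i = fst (snd (snd (w i)))" and
    "r i = fst (snd (snd (snd (w i))))" and "b i = snd (snd (snd (snd (w i))))" for i
  have bi: "biproduct C (ob X i) (ob Y i) (W i) (a i) (s i) (r i) (b i)" for i
    using w unfolding W_def a_def s_def r_def b_def .
  note [simp] = biproductD(1-11)[OF bi] biproduct_cmp[OF bi]
  \<comment> \<open>The triangular matrix with rows (d, t) and (0, d), written with the injections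
    \<open>a\<close>, \<open>s\<close> and projections \<open>r\<close>, \<open>b\<close>.\<close>
  define D where "D i = a i \<cdot> (?dX i \<cdot> r (Suc i) \<boxplus> t i \<cdot> b (Suc i)) \<boxplus> s i \<cdot> ?dY i \<cdot> b (Suc i)" for i
  have D[simp]: "ar C (D i) (W (Suc i)) (W i)" for i by (simp add: D_def)
  have Da: "D i \<cdot> a (Suc i) = a i \<cdot> ?dX i" for i by (simp add: D_def)
  have bD: "b i \<cdot> D i = ?dY i \<cdot> b (Suc i)" for i by (simp add: D_def)
  have rD: "r i \<cdot> D i = ?dX i \<cdot> r (Suc i) \<boxplus> t i \<cdot> b (Suc i)" for i by (simp add: D_def)
  have DD: "D i \<cdot> D (Suc i) = zr C (W (Suc (Suc i))) (W i)" for i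
  proof (rule biproduct_zr[OF bi])
    have "b i \<cdot> D i \<cdot> D (Suc i) = ?dY i \<cdot> b (Suc i) \<cdot> D (Suc i)" by (rule cmp_eq_cmp[OF bD]) simp_all
    also have "\<dots> = zr C (W (Suc (Suc i))) (ob Y i)" unfolding bD using acyc_dd[OF aY, of "b (Suc (Suc i))" i] by simp
    finally show "b i \<cdot> D i \<cdot> D (Suc i) = zr C (W (Suc (Suc i))) (ob Y i)" .
    have "r i \<cdot> D i \<cdot> D (Suc i) = (?dX i \<cdot> r (Suc i) \<boxplus> t i \<cdot> b (Suc i)) \<cdot> D (Suc i)" by (rule cmp_eq1[OF rD]) simp_all
    also have "\<dots> = ?dX i \<cdot> (r (Suc i) \<cdot> D (Suc i)) \<boxplus> t i \<cdot> (b (Suc i) \<cdot> D (Suc i))" by simp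
    also have "\<dots> = (?dX i \<cdot> t (Suc i) \<boxplus> t i \<cdot> ?dY (Suc i)) \<cdot> b (Suc (Suc i))"
      unfolding rD bD using acyc_dd[OF aX, of "r (Suc (Suc i))" i] by simp
    also have "\<dots> = zr C (W (Suc (Suc i))) (ob X i)" unfolding tt(3) by simp
    finally show "r i \<cdot> D i \<cdot> D (Suc i) = zr C (W (Suc (Suc i))) (ob X i)" .
  qed simp
  define Z where "Z = \<lparr>ob = W, df = (\<lambda>i. D (i - 1))\<rparr>"
  have Z[simp]: "ob Z = W" "df Z (Suc i) = D i" for i by (auto simp: Z_def)
  have ca: "chain C X Z a" unfolding chain_def by (simp add: Da)
  have cb: "chain C Z Y b" unfolding chain_def by (simp add: bD)
  have aZ: "acyc C Z" by (rule split_acyc[OF aX aY _ _ ca cb, of s r]) (simp_all add: bi DD)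
  \<comment> \<open>The map from C(-, X_0 + Y_0) to E whose components are the image x' of the
    generator of F and the lift y' of the generator of H.\<close>
  define z where "z = Act E (r 0) x' \<otimes>\<^bsub>Val E (W 0)\<^esub> Act E (b 0) y'"
  have cc: "Act E h m \<in> carrier (Val E T)" if "ar C h T B" "m \<in> carrier (Val E B)" for h m T B
    using Act_closed[OF E, of h m] that by auto
  have zc: "z \<in> carrier (Val E (W 0))" unfolding z_def
    by (rule comm_groupE(1)[OF EG cc cc]) (use x' y' in simp_all)
  have zh: "Act E h z = Act E (r 0 \<cdot> h) x' \<otimes>\<^bsub>Val E T\<^esub> Act E (b 0 \<cdot> h) y'" if h: "ar C h T (W 0)" for h T
    using Act_mult[OF E, of h "Act E (r 0) x'" "Act E (b 0) y'"] cc[of "r 0" "W 0" "ob X 0" x'] cc[of "b 0" "W 0" "ob Y 0" y'] h x' y'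
    by (simp add: z_def Act_cmp[OF E])
  have Dz: "Act E (D 0) z = \<one>\<^bsub>Val E (W (Suc 0))\<^esub>"
  proof -
    interpret G: comm_group "Val E (W (Suc 0))" by (rule EG) simp
    have 1: "Act E (?dX 0) x' = \<one>\<^bsub>Val E (ob X (Suc 0))\<^esub>"
      using \<iota>h[of "?dX 0" "ob X (Suc 0)"] presents_rel[OF pX] nat_trans_one[OF \<iota> F(1) E, of "ob X (Suc 0)"] by simp
    have "Act E (D 0) z = Act E (?dX 0 \<cdot> r (Suc 0) \<boxplus> t0 \<cdot> b (Suc 0)) x' \<otimes>\<^bsub>Val E (W (Suc 0))\<^esub> Act E (?dY 0 \<cdot> b (Suc 0)) y'"
      using zh[of "D 0" "W (Suc 0)"] by (simp add: rD bD tt(1))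
    also have "Act E (?dX 0 \<cdot> r (Suc 0) \<boxplus> t0 \<cdot> b (Suc 0)) x' = Act E (r (Suc 0)) (Act E (?dX 0) x') \<otimes>\<^bsub>Val E (W (Suc 0))\<^esub> Act E (b (Suc 0)) (Act E t0 x')"
      using t0(1) x' by (simp add: Act_add[OF E] Act_cmp[OF E])
    also have "\<dots> = Act E (b (Suc 0)) (Act E t0 x')" unfolding 1
      using cc[of "b (Suc 0)" "W (Suc 0)" "ob Y (Suc 0)" "Act E t0 x'"] cc[of t0 "ob Y (Suc 0)" "ob X 0" x'] t0(1) x' by (simp add: Act_one[OF E])
    also have "Act E (?dY 0 \<cdot> b (Suc 0)) y' = Act E (b (Suc 0)) (Act E (?dY 0) y')" using y' by (simp add: Act_cmp[OF E])
    also have "Act E (b (Suc 0)) (Act E t0 x') \<otimes>\<^bsub>Val E (W (Suc 0))\<^esub> Act E (b (Suc 0)) (Act E (?dY 0) y') =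
        Act E (b (Suc 0)) (Act E t0 x' \<otimes>\<^bsub>Val E (ob Y (Suc 0))\<^esub> Act E (?dY 0) y')"
      using Act_mult[OF E, of "b (Suc 0)" "Act E t0 x'" "Act E (?dY 0) y'"] cc[of t0 "ob Y (Suc 0)" "ob X 0" x'] cc[of "?dY 0" "ob Y (Suc 0)" "ob Y 0" y'] t0(1) x' y' by simp
    also have "\<dots> = \<one>\<^bsub>Val E (W (Suc 0))\<^esub>" unfolding t0y by (simp add: Act_one[OF E])
    finally show ?thesis .
  qed
  have "presents C (df Z (Suc 0)) z E"
  proof (rule presentsI)
    show "gen C E (Cod C (df Z (Suc 0))) z" unfolding gen_def
    proof (intro conjI ballI)
      fix T m assume T: "T \<in> Obj C" "m \<in> carrier (Val E T)"
      interpret G: comm_group "Val E T" by (rule EG[OF T(1)])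
      interpret \<pi>: group_hom "Val E T" "Val H T" "\<pi> T"
        using nat_transD(1)[OF \<pi> T(1)] Val_group[OF H(1) T(1)] G.is_group by (simp add: group_hom_def group_hom_axioms_def)
      obtain h where h: "ar C h T (ob Y 0)" "\<pi> T m = Act H h y" using genE[OF gY \<pi>.hom_closed[OF T(2)] T(1)] .
      have hy: "Act E h y' \<in> carrier (Val E T)" using cc[OF h(1) y'(1)] .
      have "\<pi> T (m \<otimes>\<^bsub>Val E T\<^esub> inv\<^bsub>Val E T\<^esub> (Act E h y')) = \<one>\<^bsub>Val H T\<^esub>"
        using \<pi>.hom_mult[OF T(2), of "inv\<^bsub>Val E T\<^esub> (Act E h y')"] \<pi>.hom_inv[OF hy] \<pi>h[OF h(1)] h(2) hy \<pi>.hom_closed[OF T(2)] by simp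
      then obtain k where k: "ar C k T (ob X 0)" "m \<otimes>\<^bsub>Val E T\<^esub> inv\<^bsub>Val E T\<^esub> (Act E h y') = Act E k x'"
        using kerI[OF T(1), of "m \<otimes>\<^bsub>Val E T\<^esub> inv\<^bsub>Val E T\<^esub> (Act E h y')"] hy T(2) by auto
      let ?l = "a 0 \<cdot> k \<boxplus> s 0 \<cdot> h"
      have l: "ar C ?l T (W 0)" "r 0 \<cdot> ?l = k" "b 0 \<cdot> ?l = h" using k(1) h(1) T(1) by simp_all
      have "Act E ?l z = Act E k x' \<otimes>\<^bsub>Val E T\<^esub> Act E h y'" using zh[OF l(1)] unfolding l(2,3) .
      also have "\<dots> = m" unfolding k(2)[symmetric] using T(2) hy G.m_assoc by simp
      finally show "\<exists>h. ar C h T (Cod C (df Z (Suc 0))) \<and> m = Act E h z" using l(1) by (intro exI[of _ ?l]) simp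
    qed (use E zc in simp_all)
    show "Act E (df Z (Suc 0) \<cdot> k) z = \<one>\<^bsub>Val E T\<^esub>" if "ar C k T (Dom C (df Z (Suc 0)))" for k T
      using that Dz zc by (simp add: Act_cmp[OF E] Act_one[OF E])
    fix h T assume h: "ar C h T (Cod C (df Z (Suc 0)))" "Act E h z = \<one>\<^bsub>Val E T\<^esub>"
    then have h1: "ar C h T (W 0)" and TO: "T \<in> Obj C" by auto
    have yz: "Act H (b 0 \<cdot> k) y = \<pi> T (Act E k z)" if k: "ar C k T (W 0)" for k
    proof -
      have 1: "Act E (r 0 \<cdot> k) x' \<in> carrier (Val E T)" "Act E (b 0 \<cdot> k) y' \<in> carrier (Val E T)"
        using cc[of "r 0 \<cdot> k" T "ob X 0" x'] cc[of "b 0 \<cdot> k" T "ob Y 0" y'] k x' y' by simp_all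
      have "Act E (r 0 \<cdot> k) x' \<in> {m \<in> carrier (Val E T). \<pi> T m = \<one>\<^bsub>Val H T\<^esub>}"
        unfolding ex[OF TO, symmetric] using \<iota>h[of "r 0 \<cdot> k" T] Act_closed[OF F(1), of "r 0 \<cdot> k" x] k F by (metis (no_types, lifting) imageI cmp_ar biproductD(6)[OF bi])
      then have "\<pi> T (Act E (r 0 \<cdot> k) x') = \<one>\<^bsub>Val H T\<^esub>" by simp
      moreover have "Act H (b 0 \<cdot> k) y \<in> carrier (Val H T)" using Act_closed[OF H(1), of "b 0 \<cdot> k" y] k H by auto
      ultimately show ?thesis
        unfolding zh[OF k] nat_transD(4)[OF \<pi> TO 1] using \<pi>h[of "b 0 \<cdot> k" T] k comm_groupE(5)[OF Val_grp[OF H(1) TO]] by simp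
    qed
    have "Act H (b 0 \<cdot> h) y = \<one>\<^bsub>Val H T\<^esub>" using yz[OF h1] h(2) nat_trans_one[OF \<pi> E H(1) TO] by simp
    then obtain k where k: "ar C k T (ob Y (Suc 0))" "b 0 \<cdot> h = ?dY 0 \<cdot> k"
      using presentsE[OF pY, of "b 0 \<cdot> h" T] h1 by auto
    let ?u = "h \<boxminus> D 0 \<cdot> s (Suc 0) \<cdot> k"
    have u: "ar C ?u T (W 0)" using h1 k by simp
    have "b 0 \<cdot> D 0 \<cdot> s (Suc 0) \<cdot> k = ?dY 0 \<cdot> k" using cmp_eq_cmp[OF bD[of 0], of "s (Suc 0) \<cdot> k"] k(1) by simp
    then have bu: "b 0 \<cdot> ?u = zr C T (ob Y 0)" using h1 k by simp
    then have ua: "?u = a 0 \<cdot> r 0 \<cdot> ?u" by (rule biproduct_ker[OF bi u])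
    define v where "v = r 0 \<cdot> ?u"
    have v: "ar C v T (ob X 0)" "?u = a 0 \<cdot> v" using u ua by (simp_all add: v_def del: subr)
    have "Act E ?u z = \<one>\<^bsub>Val E T\<^esub>"
    proof -
      have "Act E (D 0 \<cdot> s (Suc 0) \<cdot> k) z = \<one>\<^bsub>Val E T\<^esub>" using k(1) zc by (simp add: Act_cmp[OF E] Dz Act_one[OF E])
      then show ?thesis using h(2) h1 k(1) zc by (subst Act_sub[OF E]) simp_all
    qed
    moreover have "Act E (a 0 \<cdot> v) z = Act E v x'"
      using zh[of "a 0 \<cdot> v" T] v(1) y' TO comm_groupE(5)[OF EG[OF TO]] comm_groupE(4)[OF EG[OF TO]] comm_groupE(2)[OF EG[OF TO]] cc[OF v(1) x']
      by (simp add: Act_zr[OF E])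
    ultimately have "Act E v x' = \<one>\<^bsub>Val E T\<^esub>" unfolding v(2) by simp
    then have "Act F v x = \<one>\<^bsub>Val F T\<^esub>" by (rule xz[OF v(1)])
    then obtain q where q: "ar C q T (ob X (Suc 0))" "v = ?dX 0 \<cdot> q" using presentsE[OF pX, of v T] v(1) by auto
    have "?u = D 0 \<cdot> a (Suc 0) \<cdot> q" unfolding v(2) q(2) using cmp_eq_cmp[OF Da[of 0], of q] q(1) by simp
    then have "h = D 0 \<cdot> a (Suc 0) \<cdot> q \<boxplus> D 0 \<cdot> s (Suc 0) \<cdot> k" using iffD1[OF sub_eq_iff] h1 k(1) q(1) by simp
    then have "h = D 0 \<cdot> (a (Suc 0) \<cdot> q \<boxplus> s (Suc 0) \<cdot> k)" using k(1) q(1) by simp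
    then show "\<exists>k. ar C k T (Dom C (df Z (Suc 0))) \<and> h = df Z (Suc 0) \<cdot> k"
      using k(1) q(1) by (intro exI[of _ "a (Suc 0) \<cdot> q \<boxplus> s (Suc 0) \<cdot> k"]) simp
  qed simp
  then have "rres C Z z E" using aZ by (simp add: rres_def)
  then show ?thesis using that[OF _ ca cb, of z s r] bi by simp
qed

text \<open>The horseshoe is built on the padded sequences. Beyond degree n + 1 its terms are direct
  sums of zero objects, so it is again the padding of an n-exact sequence.\<close>

lemma n_exact_horseshoe:
  assumes X0: "n_exact C n X0" "presents C (df X0 (Suc 0)) x F" and Y0: "n_exact C n Y0" "presents C (df Y0 (Suc 0)) y H"
    and E: "cmodule C E" and se: "short_exact C F E H \<iota> \<pi>"
  shows "\<exists>Z z. n_exact C n Z \<and> presents C (df Z (Suc 0)) z E \<and> split_ext C n X0 Z Y0"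
proof -
  obtain X where X: "rres C X x F" and Xo: "\<And>i. i \<le> Suc n \<Longrightarrow> ob X i = ob X0 i" "\<And>i. i \<le> n \<Longrightarrow> df X (Suc i) = df X0 (Suc i)"
    and Xz: "\<And>i. i > Suc n \<Longrightarrow> zero_object C (ob X i)" and Xc: "\<And>i T. i \<le> n \<Longrightarrow> T \<in> Obj C \<Longrightarrow> coh C X T i"
    using n_exact_rres[OF X0] by metis
  obtain Y where Y: "rres C Y y H" and Yo: "\<And>i. i \<le> Suc n \<Longrightarrow> ob Y i = ob Y0 i" "\<And>i. i \<le> n \<Longrightarrow> df Y (Suc i) = df Y0 (Suc i)"
    and Yz: "\<And>i. i > Suc n \<Longrightarrow> zero_object C (ob Y i)" and Yc: "\<And>i T. i \<le> n \<Longrightarrow> T \<in> Obj C \<Longrightarrow> coh C Y T i"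
    using n_exact_rres[OF Y0] by metis
  obtain Z z a b r s where Z: "rres C Z z E" and a: "chain C X Z a" and b: "chain C Z Y b"
    and bi: "\<And>i. biproduct C (ob X i) (ob Y i) (ob Z i) (a i) (s i) (r i) (b i)"
    using horseshoe[OF X Y E se] by metis
  have aX: "acyc C X" and aY: "acyc C Y" and aZ: "acyc C Z" and pZ: "presents C (df Z (Suc 0)) z E"
    using X Y Z by (auto simp: rres_def)
  have "n_exact C n Z"
  proof (rule n_exact_acyc[OF aZ])
    fix i assume "i > Suc n" then show "zero_object C (ob Z i)" using biproduct_zero[OF bi Xz Yz] by blast
  next
    fix i T assume "i \<le> n" "T \<in> Obj C" then show "coh C Z T i"
      using split_coh[OF aX aY aZ a b bi Xc Yc] by blast
  qed
  moreover have "split_ext C n X0 Z Y0" unfolding split_ext_def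
  proof (intro exI conjI allI impI)
    show "chain_map C n X0 Z a"
      by (rule chain_mapI) (use chainD[OF a] Xo in \<open>simp_all flip: Xo(2)\<close>)
    show "chain_map C n Z Y0 b"
      by (rule chain_mapI) (use chainD[OF b] Yo in \<open>simp_all flip: Yo(2)\<close>)
    fix i assume "i \<le> Suc n" then show "biproduct C (ob X0 i) (ob Y0 i) (ob Z i) (a i) (s i) (r i) (b i)" using bi[of i] Xo(1) Yo(1) by simp
  qed
  ultimately show ?thesis using pZ by blast
qed

end

section \<open>Classes of \<open>n\<close>-exact sequences and their axioms\<close>

definition iso_class :: "('o, 'm) cat \<Rightarrow> nat \<Rightarrow> ('o, 'm) cpx set \<Rightarrow> bool" where
  "iso_class C n \<X> \<longleftrightarrow> (\<forall>X\<in>\<X>. n_exact C n X) \<and>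
    (\<forall>X\<in>\<X>. \<forall>Y. n_exact C n Y \<and> homotopy_equiv C n X Y \<longrightarrow> Y \<in> \<X>)"

definition split_ext_closed :: "('o, 'm) cat \<Rightarrow> nat \<Rightarrow> ('o, 'm) cpx set \<Rightarrow> bool" where
  "split_ext_closed C n \<X> \<longleftrightarrow> (\<forall>X\<in>\<X>. \<forall>Y\<in>\<X>. \<forall>Z. n_exact C n Z \<and> split_ext C n X Z Y \<longrightarrow> Z \<in> \<X>)"

definition deflations_compose :: "('o, 'm) cat \<Rightarrow> ('o, 'm) cpx set \<Rightarrow> bool" where
  "deflations_compose C \<X> \<longleftrightarrow> (\<forall>f g. deflation \<X> f \<and> deflation \<X> g \<and> Cod C f = Dom C g \<longrightarrow> deflation \<X> (Comp C g f))"

text \<open>The content of \<open>Ex2_op\<close> for a single \<open>d\<close>. Splitting the axiom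
  this way matches \<open>Pb\<close>, which is also a condition on one module at a time
  (\<open>Pb_iff\<close>).\<close>

definition pullback_condition :: "('o, 'm) cat \<Rightarrow> ('o, 'm) cpx set \<Rightarrow> 'm \<Rightarrow> bool" where
  "pullback_condition C \<X> d \<longleftrightarrow> (\<forall>B' f W i1 i2 p1 p2 v. ar C f B' (Cod C d) \<and> biproduct C (Dom C d) B' W i1 i2 p1 p2 \<and>
      v = add C (Comp C (neg C d) p1) (Comp C f p2) \<longrightarrow>
      deflation \<X> v \<and> (\<exists>k. weak_kernel C v k \<and> deflation \<X> (Comp C p2 k)))"

definition deflations_pull_back :: "('o, 'm) cat \<Rightarrow> ('o, 'm) cpx set \<Rightarrow> bool" where
  "deflations_pull_back C \<X> \<longleftrightarrow> (\<forall>d. deflation \<X> d \<longrightarrow> pullback_condition C \<X> d)"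

context preadditive_category
begin

lemma mod_iso_sym: "mod_iso C M N \<Longrightarrow> cmodule C M \<Longrightarrow> mod_iso C N M"
proof -
  assume "mod_iso C M N" and M: "cmodule C M"
  then obtain \<alpha> where \<alpha>: "nat_trans C M N \<alpha>" and i: "\<And>X. X \<in> Obj C \<Longrightarrow> \<alpha> X \<in> iso (Val M X) (Val N X)"
    by (auto simp: mod_iso_def)
  let ?\<beta> = "\<lambda>X. inv_into (carrier (Val M X)) (\<alpha> X)"
  have bi: "?\<beta> X \<in> iso (Val N X) (Val M X)" if "X \<in> Obj C" for X
    using group.iso_set_sym[OF Val_group[OF M that] i[OF that]] .
  have bij: "bij_betw (\<alpha> X) (carrier (Val M X)) (carrier (Val N X))" if "X \<in> Obj C" for X
    using i[OF that] by (simp add: iso_def)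
  have "nat_trans C N M ?\<beta>"
  proof (rule nat_transI)
    fix X m assume X: "X \<in> Obj C" "m \<in> carrier (Val N X)"
    show "?\<beta> X m \<in> carrier (Val M X)" using bi[OF X(1)] X(2) by (auto simp: iso_def hom_def)
    fix m' assume "m' \<in> carrier (Val N X)"
    then show "?\<beta> X (m \<otimes>\<^bsub>Val N X\<^esub> m') = ?\<beta> X m \<otimes>\<^bsub>Val M X\<^esub> ?\<beta> X m'" using bi[OF X(1)] X(2) by (auto simp: iso_def hom_def)
  next
    fix f m assume f: "Ar C f" "m \<in> carrier (Val N (Cod C f))"
    then obtain m' where m': "m' \<in> carrier (Val M (Cod C f))" "m = \<alpha> (Cod C f) m'"
      using bij[of "Cod C f"] by (auto simp: bij_betw_def)
    have "?\<beta> (Cod C f) m = m'" using m' bij[of "Cod C f"] f by (simp add: bij_betw_def)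
    moreover have "Act N f m = \<alpha> (Dom C f) (Act M f m')" using nat_transD(3)[OF \<alpha> f(1) m'(1)] m'(2) by simp
    ultimately show "?\<beta> (Dom C f) (Act N f m) = Act M f (?\<beta> (Cod C f) m)"
      using bij[of "Dom C f"] Act_closed[OF M f(1) m'(1)] f by (simp add: bij_betw_def)
  qed
  then show ?thesis using bi unfolding mod_iso_def by blast
qed

lemma homotopy_equiv_sym: "homotopy_equiv C n X Y \<Longrightarrow> homotopy_equiv C n Y X"
  unfolding homotopy_equiv_def by blast

lemma Fun_cok: "n_exact C n X \<Longrightarrow> Fun C X = cok (df X (Suc 0))"
  using n_exactD(1)[of n X 0] by (simp add: Fun_def cok_def)

lemma n_exact_d1: "n_exact C n X \<Longrightarrow> ar C (df X (Suc 0)) (ob X (Suc 0)) (ob X 0)"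
  using n_exactD(1)[of n X 0] by simp

lemma weak_kernelD:
  assumes "weak_kernel C v k" "Ar C v"
  shows "ar C k (Dom C k) (Dom C v)" "v \<cdot> k = zr C (Dom C k) (Cod C v)"
    "ar C h T (Dom C v) \<Longrightarrow> v \<cdot> h = zr C T (Cod C v) \<Longrightarrow> \<exists>u. ar C u T (Dom C k) \<and> h = k \<cdot> u"
proof -
  show k: "ar C k (Dom C k) (Dom C v)" using assms homs_iff[of "Dom C k" "Dom C v" k] by (simp add: weak_kernel_def)
  show "v \<cdot> k = zr C (Dom C k) (Cod C v)" using assms by (simp add: weak_kernel_def zr_def)
  assume h: "ar C h T (Dom C v)" "v \<cdot> h = zr C T (Cod C v)"
  have "h \<in> homs C T (Dom C v)" "T \<in> Obj C" using h Ar_homs by auto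
  then obtain u where "u \<in> homs C T (Dom C k)" "h = k \<cdot> u" using assms h(2) unfolding weak_kernel_def zr_def by blast
  then show "\<exists>u. ar C u T (Dom C k) \<and> h = k \<cdot> u" using homs_iff[of T "Dom C k" u] k h ArD(1) by metis
qed

lemma weak_kernelI:
  assumes "ar C k U A" "ar C v A B" "v \<cdot> k = zr C U B"
    "\<And>h T. ar C h T A \<Longrightarrow> v \<cdot> h = zr C T B \<Longrightarrow> \<exists>u. ar C u T U \<and> h = k \<cdot> u"
  shows "weak_kernel C v k"
  unfolding weak_kernel_def
proof (intro conjI ballI impI)
  fix T h assume T: "T \<in> Obj C" "h \<in> homs C T (Dom C v)" "v \<cdot> h = \<one>\<^bsub>Hom C T (Cod C v)\<^esub>"
  have "A \<in> Obj C" using assms(2) by auto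
  then have "ar C h T A" using T assms(2) by (simp add: homs_iff)
  then obtain u where "ar C u T U" "h = k \<cdot> u" using assms(2,4) T(3) by (auto simp: zr_def)
  then show "\<exists>u\<in>homs C T (Dom C k). h = k \<cdot> u" using assms(1) Ar_homs by (intro bexI[of _ u]) simp_all
qed (use assms Ar_homs in \<open>auto simp: zr_def\<close>)

text \<open>As G is generated by \<open>g\<close>, the image of \<alpha> consists of the elements f
  k applied to \<open>x\<close>. Hence h kills the class of \<open>x\<close> in the quotient iff h =
  f k + d l for some k and l, that is, iff h factors through the row with entries -d and f.\<close>

lemma presents_pullback_Cok:
  assumes p: "presents C d x F" and d: "ar C d A B" and bi: "biproduct C A B' W i1 i2 p1 p2" and f: "ar C f B' B"
    and \<alpha>: "nat_trans C G F \<alpha>" and g: "gen C G B' g" "\<alpha> B' g = Act F f x"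
  shows "\<exists>z. presents C (neg C d \<cdot> p1 \<boxplus> f \<cdot> p2) z (Cok_mod C \<alpha> G F)"
proof -
  note [simp] = biproductD(1-11)[OF bi] biproduct_cmp[OF bi] d f
  have gF: "gen C F B x" using presents_gen[OF p] by simp
  note F = genD[OF gF] and G = genD[OF g(1)]
  note K = gen_Cok[OF \<alpha> G(1) gF]
  let ?v = "neg C d \<cdot> p1 \<boxplus> f \<cdot> p2"
  have v: "ar C ?v W B" by simp
  have im: "Act F h x \<in> \<alpha> T ` carrier (Val G T) \<longleftrightarrow> (\<exists>k l. ar C k T B' \<and> ar C l T A \<and> h = f \<cdot> k \<boxplus> d \<cdot> l)"
    if h: "ar C h T B" for h T
  proof
    assume "Act F h x \<in> \<alpha> T ` carrier (Val G T)"
    then obtain m where m: "m \<in> carrier (Val G T)" "Act F h x = \<alpha> T m" by blast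
    have "T \<in> Obj C" using h by auto
    then obtain k where k: "ar C k T B'" "m = Act G k g" using genE[OF g(1) m(1)] by metis
    have "Act F h x = Act F (f \<cdot> k) x" using m(2) nat_trans_gen[OF \<alpha> g(1) k(1)] k F by (simp add: g(2) Act_cmp)
    then have "Act F (h \<boxminus> f \<cdot> k) x = \<one>\<^bsub>Val F T\<^esub>" using h k(1) F by (simp add: Act_sub)
    then obtain l where l: "ar C l T A" "h \<boxminus> f \<cdot> k = d \<cdot> l" using presentsE[OF p, of "h \<boxminus> f \<cdot> k" T] h k(1) by auto
    have "h = d \<cdot> l \<boxplus> f \<cdot> k" using iffD1[OF sub_eq_iff _] l h k(1) by simp
    then have "h = f \<cdot> k \<boxplus> d \<cdot> l" using add_comm[of "d \<cdot> l" "f \<cdot> k"] l(1) k(1) by simp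
    then show "\<exists>k l. ar C k T B' \<and> ar C l T A \<and> h = f \<cdot> k \<boxplus> d \<cdot> l" using k(1) l(1) by blast
  next
    assume "\<exists>k l. ar C k T B' \<and> ar C l T A \<and> h = f \<cdot> k \<boxplus> d \<cdot> l"
    then obtain k l where kl: "ar C k T B'" "ar C l T A" "h = f \<cdot> k \<boxplus> d \<cdot> l" by blast
    have "Act F (h \<boxminus> f \<cdot> k) x = \<one>\<^bsub>Val F T\<^esub>" unfolding kl(3) using kl(1,2) presents_cmp[OF p, of l T] by simp
    then have "Act F h x = Act F (f \<cdot> k) x" using h kl(1) F by (simp add: Act_sub)
    also have "\<dots> = \<alpha> T (Act G k g)" using nat_trans_gen[OF \<alpha> g(1) kl(1)] kl(1) F by (simp add: g(2) Act_cmp)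
    finally show "Act F h x \<in> \<alpha> T ` carrier (Val G T)" using Act_closed[OF G(1), of k g] kl(1) G by auto
  qed
  let ?z = "(\<alpha> B ` carrier (Val G B)) #>\<^bsub>Val F B\<^esub> x"
  have "presents C ?v ?z (Cok_mod C \<alpha> G F)"
  proof (rule presentsI)
    show "gen C (Cok_mod C \<alpha> G F) (Cod C ?v) ?z" using K(1) v by simp
    fix k T assume "ar C k T (Dom C ?v)"
    then have k: "ar C k T W" using v by simp
    have h: "ar C (?v \<cdot> k) T B" using k by simp
    have "?v \<cdot> k = f \<cdot> (p2 \<cdot> k) \<boxplus> d \<cdot> neg C (p1 \<cdot> k)" using k add_comm[of "neg C (d \<cdot> p1 \<cdot> k)" "f \<cdot> p2 \<cdot> k"] by simp
    moreover have "ar C (p2 \<cdot> k) T B'" "ar C (neg C (p1 \<cdot> k)) T A" using k by simp_all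
    ultimately have "Act F (?v \<cdot> k) x \<in> \<alpha> T ` carrier (Val G T)" using iffD2[OF im[OF h]] by blast
    then show "Act (Cok_mod C \<alpha> G F) (?v \<cdot> k) ?z = \<one>\<^bsub>Val (Cok_mod C \<alpha> G F) T\<^esub>" using K(2)[of "?v \<cdot> k"] h by metis
  next
    fix h T assume a: "ar C h T (Cod C ?v)" "Act (Cok_mod C \<alpha> G F) h ?z = \<one>\<^bsub>Val (Cok_mod C \<alpha> G F) T\<^esub>"
    then have h: "ar C h T B" using v by simp
    then have "Act F h x \<in> \<alpha> T ` carrier (Val G T)" using K(2)[of h] a(2) by auto
    then obtain k l where kl: "ar C k T B'" "ar C l T A" "h = f \<cdot> k \<boxplus> d \<cdot> l" using im[OF h] by blast
    let ?u = "i1 \<cdot> neg C l \<boxplus> i2 \<cdot> k"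
    have TO: "T \<in> Obj C" using h by auto
    have u: "ar C ?u T W" "p1 \<cdot> ?u = neg C l" "p2 \<cdot> ?u = k" using kl(1,2) TO by simp_all
    have "?v \<cdot> ?u = neg C d \<cdot> (p1 \<cdot> ?u) \<boxplus> f \<cdot> (p2 \<cdot> ?u)" using u(1) by simp
    also have "\<dots> = h" unfolding u(2,3) kl(3) using kl(1,2) add_comm[of "d \<cdot> l" "f \<cdot> k"] by simp
    finally show "\<exists>k. ar C k T (Dom C ?v) \<and> h = ?v \<cdot> k" using u(1) v by (intro exI[of _ ?u]) (simp del: addl)
  qed (use v in blast)
  then show ?thesis by blast
qed

text \<open>The image is generated by f applied to \<open>x\<close>, and h is a relation iff f h = d
  l for some l. This means that the pair (l, h) is killed by the row with entries -d and f, so it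
  factors through the weak kernel k, and h factors through its second component.\<close>

lemma presents_pullback_Im:
  assumes p: "presents C d x F" and d: "ar C d A B" and bi: "biproduct C A B' W i1 i2 p1 p2" and f: "ar C f B' B"
    and \<alpha>: "nat_trans C G F \<alpha>" and g: "gen C G B' g" "\<alpha> B' g = Act F f x"
    and wk: "weak_kernel C (neg C d \<cdot> p1 \<boxplus> f \<cdot> p2) k"
  shows "\<exists>y. presents C (p2 \<cdot> k) y (Im_mod \<alpha> G F)"
proof -
  note [simp] = biproductD(1-11)[OF bi] biproduct_cmp[OF bi] d f
  have gF: "gen C F B x" using presents_gen[OF p] by simp
  note F = genD[OF gF] and G = genD[OF g(1)]
  let ?v = "neg C d \<cdot> p1 \<boxplus> f \<cdot> p2" and ?I = "Im_mod \<alpha> G F"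
  have v: "ar C ?v W B" by simp
  have vh: "?v \<cdot> h = neg C (d \<cdot> p1 \<cdot> h) \<boxplus> f \<cdot> p2 \<cdot> h" if "ar C h T W" for h T using that by simp
  define U where "U = Dom C k"
  have k: "ar C k U W" "?v \<cdot> k = zr C U B" using weak_kernelD(1,2)[OF wk] v by (simp_all add: U_def)
  have kf: "\<exists>u. ar C u T U \<and> h = k \<cdot> u" if "ar C h T W" "?v \<cdot> h = zr C T B" for h T
    using weak_kernelD(3)[OF wk, of h T] v that by (simp add: U_def)
  note [simp] = k(1)
  let ?y = "Act F f x"
  have Iact: "Act ?I = Act F" "\<And>T. \<one>\<^bsub>Val ?I T\<^esub> = \<one>\<^bsub>Val F T\<^esub>" "\<And>T. carrier (Val ?I T) = \<alpha> T ` carrier (Val G T)"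
    by (simp_all add: Im_mod_def)
  have yh: "Act F h ?y = Act F (f \<cdot> h) x" if "ar C h T B'" for h T using that F by (simp add: Act_cmp)
  have "presents C (p2 \<cdot> k) ?y ?I"
  proof (rule presentsI)
    show "gen C ?I (Cod C (p2 \<cdot> k)) ?y" unfolding gen_def Iact
    proof (intro conjI ballI)
      show "cmodule C ?I" by (rule cmodule_Im[OF \<alpha> G(1) F(1)])
      show "?y \<in> \<alpha> (Cod C (p2 \<cdot> k)) ` carrier (Val G (Cod C (p2 \<cdot> k)))" using G(3) by (simp add: g(2)[symmetric])
      fix T m assume T: "T \<in> Obj C" "m \<in> \<alpha> T ` carrier (Val G T)"
      then obtain m' where m': "m' \<in> carrier (Val G T)" "m = \<alpha> T m'" by blast
      obtain h where h: "ar C h T B'" "m' = Act G h g" using genE[OF g(1) m'(1) T(1)] .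
      then have "m = Act F h ?y" using m'(2) nat_trans_gen[OF \<alpha> g(1) h(1)] g(2) by simp
      then show "\<exists>h. ar C h T (Cod C (p2 \<cdot> k)) \<and> m = Act F h ?y" using h(1) by auto
    qed simp
    fix u T assume "ar C u T (Dom C (p2 \<cdot> k))"
    then have u: "ar C u T U" by simp
    then have TO: "T \<in> Obj C" by auto
    have "zr C T B = ?v \<cdot> (k \<cdot> u)" using cmp_eq1[OF k(2), of u] u TO v F(2) by simp
    also have "\<dots> = neg C (d \<cdot> p1 \<cdot> k \<cdot> u) \<boxplus> f \<cdot> p2 \<cdot> k \<cdot> u" using vh[of "k \<cdot> u" T] u by simp
    finally have e: "f \<cdot> p2 \<cdot> k \<cdot> u \<boxplus> neg C (d \<cdot> p1 \<cdot> k \<cdot> u) = zr C T B"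
      using add_comm[of "neg C (d \<cdot> p1 \<cdot> k \<cdot> u)" "f \<cdot> p2 \<cdot> k \<cdot> u"] u by simp
    have "f \<cdot> p2 \<cdot> k \<cdot> u \<boxminus> d \<cdot> p1 \<cdot> k \<cdot> u = zr C T B" unfolding sub_def by (rule e)
    then have "f \<cdot> p2 \<cdot> k \<cdot> u = d \<cdot> p1 \<cdot> k \<cdot> u" using u by (subst (asm) sub_eq_zr) simp_all
    then have "Act F (f \<cdot> p2 \<cdot> k \<cdot> u) x = \<one>\<^bsub>Val F T\<^esub>" using presents_cmp[OF p, of "p1 \<cdot> k \<cdot> u" T] u by simp
    then show "Act ?I ((p2 \<cdot> k) \<cdot> u) ?y = \<one>\<^bsub>Val ?I T\<^esub>" unfolding Iact using yh[of "p2 \<cdot> k \<cdot> u" T] u by simp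
  next
    fix h T assume a: "ar C h T (Cod C (p2 \<cdot> k))" "Act ?I h ?y = \<one>\<^bsub>Val ?I T\<^esub>"
    then have h: "ar C h T B'" and TO: "T \<in> Obj C" by auto
    have "Act F (f \<cdot> h) x = \<one>\<^bsub>Val F T\<^esub>" using a(2) yh[OF h] unfolding Iact by simp
    then obtain l where l: "ar C l T A" "f \<cdot> h = d \<cdot> l" using presentsE[OF p, of "f \<cdot> h" T] h by auto
    let ?w = "i1 \<cdot> l \<boxplus> i2 \<cdot> h"
    have w: "ar C ?w T W" "p1 \<cdot> ?w = l" "p2 \<cdot> ?w = h" using h l(1) TO by simp_all
    have "?v \<cdot> ?w = zr C T B" unfolding vh[OF w(1)] w(2,3) l(2) using l(1) add_comm[of "d \<cdot> l" "neg C (d \<cdot> l)"] by simp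
    then obtain u where u: "ar C u T U" "?w = k \<cdot> u" using kf[OF w(1)] by blast
    have "h = (p2 \<cdot> k) \<cdot> u" using w(3) u by simp
    then show "\<exists>u. ar C u T (Dom C (p2 \<cdot> k)) \<and> h = (p2 \<cdot> k) \<cdot> u" using u(1) by (intro exI[of _ u]) simp
  qed simp
  then show ?thesis by blast
qed

end

section \<open>Essential images of Fun and Res through presentations\<close>

context idempotent_complete_additive_category
begin

text \<open>The augmentation corresponds to its value at the identity of X_0, and covariant
  exactness is already part of n-exactness.\<close>

lemma resolves_iff: "n_exact C n X \<Longrightarrow> cmodule C F \<Longrightarrow> resolves C n X F \<longleftrightarrow> (\<exists>x. presents C (df X (Suc 0)) x F)"
proof
  assume X: "n_exact C n X" and F: "cmodule C F"
  note d = n_exact_d1[OF X]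
  have o: "ob X 0 \<in> Obj C" "ob X (Suc 0) \<in> Obj C" using n_exactD(2)[OF X] by auto
  note R = represents_Rep[OF o(1)]
  { assume "resolves C n X F"
    then obtain \<epsilon> where \<epsilon>: "nat_trans C (Rep C (ob X 0)) F \<epsilon>"
      and s: "\<And>Y. Y \<in> Obj C \<Longrightarrow> \<epsilon> Y ` homs C Y (ob X 0) = carrier (Val F Y)"
      and k: "\<And>Y. Y \<in> Obj C \<Longrightarrow> Comp C (df X (Suc 0)) ` homs C Y (ob X (Suc 0)) = {h \<in> homs C Y (ob X 0). \<epsilon> Y h = \<one>\<^bsub>Val F Y\<^esub>}"
      by (auto simp: resolves_def exact_at_def kernel_def)
    let ?x = "\<epsilon> (ob X 0) (Idn C (ob X 0))"
    have eh: "\<epsilon> T h = Act F h ?x" if h: "ar C h T (ob X 0)" for h T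
      using nat_trans_gen[OF \<epsilon> represents_gen[OF R] h] h by simp
    have "presents C (df X (Suc 0)) ?x F"
    proof (rule presentsI)
      show "gen C F (Cod C (df X (Suc 0))) ?x" unfolding gen_def
      proof (intro conjI ballI)
        have "Idn C (ob X 0) \<in> homs C (ob X 0) (ob X 0)" by (rule Idn_closed[OF o(1)])
        then show "?x \<in> carrier (Val F (Cod C (df X (Suc 0))))" using s[OF o(1)] d by auto
        fix Y m assume Y: "Y \<in> Obj C" "m \<in> carrier (Val F Y)"
        then obtain h where h: "h \<in> homs C Y (ob X 0)" "m = \<epsilon> Y h" using s[OF Y(1)] by auto
        then have "ar C h Y (ob X 0)" using homs_iff Y(1) o(1) by blast
        then show "\<exists>h. ar C h Y (Cod C (df X (Suc 0))) \<and> m = Act F h ?x" using d eh h(2) by auto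
      qed (use F d o in auto)
      fix l T assume "ar C l T (Dom C (df X (Suc 0)))"
      then have l: "ar C l T (ob X (Suc 0))" "T \<in> Obj C" using d by auto
      then have "df X (Suc 0) \<cdot> l \<in> Comp C (df X (Suc 0)) ` homs C T (ob X (Suc 0))" using Ar_homs by blast
      then have "\<epsilon> T (df X (Suc 0) \<cdot> l) = \<one>\<^bsub>Val F T\<^esub>" unfolding k[OF l(2)] by blast
      then show "Act F (df X (Suc 0) \<cdot> l) ?x = \<one>\<^bsub>Val F T\<^esub>" using eh[of "df X (Suc 0) \<cdot> l" T] l d by simp
    next
      fix h T assume a: "ar C h T (Cod C (df X (Suc 0)))" "Act F h ?x = \<one>\<^bsub>Val F T\<^esub>"
      then have h: "ar C h T (ob X 0)" using d by simp
      then have TO: "T \<in> Obj C" by auto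
      have "h \<in> {h \<in> homs C T (ob X 0). \<epsilon> T h = \<one>\<^bsub>Val F T\<^esub>}" using a(2) eh[OF h(1)] h(1) Ar_homs by simp
      then obtain l where l: "l \<in> homs C T (ob X (Suc 0))" "h = df X (Suc 0) \<cdot> l" unfolding k[OF TO, symmetric] by blast
      then have "ar C l T (Dom C (df X (Suc 0)))" using homs_iff[OF TO o(2)] d by simp
      then show "\<exists>k. ar C k T (Dom C (df X (Suc 0))) \<and> h = df X (Suc 0) \<cdot> k" using l(2) by blast
    qed (use d in blast)
    then show "\<exists>x. presents C (df X (Suc 0)) x F" by blast }
  { assume "\<exists>x. presents C (df X (Suc 0)) x F"
    then obtain x where p: "presents C (df X (Suc 0)) x F" by blast
    have g: "gen C F (ob X 0) x" using presents_gen[OF p] d by simp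
    obtain \<epsilon> where \<epsilon>: "nat_trans C (Rep C (ob X 0)) F \<epsilon>" "\<epsilon> (ob X 0) (Idn C (ob X 0)) = x"
      using hom_from_represents[OF R F genD(3)[OF g]] by metis
    have eh: "\<epsilon> T h = Act F h x" if h: "ar C h T (ob X 0)" for h T
      using nat_trans_gen[OF \<epsilon>(1) represents_gen[OF R] h] h by (simp add: \<epsilon>(2))
    show "resolves C n X F" unfolding resolves_def
    proof (intro conjI ballI exI[of _ \<epsilon>])
      show "nat_trans C (Rep C (ob X 0)) F \<epsilon>" by (rule \<epsilon>(1))
      fix Y assume Y: "Y \<in> Obj C"
      show "hom_exact C n X Y" using X Y by (simp add: n_exact_def)
      show "\<epsilon> Y ` homs C Y (ob X 0) = carrier (Val F Y)"
      proof (intro equalityI subsetI)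
        fix m assume m: "m \<in> carrier (Val F Y)"
        obtain h where h: "ar C h Y (ob X 0)" "m = Act F h x" using genE[OF g m Y] .
        have "h \<in> homs C Y (ob X 0)" using h(1) Ar_homs by blast
        then show "m \<in> \<epsilon> Y ` homs C Y (ob X 0)" using h eh[OF h(1)] by blast
      qed (use nat_transD(2)[OF \<epsilon>(1) Y] in auto)
      show "exact_at (Hom C Y (ob X 1)) (Hom C Y (ob X 0)) (Val F Y) (Comp C (df X 1)) (\<epsilon> Y)"
        unfolding exact_at_def kernel_def One_nat_def
      proof (intro equalityI subsetI)
        fix h assume "h \<in> Comp C (df X (Suc 0)) ` homs C Y (ob X (Suc 0))"
        then obtain l where l: "ar C l Y (ob X (Suc 0))" "h = df X (Suc 0) \<cdot> l" using homs_iff[OF Y o(2)] by auto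
        have h: "ar C h Y (ob X 0)" unfolding l(2) using l(1) d by simp
        have "Act F h x = \<one>\<^bsub>Val F Y\<^esub>" unfolding l(2) using presents_cmp[OF p, of l Y] l(1) d by simp
        then show "h \<in> {h \<in> homs C Y (ob X 0). \<epsilon> Y h = \<one>\<^bsub>Val F Y\<^esub>}" using eh[OF h] h Ar_homs by simp
      next
        fix h assume "h \<in> {h \<in> homs C Y (ob X 0). \<epsilon> Y h = \<one>\<^bsub>Val F Y\<^esub>}"
        then have h: "ar C h Y (ob X 0)" "\<epsilon> Y h = \<one>\<^bsub>Val F Y\<^esub>" using homs_iff[OF Y o(1)] by auto
        then have "Act F h x = \<one>\<^bsub>Val F Y\<^esub>" using eh by simp
        then obtain l where "ar C l Y (ob X (Suc 0))" "h = df X (Suc 0) \<cdot> l" using presentsE[OF p, of h Y] h(1) d by auto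
        then show "h \<in> Comp C (df X (Suc 0)) ` homs C Y (ob X (Suc 0))" using Ar_homs by blast
      qed
    qed }
qed

lemma Res_props:
  assumes "F \<in> ex_cat C n"
  shows "n_exact C n (Res C n F)" "\<exists>x. presents C (df (Res C n F) (Suc 0)) x F"
proof -
  have F: "cmodule C F" using assms by (auto simp: ex_cat_def intro: in_mod_cmodule)
  obtain X x where "n_exact C n X" "presents C (df X (Suc 0)) x F" using assms unfolding ex_cat_iff by blast
  then have "\<exists>X. n_exact C n X \<and> resolves C n X F" using resolves_iff[OF _ F] by blast
  then have *: "n_exact C n (Res C n F) \<and> resolves C n (Res C n F) F" unfolding Res_def by (rule someI_ex)
  then show "n_exact C n (Res C n F)" by blast
  then show "\<exists>x. presents C (df (Res C n F) (Suc 0)) x F" using * resolves_iff[OF _ F] by blast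
qed

lemma Fun_presents: "n_exact C n X \<Longrightarrow> \<exists>x. presents C (df X (Suc 0)) x (Fun C X)"
  using presents_cok[of "df X (Suc 0)"] n_exact_d1[of n X] Fun_cok[of n X] by simp

lemma Fun_in_ex_cat: "n_exact C n X \<Longrightarrow> Fun C X \<in> ex_cat C n"
  using Fun_presents ex_cat_iff by blast

lemma Fun_mod_iso_iff: "n_exact C n X \<Longrightarrow> cmodule C F \<Longrightarrow> mod_iso C (Fun C X) F \<longleftrightarrow> (\<exists>x. presents C (df X (Suc 0)) x F)"
  using Fun_presents[of n X] mod_iso_presents[of "Fun C X" F "df X (Suc 0)"] presents_mod_iso[of "df X (Suc 0)" _ "Fun C X" _ F]
  by blast

lemma presents_cmodule: "presents C v x F \<Longrightarrow> cmodule C F"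
  by (rule genD(1)[OF presents_gen])

lemma iso_class_exact: "iso_class C n \<X> \<Longrightarrow> X \<in> \<X> \<Longrightarrow> n_exact C n X"
  by (simp add: iso_class_def)

lemma Fun_image_iff:
  assumes "iso_class C n \<X>"
  shows "F \<in> Fun_image C n \<X> \<longleftrightarrow> (\<exists>X\<in>\<X>. \<exists>x. presents C (df X (Suc 0)) x F)"
proof
  assume "F \<in> Fun_image C n \<X>"
  then obtain X where X: "F \<in> ex_cat C n" "X \<in> \<X>" "mod_iso C (Fun C X) F" by (auto simp: Fun_image_def)
  then have "cmodule C F" by (auto simp: ex_cat_def intro: in_mod_cmodule)
  then show "\<exists>X\<in>\<X>. \<exists>x. presents C (df X (Suc 0)) x F"
    using X Fun_mod_iso_iff[OF iso_class_exact[OF assms X(2)]] by blast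
next
  assume "\<exists>X\<in>\<X>. \<exists>x. presents C (df X (Suc 0)) x F"
  then obtain X x where X: "X \<in> \<X>" "presents C (df X (Suc 0)) x F" by blast
  note e = iso_class_exact[OF assms X(1)]
  have "F \<in> ex_cat C n" using ex_cat_iff e X(2) by blast
  moreover have "mod_iso C (Fun C X) F" using Fun_mod_iso_iff[OF e presents_cmodule[OF X(2)]] X(2) by blast
  ultimately show "F \<in> Fun_image C n \<X>" using X(1) by (auto simp: Fun_image_def)
qed

lemma iso_class_presents:
  assumes "iso_class C n \<X>" "X \<in> \<X>" "presents C (df X (Suc 0)) x F" "n_exact C n Y" "presents C (df Y (Suc 0)) y F"
  shows "Y \<in> \<X>"
  using assms presents_homotopy_equiv[OF iso_class_exact[OF assms(1,2)] assms(3,4,5)] unfolding iso_class_def by blast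

lemma deflation_presents:
  assumes "n > 0" "iso_class C n \<X>" "X \<in> \<X>" "presents C (df X (Suc 0)) x F" "presents C v y F"
  shows "deflation \<X> v"
proof -
  obtain Y where Y: "n_exact C n Y" "df Y (Suc 0) = v"
    using presents_n_exact[OF assms(1) iso_class_exact[OF assms(2,3)] assms(4,5)] by blast
  then have "Y \<in> \<X>" using iso_class_presents[OF assms(2,3,4)] assms(5) by blast
  then show ?thesis using Y(2) unfolding deflation_def by auto
qed

lemma deflationE:
  assumes "deflation \<X> v" "iso_class C n \<X>"
  obtains X where "X \<in> \<X>" "n_exact C n X" "df X (Suc 0) = v" "ar C v (ob X (Suc 0)) (ob X 0)"
  using assms iso_class_exact n_exact_d1 unfolding deflation_def One_nat_def by metis

section \<open>Pb and the pullback axiom\<close>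

lemma belongs_iff:
  assumes X: "iso_class C n \<X>" and M: "cmodule C M"
  shows "belongs C M (Fun_image C n \<X>) \<longleftrightarrow> (\<exists>X\<in>\<X>. \<exists>x. presents C (df X (Suc 0)) x M)"
proof
  assume "belongs C M (Fun_image C n \<X>)"
  then obtain F where F: "F \<in> Fun_image C n \<X>" "mod_iso C M F" by (auto simp: belongs_def)
  then obtain X x where X: "X \<in> \<X>" "presents C (df X (Suc 0)) x F" using Fun_image_iff[OF X] by blast
  then show "\<exists>X\<in>\<X>. \<exists>x. presents C (df X (Suc 0)) x M"
    using mod_iso_presents[OF mod_iso_sym[OF F(2) M] M X(2)] by blast
next
  assume "\<exists>X\<in>\<X>. \<exists>x. presents C (df X (Suc 0)) x M"
  then obtain Y x where Y: "Y \<in> \<X>" "presents C (df Y (Suc 0)) x M" by blast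
  obtain y where y: "presents C (df Y (Suc 0)) y (Fun C Y)" using Fun_presents[OF iso_class_exact[OF X Y(1)]] by blast
  have "Fun C Y \<in> Fun_image C n \<X>" using Fun_image_iff[OF X] Y(1) y by blast
  then show "belongs C M (Fun_image C n \<X>)" using presents_mod_iso[OF Y(2) y] by (auto simp: belongs_def)
qed

text \<open>A morphism f into X_0 and a map \<alpha> from a module to F carry the same information:
  f gives the map from a representable module sending the universal element to f applied to
  \<open>x\<close>, and \<alpha> gives an f through the image of a generator. The cokernel and image
  of \<alpha> are then presented by the two morphisms that the axiom requires to be
  deflations.\<close>

lemma Pb_iff:
  assumes n: "n > 0" and \<X>: "iso_class C n \<X>" and X: "X \<in> \<X>" and p: "presents C (df X (Suc 0)) x F"
  shows "F \<in> Pb C (Fun_image C n \<X>) \<longleftrightarrow> pullback_condition C \<X> (df X (Suc 0))"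
proof
  let ?d = "df X (Suc 0)" and ?A = "ob X (Suc 0)" and ?B = "ob X 0"
  note d = n_exact_d1[OF iso_class_exact[OF \<X> X]]
  have gF: "gen C F ?B x" using presents_gen[OF p] d by simp
  note F = genD[OF gF]
  { assume "F \<in> Pb C (Fun_image C n \<X>)"
    then have Pb: "\<And>(G :: ('a, 'b, 'b set) cmod) \<alpha>. in_mod C G \<Longrightarrow> nat_trans C G F \<alpha> \<Longrightarrow>
       belongs C (Im_mod \<alpha> G F) (Fun_image C n \<X>) \<and> belongs C (Cok_mod C \<alpha> G F) (Fun_image C n \<X>)"
      by (simp add: Pb_def)
    show "pullback_condition C \<X> ?d" unfolding pullback_condition_def
    proof (intro allI impI)
      fix B' f W i1 i2 p1 p2 v
      assume "ar C f B' (Cod C ?d) \<and> biproduct C (Dom C ?d) B' W i1 i2 p1 p2 \<and> v = neg C ?d \<cdot> p1 \<boxplus> f \<cdot> p2"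
      then have f: "ar C f B' ?B" and bi: "biproduct C ?A B' W i1 i2 p1 p2" and v: "v = neg C ?d \<cdot> p1 \<boxplus> f \<cdot> p2" using d by auto
      note biD = biproductD[OF bi]
      have vA: "ar C v W ?B" unfolding v using d f biD by simp
      \<comment> \<open>The quantifier in \<open>Pb\<close> ranges over modules with elements of
        type \<open>'m set\<close>, so the representable module is taken in this copy.\<close>
      let ?G = "ssub C B' (\<lambda>_. True)"
      note G = represents_ssub[OF biD(2)]
      have Gm: "in_mod C ?G" using represents_rres[OF G] by (elim exE) (rule rres_in_mod)
      have y: "Act F f x \<in> carrier (Val F B')" using Act_closed[OF F(1), of f x] f F by simp
      obtain \<alpha> where \<alpha>: "nat_trans C ?G F \<alpha>" "\<alpha> B' {Idn C B'} = Act F f x" using hom_from_represents[OF G F(1) y] by metis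
      note Gc = in_mod_cmodule[OF Gm]
      have "belongs C (Cok_mod C \<alpha> ?G F) (Fun_image C n \<X>)" using Pb[OF Gm \<alpha>(1)] by blast
      then obtain V z where V: "V \<in> \<X>" "presents C (df V (Suc 0)) z (Cok_mod C \<alpha> ?G F)"
        using belongs_iff[OF \<X> Cok_props(1)[OF \<alpha>(1) Gc F(1)]] by blast
      obtain z' where z': "presents C v z' (Cok_mod C \<alpha> ?G F)"
        using presents_pullback_Cok[OF p d bi f \<alpha>(1) represents_gen[OF G] \<alpha>(2)] unfolding v by blast
      have dv: "deflation \<X> v" by (rule deflation_presents[OF n \<X> V z'])
      then obtain V' where V': "V' \<in> \<X>" "n_exact C n V'" "df V' (Suc 0) = v" "ar C v (ob V' (Suc 0)) (ob V' 0)"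
        using deflationE[OF _ \<X>] by metis
      have d2: "ar C (df V' (Suc (Suc 0))) (ob V' (Suc (Suc 0))) (ob V' (Suc 0))" using n_exactD(1)[OF V'(2), of "Suc 0"] n by simp
      \<comment> \<open>Once \<open>?v\<close> ends a sequence in the class, the differential before
        it is a weak kernel; it exists because n > 0.\<close>
      have wk: "weak_kernel C v (df V' (Suc (Suc 0)))"
      proof (rule weak_kernelI[OF d2 V'(4)])
        show "v \<cdot> df V' (Suc (Suc 0)) = zr C (ob V' (Suc (Suc 0))) (ob V' 0)" using n_exactD(3)[OF V'(2), of 0] n V'(3) by simp
        show "\<exists>u. ar C u T (ob V' (Suc (Suc 0))) \<and> h = df V' (Suc (Suc 0)) \<cdot> u" if "ar C h T (ob V' (Suc 0))" "v \<cdot> h = zr C T (ob V' 0)" for h T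
          using n_exactD(5)[OF V'(2) n that(1)] that(2) V'(3) by simp
      qed
      have "belongs C (Im_mod \<alpha> ?G F) (Fun_image C n \<X>)" using Pb[OF Gm \<alpha>(1)] by blast
      then obtain U u where U: "U \<in> \<X>" "presents C (df U (Suc 0)) u (Im_mod \<alpha> ?G F)"
        using belongs_iff[OF \<X> cmodule_Im[OF \<alpha>(1) Gc F(1)]] by blast
      obtain u' where u': "presents C (p2 \<cdot> df V' (Suc (Suc 0))) u' (Im_mod \<alpha> ?G F)"
        using presents_pullback_Im[OF p d bi f \<alpha>(1) represents_gen[OF G] \<alpha>(2) wk[unfolded v]] by blast
      have "deflation \<X> (p2 \<cdot> df V' (Suc (Suc 0)))" by (rule deflation_presents[OF n \<X> U u'])
      then show "deflation \<X> v \<and> (\<exists>k. weak_kernel C v k \<and> deflation \<X> (p2 \<cdot> k))" using dv wk by blast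
    qed }
  { assume pc: "pullback_condition C \<X> ?d"
    show "F \<in> Pb C (Fun_image C n \<X>)" unfolding Pb_def
    proof (intro CollectI conjI allI impI)
      show "F \<in> Fun_image C n \<X>" using Fun_image_iff[OF \<X>] X p by blast
      fix G :: "('a, 'b, 'b set) cmod" and \<alpha> assume "in_mod C G \<and> nat_trans C G F \<alpha>"
      then have Gm: "in_mod C G" and \<alpha>: "nat_trans C G F \<alpha>" by auto
      obtain Y g where Y: "rres C Y g G" using in_mod_rres[OF Gm] .
      define B' where "B' = ob Y 0"
      have g: "gen C G B' g" using presents_gen[of C "df Y (Suc 0)" g G] Y acycD(3)[of C Y 0] by (simp add: rres_def B'_def)
      note G = genD[OF g]
      \<comment> \<open>The module G need not be representable; any generator g of it will do, since
        the image of \<alpha> is determined by the image of g.\<close>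
      obtain f where f: "ar C f B' ?B" "\<alpha> B' g = Act F f x" using genE[OF gF nat_transD(2)[OF \<alpha> G(2,3)] G(2)] .
      have "?A \<in> Obj C" using ArD(1)[of ?d] d by simp
      then obtain W i1 i2 p1 p2 where bi: "biproduct C ?A B' W i1 i2 p1 p2" using has_biproducts[OF _ G(2)] by metis
      let ?v = "neg C ?d \<cdot> p1 \<boxplus> f \<cdot> p2"
      have "deflation \<X> ?v \<and> (\<exists>k. weak_kernel C ?v k \<and> deflation \<X> (p2 \<cdot> k))"
        using pc[unfolded pullback_condition_def, rule_format, of f B' W i1 i2 p1 p2 ?v] f(1) bi d by simp
      then obtain k where dv: "deflation \<X> ?v" and wk: "weak_kernel C ?v k" and dk: "deflation \<X> (p2 \<cdot> k)" by blast
      obtain V where V: "V \<in> \<X>" "df V (Suc 0) = ?v" using deflationE[OF dv \<X>] by metis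
      obtain U where U: "U \<in> \<X>" "df U (Suc 0) = p2 \<cdot> k" using deflationE[OF dk \<X>] by metis
      show "belongs C (Cok_mod C \<alpha> G F) (Fun_image C n \<X>)"
        using belongs_iff[OF \<X> Cok_props(1)[OF \<alpha> G(1) F(1)]] presents_pullback_Cok[OF p d bi f(1) \<alpha> g f(2)] V by metis
      show "belongs C (Im_mod \<alpha> G F) (Fun_image C n \<X>)"
        using belongs_iff[OF \<X> cmodule_Im[OF \<alpha> G(1) F(1)]] presents_pullback_Im[OF p d bi f(1) \<alpha> g f(2) wk] U by metis
    qed }
qed

lemma Pb_eq_iff:
  assumes n: "n > 0" and \<X>: "iso_class C n \<X>"
  shows "Pb C (Fun_image C n \<X>) = Fun_image C n \<X> \<longleftrightarrow> deflations_pull_back C \<X>"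
proof
  assume e: "Pb C (Fun_image C n \<X>) = Fun_image C n \<X>"
  show "deflations_pull_back C \<X>" unfolding deflations_pull_back_def
  proof (intro allI impI)
    fix d assume "deflation \<X> d"
    then obtain X where X: "X \<in> \<X>" "n_exact C n X" "df X (Suc 0) = d" using deflationE[OF _ \<X>] by metis
    obtain x where x: "presents C (df X (Suc 0)) x (Fun C X)" using Fun_presents[OF X(2)] by blast
    then have "Fun C X \<in> Pb C (Fun_image C n \<X>)" unfolding e using Fun_image_iff[OF \<X>] X(1) by blast
    then show "pullback_condition C \<X> d" using Pb_iff[OF n \<X> X(1) x] X(3) by simp
  qed
next
  assume d: "deflations_pull_back C \<X>"
  show "Pb C (Fun_image C n \<X>) = Fun_image C n \<X>"
  proof
    show "Pb C (Fun_image C n \<X>) \<subseteq> Fun_image C n \<X>" by (auto simp: Pb_def)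
    show "Fun_image C n \<X> \<subseteq> Pb C (Fun_image C n \<X>)"
    proof
      fix F assume "F \<in> Fun_image C n \<X>"
      then obtain X x where X: "X \<in> \<X>" "presents C (df X (Suc 0)) x F" using Fun_image_iff[OF \<X>] by blast
      have "deflation \<X> (df X (Suc 0))" using X(1) by (auto simp: deflation_def)
      then show "F \<in> Pb C (Fun_image C n \<X>)" using Pb_iff[OF n \<X> X] d by (simp add: deflations_pull_back_def)
    qed
  qed
qed

section \<open>Extensions of modules and composition of deflations\<close>

lemma split_ext_short_exact:
  assumes n: "n > 0" and X: "n_exact C n X" and Y: "n_exact C n Y" and Z: "n_exact C n Z" and sp: "split_ext C n X Z Y"
  shows "\<exists>\<iota> \<pi>. short_exact C (Fun C X) (Fun C Z) (Fun C Y) \<iota> \<pi>"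
proof -
  obtain a b r s where a: "chain_map C n X Z a" and b: "chain_map C n Z Y b"
    and bi: "\<And>i. i \<le> Suc n \<Longrightarrow> biproduct C (ob X i) (ob Y i) (ob Z i) (a i) (s i) (r i) (b i)"
    using sp unfolding split_ext_def by blast
  note aD = chain_mapD[OF a X Z] and bD = chain_mapD[OF b Z Y]
  note bi0 = bi[of 0, simplified] and bi1 = bi[of "Suc 0", simplified]
  have bi2: "biproduct C (ob X (Suc (Suc 0))) (ob Y (Suc (Suc 0))) (ob Z (Suc (Suc 0))) (a (Suc (Suc 0))) (s (Suc (Suc 0))) (r (Suc (Suc 0))) (b (Suc (Suc 0)))"
    using bi[of "Suc (Suc 0)"] n by simp
  note [simp] = biproductD(1-11)[OF bi0] biproductD(1-11)[OF bi1] biproductD(1-11)[OF bi2]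
    biproduct_cmp[OF bi0] biproduct_cmp[OF bi1] biproduct_cmp[OF bi2]
    n_exact_d1[OF X] n_exact_d1[OF Y] n_exact_d1[OF Z]
  have [simp]: "ar C (df Z (Suc (Suc 0))) (ob Z (Suc (Suc 0))) (ob Z (Suc 0))" "ar C (df Y (Suc (Suc 0))) (ob Y (Suc (Suc 0))) (ob Y (Suc 0))"
    using n_exactD(1)[OF Z, of "Suc 0"] n_exactD(1)[OF Y, of "Suc 0"] n by simp_all
  let ?F = "Fun C X" and ?E = "Fun C Z" and ?H = "Fun C Y"
  let ?dX = "df X (Suc 0)" and ?dY = "df Y (Suc 0)" and ?D = "df Z (Suc 0)" and ?D2 = "df Z (Suc (Suc 0))" and ?dY2 = "df Y (Suc (Suc 0))"
  have aD0: "a 0 \<cdot> ?dX = ?D \<cdot> a (Suc 0)" using aD(2)[of 0] by simp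
  have bD0: "b 0 \<cdot> ?D = ?dY \<cdot> b (Suc 0)" using bD(2)[of 0] by simp
  have bD1: "b (Suc 0) \<cdot> ?D2 = ?dY2 \<cdot> b (Suc (Suc 0))" using bD(2)[of "Suc 0"] n by simp
  obtain x where x: "presents C ?dX x ?F" using Fun_presents[OF X] by blast
  obtain y where y: "presents C ?dY y ?H" using Fun_presents[OF Y] by blast
  obtain z where z: "presents C ?D z ?E" using Fun_presents[OF Z] by blast
  have gx: "gen C ?F (ob X 0) x" using presents_gen[OF x] by simp
  have gy: "gen C ?H (ob Y 0) y" using presents_gen[OF y] by simp
  have gz: "gen C ?E (ob Z 0) z" using presents_gen[OF z] by simp
  note F = genD[OF gx] and H = genD[OF gy] and E = genD[OF gz]
  have za: "Act ?E (a 0) z \<in> carrier (Val ?E (ob X 0))" using Act_closed[OF E(1), of "a 0" z] E by simp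
  have r\<iota>: "Act ?E h (Act ?E (a 0) z) = \<one>\<^bsub>Val ?E (Dom C h)\<^esub>"
    if h: "Ar C h" "Cod C h = ob X 0" "Act ?F h x = \<one>\<^bsub>Val ?F (Dom C h)\<^esub>" for h
  proof -
    define T where "T = Dom C h"
    obtain k where k: "ar C k T (ob X (Suc 0))" "h = ?dX \<cdot> k" using presentsE[OF x, of h T] h by (auto simp: T_def)
    have "a 0 \<cdot> h = ?D \<cdot> a (Suc 0) \<cdot> k" unfolding k(2) using cmp_eq_cmp[OF aD0, of k] k(1) by simp
    then have "Act ?E (a 0 \<cdot> h) z = \<one>\<^bsub>Val ?E T\<^esub>" using presents_cmp[OF z, of "a (Suc 0) \<cdot> k" T] k(1) by simp
    then show ?thesis using h(1,2) E by (simp add: Act_cmp T_def)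
  qed
  obtain \<iota> where \<iota>: "nat_trans C ?F ?E \<iota>" "\<iota> (ob X 0) x = Act ?E (a 0) z"
    using hom_from_gen[OF gx E(1) za] r\<iota> by metis
  have yb: "Act ?H (b 0) y \<in> carrier (Val ?H (ob Z 0))" using Act_closed[OF H(1), of "b 0" y] H by simp
  have r\<pi>: "Act ?H h (Act ?H (b 0) y) = \<one>\<^bsub>Val ?H (Dom C h)\<^esub>"
    if h: "Ar C h" "Cod C h = ob Z 0" "Act ?E h z = \<one>\<^bsub>Val ?E (Dom C h)\<^esub>" for h
  proof -
    define T where "T = Dom C h"
    obtain k where k: "ar C k T (ob Z (Suc 0))" "h = ?D \<cdot> k" using presentsE[OF z, of h T] h by (auto simp: T_def)
    have "b 0 \<cdot> h = ?dY \<cdot> b (Suc 0) \<cdot> k" unfolding k(2) using cmp_eq_cmp[OF bD0, of k] k(1) by simp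
    then have "Act ?H (b 0 \<cdot> h) y = \<one>\<^bsub>Val ?H T\<^esub>" using presents_cmp[OF y, of "b (Suc 0) \<cdot> k" T] k(1) by simp
    then show ?thesis using h(1,2) H by (simp add: Act_cmp T_def)
  qed
  obtain \<pi> where \<pi>: "nat_trans C ?E ?H \<pi>" "\<pi> (ob Z 0) z = Act ?H (b 0) y"
    using hom_from_gen[OF gz H(1) yb] r\<pi> by metis
  have \<iota>h: "\<iota> T (Act ?F h x) = Act ?E (a 0 \<cdot> h) z" if "ar C h T (ob X 0)" for h T
    using nat_trans_gen[OF \<iota>(1) gx that] that E by (simp add: \<iota>(2) Act_cmp)
  have \<pi>h: "\<pi> T (Act ?E h z) = Act ?H (b 0 \<cdot> h) y" if "ar C h T (ob Z 0)" for h T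
    using nat_trans_gen[OF \<pi>(1) gz that] that H by (simp add: \<pi>(2) Act_cmp)
  have bDs: "b 0 \<cdot> ?D \<cdot> s (Suc 0) \<cdot> k = ?dY \<cdot> k" if "ar C k T (ob Y (Suc 0))" for k T
    using cmp_eq_cmp[OF bD0, of "s (Suc 0) \<cdot> k"] that by simp
  have "short_exact C ?F ?E ?H \<iota> \<pi>" unfolding short_exact_def
  proof (intro conjI ballI)
    fix T assume T: "T \<in> Obj C"
    note [simp] = T
    have inj0: "Act ?F h x = \<one>\<^bsub>Val ?F T\<^esub>" if h: "ar C h T (ob X 0)" "Act ?E (a 0 \<cdot> h) z = \<one>\<^bsub>Val ?E T\<^esub>" for h
    proof -
      obtain k where k: "ar C k T (ob Z (Suc 0))" "a 0 \<cdot> h = ?D \<cdot> k" using presentsE[OF z, of "a 0 \<cdot> h" T] h by auto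
      \<comment> \<open>Injectivity is the one place where exactness of Y in degree 1 enters,
        available because n > 0: the Y component of k is a boundary, and after removing its lift k
        comes from X.\<close>
      have "?dY \<cdot> b (Suc 0) \<cdot> k = b 0 \<cdot> a 0 \<cdot> h" unfolding k(2) using cmp_eq_cmp[OF bD0, of k] k(1) by simp
      then have "?dY \<cdot> b (Suc 0) \<cdot> k = zr C T (ob Y 0)" using h(1) by simp
      then obtain l where l: "ar C l T (ob Y (Suc (Suc 0)))" "b (Suc 0) \<cdot> k = ?dY2 \<cdot> l"
        using n_exactD(5)[OF Y n, of "b (Suc 0) \<cdot> k" T] k(1) by auto
      let ?u = "k \<boxminus> ?D2 \<cdot> s (Suc (Suc 0)) \<cdot> l"
      have u: "ar C ?u T (ob Z (Suc 0))" using k l by simp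
      have "b (Suc 0) \<cdot> ?D2 \<cdot> s (Suc (Suc 0)) \<cdot> l = ?dY2 \<cdot> l"
        using cmp_eq_cmp[OF bD1, of "s (Suc (Suc 0)) \<cdot> l"] l(1) by simp
      then have "b (Suc 0) \<cdot> ?u = zr C T (ob Y (Suc 0))" using k l by simp
      then have ua: "?u = a (Suc 0) \<cdot> r (Suc 0) \<cdot> ?u" by (rule biproduct_ker[OF bi1 u])
      define v where "v = r (Suc 0) \<cdot> ?u"
      have v: "ar C v T (ob X (Suc 0))" "?u = a (Suc 0) \<cdot> v" using u ua by (simp_all add: v_def del: subr)
      have "?D \<cdot> ?D2 \<cdot> s (Suc (Suc 0)) \<cdot> l = zr C T (ob Z 0)"
        using cmp_eq1[OF n_exactD(3)[OF Z n], of "s (Suc (Suc 0)) \<cdot> l"] l(1) by simp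
      then have "a 0 \<cdot> h = ?D \<cdot> ?u" using k l by simp
      also have "\<dots> = a 0 \<cdot> ?dX \<cdot> v" unfolding v(2) using cmp_eq_cmp[OF aD0, of v] v(1) by simp
      finally have e: "a 0 \<cdot> h = a 0 \<cdot> ?dX \<cdot> v" .
      have "h = r 0 \<cdot> a 0 \<cdot> h" using h(1) by simp
      also have "\<dots> = ?dX \<cdot> v" unfolding e using v(1) by simp
      finally have "h = ?dX \<cdot> v" .
      then show ?thesis using presents_cmp[OF x, of v T] v(1) by simp
    qed
    show "inj_on (\<iota> T) (carrier (Val ?F T))"
    proof (rule inj_onI)
      fix m m' assume m: "m \<in> carrier (Val ?F T)" "m' \<in> carrier (Val ?F T)" "\<iota> T m = \<iota> T m'"
      obtain h where h: "ar C h T (ob X 0)" "m = Act ?F h x" using genE[OF gx m(1) T] .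
      obtain h' where h': "ar C h' T (ob X 0)" "m' = Act ?F h' x" using genE[OF gx m(2) T] .
      have "Act ?E (a 0 \<cdot> h) z = Act ?E (a 0 \<cdot> h') z" using m(3) \<iota>h[OF h(1)] \<iota>h[OF h'(1)] h(2) h'(2) by simp
      then have "Act ?E (a 0 \<cdot> (h \<boxminus> h')) z = \<one>\<^bsub>Val ?E T\<^esub>" using h(1) h'(1) E by (simp add: Act_sub)
      then have "Act ?F (h \<boxminus> h') x = \<one>\<^bsub>Val ?F T\<^esub>" by (intro inj0) (use h(1) h'(1) in simp_all)
      then show "m = m'" using h h' F by (simp add: Act_sub)
    qed
    show "exact_at (Val ?F T) (Val ?E T) (Val ?H T) (\<iota> T) (\<pi> T)" unfolding exact_at_def kernel_def
    proof (intro equalityI subsetI)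
      fix m assume "m \<in> \<iota> T ` carrier (Val ?F T)"
      then obtain m' where m': "m' \<in> carrier (Val ?F T)" "m = \<iota> T m'" by blast
      obtain h where h: "ar C h T (ob X 0)" "m' = Act ?F h x" using genE[OF gx m'(1) T] .
      have m: "m = Act ?E (a 0 \<cdot> h) z" using m' h \<iota>h by simp
      have "\<pi> T m = Act ?H (b 0 \<cdot> a 0 \<cdot> h) y" unfolding m by (rule \<pi>h) (use h(1) in simp)
      then have "\<pi> T m = \<one>\<^bsub>Val ?H T\<^esub>" using h(1) H by (simp add: Act_zr)
      then show "m \<in> {m \<in> carrier (Val ?E T). \<pi> T m = \<one>\<^bsub>Val ?H T\<^esub>}" using nat_transD(2)[OF \<iota>(1) T m'(1)] m'(2) by simp
    next
      fix m assume "m \<in> {m \<in> carrier (Val ?E T). \<pi> T m = \<one>\<^bsub>Val ?H T\<^esub>}"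
      then have m: "m \<in> carrier (Val ?E T)" "\<pi> T m = \<one>\<^bsub>Val ?H T\<^esub>" by auto
      obtain h where h: "ar C h T (ob Z 0)" "m = Act ?E h z" using genE[OF gz m(1) T] .
      have "Act ?H (b 0 \<cdot> h) y = \<one>\<^bsub>Val ?H T\<^esub>" using m(2) h \<pi>h by simp
      then obtain k where k: "ar C k T (ob Y (Suc 0))" "b 0 \<cdot> h = ?dY \<cdot> k" using presentsE[OF y, of "b 0 \<cdot> h" T] h(1) by auto
      let ?u = "h \<boxminus> ?D \<cdot> s (Suc 0) \<cdot> k"
      have u: "ar C ?u T (ob Z 0)" using h(1) k(1) by simp
      have "b 0 \<cdot> ?u = zr C T (ob Y 0)" using h(1) k bDs[OF k(1)] by simp
      then have ua: "?u = a 0 \<cdot> r 0 \<cdot> ?u" by (rule biproduct_ker[OF bi0 u])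
      define v where "v = r 0 \<cdot> ?u"
      have v: "ar C v T (ob X 0)" "?u = a 0 \<cdot> v" using u ua by (simp_all add: v_def del: subr)
      have "Act ?E (h \<boxminus> ?u) z = Act ?E (?D \<cdot> s (Suc 0) \<cdot> k) z"
      proof -
        have "h = ?u \<boxplus> ?D \<cdot> s (Suc 0) \<cdot> k" using h(1) k(1) by simp
        then have "h \<boxminus> ?u = (?u \<boxplus> ?D \<cdot> s (Suc 0) \<cdot> k) \<boxminus> ?u" by simp
        also have "\<dots> = ?D \<cdot> s (Suc 0) \<cdot> k" using u k(1) by (intro add_sub2) simp_all
        finally show ?thesis by simp
      qed
      also have "\<dots> = \<one>\<^bsub>Val ?E T\<^esub>" using presents_cmp[OF z, of "s (Suc 0) \<cdot> k" T] k(1) by simp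
      finally have "Act ?E h z = Act ?E ?u z" using h(1) u E by (subst (asm) Act_sub) simp_all
      then have "m = \<iota> T (Act ?F v x)" unfolding h(2) v(2) using \<iota>h[OF v(1)] by simp
      then show "m \<in> \<iota> T ` carrier (Val ?F T)" using Act_closed[OF F(1), of v x] v(1) F by auto
    qed
    show "\<pi> T ` carrier (Val ?E T) = carrier (Val ?H T)"
    proof (intro equalityI subsetI)
      fix m assume m: "m \<in> carrier (Val ?H T)"
      obtain h where h: "ar C h T (ob Y 0)" "m = Act ?H h y" using genE[OF gy m T] .
      have "\<pi> T (Act ?E (s 0 \<cdot> h) z) = m" using \<pi>h[of "s 0 \<cdot> h" T] h by simp
      moreover have "Act ?E (s 0 \<cdot> h) z \<in> carrier (Val ?E T)" using Act_closed[OF E(1), of "s 0 \<cdot> h" z] h(1) E by simp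
      ultimately show "m \<in> \<pi> T ` carrier (Val ?E T)" by blast
    qed (use nat_transD(2)[OF \<pi>(1) T] in blast)
  qed (rule \<iota>(1) \<pi>(1))+
  then show ?thesis by blast
qed

lemma extension_closed_iff:
  assumes n: "n > 0" and \<X>: "iso_class C n \<X>"
  shows "extension_closed C n (Fun_image C n \<X>) \<longleftrightarrow> split_ext_closed C n \<X>"
proof
  assume e: "extension_closed C n (Fun_image C n \<X>)"
  show "split_ext_closed C n \<X>" unfolding split_ext_closed_def
  proof (intro ballI allI impI)
    fix X Y Z assume XY: "X \<in> \<X>" "Y \<in> \<X>" and "n_exact C n Z \<and> split_ext C n X Z Y"
    then have Z: "n_exact C n Z" "split_ext C n X Z Y" by auto
    note X = iso_class_exact[OF \<X> XY(1)] and Y = iso_class_exact[OF \<X> XY(2)]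
    obtain \<iota> \<pi> where "short_exact C (Fun C X) (Fun C Z) (Fun C Y) \<iota> \<pi>"
      using split_ext_short_exact[OF n X Y Z] by blast
    moreover have "Fun C X \<in> Fun_image C n \<X>" "Fun C Y \<in> Fun_image C n \<X>"
      using Fun_image_iff[OF \<X>] Fun_presents[OF X] Fun_presents[OF Y] XY by blast+
    ultimately have "Fun C Z \<in> Fun_image C n \<X>" using e Fun_in_ex_cat[OF Z(1)] unfolding extension_closed_def by blast
    then obtain Z' z' where Z': "Z' \<in> \<X>" "presents C (df Z' (Suc 0)) z' (Fun C Z)" using Fun_image_iff[OF \<X>] by blast
    obtain z where "presents C (df Z (Suc 0)) z (Fun C Z)" using Fun_presents[OF Z(1)] by blast
    then show "Z \<in> \<X>" using iso_class_presents[OF \<X> Z' Z(1)] by blast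
  qed
next
  assume s: "split_ext_closed C n \<X>"
  show "extension_closed C n (Fun_image C n \<X>)" unfolding extension_closed_def
  proof (intro ballI allI impI)
    fix F H E \<iota> \<pi> assume FH: "F \<in> Fun_image C n \<X>" "H \<in> Fun_image C n \<X>" and E: "E \<in> ex_cat C n" and se: "short_exact C F E H \<iota> \<pi>"
    obtain X x where X: "X \<in> \<X>" "presents C (df X (Suc 0)) x F" using FH Fun_image_iff[OF \<X>] by blast
    obtain Y y where Y: "Y \<in> \<X>" "presents C (df Y (Suc 0)) y H" using FH Fun_image_iff[OF \<X>] by blast
    have Ec: "cmodule C E" using E by (auto simp: ex_cat_def intro: in_mod_cmodule)
    obtain Z z where Z: "n_exact C n Z" "presents C (df Z (Suc 0)) z E" "split_ext C n X Z Y"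
      using n_exact_horseshoe[OF iso_class_exact[OF \<X> X(1)] X(2) iso_class_exact[OF \<X> Y(1)] Y(2) Ec se] by blast
    then have "Z \<in> \<X>" using s X(1) Y(1) unfolding split_ext_closed_def by blast
    then show "E \<in> Fun_image C n \<X>" using Fun_image_iff[OF \<X>] Z(2) by blast
  qed
qed

text \<open>The last differential of a degreewise split extension, with components \<open>x\<close>, \<open>t\<close>, \<open>y\<close>, factors as
  \<open>(1 + y) ((x, t), (0, 1))\<close>; the two factors present the same modules as \<open>x\<close> and \<open>y\<close>.\<close>

lemma deflations_compose_split_ext_closed:
  assumes n: "n > 0" and \<X>: "iso_class C n \<X>" and c: "deflations_compose C \<X>"
  shows "split_ext_closed C n \<X>"
  unfolding split_ext_closed_def
proof (intro ballI allI impI)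
  fix X Y Z assume XY: "X \<in> \<X>" "Y \<in> \<X>" and "n_exact C n Z \<and> split_ext C n X Z Y"
  then have Z: "n_exact C n Z" and sp: "split_ext C n X Z Y" by auto
  note X = iso_class_exact[OF \<X> XY(1)] and Y = iso_class_exact[OF \<X> XY(2)]
  obtain a b r s where a: "chain_map C n X Z a" and b: "chain_map C n Z Y b"
    and bi: "\<And>i. i \<le> Suc n \<Longrightarrow> biproduct C (ob X i) (ob Y i) (ob Z i) (a i) (s i) (r i) (b i)"
    using sp unfolding split_ext_def by blast
  note aD = chain_mapD[OF a X Z] and bD = chain_mapD[OF b Z Y]
  note bi0 = bi[of 0, simplified] and bi1 = bi[of "Suc 0", simplified]
  obtain W i1 i2 p1 p2 where bW: "biproduct C (ob X 0) (ob Y (Suc 0)) W i1 i2 p1 p2"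
    using has_biproducts[of "ob X 0" "ob Y (Suc 0)"] n_exactD(2)[OF X, of 0] n_exactD(2)[OF Y, of "Suc 0"] by auto
  note [simp] = biproductD(1-11)[OF bi0] biproductD(1-11)[OF bi1] biproductD(1-11)[OF bW]
    biproduct_cmp[OF bi0] biproduct_cmp[OF bi1] biproduct_cmp[OF bW]
    n_exact_d1[OF X] n_exact_d1[OF Y] n_exact_d1[OF Z]
  let ?dX = "df X (Suc 0)" and ?dY = "df Y (Suc 0)" and ?D = "df Z (Suc 0)"
  have aD0: "a 0 \<cdot> ?dX = ?D \<cdot> a (Suc 0)" using aD(2)[of 0] by simp
  have bD0: "b 0 \<cdot> ?D = ?dY \<cdot> b (Suc 0)" using bD(2)[of 0] by simp
  let ?F = "Fun C X" and ?H = "Fun C Y"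
  obtain x where x: "presents C ?dX x ?F" using Fun_presents[OF X] by blast
  obtain y where y: "presents C ?dY y ?H" using Fun_presents[OF Y] by blast
  have gx: "gen C ?F (ob X 0) x" using presents_gen[OF x] by simp
  have gy: "gen C ?H (ob Y 0) y" using presents_gen[OF y] by simp
  note F = genD[OF gx] and H = genD[OF gy]
  let ?f = "i1 \<cdot> r 0 \<cdot> ?D \<boxplus> i2 \<cdot> b (Suc 0)" and ?g = "a 0 \<cdot> p1 \<boxplus> s 0 \<cdot> ?dY \<cdot> p2"
  have fg: "ar C ?f (ob Z (Suc 0)) W" "ar C ?g W (ob Z 0)" by simp_all
  have "?g \<cdot> ?f = a 0 \<cdot> r 0 \<cdot> ?D \<boxplus> s 0 \<cdot> ?dY \<cdot> b (Suc 0)" by simp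
  also have "\<dots> = ?D" unfolding bD0[symmetric] by (rule biproduct_split[OF bi0]) simp
  finally have gf: "?g \<cdot> ?f = ?D" .
  define t where "t = r 0 \<cdot> ?D \<cdot> s (Suc 0)"
  have t[simp]: "ar C t (ob Y (Suc 0)) (ob X 0)" by (simp add: t_def)
  have rDa: "r 0 \<cdot> ?D \<cdot> a (Suc 0) \<cdot> k = ?dX \<cdot> k" if "ar C k T (ob X (Suc 0))" for k T
    using cmp_eq_cmp[OF aD0, of k] biproduct_cmp(1)[OF bi0, of "?dX \<cdot> k"] that by simp
  \<comment> \<open>The row (1, -t) undoes the off-diagonal entry: composed with \<open>?f\<close>
    it gives the differential of X after the projection \<open>r (Suc 0)\<close>. So
    \<open>x\<close> pulled back along \<open>?q\<close> generates the same module with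
    \<open>?f\<close> as presentation.\<close>
  let ?q = "p1 \<boxminus> t \<cdot> p2"
  have q[simp]: "ar C ?q W (ob X 0)" by simp
  have "deflation \<X> ?f"
  proof (rule deflation_presents[OF n \<X> XY(1) x])
    show "presents C ?f (Act ?F ?q x) ?F"
    proof (rule presentsI)
      have qx: "Act ?F h (Act ?F ?q x) = Act ?F (?q \<cdot> h) x" if "ar C h T W" for h T
        using Act_cmp[OF F(1), of h ?q x] that F(3) q by metis
      show "gen C ?F (Cod C ?f) (Act ?F ?q x)" unfolding gen_def
      proof (intro conjI ballI)
        show "Act ?F ?q x \<in> carrier (Val ?F (Cod C ?f))" using Act_closed[OF F(1), of ?q x] F(3) by simp
        fix T m assume T: "T \<in> Obj C" "m \<in> carrier (Val ?F T)"
        obtain h where h: "ar C h T (ob X 0)" "m = Act ?F h x" using genE[OF gx T(2,1)] .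
        have "?q \<cdot> i1 \<cdot> h = h" using h(1) T(1) by simp
        then have "m = Act ?F (i1 \<cdot> h) (Act ?F ?q x)" using qx[of "i1 \<cdot> h" T] h by simp
        then show "\<exists>h. ar C h T (Cod C ?f) \<and> m = Act ?F h (Act ?F ?q x)" using h(1) by (intro exI[of _ "i1 \<cdot> h"]) simp
      qed (use F in simp_all)
      fix k T assume "ar C k T (Dom C ?f)"
      then have k: "ar C k T (ob Z (Suc 0))" by simp
      then have TO: "T \<in> Obj C" by auto
      have k': "k = a (Suc 0) \<cdot> r (Suc 0) \<cdot> k \<boxplus> s (Suc 0) \<cdot> b (Suc 0) \<cdot> k" using biproduct_split[OF bi1 k] by simp
      have "r 0 \<cdot> ?D \<cdot> k = r 0 \<cdot> ?D \<cdot> (a (Suc 0) \<cdot> r (Suc 0) \<cdot> k \<boxplus> s (Suc 0) \<cdot> b (Suc 0) \<cdot> k)"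
        using k' by (rule arg_cong)
      also have "\<dots> = ?dX \<cdot> r (Suc 0) \<cdot> k \<boxplus> t \<cdot> b (Suc 0) \<cdot> k" using k rDa[of "r (Suc 0) \<cdot> k" T] by (simp add: t_def)
      finally have e: "r 0 \<cdot> ?D \<cdot> k = ?dX \<cdot> r (Suc 0) \<cdot> k \<boxplus> t \<cdot> b (Suc 0) \<cdot> k" .
      have "?q \<cdot> ?f \<cdot> k = r 0 \<cdot> ?D \<cdot> k \<boxminus> t \<cdot> b (Suc 0) \<cdot> k" using k TO by (simp add: sub_def)
      also have "\<dots> = ?dX \<cdot> r (Suc 0) \<cdot> k" unfolding e using k by simp
      finally have "Act ?F (?q \<cdot> ?f \<cdot> k) x = \<one>\<^bsub>Val ?F T\<^esub>" using presents_cmp[OF x, of "r (Suc 0) \<cdot> k" T] k by simp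
      moreover have "ar C (?f \<cdot> k) T W" using k by simp
      ultimately show "Act ?F (?f \<cdot> k) (Act ?F ?q x) = \<one>\<^bsub>Val ?F T\<^esub>" using qx[of "?f \<cdot> k" T] by simp
    next
      have qx: "Act ?F h (Act ?F ?q x) = Act ?F (?q \<cdot> h) x" if "ar C h T W" for h T
        using Act_cmp[OF F(1), of h ?q x] that F(3) q by metis
      fix h T assume ah: "ar C h T (Cod C ?f)" "Act ?F h (Act ?F ?q x) = \<one>\<^bsub>Val ?F T\<^esub>"
      then have h: "ar C h T W" by simp
      then have TO: "T \<in> Obj C" by auto
      have "Act ?F (?q \<cdot> h) x = \<one>\<^bsub>Val ?F T\<^esub>" using ah(2) qx[OF h] by simp
      then obtain k where k: "ar C k T (ob X (Suc 0))" "?q \<cdot> h = ?dX \<cdot> k" using presentsE[OF x, of "?q \<cdot> h" T] h by auto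
      have "p1 \<cdot> h \<boxminus> t \<cdot> p2 \<cdot> h = ?dX \<cdot> k" using k(2) h by simp
      then have pe: "p1 \<cdot> h = ?dX \<cdot> k \<boxplus> t \<cdot> p2 \<cdot> h" using iffD1[OF sub_eq_iff] h k(1) by simp
      let ?l = "a (Suc 0) \<cdot> k \<boxplus> s (Suc 0) \<cdot> p2 \<cdot> h"
      have l: "ar C ?l T (ob Z (Suc 0))" "b (Suc 0) \<cdot> ?l = p2 \<cdot> h" using h k(1) TO by simp_all
      have rl: "r 0 \<cdot> ?D \<cdot> ?l = p1 \<cdot> h" unfolding pe using h k(1) rDa[OF k(1)] by (simp add: t_def)
      have "?f \<cdot> ?l = i1 \<cdot> (r 0 \<cdot> ?D \<cdot> ?l) \<boxplus> i2 \<cdot> (b (Suc 0) \<cdot> ?l)" using l(1) by (simp del: addr)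
      also have "\<dots> = h" unfolding rl l(2) by (rule biproduct_split[OF bW h])
      finally show "\<exists>k. ar C k T (Dom C ?f) \<and> h = ?f \<cdot> k" using l(1) by (intro exI[of _ ?l]) simp
    qed simp
  qed
  moreover have "deflation \<X> ?g"
  proof (rule deflation_presents[OF n \<X> XY(2) y])
    show "presents C ?g (Act ?H (b 0) y) ?H"
    proof (rule presentsI)
      show "gen C ?H (Cod C ?g) (Act ?H (b 0) y)" unfolding gen_def
      proof (intro conjI ballI)
        show "Act ?H (b 0) y \<in> carrier (Val ?H (Cod C ?g))" using Act_closed[OF H(1), of "b 0" y] H(3) by simp
        fix T m assume T: "T \<in> Obj C" "m \<in> carrier (Val ?H T)"
        obtain h where h: "ar C h T (ob Y 0)" "m = Act ?H h y" using genE[OF gy T(2,1)] .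
        have "Act ?H (s 0 \<cdot> h) (Act ?H (b 0) y) = Act ?H (b 0 \<cdot> s 0 \<cdot> h) y" using h(1) H by (simp add: Act_cmp[symmetric])
        then have "m = Act ?H (s 0 \<cdot> h) (Act ?H (b 0) y)" using h by simp
        then show "\<exists>h. ar C h T (Cod C ?g) \<and> m = Act ?H h (Act ?H (b 0) y)" using h(1) by (intro exI[of _ "s 0 \<cdot> h"]) simp
      qed (use H in simp_all)
      fix k T assume "ar C k T (Dom C ?g)"
      then have k: "ar C k T W" by simp
      then have TO: "T \<in> Obj C" by auto
      have "b 0 \<cdot> ?g \<cdot> k = ?dY \<cdot> p2 \<cdot> k" using k TO by simp
      moreover have "Act ?H (?g \<cdot> k) (Act ?H (b 0) y) = Act ?H (b 0 \<cdot> ?g \<cdot> k) y"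
        by (rule Act_cmp[OF H(1), symmetric]) (use k H in simp_all)
      ultimately show "Act ?H (?g \<cdot> k) (Act ?H (b 0) y) = \<one>\<^bsub>Val ?H T\<^esub>" using presents_cmp[OF y, of "p2 \<cdot> k" T] k by simp
    next
      fix h T assume ah: "ar C h T (Cod C ?g)" "Act ?H h (Act ?H (b 0) y) = \<one>\<^bsub>Val ?H T\<^esub>"
      then have h: "ar C h T (ob Z 0)" by simp
      then have TO: "T \<in> Obj C" by auto
      have "Act ?H (b 0 \<cdot> h) y = \<one>\<^bsub>Val ?H T\<^esub>" using ah(2) h H by (simp add: Act_cmp)
      then obtain k where k: "ar C k T (ob Y (Suc 0))" "b 0 \<cdot> h = ?dY \<cdot> k" using presentsE[OF y, of "b 0 \<cdot> h" T] h by auto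
      let ?l = "i1 \<cdot> r 0 \<cdot> h \<boxplus> i2 \<cdot> k"
      have l: "ar C ?l T W" using h k(1) by simp
      have "?g \<cdot> ?l = a 0 \<cdot> r 0 \<cdot> h \<boxplus> s 0 \<cdot> ?dY \<cdot> k" using h k(1) TO by simp
      also have "\<dots> = h" unfolding k(2)[symmetric] by (rule biproduct_split[OF bi0 h])
      finally show "\<exists>k. ar C k T (Dom C ?g) \<and> h = ?g \<cdot> k" using l by (intro exI[of _ ?l]) simp
    qed simp
  qed
  ultimately have "deflation \<X> (?g \<cdot> ?f)" using c fg unfolding deflations_compose_def by (metis (no_types))
  then obtain Z' where Z': "Z' \<in> \<X>" "df Z' (Suc 0) = ?D" unfolding gf by (metis deflationE[OF _ \<X>])
  obtain z where z: "presents C ?D z (Fun C Z)" using Fun_presents[OF Z] by blast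
  show "Z \<in> \<X>" by (rule iso_class_presents[OF \<X> Z'(1) _ Z z]) (use z Z'(2) in simp)
qed

text \<open>For deflations \<open>f\<close> and \<open>g\<close>, the cokernel of \<open>g f\<close> is an extension of the cokernel of \<open>g\<close> by a
  quotient of the cokernel of \<open>f\<close>, and this quotient is controlled by the pullback axiom.\<close>

lemma split_ext_closed_deflations_compose:
  assumes n: "n > 0" and \<X>: "iso_class C n \<X>" and s: "split_ext_closed C n \<X>" and pb: "deflations_pull_back C \<X>"
  shows "deflations_compose C \<X>"
  unfolding deflations_compose_def
proof (intro allI impI)
  fix f g assume "deflation \<X> f \<and> deflation \<X> g \<and> Cod C f = Dom C g"
  then have df: "deflation \<X> f" and dg: "deflation \<X> g" and fg: "Cod C f = Dom C g" by auto
  obtain X where X: "X \<in> \<X>" "n_exact C n X" "df X (Suc 0) = f" "ar C f (ob X (Suc 0)) (ob X 0)"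
    using deflationE[OF df \<X>] by metis
  obtain Y where Y: "Y \<in> \<X>" "n_exact C n Y" "df Y (Suc 0) = g" "ar C g (ob Y (Suc 0)) (ob Y 0)"
    using deflationE[OF dg \<X>] by metis
  define A B D where "A = ob X (Suc 0)" and "B = ob X 0" and "D = ob Y 0"
  have f: "ar C f A B" using X(4) by (simp add: A_def B_def)
  have g: "ar C g B D" using Y(4) f fg by (simp add: D_def)
  have YB: "ob Y (Suc 0) = B" using Y(4) g by simp
  \<comment> \<open>This differential is a weak kernel of \<open>g\<close>; the deflation
    \<open>f\<close> will be pulled back along it.\<close>
  let ?d = "df Y (Suc (Suc 0))" and ?B' = "ob Y (Suc (Suc 0))"
  have d: "ar C ?d ?B' B" using n_exactD(1)[OF Y(2), of "Suc 0"] n YB by simp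
  have AO: "A \<in> Obj C" and BO: "B \<in> Obj C" and DO: "D \<in> Obj C" and B'O: "?B' \<in> Obj C" using f g d ArD by metis+
  note [simp] = f g d AO BO DO B'O
  have gd: "g \<cdot> ?d = zr C ?B' D" using n_exactD(3)[OF Y(2), of 0] n Y(3) by (simp add: D_def)
  have gk: "\<exists>k. ar C k T ?B' \<and> h = ?d \<cdot> k" if "ar C h T B" "g \<cdot> h = zr C T D" for h T
    using n_exactD(5)[OF Y(2) n, of h T] that Y(3) by (simp add: YB D_def)
  have gf: "ar C (g \<cdot> f) A D" by simp
  let ?F = "cok f" and ?E = "cok (g \<cdot> f)" and ?H = "cok g"
  obtain x where x: "presents C f x ?F" using presents_cok[of f] by auto
  obtain y where y: "presents C g y ?H" using presents_cok[of g] by auto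
  obtain z where z: "presents C (g \<cdot> f) z ?E" using presents_cok[of "g \<cdot> f"] by auto
  have gx: "gen C ?F B x" using presents_gen[OF x] by simp
  have gy: "gen C ?H D y" using presents_gen[OF y] by simp
  have gz: "gen C ?E D z" using presents_gen[OF z] by simp
  note F = genD[OF gx] and H = genD[OF gy] and E = genD[OF gz]
  have zr1: "Act ?E (g \<cdot> f \<cdot> k) z = \<one>\<^bsub>Val ?E T\<^esub>" if "ar C k T A" for k T using presents_cmp[OF z, of k T] that by simp
  have "Act ?E g z \<in> carrier (Val ?E B)" using Act_closed[OF E(1), of g z] E by simp
  moreover have "Act ?E h (Act ?E g z) = \<one>\<^bsub>Val ?E (Dom C h)\<^esub>"
    if h: "Ar C h" "Cod C h = B" "Act ?F h x = \<one>\<^bsub>Val ?F (Dom C h)\<^esub>" for h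
  proof -
    define T where "T = Dom C h"
    obtain k where k: "ar C k T A" "h = f \<cdot> k" using presentsE[OF x, of h T] h by (auto simp: T_def)
    have "Act ?E h (Act ?E g z) = Act ?E (g \<cdot> h) z" using h(1,2) E by (simp add: Act_cmp)
    also have "\<dots> = \<one>\<^bsub>Val ?E T\<^esub>" unfolding k(2) by (rule zr1[OF k(1)])
    finally show ?thesis by (simp add: T_def)
  qed
  ultimately obtain \<alpha> where \<alpha>: "nat_trans C ?F ?E \<alpha>" "\<alpha> B x = Act ?E g z"
    using hom_from_gen[OF gx E(1)] by metis
  have \<alpha>h: "\<alpha> T (Act ?F h x) = Act ?E (g \<cdot> h) z" if "ar C h T B" for h T
    using nat_trans_gen[OF \<alpha>(1) gx that] that E by (simp add: \<alpha>(2) Act_cmp)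
  have rp: "Act ?H h y = \<one>\<^bsub>Val ?H (Dom C h)\<^esub>"
    if h: "Ar C h" "Cod C h = D" "Act ?E h z = \<one>\<^bsub>Val ?E (Dom C h)\<^esub>" for h
  proof -
    define T where "T = Dom C h"
    have "ar C h T (Cod C (g \<cdot> f))" "Act ?E h z = \<one>\<^bsub>Val ?E T\<^esub>" using h by (simp_all add: T_def)
    then obtain k where k': "ar C k T (Dom C (g \<cdot> f))" "h = (g \<cdot> f) \<cdot> k" by (rule presentsE[OF z])
    have k: "ar C k T A" using k'(1) by simp
    have k2: "h = g \<cdot> f \<cdot> k" unfolding k'(2) using k by simp
    have "Act ?H h y = \<one>\<^bsub>Val ?H T\<^esub>" unfolding k2 by (rule presents_cmp[OF y]) (use k in simp)
    then show ?thesis by (simp add: T_def)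
  qed
  obtain \<pi> where \<pi>: "nat_trans C ?E ?H \<pi>" "\<pi> D z = y" using hom_from_gen[OF gz H(1) H(3)] rp by metis
  have \<pi>h: "\<pi> T (Act ?E h z) = Act ?H h y" if "ar C h T D" for h T
    using nat_trans_gen[OF \<pi>(1) gz that] by (simp add: \<pi>(2))
  \<comment> \<open>The map \<alpha> from \<open>cok f\<close> to \<open>cok (g f)\<close> is
    induced by \<open>g\<close>. Its image is the quotient of \<open>cok f\<close> in question, and
    at the same time the kernel of the projection \<pi> to \<open>cok g\<close>.\<close>
  let ?I = "Im_mod \<alpha> ?F ?E"
  have Ic: "cmodule C ?I" by (rule cmodule_Im[OF \<alpha>(1) F(1) E(1)])
  have Iact: "Act ?I = Act ?E" "\<And>T. \<one>\<^bsub>Val ?I T\<^esub> = \<one>\<^bsub>Val ?E T\<^esub>" "\<And>T. carrier (Val ?I T) = \<alpha> T ` carrier (Val ?F T)"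
      "\<And>T. mult (Val ?I T) = mult (Val ?E T)"
    by (simp_all add: Im_mod_def)
  have se: "short_exact C ?I ?E ?H (\<lambda>T m. m) \<pi>" unfolding short_exact_def
  proof (intro conjI ballI)
    show "nat_trans C ?I ?E (\<lambda>T m. m)" using nat_transD(2)[OF \<alpha>(1)] by (intro nat_transI) (auto simp: Iact)
    show "nat_trans C ?E ?H \<pi>" by (rule \<pi>(1))
    fix T assume T: "T \<in> Obj C"
    show "inj_on (\<lambda>m. m) (carrier (Val ?I T))" by simp
    show "exact_at (Val ?I T) (Val ?E T) (Val ?H T) (\<lambda>m. m) (\<pi> T)" unfolding exact_at_def kernel_def Iact
    proof (intro equalityI subsetI)
      fix m assume "m \<in> (\<lambda>m. m) ` \<alpha> T ` carrier (Val ?F T)"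
      then obtain m' where m': "m' \<in> carrier (Val ?F T)" "m = \<alpha> T m'" by auto
      obtain h where h: "ar C h T B" "m' = Act ?F h x" using genE[OF gx m'(1) T] .
      have m: "m = Act ?E (g \<cdot> h) z" using m' h \<alpha>h by simp
      have "\<pi> T m = Act ?H (g \<cdot> h) y" unfolding m by (rule \<pi>h) (use h(1) in simp)
      then have "\<pi> T m = \<one>\<^bsub>Val ?H T\<^esub>" using presents_cmp[OF y, of h T] h(1) by simp
      then show "m \<in> {m \<in> carrier (Val ?E T). \<pi> T m = \<one>\<^bsub>Val ?H T\<^esub>}" using nat_transD(2)[OF \<alpha>(1) T m'(1)] m'(2) by simp
    next
      fix m assume "m \<in> {m \<in> carrier (Val ?E T). \<pi> T m = \<one>\<^bsub>Val ?H T\<^esub>}"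
      then have m: "m \<in> carrier (Val ?E T)" "\<pi> T m = \<one>\<^bsub>Val ?H T\<^esub>" by auto
      obtain h where h: "ar C h T D" "m = Act ?E h z" using genE[OF gz m(1) T] .
      have "Act ?H h y = \<one>\<^bsub>Val ?H T\<^esub>" using m(2) h \<pi>h by simp
      then obtain k where k: "ar C k T B" "h = g \<cdot> k" using presentsE[OF y, of h T] h(1) by auto
      have "m = \<alpha> T (Act ?F k x)" unfolding h(2) k(2) using \<alpha>h[OF k(1)] by simp
      moreover have "Act ?F k x \<in> carrier (Val ?F T)" using Act_closed[OF F(1), of k x] k(1) F by simp
      ultimately show "m \<in> (\<lambda>m. m) ` \<alpha> T ` carrier (Val ?F T)" by blast
    qed
    show "\<pi> T ` carrier (Val ?E T) = carrier (Val ?H T)"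
    proof (intro equalityI subsetI)
      fix m assume m: "m \<in> carrier (Val ?H T)"
      obtain h where h: "ar C h T D" "m = Act ?H h y" using genE[OF gy m T] .
      have "Act ?E h z \<in> carrier (Val ?E T)" using Act_closed[OF E(1), of h z] h(1) E by simp
      then show "m \<in> \<pi> T ` carrier (Val ?E T)" using \<pi>h[OF h(1)] h(2) by (intro image_eqI[of _ _ "Act ?E h z"]) simp_all
    qed (use nat_transD(2)[OF \<pi>(1) T] in blast)
  qed
  obtain W i1 i2 p1 p2 where bi: "biproduct C A ?B' W i1 i2 p1 p2" using has_biproducts[OF AO B'O] by metis
  note [simp] = biproductD(1-11)[OF bi] biproduct_cmp[OF bi]
  let ?v = "neg C f \<cdot> p1 \<boxplus> ?d \<cdot> p2"
  have v: "ar C ?v W B" by simp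
  have "deflation \<X> ?v"
  proof -
    have pc: "pullback_condition C \<X> f" using pb df unfolding deflations_pull_back_def by blast
    show ?thesis
      using pc[unfolded pullback_condition_def, rule_format, of ?d ?B' W i1 i2 p1 p2 ?v] bi by simp
  qed
  then obtain V where V: "V \<in> \<X>" "n_exact C n V" "df V (Suc 0) = ?v" using deflationE[OF _ \<X>] by metis
  let ?y = "Act ?E g z"
  have yh: "Act ?E h ?y = Act ?E (g \<cdot> h) z" if "ar C h T B" for h T using that E by (simp add: Act_cmp)
  \<comment> \<open>For h into B, g h factors through g f iff h - f l is killed by \<open>g\<close>
    for some l, iff h = f l + \<open>?d\<close> k. These are the morphisms factoring through the row
    \<open>?v\<close>, which the pullback axiom has just made a deflation.\<close>
  have "presents C ?v ?y ?I"
  proof (rule presentsI)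
    show "gen C ?I (Cod C ?v) ?y" unfolding gen_def Iact
    proof (intro conjI ballI)
      show "?y \<in> \<alpha> (Cod C ?v) ` carrier (Val ?F (Cod C ?v))" using F(3) by (simp add: \<alpha>(2)[symmetric])
      fix T m assume T: "T \<in> Obj C" "m \<in> \<alpha> T ` carrier (Val ?F T)"
      then obtain m' where m': "m' \<in> carrier (Val ?F T)" "m = \<alpha> T m'" by blast
      obtain h where h: "ar C h T B" "m' = Act ?F h x" using genE[OF gx m'(1) T(1)] .
      then have "m = Act ?E h ?y" using m'(2) \<alpha>h[OF h(1)] yh[OF h(1)] by simp
      then show "\<exists>h. ar C h T (Cod C ?v) \<and> m = Act ?E h ?y" using h(1) v by auto
    qed (use Ic in simp_all)
    fix u T assume "ar C u T (Dom C ?v)"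
    then have u: "ar C u T W" by simp
    then have TO: "T \<in> Obj C" by auto
    have "g \<cdot> ?d \<cdot> p2 \<cdot> u = zr C T D" using cmp_eq1[OF gd, of "p2 \<cdot> u"] u by simp
    then have "g \<cdot> ?v \<cdot> u = g \<cdot> f \<cdot> neg C (p1 \<cdot> u)" using u TO by simp
    then have "Act ?E (g \<cdot> ?v \<cdot> u) z = \<one>\<^bsub>Val ?E T\<^esub>" using zr1[of "neg C (p1 \<cdot> u)" T] u by simp
    moreover have "ar C (?v \<cdot> u) T B" using u by simp
    ultimately show "Act ?I (?v \<cdot> u) ?y = \<one>\<^bsub>Val ?I T\<^esub>" unfolding Iact using yh[of "?v \<cdot> u" T] by simp
  next
    fix h T assume a: "ar C h T (Cod C ?v)" "Act ?I h ?y = \<one>\<^bsub>Val ?I T\<^esub>"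
    then have h: "ar C h T B" by simp
    then have TO: "T \<in> Obj C" by auto
    have "Act ?E (g \<cdot> h) z = \<one>\<^bsub>Val ?E T\<^esub>" using a(2) yh[OF h] unfolding Iact by simp
    then obtain l where l: "ar C l T A" "g \<cdot> h = (g \<cdot> f) \<cdot> l" using presentsE[OF z, of "g \<cdot> h" T] h by auto
    have "g \<cdot> (h \<boxminus> f \<cdot> l) = zr C T D" using h l by simp
    then obtain k where k: "ar C k T ?B'" "h \<boxminus> f \<cdot> l = ?d \<cdot> k" using gk[of "h \<boxminus> f \<cdot> l" T] h l(1) by auto
    have hk: "h = ?d \<cdot> k \<boxplus> f \<cdot> l" using iffD1[OF sub_eq_iff] k h l(1) by simp
    let ?w = "i1 \<cdot> neg C l \<boxplus> i2 \<cdot> k"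
    have w: "ar C ?w T W" "p1 \<cdot> ?w = neg C l" "p2 \<cdot> ?w = k" using k(1) l(1) TO by simp_all
    have "?v \<cdot> ?w = neg C f \<cdot> (p1 \<cdot> ?w) \<boxplus> ?d \<cdot> (p2 \<cdot> ?w)" using w(1) by simp
    also have "\<dots> = h" unfolding w(2,3) hk using k(1) l(1) add_comm[of "f \<cdot> l" "?d \<cdot> k"] by simp
    finally show "\<exists>u. ar C u T (Dom C ?v) \<and> h = ?v \<cdot> u" using w(1) by (intro exI[of _ ?w]) simp
  qed simp
  then have VI: "presents C (df V (Suc 0)) ?y ?I" using V(3) by simp
  have YH: "presents C (df Y (Suc 0)) y ?H" using y Y(3) by simp
  obtain Z z' where Z: "n_exact C n Z" "presents C (df Z (Suc 0)) z' ?E" "split_ext C n V Z Y"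
    using n_exact_horseshoe[OF V(2) VI Y(2) YH E(1) se] by blast
  then have "Z \<in> \<X>" using s V(1) Y(1) unfolding split_ext_closed_def by blast
  then show "deflation \<X> (g \<cdot> f)" using deflation_presents[OF n \<X> _ Z(2) z] by blast
qed

end

section \<open>Duality\<close>

text \<open>A preimage under \<open>Op_cpx\<close> rather than an image, because applying
  \<open>Op_cpx\<close> twice returns the sequence only up to its values at meaningless indices;
  with the preimage, closure under homotopy equivalence passes directly to the opposite
  category.\<close>

definition op_class :: "('o, 'm) cat \<Rightarrow> nat \<Rightarrow> ('o, 'm) cpx set \<Rightarrow> ('o, 'm) cpx set" where
  "op_class C n \<X> = {Y. n_exact (op_cat C) n Y \<and> Op_cpx n Y \<in> \<X>}"

lemma Op_cpx_simps:
  "ob (Op_cpx n X) i = ob X (Suc n - i)" "i \<le> n \<Longrightarrow> df (Op_cpx n X) (Suc i) = df X (Suc (n - i))"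
  by (auto simp: Op_cpx_def Suc_diff_le)

context preadditive_category
begin

lemma n_exact_op:
  assumes X: "n_exact C n X"
  shows "n_exact (op_cat C) n (Op_cpx n X)"
proof -
  let ?Y = "Op_cpx n X"
  have c: "is_complex C n X" and h: "\<And>T. T \<in> Obj C \<Longrightarrow> hom_exact C n X T" "\<And>T. T \<in> Obj C \<Longrightarrow> cohom_exact C n X T"
    using X by (auto simp: n_exact_def)
  \<comment> \<open>Degree i of the reversed sequence corresponds to degree n + 1 - i, so exactness
    at position i + 1 is read off at index n - (i + 1) of the original.\<close>
  have idx: "Suc n - i = Suc (Suc (n - Suc i))" "Suc n - Suc i = Suc (n - Suc i)" "Suc n - Suc (Suc i) = n - Suc i"
    "n - i = Suc (n - Suc i)" if "i < n" for i using that by auto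
  have "is_complex (op_cat C) n ?Y" unfolding is_complex_def
  proof (intro conjI allI impI)
    fix i assume "i \<le> Suc n" then show "ob ?Y i \<in> Obj (op_cat C)" using c by (simp add: is_complex_def Op_cpx_simps)
  next
    fix i assume i: "i \<le> n"
    then have "Suc n - i = Suc (n - i)" "Suc n - Suc i = n - i" by auto
    then show "df ?Y (Suc i) \<in> homs (op_cat C) (ob ?Y (Suc i)) (ob ?Y i)"
      using c i by (simp add: is_complex_def Op_cpx_simps)
  next
    fix i assume i: "i < n"
    then show "Comp (op_cat C) (df ?Y (Suc i)) (df ?Y (Suc (Suc i))) = \<one>\<^bsub>Hom (op_cat C) (ob ?Y (Suc (Suc i))) (ob ?Y i)\<^esub>"
      using c idx[OF i] unfolding is_complex_def by (simp add: Op_cpx_simps)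
  qed
  moreover have "hom_exact (op_cat C) n ?Y T" if T: "T \<in> Obj C" for T
    unfolding hom_exact_def
  proof (intro conjI allI impI)
    show "inj_on (Comp (op_cat C) (df ?Y (Suc n))) (homs (op_cat C) T (ob ?Y (Suc n)))"
      using h(2)[OF T] by (simp add: cohom_exact_def Op_cpx_simps)
    fix i assume i: "i < n"
    have "n - Suc i < n" using i by simp
    then show "exact_at (Hom (op_cat C) T (ob ?Y (Suc (Suc i)))) (Hom (op_cat C) T (ob ?Y (Suc i))) (Hom (op_cat C) T (ob ?Y i))
         (Comp (op_cat C) (df ?Y (Suc (Suc i)))) (Comp (op_cat C) (df ?Y (Suc i)))"
      using h(2)[OF T] idx[OF i] i unfolding cohom_exact_def by (simp add: Op_cpx_simps)
  qed
  moreover have "cohom_exact (op_cat C) n ?Y T" if T: "T \<in> Obj C" for T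
    unfolding cohom_exact_def
  proof (intro conjI allI impI)
    show "inj_on (\<lambda>h. Comp (op_cat C) h (df ?Y 1)) (homs (op_cat C) (ob ?Y 0) T)"
      using h(1)[OF T] by (simp add: hom_exact_def Op_cpx_simps)
    fix i assume i: "i < n"
    have "n - Suc i < n" using i by simp
    then show "exact_at (Hom (op_cat C) (ob ?Y i) T) (Hom (op_cat C) (ob ?Y (Suc i)) T) (Hom (op_cat C) (ob ?Y (Suc (Suc i))) T)
        (\<lambda>h. Comp (op_cat C) h (df ?Y (Suc i))) (\<lambda>h. Comp (op_cat C) h (df ?Y (Suc (Suc i))))"
      using h(1)[OF T] idx[OF i] i unfolding hom_exact_def by (simp add: Op_cpx_simps)
  qed
  ultimately show ?thesis by (simp add: n_exact_def)
qed

lemma chain_map_op: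
  assumes "chain_map C n X Y f"
  shows "chain_map (op_cat C) n (Op_cpx n Y) (Op_cpx n X) (\<lambda>i. f (Suc n - i))"
  unfolding chain_map_def
proof (intro conjI allI impI)
  fix i assume "i \<le> Suc n"
  then show "f (Suc n - i) \<in> homs (op_cat C) (ob (Op_cpx n Y) i) (ob (Op_cpx n X) i)"
    using assms by (simp add: chain_map_def Op_cpx_simps)
next
  fix i assume i: "i \<le> n"
  then have "Suc n - i = Suc (n - i)" "Suc n - Suc i = n - i" "n - i \<le> n" by auto
  then show "Comp (op_cat C) (f (Suc n - i)) (df (Op_cpx n Y) (Suc i)) = Comp (op_cat C) (df (Op_cpx n X) (Suc i)) (f (Suc n - Suc i))"
    using assms i by (simp add: chain_map_def Op_cpx_simps)
qed

text \<open>The homotopy is read backwards. The two middle summands change places under reversal,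
  hence the appeal to commutativity, and the two boundary equations are exchanged.\<close>

lemma homotopic_op:
  assumes X: "n_exact C n X" and h: "homotopic C n X X f g"
  shows "homotopic (op_cat C) n (Op_cpx n X) (Op_cpx n X) (\<lambda>i. f (Suc n - i)) (\<lambda>i. g (Suc n - i))"
proof -
  obtain s where s: "\<And>i. i \<le> n \<Longrightarrow> s i \<in> homs C (ob X i) (ob X (Suc i))"
    and s0: "f 0 = g 0 \<otimes>\<^bsub>Hom C (ob X 0) (ob X 0)\<^esub> Comp C (df X 1) (s 0)"
    and sS: "\<And>i. i < n \<Longrightarrow> f (Suc i) = g (Suc i) \<otimes>\<^bsub>Hom C (ob X (Suc i)) (ob X (Suc i))\<^esub>
          (Comp C (df X (Suc (Suc i))) (s (Suc i)) \<otimes>\<^bsub>Hom C (ob X (Suc i)) (ob X (Suc i))\<^esub> Comp C (s i) (df X (Suc i)))"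
    and sn: "f (Suc n) = g (Suc n) \<otimes>\<^bsub>Hom C (ob X (Suc n)) (ob X (Suc n))\<^esub> Comp C (s n) (df X (Suc n))"
    using h unfolding homotopic_def by blast
  have sa: "ar C (s i) (ob X i) (ob X (Suc i))" if "i \<le> n" for i
    using s[OF that] n_exactD(2)[OF X, of i] n_exactD(2)[OF X, of "Suc i"] that by (simp add: homs_iff)
  show ?thesis unfolding homotopic_def
  proof (intro exI[of _ "\<lambda>i. s (n - i)"] conjI allI impI)
    fix i assume i: "i \<le> n"
    then have "Suc n - i = Suc (n - i)" "Suc n - Suc i = n - i" "n - i \<le> n" by auto
    then show "s (n - i) \<in> homs (op_cat C) (ob (Op_cpx n X) i) (ob (Op_cpx n X) (Suc i))"
      using s[of "n - i"] by (simp add: Op_cpx_simps)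
  next
    show "f (Suc n - 0) = g (Suc n - 0) \<otimes>\<^bsub>Hom (op_cat C) (ob (Op_cpx n X) 0) (ob (Op_cpx n X) 0)\<^esub>
        Comp (op_cat C) (df (Op_cpx n X) 1) (s (n - 0))"
      using sn by (simp add: Op_cpx_simps)
    show "f (Suc n - Suc n) = g (Suc n - Suc n) \<otimes>\<^bsub>Hom (op_cat C) (ob (Op_cpx n X) (Suc n)) (ob (Op_cpx n X) (Suc n))\<^esub>
        Comp (op_cat C) (s (n - n)) (df (Op_cpx n X) (Suc n))"
      using s0 by (simp add: Op_cpx_simps)
    fix i assume i: "i < n"
    define j where "j = n - Suc i"
    have j: "Suc n - Suc i = Suc j" "n - i = Suc j" "n - Suc i = j" "j < n" using i by (auto simp: j_def)
    let ?G = "Hom C (ob X (Suc j)) (ob X (Suc j))"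
    have G: "comm_group ?G" using Hom_group n_exactD(2)[OF X, of "Suc j"] j by simp
    have 1: "df X (Suc (Suc j)) \<cdot> s (Suc j) \<in> carrier ?G" using Ar_homs sa[of "Suc j"] n_exactD(1)[OF X, of "Suc j"] j by simp
    have 2: "s j \<cdot> df X (Suc j) \<in> carrier ?G" using Ar_homs sa[of j] n_exactD(1)[OF X, of j] j by simp
    have "f (Suc j) = g (Suc j) \<otimes>\<^bsub>?G\<^esub> (s j \<cdot> df X (Suc j) \<otimes>\<^bsub>?G\<^esub> df X (Suc (Suc j)) \<cdot> s (Suc j))"
      using sS[OF j(4)] comm_groupE(4)[OF G 1 2] by simp
    then show "f (Suc n - Suc i) = g (Suc n - Suc i) \<otimes>\<^bsub>Hom (op_cat C) (ob (Op_cpx n X) (Suc i)) (ob (Op_cpx n X) (Suc i))\<^esub>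
          (Comp (op_cat C) (df (Op_cpx n X) (Suc (Suc i))) (s (n - Suc i)) \<otimes>\<^bsub>Hom (op_cat C) (ob (Op_cpx n X) (Suc i)) (ob (Op_cpx n X) (Suc i))\<^esub>
             Comp (op_cat C) (s (n - i)) (df (Op_cpx n X) (Suc i)))"
      using i j by (simp add: Op_cpx_simps)
  qed
qed

lemma homotopy_equiv_op:
  assumes "homotopy_equiv C n X Y" "n_exact C n X" "n_exact C n Y"
  shows "homotopy_equiv (op_cat C) n (Op_cpx n X) (Op_cpx n Y)"
proof -
  obtain f g where fg: "chain_map C n X Y f" "chain_map C n Y X g"
    and h: "homotopic C n X X (\<lambda>i. g i \<cdot> f i) (\<lambda>i. Idn C (ob X i))" "homotopic C n Y Y (\<lambda>i. f i \<cdot> g i) (\<lambda>i. Idn C (ob Y i))"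
    using assms(1) unfolding homotopy_equiv_def by blast
  show ?thesis unfolding homotopy_equiv_def
    using chain_map_op[OF fg(1)] chain_map_op[OF fg(2)] homotopic_op[OF assms(2) h(1)] homotopic_op[OF assms(3) h(2)]
    by (intro exI[of _ "\<lambda>i. g (Suc n - i)"] exI[of _ "\<lambda>i. f (Suc n - i)"]) (simp add: Op_cpx_simps)
qed

text \<open>Reversal turns the projection onto Y into an inclusion, so X and Y change places while
  the direct sum in each degree stays. This is the self-duality through which closure under
  extensions yields both composition axioms.\<close>

lemma split_ext_op: "split_ext C n X Z Y \<Longrightarrow> split_ext (op_cat C) n (Op_cpx n Y) (Op_cpx n Z) (Op_cpx n X)"
proof -
  assume "split_ext C n X Z Y"
  then obtain a b r s where a: "chain_map C n X Z a" and b: "chain_map C n Z Y b"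
    and bi: "\<And>i. i \<le> Suc n \<Longrightarrow> biproduct C (ob X i) (ob Y i) (ob Z i) (a i) (s i) (r i) (b i)"
    unfolding split_ext_def by blast
  have "biproduct (op_cat C) (ob (Op_cpx n Y) i) (ob (Op_cpx n X) i) (ob (Op_cpx n Z) i)
      (b (Suc n - i)) (r (Suc n - i)) (s (Suc n - i)) (a (Suc n - i))" for i
    using biproduct_swap[OF bi[of "Suc n - i"]] biproduct_op by (simp add: Op_cpx_simps)
  then show ?thesis unfolding split_ext_def
    using chain_map_op[OF a] chain_map_op[OF b]
    by (intro exI[of _ "\<lambda>i. b (Suc n - i)"] exI[of _ "\<lambda>i. a (Suc n - i)"] exI[of _ "\<lambda>i. s (Suc n - i)"]
      exI[of _ "\<lambda>i. r (Suc n - i)"]) simp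
qed

end

context idempotent_complete_additive_category
begin

text \<open>The two sequences agree at all meaningful indices, in particular in the last
  differential. They present the same module, which makes them homotopy equivalent.\<close>

lemma Op_Op:
  assumes X: "n_exact C n X"
  shows "n_exact C n (Op_cpx n (Op_cpx n X))" "df (Op_cpx n (Op_cpx n X)) (Suc 0) = df X (Suc 0)"
    "homotopy_equiv C n X (Op_cpx n (Op_cpx n X))"
proof -
  show 1: "n_exact C n (Op_cpx n (Op_cpx n X))"
    using preadditive_category.n_exact_op[OF op_preadditive n_exact_op[OF X]] by simp
  show 2: "df (Op_cpx n (Op_cpx n X)) (Suc 0) = df X (Suc 0)" by (simp add: Op_cpx_simps)
  obtain x where "presents C (df X (Suc 0)) x (Fun C X)" using Fun_presents[OF X] by blast
  then show "homotopy_equiv C n X (Op_cpx n (Op_cpx n X))" using presents_homotopy_equiv[OF X _ 1] 2 by metis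
qed

lemma n_exact_op_iff: "n_exact (op_cat C) n Y \<Longrightarrow> n_exact C n (Op_cpx n Y)"
  using preadditive_category.n_exact_op[OF op_preadditive] by simp

lemma iso_class_Op_Op:
  assumes "iso_class C n \<X>" "n_exact C n X"
  shows "Op_cpx n (Op_cpx n X) \<in> \<X> \<longleftrightarrow> X \<in> \<X>"
  using assms Op_Op[OF assms(2)] homotopy_equiv_sym[of n X "Op_cpx n (Op_cpx n X)"] unfolding iso_class_def by blast

lemma Op_in_op_class: "iso_class C n \<X> \<Longrightarrow> X \<in> \<X> \<Longrightarrow> Op_cpx n X \<in> op_class C n \<X>"
  using iso_class_Op_Op[of n \<X> X] n_exact_op[of n X] iso_class_exact[of n \<X> X] by (simp add: op_class_def)

lemma iso_class_op_class:
  assumes \<X>: "iso_class C n \<X>"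
  shows "iso_class (op_cat C) n (op_class C n \<X>)"
  unfolding iso_class_def
proof (intro conjI ballI allI impI)
  fix X assume X: "X \<in> op_class C n \<X>"
  then show e: "n_exact (op_cat C) n X" by (simp add: op_class_def)
  fix Y assume Y: "n_exact (op_cat C) n Y \<and> homotopy_equiv (op_cat C) n X Y"
  have "homotopy_equiv C n (Op_cpx n X) (Op_cpx n Y)"
    using preadditive_category.homotopy_equiv_op[OF op_preadditive, of n X Y] Y e by simp
  then have "Op_cpx n Y \<in> \<X>" using \<X> X n_exact_op_iff[of n Y] Y unfolding iso_class_def op_class_def by blast
  then show "Y \<in> op_class C n \<X>" using Y by (simp add: op_class_def)
qed

lemma op_class_op_class:
  assumes \<X>: "iso_class C n \<X>"
  shows "op_class (op_cat C) n (op_class C n \<X>) = \<X>"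
proof (intro equalityI subsetI)
  fix X assume "X \<in> op_class (op_cat C) n (op_class C n \<X>)"
  then show "X \<in> \<X>" using iso_class_Op_Op[OF \<X>, of X] by (simp add: op_class_def)
next
  fix X assume "X \<in> \<X>"
  then show "X \<in> op_class (op_cat C) n (op_class C n \<X>)"
    using Op_in_op_class[OF \<X>] iso_class_exact[OF \<X>] by (simp add: op_class_def[of "op_cat C"])
qed

lemma split_ext_closed_op_class:
  assumes \<X>: "iso_class C n \<X>" and s: "split_ext_closed C n \<X>"
  shows "split_ext_closed (op_cat C) n (op_class C n \<X>)"
  unfolding split_ext_closed_def
proof (intro ballI allI impI)
  fix X Y Z assume XY: "X \<in> op_class C n \<X>" "Y \<in> op_class C n \<X>" and Z: "n_exact (op_cat C) n Z \<and> split_ext (op_cat C) n X Z Y"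
  have "split_ext C n (Op_cpx n Y) (Op_cpx n Z) (Op_cpx n X)"
    using preadditive_category.split_ext_op[OF op_preadditive, of n X Z Y] Z by simp
  then have "Op_cpx n Z \<in> \<X>" using s XY n_exact_op_iff[of n Z] Z unfolding split_ext_closed_def op_class_def by blast
  then show "Z \<in> op_class C n \<X>" using Z by (simp add: op_class_def)
qed

lemma inflation_iff:
  assumes \<X>: "iso_class C n \<X>"
  shows "inflation n \<X> f \<longleftrightarrow> deflation (op_class C n \<X>) f"
proof
  assume "inflation n \<X> f"
  then obtain X where X: "X \<in> \<X>" "f = df X (Suc n)" by (auto simp: inflation_def)
  then have "f = df (Op_cpx n X) 1" by (simp add: Op_cpx_simps)
  then show "deflation (op_class C n \<X>) f" using Op_in_op_class[OF \<X> X(1)] unfolding deflation_def by blast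
next
  assume "deflation (op_class C n \<X>) f"
  then obtain Y where Y: "Op_cpx n Y \<in> \<X>" "f = df Y 1" by (auto simp: deflation_def op_class_def)
  then have "f = df (Op_cpx n Y) (Suc n)" by (simp add: Op_cpx_simps)
  then show "inflation n \<X> f" using Y(1) unfolding inflation_def by blast
qed

section \<open>Passage between classes of sequences and classes of modules\<close>

lemma Fun_image_iso_closed:
  assumes "iso_class C n \<X>" "F \<in> Fun_image C n \<X>" "G \<in> ex_cat C n" "mod_iso C F G"
  shows "G \<in> Fun_image C n \<X>"
proof -
  obtain X x where X: "X \<in> \<X>" "presents C (df X (Suc 0)) x F" using assms(2) Fun_image_iff[OF assms(1)] by blast
  have "cmodule C G" using assms(3) by (auto simp: ex_cat_def intro: in_mod_cmodule)
  then show ?thesis using mod_iso_presents[OF assms(4) _ X(2)] X(1) Fun_image_iff[OF assms(1)] by blast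
qed

text \<open>\<open>Res\<close> chooses some n-exact sequence, but all those presenting the same
  module are homotopy equivalent, so a closed class contains the chosen one as soon as it contains
  any.\<close>

lemma Res_image_Fun_image:
  assumes \<X>: "iso_class C n \<X>"
  shows "Res_image C n (Fun_image C n \<X>) = \<X>"
proof (intro equalityI subsetI)
  fix X assume "X \<in> Res_image C n (Fun_image C n \<X>)"
  then obtain F where X: "n_exact C n X" and F: "F \<in> Fun_image C n \<X>" and h: "homotopy_equiv C n (Res C n F) X"
    by (auto simp: Res_image_def)
  obtain Y y where Y: "Y \<in> \<X>" "presents C (df Y (Suc 0)) y F" using F Fun_image_iff[OF \<X>] by blast
  have Fe: "F \<in> ex_cat C n" using F by (simp add: Fun_image_def)
  have "Res C n F \<in> \<X>" using Res_props[OF Fe] iso_class_presents[OF \<X> Y] by blast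
  then show "X \<in> \<X>" using \<X> h X unfolding iso_class_def by blast
next
  fix X assume X: "X \<in> \<X>"
  note e = iso_class_exact[OF \<X> X]
  obtain x where x: "presents C (df X (Suc 0)) x (Fun C X)" using Fun_presents[OF e] by blast
  have "Fun C X \<in> Fun_image C n \<X>" using Fun_image_iff[OF \<X>] X x by blast
  moreover have "homotopy_equiv C n (Res C n (Fun C X)) X"
    using Res_props[OF Fun_in_ex_cat[OF e]] presents_homotopy_equiv[OF _ _ e x] by blast
  ultimately show "X \<in> Res_image C n (Fun_image C n \<X>)" using e by (auto simp: Res_image_def)
qed

text \<open>Membership travels through presentations: along homotopy equivalences all sequences
  involved present the same F, and this is turned back into a homotopy equivalence with
  \<open>Res C n F\<close>.\<close>

lemma iso_class_Res_image:
  assumes \<F>: "\<F> \<subseteq> ex_cat C n"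
  shows "iso_class C n (Res_image C n \<F>)"
  unfolding iso_class_def
proof (intro conjI ballI allI impI)
  fix X assume X: "X \<in> Res_image C n \<F>"
  then show e: "n_exact C n X" by (simp add: Res_image_def)
  fix Y assume "n_exact C n Y \<and> homotopy_equiv C n X Y"
  then have Y: "n_exact C n Y" "homotopy_equiv C n X Y" by auto
  obtain F where F: "F \<in> \<F>" "homotopy_equiv C n (Res C n F) X" using X by (auto simp: Res_image_def)
  have Fe: "F \<in> ex_cat C n" using F \<F> by blast
  note R = Res_props[OF Fe]
  obtain r where r: "presents C (df (Res C n F) (Suc 0)) r F" using R(2) by blast
  obtain x where x: "presents C (df X (Suc 0)) x F"
    using homotopy_equiv_presents[OF homotopy_equiv_sym[OF F(2)] e R(1) r] by blast
  obtain y where y: "presents C (df Y (Suc 0)) y F"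
    using homotopy_equiv_presents[OF homotopy_equiv_sym[OF Y(2)] Y(1) e x] by blast
  show "Y \<in> Res_image C n \<F>" using presents_homotopy_equiv[OF R(1) r Y(1) y] F(1) Y(1) by (auto simp: Res_image_def)
qed

lemma Fun_image_Res_image:
  assumes \<F>: "\<F> \<subseteq> ex_cat C n" and i: "\<And>F G. F \<in> \<F> \<Longrightarrow> G \<in> ex_cat C n \<Longrightarrow> mod_iso C F G \<Longrightarrow> G \<in> \<F>"
  shows "Fun_image C n (Res_image C n \<F>) = \<F>"
proof (intro equalityI subsetI)
  note I = iso_class_Res_image[OF \<F>]
  fix G assume "G \<in> Fun_image C n (Res_image C n \<F>)"
  then obtain X x where X: "X \<in> Res_image C n \<F>" "presents C (df X (Suc 0)) x G" using Fun_image_iff[OF I] by blast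
  obtain F where F: "F \<in> \<F>" "homotopy_equiv C n (Res C n F) X" using X by (auto simp: Res_image_def)
  have Fe: "F \<in> ex_cat C n" using F \<F> by blast
  note R = Res_props[OF Fe]
  obtain r where r: "presents C (df (Res C n F) (Suc 0)) r F" using R(2) by blast
  obtain g where g: "presents C (df (Res C n F) (Suc 0)) g G"
    using homotopy_equiv_presents[OF F(2) R(1) iso_class_exact[OF I X(1)] X(2)] by blast
  then have "G \<in> ex_cat C n" using ex_cat_iff R(1) by blast
  then show "G \<in> \<F>" using i[OF F(1)] presents_mod_iso[OF r g] by blast
next
  note I = iso_class_Res_image[OF \<F>]
  fix F assume F: "F \<in> \<F>"
  then have Fe: "F \<in> ex_cat C n" using \<F> by blast
  note R = Res_props[OF Fe]
  obtain r where r: "presents C (df (Res C n F) (Suc 0)) r F" using R(2) by blast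
  have "Res C n F \<in> Res_image C n \<F>"
    using presents_homotopy_equiv[OF R(1) r R(1) r] F R(1) by (auto simp: Res_image_def)
  then show "F \<in> Fun_image C n (Res_image C n \<F>)" using Fun_image_iff[OF I] r by blast
qed

text \<open>On essential images transposition is reversal of sequences. One inclusion starts from
  \<open>Res C n F\<close>, which lies in the class; for the other, a module over the opposite
  category presented by Y is the transpose of \<open>Fun\<close> of the reversed Y.\<close>

lemma Tr_image_Fun_image:
  assumes \<X>: "iso_class C n \<X>"
  shows "Tr_image C n (Fun_image C n \<X>) = Fun_image (op_cat C) n (op_class C n \<X>)"
proof (intro equalityI subsetI)
  interpret op: idempotent_complete_additive_category "op_cat C" by (rule op_idempotent_complete)
  fix G assume "G \<in> Tr_image C n (Fun_image C n \<X>)"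
  then obtain F where G: "G \<in> ex_cat (op_cat C) n" and F: "F \<in> Fun_image C n \<X>"
    and m: "mod_iso (op_cat C) (Fun (op_cat C) (Op_cpx n (Res C n F))) G" by (auto simp: Tr_image_def Tr_def)
  have Fe: "F \<in> ex_cat C n" using F by (simp add: Fun_image_def)
  note R = Res_props[OF Fe]
  obtain X x where X: "X \<in> \<X>" "presents C (df X (Suc 0)) x F" using F Fun_image_iff[OF \<X>] by blast
  have "Res C n F \<in> \<X>" using R iso_class_presents[OF \<X> X] by blast
  then show "G \<in> Fun_image (op_cat C) n (op_class C n \<X>)"
    using Op_in_op_class[OF \<X>] m G by (auto simp: Fun_image_def)
next
  interpret op: idempotent_complete_additive_category "op_cat C" by (rule op_idempotent_complete)
  fix G assume "G \<in> Fun_image (op_cat C) n (op_class C n \<X>)"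
  then have Ge: "G \<in> ex_cat (op_cat C) n" and "\<exists>Y\<in>op_class C n \<X>. \<exists>y. presents (op_cat C) (df Y (Suc 0)) y G"
    unfolding op.Fun_image_iff[OF iso_class_op_class[OF \<X>], symmetric] by (simp_all add: Fun_image_def)
  then obtain Y y where Y: "Y \<in> op_class C n \<X>" "presents (op_cat C) (df Y (Suc 0)) y G" by blast
  then have e: "n_exact (op_cat C) n Y" "Op_cpx n Y \<in> \<X>" by (simp_all add: op_class_def)
  let ?F = "Fun C (Op_cpx n Y)"
  note e' = iso_class_exact[OF \<X> e(2)]
  obtain x where x: "presents C (df (Op_cpx n Y) (Suc 0)) x ?F" using Fun_presents[OF e'] by blast
  have F: "?F \<in> Fun_image C n \<X>" using Fun_image_iff[OF \<X>] e(2) x by blast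
  note R = Res_props[OF Fun_in_ex_cat[OF e']]
  have "homotopy_equiv C n (Res C n ?F) (Op_cpx n Y)" using R presents_homotopy_equiv[OF _ _ e' x] by blast
  then have h: "homotopy_equiv (op_cat C) n (Op_cpx n (Res C n ?F)) (Op_cpx n (Op_cpx n Y))"
    using homotopy_equiv_op R(1) e' by blast
  have "presents (op_cat C) (df (Op_cpx n (Op_cpx n Y)) (Suc 0)) y G" using Y(2) op.Op_Op(2)[OF e(1)] by simp
  from op.homotopy_equiv_presents[OF h n_exact_op[OF R(1)] op.Op_Op(1)[OF e(1)] this]
  obtain g where g: "presents (op_cat C) (df (Op_cpx n (Res C n ?F)) (Suc 0)) g G" by (elim exE)
  have "mod_iso (op_cat C) (Tr C n ?F) G" unfolding Tr_def
    using op.Fun_mod_iso_iff[OF n_exact_op[OF R(1)] op.presents_cmodule[OF g]] g by blast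
  then show "G \<in> Tr_image C n (Fun_image C n \<X>)" using F Ge by (auto simp: Tr_image_def)
qed

lemma Pb_iso_closed:
  assumes n: "n > 0" and \<X>: "iso_class C n \<X>" and F: "F \<in> Pb C (Fun_image C n \<X>)" and G: "G \<in> ex_cat C n" "mod_iso C F G"
  shows "G \<in> Pb C (Fun_image C n \<X>)"
proof -
  have "F \<in> Fun_image C n \<X>" using F by (simp add: Pb_def)
  then obtain X x where X: "X \<in> \<X>" "presents C (df X (Suc 0)) x F" using Fun_image_iff[OF \<X>] by blast
  have "cmodule C G" using G(1) by (auto simp: ex_cat_def intro: in_mod_cmodule)
  then obtain y where "presents C (df X (Suc 0)) y G" using mod_iso_presents[OF G(2) _ X(2)] by blast
  then show ?thesis using Pb_iff[OF n \<X> X] Pb_iff[OF n \<X> X(1)] F by blast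
qed

text \<open>Since transposition of essential images is \<open>op_class\<close>, which is involutive,
  \<open>Po\<close> fixes the class iff \<open>Pb\<close> fixes its transpose. The point is the
  implication from \<open>Po\<close>, where transposition has to be cancelled on a class not yet
  known to be the transpose of the original.\<close>

lemma Po_eq_iff:
  assumes n: "n > 0" and \<X>: "iso_class C n \<X>"
  shows "Po C n (Fun_image C n \<X>) = Fun_image C n \<X> \<longleftrightarrow> deflations_pull_back (op_cat C) (op_class C n \<X>)"
proof -
  interpret op: idempotent_complete_additive_category "op_cat C" by (rule op_idempotent_complete)
  note \<Y> = iso_class_op_class[OF \<X>]
  let ?\<Y> = "op_class C n \<X>" and ?G = "Fun_image (op_cat C) n (op_class C n \<X>)"
  let ?P = "Pb (op_cat C) ?G"
  have Po: "Po C n (Fun_image C n \<X>) = Tr_image (op_cat C) n ?P"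
    unfolding Po_def Tr_image_Fun_image[OF \<X>] ..
  have Tr_Tr: "Tr_image (op_cat C) n ?G = Fun_image C n \<X>"
    using op.Tr_image_Fun_image[OF \<Y>] op_class_op_class[OF \<X>] by simp
  have "Po C n (Fun_image C n \<X>) = Fun_image C n \<X> \<longleftrightarrow> ?P = ?G"
  proof
    assume "?P = ?G" then show "Po C n (Fun_image C n \<X>) = Fun_image C n \<X>" using Po Tr_Tr by simp
  next
    assume e: "Po C n (Fun_image C n \<X>) = Fun_image C n \<X>"
    have sub: "?P \<subseteq> ex_cat (op_cat C) n" by (auto simp: Pb_def Fun_image_def)
    \<comment> \<open>\<open>?P\<close> is closed under isomorphism, so it is the essential image of
      its own class of resolutions. This puts it within the scope of
      \<open>Tr_image_Fun_image\<close>, and involutivity of \<open>op_class\<close> then identifies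
      \<open>?\<Z>\<close> with the opposite class.\<close>
    let ?\<Z> = "Res_image (op_cat C) n ?P"
    have P: "Fun_image (op_cat C) n ?\<Z> = ?P"
      by (rule op.Fun_image_Res_image[OF sub]) (rule op.Pb_iso_closed[OF n \<Y>])
    note \<Z> = op.iso_class_Res_image[OF sub]
    have "Fun_image C n (op_class (op_cat C) n ?\<Z>) = Tr_image (op_cat C) n ?P"
      using op.Tr_image_Fun_image[OF \<Z>] P by simp
    also have "\<dots> = Fun_image C n \<X>" using Po e by simp
    finally have "op_class (op_cat C) n ?\<Z> = \<X>"
      using Res_image_Fun_image[OF \<X>] Res_image_Fun_image[of n "op_class (op_cat C) n ?\<Z>"] op.iso_class_op_class[OF \<Z>] by simp
    then have "op_class C n \<X> = ?\<Z>" using op.op_class_op_class[OF \<Z>] by simp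
    then show "?P = ?G" using P by simp
  qed
  then show ?thesis using op.Pb_eq_iff[OF n \<Y>] by simp
qed

section \<open>The axioms of an n-exact structure as conditions on a class\<close>

lemma zero_complex_n_exact:
  assumes z: "\<And>i. i \<le> Suc n \<Longrightarrow> zero_object C (ob X i)" and c: "is_complex C n X"
  shows "n_exact C n X"
proof -
  have o: "ob X i \<in> Obj C" if "i \<le> Suc n" for i using zero_objectD(1)[OF z[OF that]] .
  have d: "ar C (df X (Suc i)) (ob X (Suc i)) (ob X i)" if "i \<le> n" for i
  proof -
    have "df X (Suc i) \<in> homs C (ob X (Suc i)) (ob X i)" using c that unfolding is_complex_def by blast
    then show ?thesis using homs_iff[OF o[of "Suc i"] o[of i]] that by simp
  qed
  have zi: "h = zr C T (ob X i)" if "i \<le> Suc n" "ar C h T (ob X i)" for i h T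
    using zero_objectD(3)[OF z[OF that(1)], of h] that(2) by simp
  have zo: "h = zr C (ob X i) T" if "i \<le> Suc n" "ar C h (ob X i) T" for i h T
    using zero_objectD(2)[OF z[OF that(1)], of h] that(2) by simp
  have "hom_exact C n X T" if T: "T \<in> Obj C" for T unfolding hom_exact_def
  proof (intro conjI allI impI)
    show "inj_on (Comp C (df X (Suc n))) (homs C T (ob X (Suc n)))"
      unfolding inj_on_post[OF T d[OF order_refl]] using zi by blast
    fix i assume i: "i < n"
    then have di: "ar C (df X (Suc (Suc i))) (ob X (Suc (Suc i))) (ob X (Suc i))" "ar C (df X (Suc i)) (ob X (Suc i)) (ob X i)"
      using d[of "Suc i"] d[of i] by simp_all
    show "exact_at (Hom C T (ob X (Suc (Suc i)))) (Hom C T (ob X (Suc i))) (Hom C T (ob X i)) (Comp C (df X (Suc (Suc i)))) (Comp C (df X (Suc i)))"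
      unfolding exact_at_post[OF T di]
    proof (intro conjI allI impI)
      fix h assume h: "ar C h T (ob X (Suc (Suc i)))"
      show "df X (Suc i) \<cdot> df X (Suc (Suc i)) \<cdot> h = zr C T (ob X i)" by (rule zi) (use i di h in simp_all)
    next
      fix h assume "ar C h T (ob X (Suc i)) \<and> df X (Suc i) \<cdot> h = zr C T (ob X i)"
      then have "h = zr C T (ob X (Suc i))" using zi[of "Suc i" h T] i by simp
      then show "\<exists>k. ar C k T (ob X (Suc (Suc i))) \<and> h = df X (Suc (Suc i)) \<cdot> k"
        using di T o[of "Suc (Suc i)"] i by (intro exI[of _ "zr C T (ob X (Suc (Suc i)))"]) simp
    qed
  qed
  moreover have "cohom_exact C n X T" if T: "T \<in> Obj C" for T unfolding cohom_exact_def
  proof (intro conjI allI impI)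
    show "inj_on (\<lambda>h. h \<cdot> df X 1) (homs C (ob X 0) T)"
      using inj_on_pre[OF T, of "df X (Suc 0)"] d[of 0] zo[of 0 _ T] by auto
    fix i assume i: "i < n"
    then have di: "ar C (df X (Suc (Suc i))) (ob X (Suc (Suc i))) (ob X (Suc i))" "ar C (df X (Suc i)) (ob X (Suc i)) (ob X i)"
      using d[of "Suc i"] d[of i] by simp_all
    show "exact_at (Hom C (ob X i) T) (Hom C (ob X (Suc i)) T) (Hom C (ob X (Suc (Suc i))) T)
       (\<lambda>h. h \<cdot> df X (Suc i)) (\<lambda>h. h \<cdot> df X (Suc (Suc i)))"
      unfolding exact_at_pre[OF T di]
    proof (intro conjI allI impI)
      fix h assume h: "ar C h (ob X i) T"
      show "(h \<cdot> df X (Suc i)) \<cdot> df X (Suc (Suc i)) = zr C (ob X (Suc (Suc i))) T" by (rule zo) (use i di h in simp_all)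
    next
      fix h assume "ar C h (ob X (Suc i)) T \<and> h \<cdot> df X (Suc (Suc i)) = zr C (ob X (Suc (Suc i))) T"
      then have "h = zr C (ob X (Suc i)) T" using zo[of "Suc i" h T] i by simp
      then show "\<exists>k. ar C k (ob X i) T \<and> h = k \<cdot> df X (Suc i)"
        using di T o[of i] i by (intro exI[of _ "zr C (ob X i) T"]) simp
    qed
  qed
  ultimately show ?thesis using c by (simp add: n_exact_def)
qed

text \<open>Some deflation exists, and pulling it back along the identity of its codomain gives a
  deflation with a right inverse. Its cokernel is zero, and every complex of zero objects presents
  the zero module too.\<close>

lemma zero_complex_in_class:
  assumes n: "n > 0" and \<X>: "iso_class C n \<X>" and ne: "\<X> \<noteq> {}" and pb: "deflations_pull_back C \<X>"
    and z: "\<And>i. i \<le> Suc n \<Longrightarrow> zero_object C (ob X i)" and c: "is_complex C n X"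
  shows "X \<in> \<X>"
proof -
  note e = zero_complex_n_exact[OF z c]
  obtain Y where Y: "Y \<in> \<X>" using ne by blast
  note d = n_exact_d1[OF iso_class_exact[OF \<X> Y]]
  let ?d = "df Y (Suc 0)" and ?A = "ob Y (Suc 0)" and ?B = "ob Y 0"
  have AB: "?A \<in> Obj C" "?B \<in> Obj C" using n_exactD(2)[OF iso_class_exact[OF \<X> Y]] by simp_all
  obtain W i1 i2 p1 p2 where bi: "biproduct C ?A ?B W i1 i2 p1 p2" using has_biproducts[OF AB] by metis
  note [simp] = biproductD(1-11)[OF bi] biproduct_cmp[OF bi] d
  \<comment> \<open>The row with entries -d and 1; the injection \<open>i2\<close> is a right
    inverse, so every morphism into \<open>?B\<close> is a relation of the presented module.\<close>
  let ?v = "neg C ?d \<cdot> p1 \<boxplus> Idn C ?B \<cdot> p2"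
  have v: "ar C ?v W ?B" by simp
  have pc: "pullback_condition C \<X> ?d" using pb Y unfolding deflations_pull_back_def deflation_def One_nat_def by blast
  have "deflation \<X> ?v"
    using pc[unfolded pullback_condition_def, rule_format, of "Idn C ?B" ?B W i1 i2 p1 p2 ?v] bi by simp
  then obtain V where V: "V \<in> \<X>" "df V (Suc 0) = ?v" using deflationE[OF _ \<X>] by metis
  let ?M = "cok ?v"
  obtain x where x: "presents C ?v x ?M" using presents_cok v by blast
  have gx: "gen C ?M ?B x" using presents_gen[OF x] v by simp
  note M = genD[OF gx]
  have triv: "m = \<one>\<^bsub>Val ?M T\<^esub>" if T: "T \<in> Obj C" "m \<in> carrier (Val ?M T)" for T m
  proof -
    obtain h where h: "ar C h T ?B" "m = Act ?M h x" using genE[OF gx T(2,1)] .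
    have "?v \<cdot> i2 \<cdot> h = h" using h(1) T(1) by simp
    then show ?thesis using presents_cmp[OF x, of "i2 \<cdot> h" T] h v by simp
  qed
  have dX: "ar C (df X (Suc 0)) (ob X (Suc 0)) (ob X 0)" by (rule n_exact_d1[OF e])
  have o: "ob X 0 \<in> Obj C" "ob X (Suc 0) \<in> Obj C" using zero_objectD(1)[OF z] by simp_all
  let ?o = "\<one>\<^bsub>Val ?M (ob X 0)\<^esub>"
  have oc: "?o \<in> carrier (Val ?M (ob X 0))" using comm_groupE(2)[OF Val_grp[OF M(1) o(1)]] .
  have oh: "Act ?M h ?o = \<one>\<^bsub>Val ?M T\<^esub>" if "ar C h T (ob X 0)" for h T using Act_one[OF M(1), of h "ob X 0"] that by simp
  have "presents C (df X (Suc 0)) ?o ?M"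
  proof (rule presentsI)
    show "gen C ?M (Cod C (df X (Suc 0))) ?o" unfolding gen_def
    proof (intro conjI ballI)
      fix T m assume T: "T \<in> Obj C" "m \<in> carrier (Val ?M T)"
      then show "\<exists>h. ar C h T (Cod C (df X (Suc 0))) \<and> m = Act ?M h ?o"
        using triv[OF T] oh[of "zr C T (ob X 0)" T] dX o by (intro exI[of _ "zr C T (ob X 0)"]) simp
    qed (use M dX o oc in simp_all)
    show "Act ?M (df X (Suc 0) \<cdot> k) ?o = \<one>\<^bsub>Val ?M T\<^esub>" if "ar C k T (Dom C (df X (Suc 0)))" for k T
      by (rule oh) (use that dX in simp)
    fix h T assume "ar C h T (Cod C (df X (Suc 0)))"
    then have h: "ar C h T (ob X 0)" using dX by simp
    then have "T \<in> Obj C" by auto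
    moreover have "h = zr C T (ob X 0)" using zero_objectD(3)[OF z[of 0], of h] h by simp
    ultimately show "\<exists>k. ar C k T (Dom C (df X (Suc 0))) \<and> h = df X (Suc 0) \<cdot> k"
      using dX o by (intro exI[of _ "zr C T (ob X (Suc 0))"]) simp
  qed (use dX in blast)
  then show "X \<in> \<X>" using iso_class_presents[OF \<X> V(1) _ e] x V(2) by metis
qed

text \<open>Translation between the group notation of the locale axiom and \<open>neg\<close>,
  \<open>add\<close>. The quantified form on the right is what unifies with the axiom and can be
  read in the opposite category.\<close>

lemma Ex2_op_iff:
  assumes \<X>: "iso_class C n \<X>"
  shows "deflations_pull_back C \<X> \<longleftrightarrow>
    (\<forall>d A B B' f W i1 i2 p1 p2 v. deflation \<X> d \<longrightarrow> A = Dom C d \<longrightarrow> B = Cod C d \<longrightarrow>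
      B' \<in> Obj C \<longrightarrow> f \<in> homs C B' B \<longrightarrow> biproduct C A B' W i1 i2 p1 p2 \<longrightarrow>
      v = Comp C (inv\<^bsub>Hom C A B\<^esub> d) p1 \<otimes>\<^bsub>Hom C W B\<^esub> Comp C f p2 \<longrightarrow>
      deflation \<X> v \<and> (\<exists>k. weak_kernel C v k \<and> deflation \<X> (Comp C p2 k)))" (is "_ \<longleftrightarrow> ?R")
proof -
  have v: "neg C d \<cdot> p1 \<boxplus> f \<cdot> p2 = Comp C (inv\<^bsub>Hom C (Dom C d) (Cod C d)\<^esub> d) p1 \<otimes>\<^bsub>Hom C W (Cod C d)\<^esub> Comp C f p2"
    if "deflation \<X> d" "biproduct C (Dom C d) B' W i1 i2 p1 p2" for d B' W i1 i2 p1 p2 f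
  proof -
    have d: "Ar C d" using deflationE[OF that(1) \<X>] by metis
    have "ar C (neg C d \<cdot> p1) W (Cod C d)" using d biproductD[OF that(2)] by simp
    then show ?thesis using mult_eq_add[of "neg C d \<cdot> p1" W "Cod C d"] by (simp add: neg_def)
  qed
  have o: "Cod C d \<in> Obj C" if "deflation \<X> d" for d using deflationE[OF that \<X>] ArD(2) by metis
  show ?thesis
  proof
    assume l: "deflations_pull_back C \<X>"
    show ?R
    proof (intro allI impI)
      fix d A B B' f W i1 i2 p1 p2 w
      assume a: "deflation \<X> d" "A = Dom C d" "B = Cod C d" "B' \<in> Obj C" "f \<in> homs C B' B" "biproduct C A B' W i1 i2 p1 p2"
        "w = Comp C (inv\<^bsub>Hom C A B\<^esub> d) p1 \<otimes>\<^bsub>Hom C W B\<^esub> Comp C f p2"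
      have f: "ar C f B' (Cod C d)" using a o[OF a(1)] by (simp add: homs_iff)
      have w: "w = neg C d \<cdot> p1 \<boxplus> f \<cdot> p2" using v[OF a(1) a(6)[unfolded a(2)]] a(2,3,7) by simp
      have "pullback_condition C \<X> d" using l a(1) unfolding deflations_pull_back_def by blast
      then show "deflation \<X> w \<and> (\<exists>k. weak_kernel C w k \<and> deflation \<X> (p2 \<cdot> k))"
        using f a(6) w unfolding a(2) pullback_condition_def by blast
    qed
  next
    assume r: ?R
    show "deflations_pull_back C \<X>" unfolding deflations_pull_back_def pullback_condition_def
    proof (intro allI impI)
      fix d B' f W i1 i2 p1 p2 w
      assume d: "deflation \<X> d"
      assume "ar C f B' (Cod C d) \<and> biproduct C (Dom C d) B' W i1 i2 p1 p2 \<and> w = neg C d \<cdot> p1 \<boxplus> f \<cdot> p2"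
      then have f: "ar C f B' (Cod C d)" and bi: "biproduct C (Dom C d) B' W i1 i2 p1 p2" and w: "w = neg C d \<cdot> p1 \<boxplus> f \<cdot> p2" by auto
      show "deflation \<X> w \<and> (\<exists>k. weak_kernel C w k \<and> deflation \<X> (p2 \<cdot> k))"
        using r[rule_format, OF d refl refl biproductD(2)[OF bi] _ bi w[unfolded v[OF d bi]]] f Ar_homs by blast
    qed
  qed
qed

text \<open>The statement for \<open>op_cat C\<close> rewritten: reversal exchanges injections and
  projections of a direct sum, weak kernels and weak cokernels, and deflations of the opposite class
  with inflations.\<close>

lemma Ex2_iff:
  assumes \<X>: "iso_class C n \<X>"
  shows "deflations_pull_back (op_cat C) (op_class C n \<X>) \<longleftrightarrow>
    (\<forall>d A B A' f W i1 i2 p1 p2 v. inflation n \<X> d \<longrightarrow> A = Dom C d \<longrightarrow> B = Cod C d \<longrightarrow>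
      A' \<in> Obj C \<longrightarrow> f \<in> homs C A A' \<longrightarrow> biproduct C B A' W i1 i2 p1 p2 \<longrightarrow>
      v = Comp C i1 (inv\<^bsub>Hom C A B\<^esub> d) \<otimes>\<^bsub>Hom C A W\<^esub> Comp C i2 f \<longrightarrow>
      inflation n \<X> v \<and> (\<exists>c. weak_cokernel C v c \<and> inflation n \<X> (Comp C c i2)))" (is "_ \<longleftrightarrow> ?R")
proof -
  have wc: "weak_kernel (op_cat C) v k \<longleftrightarrow> weak_cokernel C v k" for v k
    by (simp add: weak_kernel_def weak_cokernel_def)
  have bo: "biproduct (op_cat C) A B W j1 j2 q1 q2 \<longleftrightarrow> biproduct C A B W q1 q2 j1 j2" for A B W j1 j2 q1 q2
    using biproduct_op by blast
  have "deflations_pull_back (op_cat C) (op_class C n \<X>) \<longleftrightarrow>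
    (\<forall>d A B B' f W i1 i2 p1 p2 v. deflation (op_class C n \<X>) d \<longrightarrow> A = Dom (op_cat C) d \<longrightarrow> B = Cod (op_cat C) d \<longrightarrow>
      B' \<in> Obj (op_cat C) \<longrightarrow> f \<in> homs (op_cat C) B' B \<longrightarrow> biproduct (op_cat C) A B' W i1 i2 p1 p2 \<longrightarrow>
      v = Comp (op_cat C) (inv\<^bsub>Hom (op_cat C) A B\<^esub> d) p1 \<otimes>\<^bsub>Hom (op_cat C) W B\<^esub> Comp (op_cat C) f p2 \<longrightarrow>
      deflation (op_class C n \<X>) v \<and> (\<exists>k. weak_kernel (op_cat C) v k \<and> deflation (op_class C n \<X>) (Comp (op_cat C) p2 k)))"
    by (rule idempotent_complete_additive_category.Ex2_op_iff[OF op_idempotent_complete iso_class_op_class[OF \<X>]])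
  also have "\<dots> \<longleftrightarrow> (\<forall>d A B B' f W i1 i2 p1 p2 v. inflation n \<X> d \<longrightarrow> A = Cod C d \<longrightarrow> B = Dom C d \<longrightarrow>
      B' \<in> Obj C \<longrightarrow> f \<in> homs C B B' \<longrightarrow> biproduct C A B' W p1 p2 i1 i2 \<longrightarrow>
      v = Comp C p1 (inv\<^bsub>Hom C B A\<^esub> d) \<otimes>\<^bsub>Hom C B W\<^esub> Comp C p2 f \<longrightarrow>
      inflation n \<X> v \<and> (\<exists>k. weak_cokernel C v k \<and> inflation n \<X> (Comp C k p2)))"
    unfolding wc inflation_iff[OF \<X>, symmetric] bo op_cat_simps ..
  also have "\<dots> \<longleftrightarrow> ?R" (is "?L \<longleftrightarrow> _")
  proof
    assume l: ?L
    show ?R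
    proof (intro allI impI)
      fix d A B A' f W i1 i2 p1 p2 v
      assume "inflation n \<X> d" "A = Dom C d" "B = Cod C d" "A' \<in> Obj C" "f \<in> homs C A A'" "biproduct C B A' W i1 i2 p1 p2"
        "v = Comp C i1 (inv\<^bsub>Hom C A B\<^esub> d) \<otimes>\<^bsub>Hom C A W\<^esub> Comp C i2 f"
      then show "inflation n \<X> v \<and> (\<exists>c. weak_cokernel C v c \<and> inflation n \<X> (Comp C c i2))"
        by (intro l[rule_format])
    qed
  next
    assume r: ?R
    show ?L
    proof (intro allI impI)
      fix d A B A' f W i1 i2 p1 p2 v
      assume "inflation n \<X> d" "B = Cod C d" "A = Dom C d" "A' \<in> Obj C" "f \<in> homs C A A'" "biproduct C B A' W i1 i2 p1 p2"
        "v = Comp C i1 (inv\<^bsub>Hom C A B\<^esub> d) \<otimes>\<^bsub>Hom C A W\<^esub> Comp C i2 f"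
      then show "inflation n \<X> v \<and> (\<exists>c. weak_cokernel C v c \<and> inflation n \<X> (Comp C c i2))"
        by (intro r[rule_format])
    qed
  qed
  finally show ?thesis .
qed

text \<open>The right side is invariant under passing to the opposite category, the last two
  conditions being exchanged. So for the converse \<open>split_ext_closed_deflations_compose\<close>
  applies to both categories and delivers \<open>Ex1_op\<close> and \<open>Ex1\<close>.\<close>

lemma n_exact_structure_iff:
  assumes n: "n > 0"
  shows "n_exact_structure C n \<X> \<longleftrightarrow> iso_class C n \<X> \<and> \<X> \<noteq> {} \<and> split_ext_closed C n \<X> \<and>
    deflations_pull_back C \<X> \<and> deflations_pull_back (op_cat C) (op_class C n \<X>)"
proof
  assume "n_exact_structure C n \<X>"
  then interpret n_exact_structure C n \<X> .
  have \<X>: "iso_class C n \<X>" unfolding iso_class_def using conflations iso_closed by blast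
  obtain Z where Z: "zero_object C Z" using has_zero by blast
  have ZO: "Z \<in> Obj C" by (rule zero_objectD(1)[OF Z])
  have "is_complex C n \<lparr>ob = (\<lambda>_. Z), df = (\<lambda>_. zr C Z Z)\<rparr>"
    using ZO by (auto simp: is_complex_def homs_iff zr_def[symmetric])
  then have "\<lparr>ob = (\<lambda>_. Z), df = (\<lambda>_. zr C Z Z)\<rparr> \<in> \<X>" by (rule Ex0[rotated]) (use Z in simp)
  moreover have "deflations_compose C \<X>" unfolding deflations_compose_def using Ex1_op by blast
  then have "split_ext_closed C n \<X>" by (rule deflations_compose_split_ext_closed[OF n \<X>])
  moreover have "deflations_pull_back C \<X>" unfolding Ex2_op_iff[OF \<X>] using Ex2_op by blast
  moreover have "deflations_pull_back (op_cat C) (op_class C n \<X>)" unfolding Ex2_iff[OF \<X>] using Ex2 by blast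
  ultimately show "iso_class C n \<X> \<and> \<X> \<noteq> {} \<and> split_ext_closed C n \<X> \<and>
    deflations_pull_back C \<X> \<and> deflations_pull_back (op_cat C) (op_class C n \<X>)" using \<X> by blast
next
  interpret op: idempotent_complete_additive_category "op_cat C" by (rule op_idempotent_complete)
  assume "iso_class C n \<X> \<and> \<X> \<noteq> {} \<and> split_ext_closed C n \<X> \<and>
    deflations_pull_back C \<X> \<and> deflations_pull_back (op_cat C) (op_class C n \<X>)"
  then have \<X>: "iso_class C n \<X>" and ne: "\<X> \<noteq> {}" and s: "split_ext_closed C n \<X>"
    and pb: "deflations_pull_back C \<X>" and po: "deflations_pull_back (op_cat C) (op_class C n \<X>)" by auto
  have dc: "deflations_compose C \<X>" by (rule split_ext_closed_deflations_compose[OF n \<X> s pb])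
  have ic: "deflations_compose (op_cat C) (op_class C n \<X>)"
    by (rule op.split_ext_closed_deflations_compose[OF n iso_class_op_class[OF \<X>] split_ext_closed_op_class[OF \<X> s] po])
  note E2o = pb[unfolded Ex2_op_iff[OF \<X>]] and E2 = po[unfolded Ex2_iff[OF \<X>]]
  show "n_exact_structure C n \<X>"
  proof
    show "X \<in> \<X> \<Longrightarrow> n_exact C n X" for X by (rule iso_class_exact[OF \<X>])
    show "X \<in> \<X> \<Longrightarrow> n_exact C n Y \<Longrightarrow> homotopy_equiv C n X Y \<Longrightarrow> Y \<in> \<X>" for X Y
      using \<X> unfolding iso_class_def by blast
    show "(\<And>i. i \<le> Suc n \<Longrightarrow> zero_object C (ob X i)) \<Longrightarrow> is_complex C n X \<Longrightarrow> X \<in> \<X>" for X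
      by (rule zero_complex_in_class[OF n \<X> ne pb])
    show "inflation n \<X> f \<Longrightarrow> inflation n \<X> g \<Longrightarrow> Cod C f = Dom C g \<Longrightarrow> inflation n \<X> (g \<cdot> f)" for f g
      \<comment> \<open>Composition is reversed in the opposite category, so \<open>g\<close> is the
        first factor there.\<close>
      using ic[unfolded deflations_compose_def, rule_format, of g f] unfolding inflation_iff[OF \<X>] by simp
    show "deflation \<X> f \<Longrightarrow> deflation \<X> g \<Longrightarrow> Cod C f = Dom C g \<Longrightarrow> deflation \<X> (g \<cdot> f)" for f g
      using dc unfolding deflations_compose_def by blast
  qed (rule E2[rule_format] E2o[rule_format]; assumption)+
qed

text \<open>The conditions match one by one; nonemptiness of the class of sequences corresponds to
  the nonemptiness demanded in \<open>subcategory\<close>.\<close>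

lemma exact_structure_subcategory:
  assumes n: "n > 0" and \<X>: "iso_class C n \<X>"
  shows "n_exact_structure C n \<X> \<longleftrightarrow> subcategory C n (Fun_image C n \<X>) \<and> extension_closed C n (Fun_image C n \<X>) \<and>
      Pb C (Fun_image C n \<X>) = Fun_image C n \<X> \<and> Po C n (Fun_image C n \<X>) = Fun_image C n \<X>"
proof -
  have "subcategory C n (Fun_image C n \<X>) \<longleftrightarrow> \<X> \<noteq> {}"
  proof
    assume "subcategory C n (Fun_image C n \<X>)"
    then show "\<X> \<noteq> {}" by (auto simp: subcategory_def Fun_image_def)
  next
    assume "\<X> \<noteq> {}"
    then obtain X where X: "X \<in> \<X>" by blast
    then have "Fun C X \<in> Fun_image C n \<X>" using Fun_image_iff[OF \<X>] Fun_presents[OF iso_class_exact[OF \<X> X]] by blast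
    moreover have "Fun_image C n \<X> \<subseteq> ex_cat C n" unfolding Fun_image_def by blast
    ultimately show "subcategory C n (Fun_image C n \<X>)" unfolding subcategory_def
      using Fun_image_iso_closed[OF \<X>] by blast
  qed
  then show ?thesis
    using \<X> by (simp add: n_exact_structure_iff[OF n] extension_closed_iff[OF n \<X>] Pb_eq_iff[OF n \<X>] Po_eq_iff[OF n \<X>])
qed

end

theorem theorem1:
  fixes C :: "('o, 'm) cat" and n :: nat
  assumes "n > 0"
    and "idempotent_complete_additive_category C"
  defines "exact_structures \<equiv> {\<X>. n_exact_structure C n \<X>}"
    and "subcategories \<equiv> {\<F>. subcategory C n \<F> \<and> extension_closed C n \<F> \<and>
           Pb C \<F> = \<F> \<and> Po C n \<F> = \<F>}"
  shows "bij_betw (Fun_image C n) exact_structures subcategories \<and>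
    bij_betw (Res_image C n) subcategories exact_structures \<and>
    (\<forall>\<X>\<in>exact_structures. Res_image C n (Fun_image C n \<X>) = \<X>) \<and>
    (\<forall>\<F>\<in>subcategories. Fun_image C n (Res_image C n \<F>) = \<F>) \<and>
    (\<forall>\<X>\<in>exact_structures. \<forall>\<Y>\<in>exact_structures.
       \<X> \<subseteq> \<Y> \<longleftrightarrow> Fun_image C n \<X> \<subseteq> Fun_image C n \<Y>)"
proof -
  interpret idempotent_complete_additive_category C by fact
  note n = \<open>n > 0\<close>
  have iso: "iso_class C n \<X>" if "\<X> \<in> exact_structures" for \<X>
    using that n_exact_structure_iff[OF n] by (simp add: exact_structures_def)
  have RF: "Res_image C n (Fun_image C n \<X>) = \<X>" if "\<X> \<in> exact_structures" for \<X>
    by (rule Res_image_Fun_image[OF iso[OF that]])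
  have FR: "Fun_image C n (Res_image C n \<F>) = \<F>" if "\<F> \<in> subcategories" for \<F>
    using that Fun_image_Res_image[of \<F> n] unfolding subcategories_def subcategory_def by blast
  have F: "Fun_image C n \<X> \<in> subcategories" if "\<X> \<in> exact_structures" for \<X>
    using exact_structure_subcategory[OF n iso[OF that]] that by (simp add: exact_structures_def subcategories_def)
  have R: "Res_image C n \<F> \<in> exact_structures" if "\<F> \<in> subcategories" for \<F>
  proof -
    have "iso_class C n (Res_image C n \<F>)"
      using that by (intro iso_class_Res_image) (auto simp: subcategories_def subcategory_def)
    \<comment> \<open>The criterion speaks of the essential image of the class, which by
      \<open>FR\<close> is the given subcategory again.\<close>
    from exact_structure_subcategory[OF n this] show ?thesis
      using that by (simp add: FR[OF that] exact_structures_def subcategories_def)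
  qed
  have mono: "Fun_image C n \<X> \<subseteq> Fun_image C n \<Y>" if "\<X> \<subseteq> \<Y>" for \<X> \<Y> using that by (auto simp: Fun_image_def)
  have mono': "Res_image C n \<F> \<subseteq> Res_image C n \<G>" if "\<F> \<subseteq> \<G>" for \<F> \<G> using that by (auto simp: Res_image_def)
  have "bij_betw (Fun_image C n) exact_structures subcategories"
    by (rule bij_betw_byWitness[of _ "Res_image C n"]) (use RF FR F R in auto)
  moreover have "bij_betw (Res_image C n) subcategories exact_structures"
    by (rule bij_betw_byWitness[of _ "Fun_image C n"]) (use RF FR F R in auto)
  moreover have "\<X> \<subseteq> \<Y> \<longleftrightarrow> Fun_image C n \<X> \<subseteq> Fun_image C n \<Y>"
    if "\<X> \<in> exact_structures" "\<Y> \<in> exact_structures" for \<X> \<Y>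
    using mono mono'[of "Fun_image C n \<X>" "Fun_image C n \<Y>"] RF that by auto
  ultimately show ?thesis using RF FR by blast
qed

end
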